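(* Let $\theta_0$ be an interior point of $\Theta$ and $f_0\in H$ with $\dot K_{\theta_0}f_0\neq0$. Assume: (a) There is a normed space $(S,\|\cdot\|_S)$ with $S\subset H$, whose norm is stronger than that of $H$, such that $K_\theta H\subset S$ for all $\theta\in\Theta$ and $$\int_0^1\sqrt{\log N\bigl(\epsilon,\{h:\|h\|_S\le 1\},\|\cdot\|_H\bigr)}\,d\epsilon<\infty .$$ (b) There are operators $\dot K_\theta:H\to H$ with $(K_{\theta+s}f-K_\theta f)/s\to\dot K_\theta f$ in $H$ as $s\to0$, for every $f\in H$, $\theta\in\Theta$, and constants $D_0,\dots,D_3$ such that for all $\theta,\theta_1,\theta_2\in\Theta$ and $f_1,f_2\in H$: (i) $\|K_\theta\|\le D_0$, $\|\dot K_\theta\|\le D_0$; (ii) $\|K_\theta-K_{\theta_0}\|_{H\to S}\le D_1|\theta-\theta_0|$; (iii) $\|K_\theta-K_{\theta_0}-(\theta-\theta_0)\dot K_{\theta_0}\|_{H\to S}\le D_2(\theta-\theta_0)^2$; (iv) $\|K_{\theta_1}f_1-K_{\theta_2}f_2\|\le D_3|\theta_1-\theta_2|(\|f_1\|\wedge\|f_2\|)+D_3\|f_1-f_2\|$. (c) The posterior distribution of $(\theta,f)$ and the posterior distribution of $f$ given $\theta=\theta_0$ contract at rate $\epsilon_n$, where $\epsilon_n\to0$ and $\epsilon_n\gg n^{-1/2}$. (d) There are positive numbers $\eta_n\to0$, elements $\gamma_n\in H$ and numbers $\rho_n$ with $\|\gamma_n-\gamma_{\theta_0,f_0}\|\lesssim\rho_n$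 and $n\epsilon_n^2\rho_n^2\to0$, such that $$\pi_f\bigl(\|f-f_0\|\le\epsilon_n/(2D_3+2)\bigr)\ge e^{-n\epsilon_n^2/65},$$ $$\pi_f\Bigl(\exists\,s,t\in(-\epsilon_n,\epsilon_n):\ \Bigl|\log\frac{d\pi_{f+(s+t)\gamma_n}}{d\pi_{f+s\gamma_n}}(f)\Bigr|>\eta_n(1+nt^2)\Bigr)\le e^{-3n\epsilon_n^2}.$$ (e) Either the map $\theta\mapsto\|K_\theta f\|$ is constant on $\Theta$ for every $f\in H$, or $$\sqrt n\sup_{f\in H_n}\bigl|\langle K_{\theta_0}(f-f_0),\dot K_{\theta_0}(f-f_0)\rangle\bigr|\to0$$ for some subsets $H_n\subset H$ for which there are $\Theta_n\subset\Theta$ with $\sqrt n(\Theta_n-\theta_0)\uparrow\mathbb R$ such that $\Pi(\Theta_n\times H_n\mid X^n)\to1$ and $\inf_{\theta\in\Theta_n}\Pi^{\theta=\theta_0}(H_n+(\theta-\theta_0)\gamma_n\mid X^n)\to1$ in $P^n_{\theta_0,f_0}$-probability. Then the Bernstein-von Mises theorem holds at $(\theta_0,f_0)$, i.e. in $P^n_{\theta_0,f_0}$-probability as $n\to\infty$, $$\Big\|\Pi(\theta\in\cdot\mid X^n)-N\Big(\theta_0+\tfrac1{\sqrt n}\Delta^n_{\theta_0,f_0},\ \tfrac1n\tilde I_{\theta_0,f_0}^{-1}\Big)\Big\|_{\rm TV}\to0 .$$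
   Context: Model. $\Theta\subset\mathbb R$ is compact, $(H,\langle\cdot,\cdot\rangle,\|\cdot\|)$ is a separable Hilbert space, and $K_\theta:H\to H$, $\theta\in\Theta$, are bounded linear operators with adjoints $K_\theta^*$. $\|A\|_{H\to S}=\sup_{\|h\|\le1}\|Ah\|_S$ is the operator norm, written $\|A\|$ if $S=H$. $N(\epsilon,A,d)$ is the minimal number of $d$-balls of radius $\epsilon$ needed to cover $A$; $a\wedge b$ is the minimum; $a_n\lesssim b_n$ means $a_n/b_n$ is bounded (with $\|\gamma_n-\gamma_{\theta_0,f_0}\|=0$ if $\rho_n=0$); $a_n\gg b_n$ means $b_n/a_n\to0$. Fix an orthonormal basis $(e_k)_{k\in\mathbb N}$ of $H$. $P^n_{\theta,f}$ is the law of $X^n=(X^{(1)},X^{(2)})$, two sequences with $$X^{(1)}_k=\langle f,e_k\rangle+n^{-1/2}Z_{1,k},\qquad X^{(2)}_k=\langle K_\theta f,e_k\rangle+n^{-1/2}Z_{2,k},$$ where the $Z_{i,k}$ are i.i.d. standard normal. For $h\in H$, $\langle X^{(i)},h\rangle:=\sum_kX^{(i)}_k\langle h,e_k\rangle$ (convergent in $L_2$ and almost surely), and, under $P^n_{\theta,f}$, $\langle h,\dot W^{(1)}\rangle:=\sqrt n(\langle X^{(1)},h\rangle-\langle f,h\rangle)$ and $\langle h,\dot W^{(2)}\rangle:=\sqrt n(\langle X^{(2)},h\rangle-\langle K_\theta f,h\rangle)$. With $P_0^n$ the law for $f=0$, $$\log\frac{dP^n_{\theta,f}}{dP^n_0}(X^n)=n\langle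 X^{(1)},f\rangle-\tfrac n2\|f\|^2+n\langle X^{(2)},K_\theta f\rangle-\tfrac n2\|K_\theta f\|^2 .$$ Prior and posterior. The prior is $\Pi=\pi_\theta\times\pi_f$, where $\pi_\theta$ has a continuous Lebesgue density on $\Theta$ bounded away from $0$ and $\infty$, and $\pi_f$ is a probability measure on $H$. $\Pi(\cdot\mid X^n)$ is the posterior of $(\theta,f)$ obtained from the likelihood $\frac{dP^n_{\theta,f}}{dP^n_0}(X^n)=\exp\bigl(n\langle X^{(1)},f\rangle-\tfrac n2\|f\|^2+n\langle X^{(2)},K_\theta f\rangle-\tfrac n2\|K_\theta f\|^2\bigr)$ by Bayes' formula; $\Pi^{\theta=\theta_0}(\cdot\mid X^n)$ is the posterior of $f$ (prior $\pi_f$) in the model where $\theta=\theta_0$ is known. For $h\in H$, $\pi_{f+h}$ denotes the law of $f+h$ when $f\sim\pi_f$. The posterior of $(\theta,f)$ contracts at rate $\epsilon_n$ if $\Pi(|\theta-\theta_0|<\epsilon_n,\|f-f_0\|<\epsilon_n\mid X^n)\to1$ in $P^n_{\theta_0,f_0}$-probability; the posterior of $f$ given $\theta_0$ contracts at rate $\epsilon_n$ if $\Pi^{\theta=\theta_0}(\|f-f_0\|<\epsilon_n\mid X^n)\to1$ in $P^n_{\theta_0,f_0}$-probability. Semiparametric quantities. The least favorable direction is $\gamma_{\theta,f}=(I+K_\theta^*K_\theta)^{-1}K_\theta^*\dot K_\theta f$, and the efficient Fisher information is $\tilde I_{\theta,f}=\|\gamma_{\theta,f}\|^2+\|\dot K_\theta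 f-K_\theta\gamma_{\theta,f}\|^2$. Further $$\Delta^n_{\theta,f}=\frac1{\tilde I_{\theta,f}}\bigl(\langle\dot K_\theta f,\dot W^{(2)}\rangle-\langle\gamma_{\theta,f},\dot W^{(1)}\rangle-\langle K_\theta\gamma_{\theta,f},\dot W^{(2)}\rangle\bigr),$$ a measurable transformation of $X^n$ distributed as $N(0,\tilde I_{\theta,f}^{-1})$ under $P^n_{\theta,f}$. The total variation distance is $\|P-Q\|_{\rm TV}=2\sup_F|P(F)-Q(F)|$. *)

theory Defs
  imports "HOL-Probability.Probability"
begin

section \<open>Normed subspaces, operator norm and entropy\<close>

definition orthonormal_basis :: "(nat \<Rightarrow> 'h::real_inner) \<Rightarrow> bool" where
  "orthonormal_basis e \<longleftrightarrow>
     (\<forall>i j. e i \<bullet> e j = (if i = j then 1 else 0)) \<and> closure (span (range e)) = UNIV"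

definition normed_subspace :: "'h::real_vector set \<Rightarrow> ('h \<Rightarrow> real) \<Rightarrow> bool" where
  "normed_subspace S nS \<longleftrightarrow> subspace S \<and>
     (\<forall>x\<in>S. 0 \<le> nS x \<and> (nS x = 0 \<longleftrightarrow> x = 0)) \<and>
     (\<forall>x\<in>S. \<forall>c. nS (c *\<^sub>R x) = \<bar>c\<bar> * nS x) \<and>
     (\<forall>x\<in>S. \<forall>y\<in>S. nS (x + y) \<le> nS x + nS y)"

text \<open>The operator norm from \<open>H\<close> into \<open>(S, nS)\<close>. It takes the value \<open>\<infinity>\<close> if the operator does
  not map into \<open>S\<close>; hence a finite bound includes the statement that it does.\<close>

definition onorm_into :: "'h set \<Rightarrow> ('h \<Rightarrow> real) \<Rightarrow> ('h::real_normed_vector \<Rightarrow> 'h) \<Rightarrow> ereal" where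
  "onorm_into S nS A = (SUP h\<in>{h. norm h \<le> 1}. if A h \<in> S then ereal (nS (A h)) else \<infinity>)"

text \<open>The infimum over the empty set is \<open>\<infinity>\<close>: this is the value for sets that have no finite cover.\<close>

definition covering_number :: "real \<Rightarrow> 'h::metric_space set \<Rightarrow> enat" where
  "covering_number \<epsilon> A = (INF C\<in>{C. finite C \<and> A \<subseteq> (\<Union>c\<in>C. ball c \<epsilon>)}. enat (card C))"

definition sqrt_entropy :: "real \<Rightarrow> 'h::metric_space set \<Rightarrow> ennreal" where
  "sqrt_entropy \<epsilon> A = (case covering_number \<epsilon> A of
      enat N \<Rightarrow> ennreal (sqrt (ln (real N))) | \<infinity> \<Rightarrow> \<infinity>)"

definition entropy_integral :: "'h::metric_space set \<Rightarrow> ennreal" where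
  "entropy_integral A = (\<integral>\<^sup>+\<epsilon>. sqrt_entropy \<epsilon> A * indicator {0<..<1} \<epsilon> \<partial>lborel)"


section \<open>Convergence in probability and total variation\<close>

text \<open>The outer measure makes the notion meaningful for maps that are not known to be measurable,
  such as an infimum over uncountably many posterior probabilities; \<^const>\<open>measure\<close> is \<open>0\<close> on
  non-measurable sets.\<close>

definition conv_in_prob :: "(nat \<Rightarrow> 'x measure) \<Rightarrow> (nat \<Rightarrow> 'x \<Rightarrow> real) \<Rightarrow> real \<Rightarrow> bool" where
  "conv_in_prob P Y c \<longleftrightarrow> (\<forall>\<delta>>0.
     (\<lambda>n. outer_measure_of (P n) {x \<in> space (P n). \<delta> < \<bar>Y n x - c\<bar>}) \<longlonglongrightarrow> 0)"

definition tv_dist :: "'x measure \<Rightarrow> 'x measure \<Rightarrow> real" where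
  "tv_dist P Q = 2 * (SUP F\<in>sets P. \<bar>measure P F - measure Q F\<bar>)"

definition normal_law :: "real \<Rightarrow> real \<Rightarrow> real measure" where
  "normal_law \<mu> v = density lborel (\<lambda>x. ennreal (normal_density \<mu> (sqrt v) x))"


section \<open>The statistical model\<close>

type_synonym obs = "(nat \<Rightarrow> real) \<times> (nat \<Rightarrow> real)"

definition white_noise :: "obs measure" where
  "white_noise = (\<Pi>\<^sub>M k\<in>UNIV. normal_law 0 1) \<Otimes>\<^sub>M (\<Pi>\<^sub>M k\<in>UNIV. normal_law 0 1)"

definition obs_law ::
  "(nat \<Rightarrow> 'h::real_inner) \<Rightarrow> (real \<Rightarrow> 'h \<Rightarrow>\<^sub>L 'h) \<Rightarrow> real \<Rightarrow> 'h \<Rightarrow> nat \<Rightarrow> obs measure" where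
  "obs_law e K \<theta> f n = distr white_noise
     ((\<Pi>\<^sub>M k\<in>UNIV. borel) \<Otimes>\<^sub>M (\<Pi>\<^sub>M k\<in>UNIV. borel))
     (\<lambda>(z1, z2). (\<lambda>k. f \<bullet> e k + z1 k / sqrt (real n),
                  \<lambda>k. K \<theta> f \<bullet> e k + z2 k / sqrt (real n)))"

definition obs_inner :: "(nat \<Rightarrow> 'h::real_inner) \<Rightarrow> (nat \<Rightarrow> real) \<Rightarrow> 'h \<Rightarrow> real" where
  "obs_inner e x h = (\<Sum>k. x k * (h \<bullet> e k))"

definition noise1 :: "(nat \<Rightarrow> 'h::real_inner) \<Rightarrow> 'h \<Rightarrow> nat \<Rightarrow> obs \<Rightarrow> 'h \<Rightarrow> real" where
  "noise1 e f n x h = sqrt (real n) * (obs_inner e (fst x) h - f \<bullet> h)"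

definition noise2 ::
  "(nat \<Rightarrow> 'h::real_inner) \<Rightarrow> (real \<Rightarrow> 'h \<Rightarrow>\<^sub>L 'h) \<Rightarrow> real \<Rightarrow> 'h \<Rightarrow> nat \<Rightarrow> obs \<Rightarrow> 'h \<Rightarrow> real" where
  "noise2 e K \<theta> f n x h = sqrt (real n) * (obs_inner e (snd x) h - K \<theta> f \<bullet> h)"

definition likelihood ::
  "(nat \<Rightarrow> 'h::real_inner) \<Rightarrow> (real \<Rightarrow> 'h \<Rightarrow>\<^sub>L 'h) \<Rightarrow> nat \<Rightarrow> obs \<Rightarrow> real \<Rightarrow> 'h \<Rightarrow> real" where
  "likelihood e K n x \<theta> f =
     exp (real n * obs_inner e (fst x) f - real n / 2 * (norm f)\<^sup>2
        + real n * obs_inner e (snd x) (K \<theta> f) - real n / 2 * (norm (K \<theta> f))\<^sup>2)"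


section \<open>Prior and posterior\<close>

definition param_prior :: "real set \<Rightarrow> (real \<Rightarrow> real) \<Rightarrow> real measure" where
  "param_prior \<Theta> p = density (restrict_space lborel \<Theta>) (\<lambda>\<theta>. ennreal (p \<theta>))"

definition bayes :: "'w measure \<Rightarrow> ('w \<Rightarrow> real) \<Rightarrow> 'w measure" where
  "bayes M l = density M (\<lambda>w. ennreal (l w) / (\<integral>\<^sup>+v. ennreal (l v) \<partial>M))"

definition posterior ::
  "(nat \<Rightarrow> 'h::real_inner) \<Rightarrow> (real \<Rightarrow> 'h \<Rightarrow>\<^sub>L 'h) \<Rightarrow> real measure \<Rightarrow> 'h measure \<Rightarrow>
   nat \<Rightarrow> obs \<Rightarrow> (real \<times> 'h) measure" where
  "posterior e K \<pi>\<theta> \<pi>f n x = bayes (\<pi>\<theta> \<Otimes>\<^sub>M \<pi>f) (\<lambda>(\<theta>, f). likelihood e K n x \<theta> f)"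

definition posterior_known ::
  "(nat \<Rightarrow> 'h::real_inner) \<Rightarrow> (real \<Rightarrow> 'h \<Rightarrow>\<^sub>L 'h) \<Rightarrow> real \<Rightarrow> 'h measure \<Rightarrow>
   nat \<Rightarrow> obs \<Rightarrow> 'h measure" where
  "posterior_known e K \<theta>0 \<pi>f n x = bayes \<pi>f (likelihood e K n x \<theta>0)"

definition shifted_law :: "'h::real_normed_vector measure \<Rightarrow> 'h \<Rightarrow> 'h measure" where
  "shifted_law \<pi>f h = distr \<pi>f borel (\<lambda>f. f + h)"

text \<open>\<open>L\<close> is a version of \<open>log (dP/dQ)\<close>. Writing the density as \<open>exp L\<close> avoids the HOL convention
  \<open>ln 0 = 0\<close>, which would wrongly turn a vanishing density into a small log-density. A real-valued
  \<open>L\<close> exists iff \<open>P\<close> and \<open>Q\<close> have the same null sets. For the laws of \<open>f + (s + t) \<gamma>\<close> and \<open>f + s \<gamma>\<close>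
  this already follows if the former is absolutely continuous with respect to the latter for all
  \<open>s\<close>, \<open>t\<close> in a symmetric interval.\<close>

definition log_density_version :: "'x measure \<Rightarrow> 'x measure \<Rightarrow> ('x \<Rightarrow> real) \<Rightarrow> bool" where
  "log_density_version P Q L \<longleftrightarrow>
     L \<in> borel_measurable Q \<and> P = density Q (\<lambda>x. ennreal (exp (L x)))"


section \<open>Semiparametric quantities\<close>

definition least_favorable ::
  "(real \<Rightarrow> 'h::real_inner \<Rightarrow>\<^sub>L 'h) \<Rightarrow> (real \<Rightarrow> 'h \<Rightarrow>\<^sub>L 'h) \<Rightarrow> real \<Rightarrow> 'h \<Rightarrow> 'h" where
  "least_favorable K K' \<theta> f =
     inv (\<lambda>h. h + adjoint (K \<theta>) (K \<theta> h)) (adjoint (K \<theta>) (K' \<theta> f))"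

definition efficient_info ::
  "(real \<Rightarrow> 'h::real_inner \<Rightarrow>\<^sub>L 'h) \<Rightarrow> (real \<Rightarrow> 'h \<Rightarrow>\<^sub>L 'h) \<Rightarrow> real \<Rightarrow> 'h \<Rightarrow> real" where
  "efficient_info K K' \<theta> f =
     (let \<gamma> = least_favorable K K' \<theta> f
      in (norm \<gamma>)\<^sup>2 + (norm (K' \<theta> f - K \<theta> \<gamma>))\<^sup>2)"

definition efficient_influence ::
  "(nat \<Rightarrow> 'h::real_inner) \<Rightarrow> (real \<Rightarrow> 'h \<Rightarrow>\<^sub>L 'h) \<Rightarrow> (real \<Rightarrow> 'h \<Rightarrow>\<^sub>L 'h) \<Rightarrow> real \<Rightarrow> 'h \<Rightarrow>
   nat \<Rightarrow> obs \<Rightarrow> real" where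
  "efficient_influence e K K' \<theta> f n x =
     (let \<gamma> = least_favorable K K' \<theta> f
      in (noise2 e K \<theta> f n x (K' \<theta> f) - noise1 e f n x \<gamma> - noise2 e K \<theta> f n x (K \<theta> \<gamma>))
           / efficient_info K K' \<theta> f)"

end

theory Submission
  imports Defs
begin

text \<open>
  Let \<open>u = \<theta> - \<theta>\<^sub>0\<close>. Along the least favourable direction the log-likelihood expands as
  \<open>\<ell>(\<theta>, f) = \<ell>(\<theta>\<^sub>0, f + u \<gamma>\<^sub>n) + u \<surd>n V - n u\<^sup>2 I / 2\<close> up to an error
  \<open>o(1) (1 + n u\<^sup>2)\<close>: the normal equation of \<open>\<gamma>\<close> removes the term linear in \<open>f - f\<^sub>0\<close>, condition (e)
  the term \<open>n u \<langle>K (f - f\<^sub>0), K' (f - f\<^sub>0)\<rangle>\<close>, and chaining under the entropy condition makes the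
  noise integrals of the remainder uniformly small. Integrating over \<open>f\<close> and changing variables
  from \<open>f\<close> to \<open>f + u \<gamma>\<^sub>n\<close>, which hardly changes the prior outside a set that is negligible for the
  posterior, turns the marginal posterior density of \<open>\<theta>\<close> into \<open>exp (u \<surd>n V - n u\<^sup>2 I / 2)\<close> times
  a factor that is nearly constant in \<open>\<theta>\<close>. A lower bound for this density and an upper bound for its
  integral already give convergence in total variation.
\<close>

section \<open>Hilbert space preliminaries\<close>

text \<open>The series \<open>obs_inner\<close> converges almost surely for each fixed vector, but
  the exceptional set depends on the vector. The likelihood is therefore handled only on the random
  subspace \<open>conv_set\<close>, for almost every parameter under the prior;
  \<open>regular\<close> gathers the exceptions. Data are recoded as noise, whose law depends
  neither on n nor on the parameter, so each random event becomes an exceptional set under the one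
  measure \<open>white_noise\<close>, bounded by Markov's inequality and the Gaussian moment
  generating function. Outer measures are used because posterior statements over uncountably many
  \<theta> may fail to be measurable. An error t (1 + n u^2) in the exponent is harmless for |u| of
  order 1 / sqrt n. Outside such a window it is not small, but its quadratic part can be absorbed by
  lowering the information I to I - 2 t. The constants 3 and 1/65 of condition (d) leave room for
  5/4 < 2 < 3 - 1/65: the denominator of the posterior costs exp (5/4 n \<epsilon>^2) on a small
  ball, the exceptional set of the prior densities has relative prior mass exp (-(3 - 1/65) n
  \<epsilon>^2), and splitting at exponent 2 makes it negligible.\<close>

definition trunc :: "(nat \<Rightarrow> 'h::real_inner) \<Rightarrow> nat \<Rightarrow> 'h \<Rightarrow> 'h" where
  "trunc e N h = (\<Sum>k<N. (h \<bullet> e k) *\<^sub>R e k)"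

locale hilbert_basis =
  fixes e :: "nat \<Rightarrow> 'h::{real_inner, complete_space, second_countable_topology}"
  assumes basis: "orthonormal_basis e"
begin

lemma inner_basis: "e i \<bullet> e j = (if i = j then 1 else 0)"
  using basis by (simp add: orthonormal_basis_def)

lemma trunc_inner_basis: "trunc e N h \<bullet> e j = (if j < N then h \<bullet> e j else 0)"
  by (simp add: trunc_def inner_sum_left inner_basis if_distrib sum.delta cong: if_cong)

lemma trunc_inner: "trunc e N a \<bullet> b = (\<Sum>k<N. (a \<bullet> e k) * (b \<bullet> e k))"
  unfolding trunc_def inner_sum_left by (simp add: inner_commute)

lemma norm_trunc_sq: "(norm (trunc e N h))\<^sup>2 = (\<Sum>k<N. (h \<bullet> e k)\<^sup>2)"
  unfolding power2_norm_eq_inner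
  by (subst trunc_inner) (auto simp: trunc_inner_basis power2_eq_square)

lemma norm_trunc_le: "norm (trunc e N h) \<le> norm h"
proof -
  have "trunc e N h \<bullet> trunc e N h = trunc e N h \<bullet> h"
    by (subst (1 2) trunc_inner) (auto simp: trunc_inner_basis)
  then have "norm (trunc e N h) * norm (trunc e N h) \<le> norm (trunc e N h) * norm h"
    using norm_cauchy_schwarz[of "trunc e N h" h]
    by (metis power2_eq_square power2_norm_eq_inner)
  then show ?thesis
    by (cases "norm (trunc e N h) = 0") (auto simp: mult_le_cancel_left)
qed

lemma trunc_add: "trunc e N (a + b) = trunc e N a + trunc e N b"
  by (simp add: trunc_def inner_add_left scaleR_left_distrib sum.distrib)

lemma trunc_scaleR: "trunc e N (c *\<^sub>R a) = c *\<^sub>R trunc e N a"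
  by (simp add: trunc_def scaleR_sum_right)

lemma trunc_diff: "trunc e N (a - b) = trunc e N a - trunc e N b"
  by (simp add: trunc_def inner_diff_left scaleR_left_diff_distrib sum_subtractf)

lemma trunc_span_eventually:
  assumes "v \<in> span (range e)"
  shows "\<exists>N0. \<forall>N\<ge>N0. trunc e N v = v"
  using assms
proof (induction rule: span_induct_alt)
  case base
  then show ?case by (auto simp: trunc_def)
next
  case (step c x y)
  then obtain k N0 where x: "x = e k" and N0: "\<forall>N\<ge>N0. trunc e N y = y" by auto
  have "trunc e N (e k) = e k" if "N \<ge> Suc k" for N
    using that by (simp add: trunc_def inner_basis if_distrib[of "\<lambda>t. t *\<^sub>R _"] sum.delta cong: if_cong)
  then show ?case using N0 x
    by (intro exI[of _ "max N0 (Suc k)"]) (auto simp: trunc_add trunc_scaleR)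
qed

text \<open>Truncations do not increase the norm and eventually fix every vector of the span, so
  approximating h from the dense span suffices.\<close>

lemma trunc_tendsto: "(\<lambda>N. trunc e N h) \<longlonglongrightarrow> h"
proof (rule LIMSEQ_I)
  fix r :: real assume r: "0 < r"
  have "h \<in> closure (span (range e))" using basis by (simp add: orthonormal_basis_def)
  then obtain v where v: "v \<in> span (range e)" "dist v h < r / 2"
    using r by (metis closure_approachable half_gt_zero)
  obtain N0 where N0: "\<forall>N\<ge>N0. trunc e N v = v" using trunc_span_eventually[OF v(1)] by blast
  have "norm (trunc e N h - h) < r" if "N \<ge> N0" for N
  proof -
    have "trunc e N h - h = trunc e N (h - v) - (h - v)" using N0 that by (simp add: trunc_diff)
    then have "norm (trunc e N h - h) \<le> norm (trunc e N (h - v)) + norm (h - v)"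
      by (metis norm_triangle_ineq4)
    also have "\<dots> \<le> 2 * norm (h - v)" using norm_trunc_le[of N "h - v"] by simp
    also have "\<dots> < r" using v(2) by (simp add: dist_norm norm_minus_commute)
    finally show ?thesis .
  qed
  then show "\<exists>no. \<forall>n\<ge>no. norm (trunc e n h - h) < r" by blast
qed

lemma parseval: "(\<lambda>k. (a \<bullet> e k) * (b \<bullet> e k)) sums (a \<bullet> b)"
  unfolding sums_def trunc_inner[symmetric]
  by (intro tendsto_inner trunc_tendsto tendsto_const)

lemma parseval_sq: "(\<lambda>k. (a \<bullet> e k)\<^sup>2) sums (norm a)\<^sup>2"
  using parseval[of a a] unfolding power2_norm_eq_inner by (simp add: power2_eq_square)

text \<open>Riesz-Fischer: squared distances of partial sums are blocks of a convergent series, and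
  completeness supplies the limit.\<close>

lemma basis_expansion:
  assumes "summable (\<lambda>k. (c k)\<^sup>2)"
  shows "\<exists>h. \<forall>k. h \<bullet> e k = c k"
proof -
  define s where "s N = (\<Sum>k<N. c k *\<^sub>R e k)" for N
  have s_inner: "s N \<bullet> e j = (if j < N then c j else 0)" for N j
    by (simp add: s_def inner_sum_left inner_basis if_distrib sum.delta cong: if_cong)
  have norm_diff: "(norm (s N - s M))\<^sup>2 = (\<Sum>k=M..<N. (c k)\<^sup>2)" if "M \<le> N" for M N
  proof -
    have "{..<N} = {..<M} \<union> {M..<N}" using that by auto
    then have d: "s N - s M = (\<Sum>k=M..<N. c k *\<^sub>R e k)"
      unfolding s_def by (simp add: sum.union_disjoint ivl_disj_int)
    have "(s N - s M) \<bullet> (s N - s M) = (\<Sum>k=M..<N. c k * (e k \<bullet> (s N - s M)))"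
      by (subst (1) d) (simp add: inner_sum_left)
    also have "\<dots> = (\<Sum>k=M..<N. (c k)\<^sup>2)"
      using that by (intro sum.cong) (auto simp: inner_diff_right inner_commute[of "e _"] s_inner power2_eq_square)
    finally show ?thesis by (simp add: power2_norm_eq_inner)
  qed
  have "Cauchy s"
  proof (rule CauchyI)
    fix r :: real assume r: "0 < r"
    then obtain N0 where N0: "\<And>m n. m \<ge> N0 \<Longrightarrow> norm (\<Sum>k=m..<n. (c k)\<^sup>2) < r\<^sup>2"
      using assms unfolding summable_Cauchy by (metis zero_less_power)
    have le: "norm (s N - s M) < r" if "N0 \<le> M" "M \<le> N" for M N
    proof -
      have "(norm (s N - s M))\<^sup>2 < r\<^sup>2"
        unfolding norm_diff[OF that(2)] using N0[OF that(1), of N] by (simp add: sum_nonneg)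
      then show ?thesis using r by (simp add: power_less_imp_less_base)
    qed
    show "\<exists>M. \<forall>m\<ge>M. \<forall>n\<ge>M. norm (s m - s n) < r"
    proof (intro exI allI impI)
      fix m n assume "N0 \<le> m" "N0 \<le> n"
      then show "norm (s m - s n) < r"
        using le[of m n] le[of n m] by (cases "m \<le> n") (auto simp: norm_minus_commute)
    qed
  qed
  then obtain h where h: "s \<longlonglongrightarrow> h" by (auto simp: Cauchy_convergent_iff convergent_def)
  have "h \<bullet> e j = c j" for j
  proof -
    have "(\<lambda>N. s N \<bullet> e j) \<longlonglongrightarrow> h \<bullet> e j" by (intro tendsto_inner h tendsto_const)
    moreover have "(\<lambda>N. s N \<bullet> e j) \<longlonglongrightarrow> c j"
      by (rule tendsto_eventually) (auto simp: s_inner eventually_sequentially intro!: exI[of _ "Suc j"])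
    ultimately show ?thesis by (rule LIMSEQ_unique)
  qed
  then show ?thesis by blast
qed

text \<open>\<open>adjoint\<close> is a choice among the maps with this property, so one such map
  has to be exhibited. It is built in coordinates, as the vector with coefficients
  \<open>A (e k) \<bullet> y\<close>.\<close>

lemma inner_adjoint:
  fixes A :: "'h \<Rightarrow>\<^sub>L 'h"
  shows "A x \<bullet> y = x \<bullet> adjoint A y"
proof -
  have "\<exists>g. \<forall>x. A x \<bullet> y = x \<bullet> g" for y
  proof -
    have tr: "A (trunc e N v) \<bullet> y = (\<Sum>k<N. (v \<bullet> e k) * (A (e k) \<bullet> y))" for N v
      by (simp add: trunc_def blinfun.sum_right blinfun.scaleR_right inner_sum_left)
    have "(\<Sum>k<N. (A (e k) \<bullet> y)\<^sup>2) \<le> (norm A * norm y)\<^sup>2" for N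
    proof -
      \<comment> \<open>Testing A on the vector whose own coefficients are
        \<open>A (e k) \<bullet> y\<close> gives |v|^2 = \<open>A v \<bullet> y\<close>, at most |A|
        |v| |y|; hence a bound on |v| uniform in N.\<close>
      define v where "v = (\<Sum>k<N. (A (e k) \<bullet> y) *\<^sub>R e k)"
      have ve: "v \<bullet> e j = (if j < N then A (e j) \<bullet> y else 0)" for j
        by (simp add: v_def inner_sum_left inner_basis if_distrib sum.delta cong: if_cong)
      have "trunc e N v = v" unfolding trunc_def ve by (simp add: v_def)
      then have Av: "A v \<bullet> y = (\<Sum>k<N. (A (e k) \<bullet> y)\<^sup>2)" and nv: "(norm v)\<^sup>2 = (\<Sum>k<N. (A (e k) \<bullet> y)\<^sup>2)"
        using tr[of N v] norm_trunc_sq[of N v] by (auto simp: ve power2_eq_square)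
      have "A v \<bullet> y \<le> norm A * norm v * norm y"
        using norm_cauchy_schwarz[of "A v" y] norm_blinfun[of A v]
        by (meson mult_right_mono norm_ge_zero order_trans)
      then have "norm v * norm v \<le> (norm A * norm y) * norm v"
        using Av nv by (simp add: power2_eq_square algebra_simps)
      then have "norm v \<le> norm A * norm y"
        by (cases "norm v = 0") (auto simp: mult_le_cancel_right)
      then show ?thesis unfolding nv[symmetric] by (intro power_mono) auto
    qed
    then have "(\<Sum>k\<le>N. (A (e k) \<bullet> y)\<^sup>2) \<le> (norm A * norm y)\<^sup>2" for N
      unfolding lessThan_Suc_atMost[symmetric] .
    then have "summable (\<lambda>k. (A (e k) \<bullet> y)\<^sup>2)"
      by (intro bounded_imp_summable) auto
    from basis_expansion[OF this] obtain g where g: "\<And>k. g \<bullet> e k = A (e k) \<bullet> y" by blast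
    have "A x \<bullet> y = x \<bullet> g" for x
    proof -
      have "(\<lambda>N. A (trunc e N x) \<bullet> y) \<longlonglongrightarrow> A x \<bullet> y"
        by (intro tendsto_inner tendsto_const blinfun.tendsto trunc_tendsto)
      moreover have "(\<lambda>N. A (trunc e N x) \<bullet> y) \<longlonglongrightarrow> x \<bullet> g"
        unfolding tr g[symmetric] using parseval[of x g] by (simp add: sums_def)
      ultimately show ?thesis by (rule LIMSEQ_unique)
    qed
    then show ?thesis by blast
  qed
  then obtain G where "\<forall>x y. A x \<bullet> y = x \<bullet> G y" by metis
  then have "\<forall>x y. A x \<bullet> y = x \<bullet> adjoint A y"
    unfolding adjoint_def by (rule someI[of "\<lambda>f'. \<forall>x y. A x \<bullet> y = x \<bullet> f' y"])
  then show ?thesis by blast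
qed

text \<open>\<open>least_favorable\<close> is defined through \<open>inv\<close>, which is
  meaningful only on the range, so the work lies in showing that the right-hand side is attained.
  The weak form, tested against v, is what the likelihood expansion consumes.\<close>

lemma least_favorable_normal_equation:
  fixes K K' :: "real \<Rightarrow> 'h \<Rightarrow>\<^sub>L 'h" and f :: 'h and \<theta> :: real
  defines "g \<equiv> least_favorable K K' \<theta> f"
  shows "g \<bullet> v + K \<theta> g \<bullet> K \<theta> v = K' \<theta> f \<bullet> K \<theta> v"
proof -
  define A where "A = K \<theta>"
  define B where "B h = adjoint A (A h)" for h
  define y where "y = adjoint A (K' \<theta> f)"
  have adj: "x \<bullet> adjoint A z = A x \<bullet> z" for x z by (simp add: inner_adjoint)
  have B_diff: "B (a - b) = B a - B b" for a b
  proof -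
    have "\<forall>x. x \<bullet> B (a - b) = x \<bullet> (B a - B b)"
      by (simp add: B_def adj blinfun.diff_right inner_diff_right)
    then show ?thesis by (metis vector_eq_ldot)
  qed
  have hB: "h \<bullet> B h = (norm (A h))\<^sup>2" for h
    by (simp add: B_def adj power2_norm_eq_inner)
  have nB: "norm (B h) \<le> norm A * norm (A h)" for h
  proof -
    have "norm (B h) * norm (B h) = B h \<bullet> B h" by (metis power2_eq_square power2_norm_eq_inner)
    also have "\<dots> = A (B h) \<bullet> A h" by (subst (2) B_def) (rule adj)
    also have "\<dots> \<le> norm (A (B h)) * norm (A h)" by (rule norm_cauchy_schwarz)
    also have "\<dots> \<le> (norm A * norm (A h)) * norm (B h)"
      using mult_right_mono[OF norm_blinfun[of A "B h"], of "norm (A h)"] by (simp add: algebra_simps)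
    finally show ?thesis
      by (cases "norm (B h) = 0") (auto simp: mult_le_cancel_right)
  qed
  text \<open>The equation \<open>h + B h = y\<close> is solved as the fixed point of the damped iteration
    \<open>h - \<tau> (h + B h - y)\<close>, a contraction with constant \<open>1 - \<tau>\<close>.\<close>
  define \<tau> where "\<tau> = 1 / (1 + (norm A)\<^sup>2)"
  have \<tau>: "0 < \<tau>" "\<tau> \<le> 1" "\<tau> * (norm A)\<^sup>2 = 1 - \<tau>"
    using add_pos_nonneg[of 1 "(norm A)\<^sup>2"] by (auto simp: \<tau>_def field_simps)
  define T where "T h = h - \<tau> *\<^sub>R (h + B h - y)" for h
  have "\<exists>!h. T h = h"
  proof (rule banach_fix_type)
    show "0 \<le> 1 - \<tau>" "1 - \<tau> < 1" using \<tau> by auto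
    show "\<forall>a b. dist (T a) (T b) \<le> (1 - \<tau>) * dist a b"
    proof (intro allI)
      fix a b :: 'h
      define d where "d = a - b"
      have T_diff: "T a - T b = (1 - \<tau>) *\<^sub>R d - \<tau> *\<^sub>R B d"
        by (simp add: T_def d_def B_diff algebra_simps)
      have "(norm (T a - T b))\<^sup>2
          = (1 - \<tau>)\<^sup>2 * (norm d)\<^sup>2 - 2 * (1 - \<tau>) * \<tau> * (d \<bullet> B d) + \<tau>\<^sup>2 * (norm (B d))\<^sup>2"
        unfolding T_diff power2_norm_eq_inner
        by (simp add: inner_diff_left inner_diff_right inner_commute power2_eq_square algebra_simps)
      also have "\<dots> \<le> (1 - \<tau>)\<^sup>2 * (norm d)\<^sup>2 - 2 * (1 - \<tau>) * \<tau> * (norm (A d))\<^sup>2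
          + \<tau>\<^sup>2 * ((norm A)\<^sup>2 * (norm (A d))\<^sup>2)"
        using nB[of d] \<tau> by (auto simp: hB power_mult_distrib[symmetric] intro!: mult_left_mono power_mono)
      \<comment> \<open>The choice of \<tau> gives
        \<open>\<tau> * (norm A)\<^sup>2 = 1 - \<tau>\<close>, so the squared term in B d cancels
        half of the cross term and the rest is non-positive.\<close>
      also have "\<dots> = (1 - \<tau>)\<^sup>2 * (norm d)\<^sup>2 - (1 - \<tau>) * \<tau> * (norm (A d))\<^sup>2"
      proof -
        have "\<tau>\<^sup>2 * ((norm A)\<^sup>2 * (norm (A d))\<^sup>2) = \<tau> * (\<tau> * (norm A)\<^sup>2) * (norm (A d))\<^sup>2"
          by (simp add: power2_eq_square)
        then show ?thesis unfolding \<tau>(3) by (simp add: algebra_simps)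
      qed
      also have "\<dots> \<le> ((1 - \<tau>) * norm d)\<^sup>2" using \<tau> by (simp add: power_mult_distrib)
      finally have "norm (T a - T b) \<le> (1 - \<tau>) * norm d"
        using \<tau> by (simp add: power2_le_iff_abs_le abs_mult)
      then show "dist (T a) (T b) \<le> (1 - \<tau>) * dist a b" by (simp add: dist_norm d_def)
    qed
  qed
  then obtain h where "T h = h" by blast
  then have "y \<in> range (\<lambda>h. h + B h)" using \<tau> by (auto simp: T_def image_iff)
  then have "g + B g = y"
    unfolding g_def least_favorable_def A_def[symmetric] B_def[symmetric] y_def[symmetric]
    by (rule f_inv_into_f)
  then have "v \<bullet> (g + B g) = v \<bullet> y" by simp
  then show ?thesis
    by (simp add: inner_add_right B_def y_def adj A_def[symmetric] inner_commute)
qed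

end

section \<open>Gaussian white noise\<close>

lemma sets_normal_law [measurable_cong, simp]: "sets (normal_law \<mu> v) = sets borel"
  by (simp add: normal_law_def)

lemma space_normal_law [simp]: "space (normal_law \<mu> v) = UNIV"
  by (simp add: normal_law_def)

lemma prob_space_normal_law: "0 < v \<Longrightarrow> prob_space (normal_law \<mu> v)"
  unfolding normal_law_def by (intro prob_space_normal_density) simp

text \<open>Completing the square: tilting the standard normal density by exp (a x) gives exp (a^2 /
  2) times the normal density with mean a.\<close>

lemma nn_integral_normal_law_exp:
  "(\<integral>\<^sup>+x. ennreal (exp (a * x)) \<partial>normal_law 0 1) = ennreal (exp (a\<^sup>2 / 2))"
proof -
  have eq: "normal_density 0 1 x * exp (a * x) = exp (a\<^sup>2 / 2) * normal_density a 1 x" for x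
  proof -
    have "- (x\<^sup>2 / 2) + a * x = a\<^sup>2 / 2 + - ((x - a)\<^sup>2 / 2)"
      by (simp add: field_simps power2_eq_square)
    then have "exp (- (x\<^sup>2 / 2)) * exp (a * x) = exp (a\<^sup>2 / 2) * exp (- ((x - a)\<^sup>2 / 2))"
      by (simp flip: exp_add)
    then show ?thesis by (simp add: normal_density_def)
  qed
  have "(\<integral>\<^sup>+x. ennreal (exp (a * x)) \<partial>normal_law 0 1)
      = (\<integral>\<^sup>+x. ennreal (normal_density 0 1 x) * ennreal (exp (a * x)) \<partial>lborel)"
    by (simp add: normal_law_def nn_integral_density)
  also have "\<dots> = (\<integral>\<^sup>+x. ennreal (exp (a\<^sup>2 / 2)) * ennreal (normal_density a 1 x) \<partial>lborel)"
    by (simp add: ennreal_mult[symmetric] eq)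
  also have "\<dots> = ennreal (exp (a\<^sup>2 / 2)) * (\<integral>\<^sup>+x. ennreal (normal_density a 1 x) \<partial>lborel)"
    by (rule nn_integral_cmult) simp
  also have "(\<integral>\<^sup>+x. ennreal (normal_density a 1 x) \<partial>lborel) = 1"
    by (subst nn_integral_eq_integral) auto
  finally show ?thesis by simp
qed

definition gauss_seq :: "(nat \<Rightarrow> real) measure" where
  "gauss_seq = (\<Pi>\<^sub>M k\<in>UNIV. normal_law 0 1)"

lemma sets_gauss_seq [measurable_cong]: "sets gauss_seq = sets (\<Pi>\<^sub>M k\<in>UNIV. borel)"
  unfolding gauss_seq_def by (intro sets_PiM_cong) auto

lemma space_gauss_seq [simp]: "space gauss_seq = UNIV"
  by (simp add: gauss_seq_def space_PiM)

lemma prob_space_gauss_seq: "prob_space gauss_seq"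
  unfolding gauss_seq_def by (intro prob_space_PiM prob_space_normal_law) simp

lemma white_noise_eq: "white_noise = gauss_seq \<Otimes>\<^sub>M gauss_seq"
  by (simp add: white_noise_def gauss_seq_def)

lemma sets_white_noise [measurable_cong]:
  "sets white_noise = sets ((\<Pi>\<^sub>M k\<in>UNIV. borel) \<Otimes>\<^sub>M (\<Pi>\<^sub>M k\<in>UNIV. borel))"
  unfolding white_noise_eq by (intro sets_pair_measure_cong sets_gauss_seq)

lemma space_white_noise [simp]: "space white_noise = UNIV"
  by (simp add: white_noise_eq space_pair_measure)

lemma prob_space_white_noise: "prob_space white_noise"
proof -
  interpret G: prob_space gauss_seq by (rule prob_space_gauss_seq)
  interpret pair_prob_space gauss_seq gauss_seq ..
  show ?thesis unfolding white_noise_eq by (rule prob_space_axioms)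
qed

lemma measurable_case_nat_seq [measurable]:
  "(\<lambda>(x, \<omega>). case_nat x \<omega>) \<in> borel \<Otimes>\<^sub>M gauss_seq \<rightarrow>\<^sub>M gauss_seq"
  unfolding gauss_seq_def
  by (rule measurable_PiM_single') (auto simp: space_PiM split_beta' split: nat.split
      intro!: measurable_case_nat')

text \<open>Prepending an independent normal coordinate preserves the law of the sequence. Peeling
  off the first coordinate lets inductions proceed by shifting the coefficients.\<close>

lemma nn_integral_gauss_seq_iter:
  assumes [measurable]: "F \<in> borel_measurable gauss_seq"
  shows "(\<integral>\<^sup>+\<omega>. F \<omega> \<partial>gauss_seq)
      = (\<integral>\<^sup>+x. (\<integral>\<^sup>+\<omega>. F (case_nat x \<omega>) \<partial>gauss_seq) \<partial>normal_law 0 1)"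
proof -
  interpret N: prob_space "normal_law 0 1" by (rule prob_space_normal_law) simp
  interpret G: prob_space gauss_seq by (rule prob_space_gauss_seq)
  interpret sequence_space "normal_law 0 1" ..
  have [measurable]: "(\<lambda>(x, \<omega>). case_nat x \<omega>) \<in> normal_law 0 1 \<Otimes>\<^sub>M gauss_seq \<rightarrow>\<^sub>M gauss_seq"
    using measurable_case_nat_seq by (simp cong: measurable_cong_sets sets_pair_measure_cong)
  have "(\<integral>\<^sup>+\<omega>. F \<omega> \<partial>gauss_seq)
      = (\<integral>\<^sup>+\<omega>. F \<omega> \<partial>distr (normal_law 0 1 \<Otimes>\<^sub>M gauss_seq) gauss_seq (\<lambda>(x, \<omega>). case_nat x \<omega>))"
    using PiM_iter unfolding gauss_seq_def by simp
  also have "\<dots> = (\<integral>\<^sup>+p. F (case p of (x, \<omega>) \<Rightarrow> case_nat x \<omega>) \<partial>(normal_law 0 1 \<Otimes>\<^sub>M gauss_seq))"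
    by (rule nn_integral_distr) measurable
  also have "\<dots> = (\<integral>\<^sup>+x. (\<integral>\<^sup>+\<omega>. F (case_nat x \<omega>) \<partial>gauss_seq) \<partial>normal_law 0 1)"
    by (subst G.nn_integral_fst[symmetric]) (auto simp: split_beta')
  finally show ?thesis .
qed

lemma measurable_coord [measurable (raw)]: "(\<lambda>\<omega>. \<omega> k) \<in> borel_measurable gauss_seq"
  by (simp cong: measurable_cong_sets add: sets_gauss_seq)

lemma mgf_partial_sum:
  "(\<integral>\<^sup>+\<omega>. ennreal (exp (\<Sum>k<n. a k * \<omega> k)) \<partial>gauss_seq) = ennreal (exp ((\<Sum>k<n. (a k)\<^sup>2) / 2))"
proof (induction n arbitrary: a)
  case 0
  show ?case using prob_space.emeasure_space_1[OF prob_space_gauss_seq] by simp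
next
  case (Suc n)
  define c where "c = a 0"
  have "(\<integral>\<^sup>+\<omega>. ennreal (exp (\<Sum>k<Suc n. a k * \<omega> k)) \<partial>gauss_seq)
      = (\<integral>\<^sup>+x. (\<integral>\<^sup>+\<omega>. ennreal (exp (c * x)) * ennreal (exp (\<Sum>k<n. a (Suc k) * \<omega> k)) \<partial>gauss_seq)
          \<partial>normal_law 0 1)"
    by (subst nn_integral_gauss_seq_iter)
       (auto simp: c_def sum.lessThan_Suc_shift exp_add ennreal_mult simp del: sum.lessThan_Suc)
  also have "\<dots> = (\<integral>\<^sup>+x. ennreal (exp (c * x)) * ennreal (exp ((\<Sum>k<n. (a (Suc k))\<^sup>2) / 2)) \<partial>normal_law 0 1)"
    by (simp add: nn_integral_cmult Suc.IH)
  also have "\<dots> = ennreal (exp (c\<^sup>2 / 2)) * ennreal (exp ((\<Sum>k<n. (a (Suc k))\<^sup>2) / 2))"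
    by (subst nn_integral_multc) (auto simp: nn_integral_normal_law_exp)
  also have "\<dots> = ennreal (exp ((\<Sum>k<Suc n. (a k)\<^sup>2) / 2))"
    by (simp add: c_def sum.lessThan_Suc_shift add_divide_distrib exp_add ennreal_mult del: sum.lessThan_Suc)
  finally show ?case .
qed

text \<open>A maximal inequality for the supermartingale \<open>cosh (\<lambda> S\<^sub>m)\<close>; peeling off the first coordinate
  replaces stopping times.\<close>

lemma maximal_inequality:
  fixes l c x :: real
  assumes l: "0 \<le> l"
  shows "emeasure gauss_seq {\<omega>. \<exists>m\<le>n. c \<le> \<bar>x + (\<Sum>k<m. a k * \<omega> k)\<bar>}
    \<le> ennreal ((exp (l * x) + exp (- (l * x))) * exp (l\<^sup>2 * (\<Sum>k<n. (a k)\<^sup>2) / 2 - l * c))"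
    (is "emeasure _ (?E n a x) \<le> ennreal (?b n a x)")
proof (induction n arbitrary: a x)
  \<comment> \<open>A walk that starts at or beyond the level: the right-hand side is then at least
    one, because exp (l |x|) is at most the sum of the two exponentials.\<close>
  have start: "emeasure gauss_seq (?E n a x) \<le> ennreal (?b n a x)" if "c \<le> \<bar>x\<bar>" for n a x
  proof -
    have "l * c \<le> l * \<bar>x\<bar>" using l that by (simp add: mult_left_mono)
    then have "exp (l * c) \<le> exp (l * \<bar>x\<bar>)" by simp
    also have "\<dots> \<le> exp (l * x) + exp (- (l * x))" by (simp add: abs_if)
    finally have "exp (l * c) \<le> exp (l * x) + exp (- (l * x))" .
    then have "1 \<le> (exp (l * x) + exp (- (l * x))) * exp (- (l * c))"
      by (simp add: exp_minus field_simps)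
    also have "\<dots> \<le> ?b n a x" by (intro mult_left_mono) (auto simp: sum_nonneg add_nonneg_nonneg)
    finally have "1 \<le> ?b n a x" .
    have "emeasure gauss_seq (?E n a x) \<le> 1"
      by (rule prob_space.emeasure_le_1[OF prob_space_gauss_seq])
    also have "1 \<le> ennreal (?b n a x)" using \<open>1 \<le> ?b n a x\<close> by (simp add: ennreal_leI flip: ennreal_1)
    finally show ?thesis .
  qed
  {
    case 0
    show ?case by (cases "c \<le> \<bar>x\<bar>") (use start[of x 0 a] in auto)
  next
    case (Suc n)
    show ?case
    proof (cases "c \<le> \<bar>x\<bar>")
      case True then show ?thesis by (rule start)
    next
      case False
      let ?a = "\<lambda>k. a (Suc k)"
      have [measurable]: "?E n a x \<in> sets gauss_seq" for n a x
      proof -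
        have "{\<omega> \<in> space gauss_seq. \<exists>m\<le>n. c \<le> \<bar>x + (\<Sum>k<m. a k * \<omega> k)\<bar>} \<in> sets gauss_seq"
          by measurable
        then show ?thesis by simp
      qed
      \<comment> \<open>After the first coordinate y the walk restarts from
        \<open>x + a 0 * y\<close> with shifted coefficients. The index m = 0 cannot witness the
        event since |x| < c in this case.\<close>
      have shift: "case_nat y \<omega> \<in> ?E (Suc n) a x \<longleftrightarrow> \<omega> \<in> ?E n ?a (x + a 0 * y)" for y \<omega>
      proof
        assume "case_nat y \<omega> \<in> ?E (Suc n) a x"
        then obtain m where m: "m \<le> Suc n" "c \<le> \<bar>x + (\<Sum>k<m. a k * case_nat y \<omega> k)\<bar>" by blast
        then obtain m' where "m = Suc m'" using False by (cases m) auto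
        then show "\<omega> \<in> ?E n ?a (x + a 0 * y)"
          using m by (auto simp: sum.lessThan_Suc_shift add.assoc simp del: sum.lessThan_Suc)
      next
        assume "\<omega> \<in> ?E n ?a (x + a 0 * y)"
        then obtain m where "m \<le> n" "c \<le> \<bar>x + a 0 * y + (\<Sum>k<m. ?a k * \<omega> k)\<bar>" by blast
        then show "case_nat y \<omega> \<in> ?E (Suc n) a x"
          by (auto simp: sum.lessThan_Suc_shift add.assoc simp del: sum.lessThan_Suc intro!: exI[of _ "Suc m"])
      qed
      let ?C = "exp (l\<^sup>2 * (\<Sum>k<n. (?a k)\<^sup>2) / 2 - l * c)"
      have "emeasure gauss_seq (?E (Suc n) a x) = (\<integral>\<^sup>+\<omega>. indicator (?E (Suc n) a x) \<omega> \<partial>gauss_seq)"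
        by simp
      also have "\<dots> = (\<integral>\<^sup>+y. (\<integral>\<^sup>+\<omega>. indicator (?E (Suc n) a x) (case_nat y \<omega>) \<partial>gauss_seq) \<partial>normal_law 0 1)"
        by (rule nn_integral_gauss_seq_iter) measurable
      also have "\<dots> = (\<integral>\<^sup>+y. (\<integral>\<^sup>+\<omega>. indicator (?E n ?a (x + a 0 * y)) \<omega> \<partial>gauss_seq) \<partial>normal_law 0 1)"
        using shift by (simp add: indicator_def)
      also have "\<dots> = (\<integral>\<^sup>+y. emeasure gauss_seq (?E n ?a (x + a 0 * y)) \<partial>normal_law 0 1)"
        by simp
      also have "\<dots> \<le> (\<integral>\<^sup>+y. ennreal (?b n ?a (x + a 0 * y)) \<partial>normal_law 0 1)"
        by (intro nn_integral_mono Suc.IH)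
      also have "\<dots> = (\<integral>\<^sup>+y. ennreal (exp (l * x) * ?C) * ennreal (exp ((l * a 0) * y))
          + ennreal (exp (- (l * x)) * ?C) * ennreal (exp ((- (l * a 0)) * y)) \<partial>normal_law 0 1)"
        by (intro nn_integral_cong)
           (simp add: ennreal_mult[symmetric] ennreal_plus[symmetric] exp_add[symmetric] algebra_simps
             del: ennreal_plus)
      \<comment> \<open>Both exponentials gain the same factor exp ((l a 0)^2 / 2), which is the
        variance contribution missing from the induction hypothesis.\<close>
      also have "\<dots> = ennreal (exp (l * x) * ?C) * ennreal (exp ((l * a 0)\<^sup>2 / 2))
          + ennreal (exp (- (l * x)) * ?C) * ennreal (exp ((- (l * a 0))\<^sup>2 / 2))"
        using nn_integral_normal_law_exp[of "- (l * a 0)"]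
        by (simp add: nn_integral_add nn_integral_cmult nn_integral_normal_law_exp)
      also have "\<dots> = ennreal ((exp (l * x) + exp (- (l * x))) * (?C * exp ((l * a 0)\<^sup>2 / 2)))"
        by (simp add: ennreal_mult[symmetric] ennreal_plus[symmetric] algebra_simps del: ennreal_plus)
      also have "?C * exp ((l * a 0)\<^sup>2 / 2) = exp (l\<^sup>2 * (\<Sum>k<Suc n. (a k)\<^sup>2) / 2 - l * c)"
        by (simp add: sum.lessThan_Suc_shift power_mult_distrib exp_add[symmetric] field_simps del: sum.lessThan_Suc)
      finally show ?thesis .
    qed
  }
qed

text \<open>The maximal inequality, applied to tails of small variance, shows that the oscillation
  of the partial sums after N tends to zero almost surely; so they are Cauchy.\<close>

lemma AE_gauss_seq_summable:
  assumes a: "summable (\<lambda>k. (a k)\<^sup>2)"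
  shows "AE \<omega> in gauss_seq. summable (\<lambda>k. a k * \<omega> k)"
proof -
  \<comment> \<open>Tails are produced by zeroing the first N coefficients: the sums still start at
    index 0 and the maximal inequality applies directly.\<close>
  define E where "E N c = {\<omega>. \<exists>m. c \<le> \<bar>\<Sum>k<m. (if k < N then 0 else a k) * \<omega> k\<bar>}" for N c
  have E_meas [measurable]: "E N c \<in> sets gauss_seq" for N c
  proof -
    have "{\<omega> \<in> space gauss_seq. \<exists>m. c \<le> \<bar>\<Sum>k<m. (if k < N then 0 else a k) * \<omega> k\<bar>} \<in> sets gauss_seq"
      by measurable
    then show ?thesis by (simp add: E_def)
  qed
  have small: "\<exists>N. emeasure gauss_seq (E N c) \<le> ennreal d" if c: "0 < c" and d: "0 < d" for c d :: real
  proof -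
    \<comment> \<open>Once the tail variance is below 1 / l^2 the bound is at most
      \<open>2 * exp (1/2 - l * c)\<close>, and this l makes that at most d.\<close>
    define l where "l = max 1 ((1/2 - ln (d / 2)) / c)"
    have l: "0 < l" "1/2 - l * c \<le> ln (d/2)"
    proof -
      have "(1/2 - ln (d / 2)) / c \<le> l" by (simp add: l_def)
      then show "1/2 - l * c \<le> ln (d/2)" using c by (simp add: field_simps)
    qed (simp add: l_def)
    obtain N where N: "\<And>n. norm (\<Sum>k=N..<n. (a k)\<^sup>2) < 1 / l\<^sup>2"
      using a[unfolded summable_Cauchy, rule_format, of "1 / l\<^sup>2"] l(1) by auto
    let ?a = "\<lambda>k. if k < N then 0 else a k"
    let ?F = "\<lambda>n. {\<omega>. \<exists>m\<le>n. c \<le> \<bar>\<Sum>k<m. ?a k * \<omega> k\<bar>}"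
    have [measurable]: "?F n \<in> sets gauss_seq" for n
    proof -
      have "{\<omega> \<in> space gauss_seq. \<exists>m\<le>n. c \<le> \<bar>\<Sum>k<m. ?a k * \<omega> k\<bar>} \<in> sets gauss_seq"
        by measurable
      then show ?thesis by simp
    qed
    have F_le: "emeasure gauss_seq (?F n) \<le> ennreal d" for n
    proof -
      have "(\<Sum>k<n. (?a k)\<^sup>2) = (\<Sum>k=N..<n. (a k)\<^sup>2)"
        by (intro sum.mono_neutral_cong_right) auto
      then have "l\<^sup>2 * (\<Sum>k<n. (?a k)\<^sup>2) \<le> 1"
        using N[of n] l(1) by (simp add: sum_nonneg field_simps)
      then have "exp (l\<^sup>2 * (\<Sum>k<n. (?a k)\<^sup>2) / 2 - l * c) \<le> exp (ln (d/2))"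
        using l(2) by (intro exp_le_cancel_iff[THEN iffD2]) linarith
      then have "(exp (l * 0) + exp (- (l * 0))) * exp (l\<^sup>2 * (\<Sum>k<n. (?a k)\<^sup>2) / 2 - l * c) \<le> d"
        using d by simp
      then have "ennreal ((exp (l * 0) + exp (- (l * 0))) * exp (l\<^sup>2 * (\<Sum>k<n. (?a k)\<^sup>2) / 2 - l * c)) \<le> ennreal d"
        by (rule ennreal_leI)
      with maximal_inequality[where l=l and c=c and x=0 and a="?a" and n=n] l(1)
      have "emeasure gauss_seq {\<omega>. \<exists>m\<le>n. c \<le> \<bar>0 + (\<Sum>k<m. ?a k * \<omega> k)\<bar>} \<le> ennreal d"
        by (meson less_imp_le order_trans)
      then show ?thesis by (simp only: add_0)
    qed
    have "(SUP n. emeasure gauss_seq (?F n)) = emeasure gauss_seq (\<Union>n. ?F n)"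
      by (rule SUP_emeasure_incseq) (auto simp: incseq_def intro: order_trans)
    moreover have "E N c = (\<Union>n. ?F n)" by (auto simp: E_def)
    ultimately have "emeasure gauss_seq (E N c) = (SUP n. emeasure gauss_seq (?F n))" by simp
    also have "\<dots> \<le> ennreal d" by (intro SUP_least F_le)
    finally have "emeasure gauss_seq (E N c) \<le> ennreal d" .
    then show ?thesis ..
  qed
  have "AE \<omega> in gauss_seq. \<exists>N. \<omega> \<notin> E N c" if c: "0 < c" for c
  proof (rule AE_I')
    show "{\<omega> \<in> space gauss_seq. \<not> (\<exists>N. \<omega> \<notin> E N c)} \<subseteq> (\<Inter>N. E N c)" by auto
    have Inter_le: "emeasure gauss_seq (\<Inter>N. E N c) \<le> ennreal d" if d: "0 < d" for d
    proof -
      obtain N where N: "emeasure gauss_seq (E N c) \<le> ennreal d" using small[OF c d] by blast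
      have "emeasure gauss_seq (\<Inter>N. E N c) \<le> emeasure gauss_seq (E N c)"
        by (intro emeasure_mono) auto
      then show ?thesis using N by (rule order_trans)
    qed
    have "emeasure gauss_seq (\<Inter>N. E N c) \<le> 0"
      by (rule ennreal_le_epsilon) (simp add: Inter_le)
    then show "(\<Inter>N. E N c) \<in> null_sets gauss_seq" by (intro null_setsI) auto
  qed
  then have "AE \<omega> in gauss_seq. \<forall>i::nat. \<exists>N. \<omega> \<notin> E N (1 / Suc i)"
    by (subst AE_all_countable) simp
  then show ?thesis
  proof eventually_elim
    case (elim \<omega>)
    show ?case unfolding summable_Cauchy
    proof (intro allI impI)
      fix r :: real assume "0 < r"
      \<comment> \<open>Half of r, because a block of the series is the difference of two tail
        sums.\<close>
      then obtain i :: nat where i: "1 / Suc i < r / 2"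
        using nat_approx_posE[of "r/2"] by auto
      obtain N where N: "\<omega> \<notin> E N (1 / Suc i)" using elim by blast
      let ?s = "\<lambda>m. \<Sum>k<m. (if k < N then 0 else a k) * \<omega> k"
      have s: "\<bar>?s m\<bar> < 1 / Suc i" for m using N unfolding E_def by (auto simp: not_le)
      have "norm (\<Sum>k=m..<n. a k * \<omega> k) < r" if "m \<ge> N" for m n
      proof (cases "m \<le> n")
        case True
        have "{..<n} = {..<m} \<union> {m..<n}" using True by auto
        then have "?s n = ?s m + (\<Sum>k=m..<n. (if k < N then 0 else a k) * \<omega> k)"
          by (simp add: sum.union_disjoint ivl_disj_int)
        moreover have "(\<Sum>k=m..<n. (if k < N then 0 else a k) * \<omega> k) = (\<Sum>k=m..<n. a k * \<omega> k)"
          using that by (intro sum.cong) auto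
        ultimately have "(\<Sum>k=m..<n. a k * \<omega> k) = ?s n - ?s m" by simp
        then show ?thesis using s[of n] s[of m] i by (simp add: abs_le_iff abs_less_iff)
      qed (use \<open>0 < r\<close> in auto)
      then show "\<exists>N. \<forall>m\<ge>N. \<forall>n. norm (\<Sum>k=m..<n. a k * \<omega> k) < r" by blast
    qed
  qed
qed

text \<open>Where the series diverges, \<open>suminf\<close> is an unspecified value, so
  \<open>obs_inner\<close> is linear only on this random linear subspace. Each fixed vector belongs
  to it almost surely.\<close>

definition conv_set :: "(nat \<Rightarrow> 'h::real_inner) \<Rightarrow> (nat \<Rightarrow> real) \<Rightarrow> 'h set" where
  "conv_set e z = {h. summable (\<lambda>k. z k * (h \<bullet> e k))}"

lemma conv_set_add: "a \<in> conv_set e z \<Longrightarrow> b \<in> conv_set e z \<Longrightarrow> a + b \<in> conv_set e z"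
  by (auto simp: conv_set_def inner_add_left algebra_simps intro: summable_add)

lemma conv_set_scaleR: "a \<in> conv_set e z \<Longrightarrow> c *\<^sub>R a \<in> conv_set e z"
  using summable_mult[of "\<lambda>k. z k * (a \<bullet> e k)" c] by (auto simp: conv_set_def algebra_simps)

lemma conv_set_diff: "a \<in> conv_set e z \<Longrightarrow> b \<in> conv_set e z \<Longrightarrow> a - b \<in> conv_set e z"
  using conv_set_add[of a e z "(-1) *\<^sub>R b"] conv_set_scaleR[of b e z "-1"] by simp

lemma obs_inner_add:
  "a \<in> conv_set e z \<Longrightarrow> b \<in> conv_set e z \<Longrightarrow> obs_inner e z (a + b) = obs_inner e z a + obs_inner e z b"
  by (simp add: obs_inner_def conv_set_def suminf_add inner_add_left algebra_simps)

lemma obs_inner_scaleR: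
  "a \<in> conv_set e z \<Longrightarrow> obs_inner e z (c *\<^sub>R a) = c * obs_inner e z a"
  using suminf_mult[of "\<lambda>k. z k * (a \<bullet> e k)" c] by (simp add: obs_inner_def conv_set_def algebra_simps)

lemma obs_inner_diff:
  "a \<in> conv_set e z \<Longrightarrow> b \<in> conv_set e z \<Longrightarrow> obs_inner e z (a - b) = obs_inner e z a - obs_inner e z b"
  using obs_inner_add[of a e z "(-1) *\<^sub>R b"] conv_set_scaleR[of b e z "-1"] obs_inner_scaleR[of b e z "-1"]
  by simp

lemma measurable_obs_inner [measurable]:
  fixes e :: "nat \<Rightarrow> 'h::{real_inner, second_countable_topology}"
  assumes [measurable]: "z \<in> M \<rightarrow>\<^sub>M (\<Pi>\<^sub>M k\<in>UNIV. borel)" "h \<in> borel_measurable M"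
  shows "(\<lambda>x. obs_inner e (z x) (h x)) \<in> borel_measurable M"
proof -
  have [measurable]: "(\<lambda>x. z x k) \<in> borel_measurable M" for k
    using measurable_compose[OF assms(1) measurable_component_singleton[of k UNIV]] by simp
  show ?thesis unfolding obs_inner_def by measurable
qed

lemma measurable_conv_set [measurable]:
  fixes e :: "nat \<Rightarrow> 'h::{real_inner, second_countable_topology}"
  assumes [measurable]: "z \<in> M \<rightarrow>\<^sub>M (\<Pi>\<^sub>M k\<in>UNIV. borel)" "h \<in> borel_measurable M"
  shows "Measurable.pred M (\<lambda>x. h x \<in> conv_set e (z x))"
proof -
  have [measurable]: "(\<lambda>x. z x k) \<in> borel_measurable M" for k
    using measurable_compose[OF assms(1) measurable_component_singleton[of k UNIV]] by simp
  have eq: "h x \<in> conv_set e (z x) \<longleftrightarrow> Cauchy (\<lambda>n. \<Sum>k<n. z x k * (h x \<bullet> e k))" for x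
    by (simp add: conv_set_def summable_iff_convergent Cauchy_convergent_iff)
  show ?thesis unfolding eq by measurable
qed

context hilbert_basis
begin

lemma AE_conv_set: "AE z in gauss_seq. h \<in> conv_set e z"
  using AE_gauss_seq_summable[of "\<lambda>k. h \<bullet> e k"] parseval_sq[of h]
  by (auto simp: conv_set_def mult.commute sums_iff)

text \<open>Fatou's lemma turns the identity for partial sums into an upper bound for the limit,
  which is what Markov's inequality takes as input.\<close>

lemma mgf_obs_inner:
  "(\<integral>\<^sup>+z. ennreal (exp (obs_inner e z h)) \<partial>gauss_seq) \<le> ennreal (exp ((norm h)\<^sup>2 / 2))"
proof -
  have "(\<integral>\<^sup>+z. ennreal (exp (obs_inner e z h)) \<partial>gauss_seq)
      = (\<integral>\<^sup>+z. liminf (\<lambda>n. ennreal (exp (\<Sum>k<n. (h \<bullet> e k) * z k))) \<partial>gauss_seq)"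
  proof (rule nn_integral_cong_AE)
    show "AE z in gauss_seq. ennreal (exp (obs_inner e z h))
        = liminf (\<lambda>n. ennreal (exp (\<Sum>k<n. (h \<bullet> e k) * z k)))"
      using AE_conv_set[of h]
    proof eventually_elim
      case (elim z)
      have "(\<lambda>n. \<Sum>k<n. (h \<bullet> e k) * z k) \<longlonglongrightarrow> obs_inner e z h"
        using summable_LIMSEQ[of "\<lambda>k. z k * (h \<bullet> e k)"] elim
        by (simp add: conv_set_def obs_inner_def mult.commute)
      then have "(\<lambda>n. ennreal (exp (\<Sum>k<n. (h \<bullet> e k) * z k))) \<longlonglongrightarrow> ennreal (exp (obs_inner e z h))"
        by (intro tendsto_ennrealI tendsto_exp)
      then show ?case by (intro lim_imp_Liminf[symmetric]) auto
    qed
  qed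
  also have "\<dots> \<le> liminf (\<lambda>n. \<integral>\<^sup>+z. ennreal (exp (\<Sum>k<n. (h \<bullet> e k) * z k)) \<partial>gauss_seq)"
    by (intro nn_integral_liminf) measurable
  also have "\<dots> = liminf (\<lambda>n. ennreal (exp ((\<Sum>k<n. (h \<bullet> e k)\<^sup>2) / 2)))"
    by (simp add: mgf_partial_sum)
  also have "\<dots> = ennreal (exp ((norm h)\<^sup>2 / 2))"
    using parseval_sq[of h]
    by (intro lim_imp_Liminf tendsto_ennrealI tendsto_exp tendsto_divide tendsto_const) (auto simp: sums_def)
  finally show ?thesis .
qed

lemma mgf_white_noise:
  "(\<integral>\<^sup>+z. ennreal (exp (obs_inner e (fst z) a + obs_inner e (snd z) b)) \<partial>white_noise)
    \<le> ennreal (exp (((norm a)\<^sup>2 + (norm b)\<^sup>2) / 2))"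
proof -
  interpret G: prob_space gauss_seq by (rule prob_space_gauss_seq)
  have "(\<integral>\<^sup>+z. ennreal (exp (obs_inner e (fst z) a + obs_inner e (snd z) b)) \<partial>white_noise)
      = (\<integral>\<^sup>+z1. (\<integral>\<^sup>+z2. ennreal (exp (obs_inner e z1 a)) * ennreal (exp (obs_inner e z2 b)) \<partial>gauss_seq) \<partial>gauss_seq)"
    unfolding white_noise_eq
    by (subst G.nn_integral_fst[symmetric]) (auto simp: exp_add ennreal_mult)
  also have "\<dots> = (\<integral>\<^sup>+z. ennreal (exp (obs_inner e z a)) \<partial>gauss_seq) * (\<integral>\<^sup>+z. ennreal (exp (obs_inner e z b)) \<partial>gauss_seq)"
    by (simp add: nn_integral_cmult nn_integral_multc)
  also have "\<dots> \<le> ennreal (exp ((norm a)\<^sup>2 / 2)) * ennreal (exp ((norm b)\<^sup>2 / 2))"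
    by (intro mult_mono mgf_obs_inner) auto
  also have "\<dots> = ennreal (exp (((norm a)\<^sup>2 + (norm b)\<^sup>2) / 2))"
    by (simp add: ennreal_mult[symmetric] exp_add[symmetric] add_divide_distrib)
  finally show ?thesis .
qed

lemma AE_white_noise_conv_set:
  "AE z in white_noise. a \<in> conv_set e (fst z) \<and> b \<in> conv_set e (snd z)"
proof -
  interpret G: prob_space gauss_seq by (rule prob_space_gauss_seq)
  interpret pair_prob_space gauss_seq gauss_seq ..
  have [measurable]: "{z \<in> space (gauss_seq \<Otimes>\<^sub>M gauss_seq). a \<in> conv_set e (fst z) \<and> b \<in> conv_set e (snd z)}
      \<in> sets (gauss_seq \<Otimes>\<^sub>M gauss_seq)"
    by measurable
  show ?thesis
    unfolding white_noise_eq using AE_conv_set[of a] AE_conv_set[of b]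
    by (intro AE_pair_measure) (auto elim!: eventually_mono)
qed

end

section \<open>Chaining\<close>

lemma Inf_enat_attained:
  fixes A :: "enat set"
  assumes "A \<noteq> {}"
  shows "Inf A \<in> A"
proof -
  obtain x where "x \<in> A" using assms by blast
  then have "(LEAST x. x \<in> A) \<in> A" by (rule LeastI)
  then show ?thesis using assms by (simp add: Inf_enat_def)
qed

text \<open>A finite value means that the family of finite covers is not empty, and
  \<open>enat\<close> is well ordered, so the infimum is realised by an actual net.\<close>

lemma covering_number_attained:
  assumes "covering_number d A = enat m"
  shows "\<exists>C. finite C \<and> card C = m \<and> A \<subseteq> (\<Union>c\<in>C. ball c d)"
proof -
  let ?S = "{C. finite C \<and> A \<subseteq> (\<Union>c\<in>C. ball c d)}"
  have "?S \<noteq> {}"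
  proof
    assume empty: "?S = {}"
    show False using assms unfolding covering_number_def empty by (simp add: top_enat_def)
  qed
  then have "Inf ((\<lambda>C. enat (card C)) ` ?S) \<in> (\<lambda>C. enat (card C)) ` ?S"
    by (intro Inf_enat_attained) blast
  then have "enat m \<in> (\<lambda>C. enat (card C)) ` ?S"
    using assms unfolding covering_number_def by simp
  then show ?thesis by auto
qed

lemma covering_number_antimono:
  assumes "d \<le> d'"
  shows "covering_number d' A \<le> covering_number d A"
  unfolding covering_number_def
proof (rule INF_superset_mono)
  show "{C. finite C \<and> A \<subseteq> (\<Union>c\<in>C. ball c d)} \<subseteq> {C. finite C \<and> A \<subseteq> (\<Union>c\<in>C. ball c d')}"
    using subset_ball[OF assms] by blast
qed simp

lemma sqrt_entropy_antimono:
  assumes "d \<le> d'"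
  shows "sqrt_entropy d' A \<le> sqrt_entropy d A"
proof (cases "covering_number d A")
  case (enat m)
  then obtain m' where m': "covering_number d' A = enat m'" "m' \<le> m"
    using covering_number_antimono[OF assms, of A] by (cases "covering_number d' A") auto
  have "ln (real m') \<le> ln (real m)"
    using m'(2) by (cases "m' = 0"; cases "m = 0") auto
  then show ?thesis using enat m'(1) by (simp add: sqrt_entropy_def ennreal_leI)
qed (simp add: sqrt_entropy_def)

text \<open>Entropy decreases in the radius, so on each dyadic interval it is at least its value at
  the right end point. The intervals are disjoint, hence at most one summand is non-zero at each
  point.\<close>

lemma dyadic_entropy_sum:
  "(\<Sum>k. sqrt_entropy ((1/2)^k) A * ennreal ((1/2)^Suc k)) \<le> entropy_integral A"
proof -
  define I where "I k = {(1/2::real)^Suc k<..<(1/2)^k}" for k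
  have "(\<Sum>k. sqrt_entropy ((1/2)^k) A * ennreal ((1/2)^Suc k))
      = (\<Sum>k. \<integral>\<^sup>+x. sqrt_entropy ((1/2)^k) A * indicator (I k) x \<partial>lborel)"
    by (intro suminf_cong) (simp add: nn_integral_cmult I_def power_decreasing)
  also have "\<dots> = (\<integral>\<^sup>+x. (\<Sum>k. sqrt_entropy ((1/2)^k) A * indicator (I k) x) \<partial>lborel)"
    by (intro nn_integral_suminf[symmetric]) (simp add: I_def)
  also have "\<dots> \<le> entropy_integral A"
    unfolding entropy_integral_def
  proof (intro nn_integral_mono)
    fix x :: real
    show "(\<Sum>k. sqrt_entropy ((1/2)^k) A * indicator (I k) x) \<le> sqrt_entropy x A * indicator {0<..<1} x"
    proof (cases "\<exists>k. x \<in> I k")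
      case True
      then obtain k where k: "x \<in> I k" by blast
      have other: "x \<notin> I j" if "j \<noteq> k" for j
      proof
        assume j: "x \<in> I j"
        have "j < k \<or> k < j" using that by linarith
        then show False
        proof
          assume "j < k"
          then have "(1/2::real)^k \<le> (1/2)^Suc j" by (intro power_decreasing) auto
          then show False using j k by (auto simp: I_def)
        next
          assume "k < j"
          then have "(1/2::real)^j \<le> (1/2)^Suc k" by (intro power_decreasing) auto
          then show False using j k by (auto simp: I_def)
        qed
      qed
      have "(\<Sum>k. sqrt_entropy ((1/2)^k) A * indicator (I k) x)
          = (\<Sum>j\<in>{k}. sqrt_entropy ((1/2)^j) A * indicator (I j) x)"
        using other by (intro suminf_finite) auto
      also have "\<dots> \<le> sqrt_entropy x A * indicator {0<..<1} x"
      proof -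
        have "0 < (1/2::real)^Suc k" by simp
        also have "\<dots> < x" using k by (simp add: I_def)
        finally have "0 < x" .
        moreover have "x < 1" using k power_le_one[of "1/2::real" k] by (auto simp: I_def)
        ultimately show ?thesis using k sqrt_entropy_antimono[of x "(1/2)^k" A] by (auto simp: I_def)
      qed
      finally show ?thesis .
    qed simp
  qed
  finally show ?thesis .
qed

text \<open>Turns the entropy integral into the data used by chaining. The summand one in the
  weights covers nets with a single point, whose logarithm vanishes, and costs only a geometric
  series.\<close>

lemma entropy_nets:
  assumes fin: "entropy_integral A < \<infinity>" and ne: "A \<noteq> {}"
  shows "\<exists>C m. (\<forall>k. finite (C k) \<and> card (C k) = m k \<and> 1 \<le> m k \<and> A \<subseteq> (\<Union>c\<in>C k. ball c ((1/2)^k)))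
    \<and> summable (\<lambda>k. (1/2)^k * (1 + sqrt (ln (real (m k)))))"
proof -
  let ?f = "\<lambda>k. sqrt_entropy ((1/2)^k) A * ennreal ((1/2)^Suc k)"
  have sum_fin: "(\<Sum>k. ?f k) < \<infinity>" using dyadic_entropy_sum fin by (rule le_less_trans)
  have f_fin: "?f k < \<infinity>" for k
  proof -
    have "?f k = (\<Sum>j\<in>{k}. ?f j)" by simp
    also have "\<dots> \<le> (\<Sum>j. ?f j)" by (rule sum_le_suminf) auto
    finally show ?thesis using sum_fin by (rule le_less_trans)
  qed
  have "\<exists>m. covering_number ((1/2)^k) A = enat m" for k
    using f_fin[of k] by (cases "covering_number ((1/2)^k) A")
      (auto simp: sqrt_entropy_def ennreal_top_mult)
  then obtain m where m: "\<And>k. covering_number ((1/2)^k) A = enat (m k)" by metis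
  have "\<exists>C. finite C \<and> card C = m k \<and> A \<subseteq> (\<Union>c\<in>C. ball c ((1/2)^k))" for k
    using covering_number_attained[OF m] by blast
  then obtain C where C: "\<And>k. finite (C k) \<and> card (C k) = m k \<and> A \<subseteq> (\<Union>c\<in>C k. ball c ((1/2)^k))" by metis
  have m1: "1 \<le> m k" for k
  proof (rule ccontr)
    assume "\<not> 1 \<le> m k"
    then have "card (C k) = 0" using C[of k] by linarith
    then have "C k = {}" using C[of k] by auto
    then show False using C[of k] ne by auto
  qed
  have "ennreal (sqrt (ln (real (m k))) * (1/2)^Suc k) = ?f k" for k
    using m1[of k] by (subst ennreal_mult) (auto simp: m sqrt_entropy_def)
  with sum_fin have "(\<Sum>k. ennreal (sqrt (ln (real (m k))) * (1/2)^Suc k)) < \<infinity>" by simp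
  then have "summable (\<lambda>k. sqrt (ln (real (m k))) * (1/2)^Suc k)"
    using m1 by (intro summable_suminf_not_top) auto
  then have "summable (\<lambda>k. 2 * (sqrt (ln (real (m k))) * (1/2)^Suc k))" by (rule summable_mult)
  then have "summable (\<lambda>k. (1/2::real)^k + 2 * (sqrt (ln (real (m k))) * (1/2)^Suc k))"
    by (intro summable_add summable_geometric) auto
  then have "summable (\<lambda>k. (1/2)^k * (1 + sqrt (ln (real (m k)))))"
    by (simp add: algebra_simps)
  then show ?thesis using C m1 by blast
qed

context hilbert_basis
begin

text \<open>Truncation does not increase the norm; hence the bound is uniform in N.\<close>

lemma partial_sum_mgf:
  "(\<integral>\<^sup>+z. ennreal (exp (c * (\<Sum>k<N. z k * (h \<bullet> e k)) - d)) \<partial>gauss_seq)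
    \<le> ennreal (exp (c\<^sup>2 * (norm h)\<^sup>2 / 2 - d))"
proof -
  have "(\<integral>\<^sup>+z. ennreal (exp (c * (\<Sum>k<N. z k * (h \<bullet> e k)) - d)) \<partial>gauss_seq)
      = (\<integral>\<^sup>+z. ennreal (exp (- d)) * ennreal (exp (\<Sum>k<N. (c * (h \<bullet> e k)) * z k)) \<partial>gauss_seq)"
    by (intro nn_integral_cong)
       (simp add: ennreal_mult[symmetric] exp_add[symmetric] sum_distrib_left mult_ac)
  also have "\<dots> = ennreal (exp (- d)) * ennreal (exp ((\<Sum>k<N. (c * (h \<bullet> e k))\<^sup>2) / 2))"
    by (simp add: nn_integral_cmult mgf_partial_sum)
  also have "(\<Sum>k<N. (c * (h \<bullet> e k))\<^sup>2) = c\<^sup>2 * (norm (trunc e N h))\<^sup>2"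
    by (simp add: norm_trunc_sq power_mult_distrib sum_distrib_left)
  also have "ennreal (exp (- d)) * ennreal (exp (c\<^sup>2 * (norm (trunc e N h))\<^sup>2 / 2))
      = ennreal (exp (c\<^sup>2 * (norm (trunc e N h))\<^sup>2 / 2 - d))"
    by (simp add: ennreal_mult[symmetric] exp_add[symmetric])
  also have "\<dots> \<le> ennreal (exp (c\<^sup>2 * (norm h)\<^sup>2 / 2 - d))"
    using norm_trunc_le[of N h] by (intro ennreal_leI) (simp add: mult_left_mono power_mono)
  finally show ?thesis .
qed

text \<open>The envelope is \<open>a + \<lambda>\<^sup>-\<^sup>1 \<Sum> exp (\<lambda> (\<bar>g\<bar> - a))\<close>, which dominates every \<open>\<bar>g\<bar>\<close> because
  \<open>y \<le> exp y\<close>; its expectation is controlled by the Gaussian moment generating function.\<close>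

lemma gaussian_max_envelope:
  fixes I :: "'h set" and \<sigma> :: real and m :: nat
  assumes fin: "finite I" and I: "\<And>c. c \<in> I \<Longrightarrow> norm c \<le> \<sigma>" and \<sigma>: "0 < \<sigma>"
    and m: "card I \<le> m" "1 \<le> m"
  shows "\<exists>Y\<in>borel_measurable gauss_seq.
    (\<integral>\<^sup>+z. Y z \<partial>gauss_seq) \<le> ennreal (4 * \<sigma> * (1 + sqrt (ln (real m)))) \<and>
    (\<forall>z. \<forall>c\<in>I. ennreal \<bar>\<Sum>k<N. z k * (c \<bullet> e k)\<bar> \<le> Y z)"
proof -
  \<comment> \<open>With l = s / \<sigma> and a = 2 s \<sigma> the exponent of each term is at most
    s^2 / 2 - 2 s^2, hence at most - ln m. So each of the at most m vectors contributes at most 2 /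
    (l m), and the total stays below 4 \<sigma> s. The added one keeps s positive when m =
    1.\<close>
  define s where "s = 1 + sqrt (ln (real m))"
  define l where "l = s / \<sigma>"
  define a where "a = 2 * s * \<sigma>"
  have lnm: "0 \<le> ln (real m)" using m by simp
  have s: "1 \<le> s" "ln (real m) \<le> s\<^sup>2"
    using lnm by (auto simp: s_def power2_eq_square algebra_simps)
  have l: "0 < l" using s \<sigma> by (simp add: l_def)
  have a: "0 \<le> a" using s \<sigma> by (simp add: a_def)
  define g where "g c z = (\<Sum>k<N. z k * (c \<bullet> e k))" for c :: 'h and z :: "nat \<Rightarrow> real"
  have [measurable]: "g c \<in> borel_measurable gauss_seq" for c unfolding g_def by measurable
  define Y where "Y z = ennreal a + (\<Sum>c\<in>I. ennreal (1 / l) * (ennreal (exp (l * g c z - l * a))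
      + ennreal (exp ((- l) * g c z - l * a))))" for z
  have "Y \<in> borel_measurable gauss_seq" unfolding Y_def by measurable
  moreover have "(\<integral>\<^sup>+z. Y z \<partial>gauss_seq) \<le> ennreal (4 * \<sigma> * s)"
  proof -
    have e_le: "(\<integral>\<^sup>+z. ennreal (exp (b * g c z - l * a)) \<partial>gauss_seq) \<le> ennreal (1 / real m)"
      if "c \<in> I" "b = l \<or> b = - l" for b c
    proof -
      have "b\<^sup>2 * (norm c)\<^sup>2 = (l * norm c)\<^sup>2" using that(2) by (auto simp: power_mult_distrib)
      also have "\<dots> \<le> s\<^sup>2"
        using I[OF that(1)] \<sigma> l s by (intro power_mono) (auto simp: l_def field_simps mult_left_mono)
      finally have "b\<^sup>2 * (norm c)\<^sup>2 / 2 - l * a \<le> s\<^sup>2 / 2 - 2 * s\<^sup>2"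
        using \<sigma> by (simp add: l_def a_def power2_eq_square)
      also have "\<dots> \<le> - ln (real m)" using s(2) zero_le_power2[of s] by linarith
      finally have "exp (b\<^sup>2 * (norm c)\<^sup>2 / 2 - l * a) \<le> exp (- ln (real m))" by simp
      also have "\<dots> = 1 / real m" using m by (simp add: exp_minus inverse_eq_divide)
      finally show ?thesis
        unfolding g_def by (intro order_trans[OF partial_sum_mgf] ennreal_leI)
    qed
    have "(\<integral>\<^sup>+z. Y z \<partial>gauss_seq) = ennreal a + (\<Sum>c\<in>I. ennreal (1 / l) *
        ((\<integral>\<^sup>+z. ennreal (exp (l * g c z - l * a)) \<partial>gauss_seq)
        + (\<integral>\<^sup>+z. ennreal (exp ((- l) * g c z - l * a)) \<partial>gauss_seq)))"
      unfolding Y_def using prob_space.emeasure_space_1[OF prob_space_gauss_seq]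
      by (simp add: nn_integral_add nn_integral_sum nn_integral_cmult)
    also have "\<dots> \<le> ennreal a + (\<Sum>c\<in>I. ennreal (1 / l) * (ennreal (1 / real m) + ennreal (1 / real m)))"
      by (intro add_left_mono sum_mono mult_left_mono add_mono e_le) auto
    also have "\<dots> = ennreal (a + real (card I) * (1 / l * (2 / real m)))"
      using l a m by (simp add: ennreal_plus[symmetric] ennreal_mult[symmetric] ennreal_of_nat_eq_real_of_nat
          sum_nonneg del: ennreal_plus)
    also have "\<dots> \<le> ennreal (4 * \<sigma> * s)"
    proof (rule ennreal_leI)
      have "real (card I) * (1 / l * (2 / real m)) \<le> real m * (1 / l * (2 / real m))"
        using m l by (intro mult_right_mono) auto
      also have "\<dots> = 2 * \<sigma> / s" using m by (simp add: l_def)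
      also have "\<dots> \<le> 2 * \<sigma> * s"
      proof -
        have "1 \<le> s * s" using s(1) mult_mono[of 1 s 1 s] by simp
        then show ?thesis using s \<sigma> by (simp add: field_simps)
      qed
      finally show "a + real (card I) * (1 / l * (2 / real m)) \<le> 4 * \<sigma> * s"
        by (simp add: a_def)
    qed
    finally show ?thesis .
  qed
  moreover have "ennreal \<bar>g c z\<bar> \<le> Y z" if c: "c \<in> I" for c z
  proof -
    have "l * (\<bar>g c z\<bar> - a) \<le> exp (l * (\<bar>g c z\<bar> - a))"
      using exp_ge_add_one_self[of "l * (\<bar>g c z\<bar> - a)"] by linarith
    also have "\<dots> \<le> exp (l * g c z - l * a) + exp ((- l) * g c z - l * a)"
      by (simp add: abs_if algebra_simps)
    finally have "\<bar>g c z\<bar> \<le> a + 1 / l * (exp (l * g c z - l * a) + exp ((- l) * g c z - l * a))"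
      using l by (simp add: field_simps)
    then have "ennreal \<bar>g c z\<bar> \<le> ennreal a + ennreal (1 / l) * (ennreal (exp (l * g c z - l * a))
      + ennreal (exp ((- l) * g c z - l * a)))"
      using a l by (simp add: ennreal_plus[symmetric] ennreal_mult[symmetric] ennreal_leI del: ennreal_plus)
    also have "\<dots> \<le> Y z" unfolding Y_def
      by (intro add_left_mono member_le_sum c fin) auto
    finally show ?thesis .
  qed
  ultimately show ?thesis unfolding s_def g_def by (intro bexI[of _ Y]) auto
qed

text \<open>Each h is approximated by net points at scales 2^-k, and the increments along the chain
  are dominated by one Gaussian envelope per scale. Chaining is done for partial sums with N fixed,
  because these are continuous in h and the bound passes to the limit of the chain.\<close>

lemma chaining_partial_sums:
  fixes T :: "'h set" and C :: "nat \<Rightarrow> 'h set" and m :: "nat \<Rightarrow> nat" and w :: "nat \<Rightarrow> real"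
  assumes w_def: "\<And>k. w k = (1/2)^k * (1 + sqrt (ln (real (m k))))"
    and C: "\<And>k. finite (C k)" "\<And>k. card (C k) = m k" "\<And>k. 1 \<le> m k"
      "\<And>k. T \<subseteq> (\<Union>c\<in>C k. ball c ((1/2)^k))"
    and small: "\<And>h. h \<in> T \<Longrightarrow> norm h \<le> (1/2)^k0"
  shows "\<exists>Y\<in>borel_measurable gauss_seq.
    (\<integral>\<^sup>+z. Y z \<partial>gauss_seq) \<le> ennreal (8 * w k0) + (\<Sum>j. ennreal (8 * w (j + k0) + 16 * w (Suc j + k0))) \<and>
    (\<forall>z. \<forall>h\<in>T. ennreal \<bar>\<Sum>k<N. z k * (h \<bullet> e k)\<bar> \<le> Y z)"
proof -
  define g where "g h z = (\<Sum>k<N. z k * (h \<bullet> e k))" for h :: 'h and z :: "nat \<Rightarrow> real"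
  have g_add: "g (a + b) z = g a z + g b z" for a b z
    by (simp add: g_def inner_add_left algebra_simps sum.distrib)
  \<comment> \<open>All of T lies within 2^-k0 of the origin, so the net points approximating it at
    the first scale have norm at most twice that; the origin serves as the base point.\<close>
  define I0 where "I0 = {c \<in> C k0. norm c \<le> 2 * (1/2)^k0}"
  have I0: "finite I0" "card I0 \<le> m k0"
    using C(1,2)[of k0] card_mono[of "C k0" I0] by (auto simp: I0_def)
  obtain Y0 where Y0 [measurable]: "Y0 \<in> borel_measurable gauss_seq"
    and Y0_int: "(\<integral>\<^sup>+z. Y0 z \<partial>gauss_seq) \<le> ennreal (4 * (2 * (1/2)^k0) * (1 + sqrt (ln (real (m k0)))))"
    and Y0_le: "\<And>z c. c \<in> I0 \<Longrightarrow> ennreal \<bar>g c z\<bar> \<le> Y0 z"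
    using gaussian_max_envelope[of I0 "2 * (1/2)^k0" "m k0" N, OF I0(1) _ _ I0(2) C(3)]
    unfolding g_def by (auto simp: I0_def)
  \<comment> \<open>Consecutive net points both approximate the same h, one within 2^-(j + k0) and
    one within half of that, so only such short differences occur. There are at most as many as
    pairs of net points.\<close>
  define J where "J j = (\<lambda>(a, b). a - b) ` {(a, b). a \<in> C (Suc j + k0) \<and> b \<in> C (j + k0) \<and> norm (a - b) \<le> 2 * (1/2)^(j + k0)}" for j
  have J: "finite (J j)" "card (J j) \<le> m (j + k0) * m (Suc j + k0)" "\<And>c. c \<in> J j \<Longrightarrow> norm c \<le> 2 * (1/2)^(j + k0)" for j
  proof -
    have sub: "J j \<subseteq> (\<lambda>(a, b). a - b) ` (C (Suc j + k0) \<times> C (j + k0))" by (auto simp: J_def)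
    have fin: "finite (C (Suc j + k0) \<times> C (j + k0))" using C(1) by blast
    show "finite (J j)" using sub fin by (meson finite_imageI finite_subset)
    have "card (J j) \<le> card ((\<lambda>(a, b). a - b) ` (C (Suc j + k0) \<times> C (j + k0)))"
      using sub fin by (intro card_mono finite_imageI)
    also have "\<dots> \<le> card (C (Suc j + k0) \<times> C (j + k0))" by (rule card_image_le[OF fin])
    finally show "card (J j) \<le> m (j + k0) * m (Suc j + k0)"
      by (simp only: card_cartesian_product C(2) mult.commute)
    show "\<And>c. c \<in> J j \<Longrightarrow> norm c \<le> 2 * (1/2)^(j + k0)" by (auto simp: J_def)
  qed
  have "\<exists>Y\<in>borel_measurable gauss_seq. (\<integral>\<^sup>+z. Y z \<partial>gauss_seq) \<le> ennreal (8 * w (j + k0) + 16 * w (Suc j + k0))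
      \<and> (\<forall>z. \<forall>c\<in>J j. ennreal \<bar>g c z\<bar> \<le> Y z)" for j
  proof -
    let ?m = "m (j + k0) * m (Suc j + k0)"
    have pos: "1 \<le> m (j + k0)" "1 \<le> m (Suc j + k0)" by (rule C(3))+
    then have "1 \<le> ?m" using mult_le_mono[OF pos] by simp
    have "sqrt (ln (real ?m)) = sqrt (ln (real (m (j + k0))) + ln (real (m (Suc j + k0))))"
      using pos by (simp add: ln_mult)
    \<comment> \<open>Subadditivity of the square root separates the two nets. The coefficient 16
      instead of 8 compensates for the halved radius inside the weight of the finer scale.\<close>
    also have "\<dots> \<le> sqrt (ln (real (m (j + k0)))) + sqrt (ln (real (m (Suc j + k0))))"
      using pos by (intro sqrt_add_le_add_sqrt) auto
    finally have "4 * (2 * (1/2)^(j + k0)) * (1 + sqrt (ln (real ?m)))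
        \<le> 8 * (1/2)^(j + k0) * ((1 + sqrt (ln (real (m (j + k0))))) + (1 + sqrt (ln (real (m (Suc j + k0))))))"
      by simp
    also have "\<dots> = 8 * w (j + k0) + 16 * w (Suc j + k0)" by (simp add: w_def algebra_simps)
    finally have "ennreal (4 * (2 * (1/2)^(j + k0)) * (1 + sqrt (ln (real ?m)))) \<le> ennreal (8 * w (j + k0) + 16 * w (Suc j + k0))"
      by (rule ennreal_leI)
    moreover obtain Y where "Y \<in> borel_measurable gauss_seq"
      "(\<integral>\<^sup>+z. Y z \<partial>gauss_seq) \<le> ennreal (4 * (2 * (1/2)^(j + k0)) * (1 + sqrt (ln (real ?m))))"
      "\<forall>z. \<forall>c\<in>J j. ennreal \<bar>g c z\<bar> \<le> Y z"
      using gaussian_max_envelope[of "J j" "2 * (1/2)^(j + k0)" ?m N, OF J(1) J(3) _ J(2) \<open>1 \<le> ?m\<close>]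
      unfolding g_def by auto
    ultimately show ?thesis by (meson order_trans)
  qed
  then obtain Y where Y [measurable]: "\<And>j. Y j \<in> borel_measurable gauss_seq"
    and Y_int: "\<And>j. (\<integral>\<^sup>+z. Y j z \<partial>gauss_seq) \<le> ennreal (8 * w (j + k0) + 16 * w (Suc j + k0))"
    and Y_le: "\<And>j z c. c \<in> J j \<Longrightarrow> ennreal \<bar>g c z\<bar> \<le> Y j z"
    by metis
  define Z where "Z z = Y0 z + (\<Sum>j. Y j z)" for z
  have "Z \<in> borel_measurable gauss_seq" unfolding Z_def by measurable
  moreover have "(\<integral>\<^sup>+z. Z z \<partial>gauss_seq)
      \<le> ennreal (8 * w k0) + (\<Sum>j. ennreal (8 * w (j + k0) + 16 * w (Suc j + k0)))"
  proof -
    have "(\<integral>\<^sup>+z. Z z \<partial>gauss_seq) = (\<integral>\<^sup>+z. Y0 z \<partial>gauss_seq) + (\<Sum>j. \<integral>\<^sup>+z. Y j z \<partial>gauss_seq)"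
      unfolding Z_def by (simp add: nn_integral_add nn_integral_suminf)
    also have "\<dots> \<le> ennreal (8 * w k0) + (\<Sum>j. ennreal (8 * w (j + k0) + 16 * w (Suc j + k0)))"
      using Y0_int by (intro add_mono suminf_le Y_int) (auto simp: w_def algebra_simps)
    finally show ?thesis .
  qed
  moreover have "ennreal \<bar>g h z\<bar> \<le> Z z" if h: "h \<in> T" for h z
  proof -
    have "\<exists>c. c \<in> C k \<and> dist c h < (1/2)^k" for k
    proof -
      have "h \<in> (\<Union>c\<in>C k. ball c ((1/2)^k))" using C(4)[of k] h by (rule subsetD)
      then show ?thesis by auto
    qed
    then obtain c where c: "\<And>k. c k \<in> C k" "\<And>k. dist (c k) h < (1/2)^k" by metis
    have c0: "c k0 \<in> I0"
    proof -
      have "norm (c k0) \<le> norm h + dist (c k0) h" by (metis dist_norm norm_triangle_sub)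
      also have "\<dots> \<le> 2 * (1/2)^k0" using c(2)[of k0] small[OF h] by simp
      finally show ?thesis using c(1) by (simp add: I0_def)
    qed
    have inc: "c (Suc j + k0) - c (j + k0) \<in> J j" for j
    proof -
      have "norm (c (Suc j + k0) - c (j + k0)) \<le> dist (c (Suc j + k0)) h + dist (c (j + k0)) h"
        by (metis dist_norm dist_triangle2)
      also have "\<dots> \<le> (1/2)^(Suc j + k0) + (1/2)^(j + k0)"
        using c(2)[of "Suc j + k0"] c(2)[of "j + k0"] by simp
      also have "\<dots> \<le> 2 * (1/2)^(j + k0)" by simp
      finally show ?thesis unfolding J_def using c(1) by (auto intro!: image_eqI[of _ _ "(c (Suc j + k0), c (j + k0))"])
    qed
    have tele: "ennreal \<bar>g (c (n + k0)) z\<bar> \<le> Y0 z + (\<Sum>j<n. Y j z)" for n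
    proof (induction n)
      case 0
      show ?case using Y0_le[OF c0] by simp
    next
      case (Suc n)
      have "g (c (Suc n + k0)) z = g (c (n + k0)) z + g (c (Suc n + k0) - c (n + k0)) z"
        using g_add[of "c (n + k0)" "c (Suc n + k0) - c (n + k0)" z] by simp
      then have "ennreal \<bar>g (c (Suc n + k0)) z\<bar> \<le> ennreal (\<bar>g (c (n + k0)) z\<bar> + \<bar>g (c (Suc n + k0) - c (n + k0)) z\<bar>)"
        by (intro ennreal_leI) linarith
      also have "\<dots> = ennreal \<bar>g (c (n + k0)) z\<bar> + ennreal \<bar>g (c (Suc n + k0) - c (n + k0)) z\<bar>" by simp
      also have "\<dots> \<le> (Y0 z + (\<Sum>j<n. Y j z)) + Y n z" by (intro add_mono Suc.IH Y_le inc)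
      finally show ?case by (simp add: add.assoc)
    qed
    have le: "ennreal \<bar>g (c (n + k0)) z\<bar> \<le> Z z" for n
      using tele[of n] unfolding Z_def
      by (rule order_trans) (intro add_left_mono sum_le_suminf, auto)
    have "(\<lambda>n. dist (c (n + k0)) h) \<longlonglongrightarrow> 0"
    proof (rule tendsto_sandwich[of "\<lambda>_. 0" _ _ "\<lambda>n. (1/2)^(n + k0)"])
      show "\<forall>\<^sub>F n in sequentially. dist (c (n + k0)) h \<le> (1/2)^(n + k0)"
        using c(2) by (intro always_eventually allI less_imp_le)
      show "(\<lambda>n. (1/2::real)^(n + k0)) \<longlonglongrightarrow> 0"
        by (rule LIMSEQ_ignore_initial_segment[OF LIMSEQ_realpow_zero]) auto
    qed auto
    then have lim: "(\<lambda>n. c (n + k0)) \<longlonglongrightarrow> h" by (rule tendsto_dist_iff[THEN iffD2])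
    have "(\<lambda>n. ennreal \<bar>g (c (n + k0)) z\<bar>) \<longlonglongrightarrow> ennreal \<bar>g h z\<bar>"
      unfolding g_def by (intro tendsto_intros tendsto_ennrealI lim)
    then show ?thesis by (rule LIMSEQ_le_const2) (use le in auto)
  qed
  ultimately show ?thesis unfolding g_def by (intro bexI[of _ Z]) auto
qed

text \<open>The series \<^const>\<open>obs_inner\<close> converges almost surely for each \<open>h\<close>, but not for all \<open>h\<close> at once. The
  lower limit of the envelopes of the partial sums bounds it wherever it converges.\<close>

lemma small_ball_sup:
  fixes B :: "'h set" and b \<tau> :: real
  assumes ent: "entropy_integral B < \<infinity>" and b: "0 < b" and \<tau>: "0 < \<tau>"
  shows "\<exists>\<delta>>0. \<exists>E\<in>sets gauss_seq. emeasure gauss_seq E \<le> ennreal \<tau> \<and>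
    (\<forall>z. z \<notin> E \<longrightarrow> (\<forall>h\<in>B. norm h \<le> \<delta> \<longrightarrow> h \<in> conv_set e z \<longrightarrow> \<bar>obs_inner e z h\<bar> \<le> b))"
proof (cases "B = {}")
  case True
  then show ?thesis by (intro exI[of _ 1] conjI bexI[of _ "{}"]) auto
next
  case False
  obtain C m where C: "\<And>k. finite (C k)" "\<And>k. card (C k) = m k" "\<And>k. 1 \<le> m k"
      "\<And>k. B \<subseteq> (\<Union>c\<in>C k. ball c ((1/2)^k))"
    and sm: "summable (\<lambda>k. (1/2)^k * (1 + sqrt (ln (real (m k)))))"
    using entropy_nets[OF ent False] by blast
  define w where "w k = (1/2)^k * (1 + sqrt (ln (real (m k))))" for k
  have sw: "summable w" using sm by (simp add: w_def[abs_def])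
  have w0: "0 \<le> w k" for k using C(3)[of k] by (simp add: w_def)
  define v where "v k = 8 * w k + 16 * w (Suc k)" for k
  have sv: "summable v"
    unfolding v_def using sw by (intro summable_add summable_mult) (auto simp: summable_Suc_iff)
  have v0: "0 \<le> v k" for k using w0[of k] w0[of "Suc k"] by (simp add: v_def)
  \<comment> \<open>The envelope will have mean at most 2 r, which is below b \<tau>; Markov's
    inequality at level b then gives probability at most \<tau>.\<close>
  define r where "r = b * \<tau> / 3"
  have r: "0 < r" using b \<tau> by (simp add: r_def)
  obtain N1 where N1: "\<And>n. n \<ge> N1 \<Longrightarrow> norm (\<Sum>i. v (i + n)) < r"
    using suminf_exist_split[OF r sv] by blast
  have "w \<longlonglongrightarrow> 0" using sw by (rule summable_LIMSEQ_zero)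
  then obtain N2 where N2: "\<And>n. n \<ge> N2 \<Longrightarrow> norm (w n) < r / 8"
    using r by (metis LIMSEQ_D diff_zero zero_less_divide_iff zero_less_numeral)
  \<comment> \<open>Starting the chain at this scale makes the initial envelope and the tail of the
    chaining series each at most r. The radius \<delta> of the conclusion is 2^-k0.\<close>
  define k0 where "k0 = max N1 N2"
  define T where "T = {h \<in> B. norm h \<le> (1/2)^k0}"
  have bound: "ennreal (8 * w k0) + (\<Sum>j. ennreal (8 * w (j + k0) + 16 * w (Suc j + k0))) \<le> ennreal (2 * r)"
  proof -
    have "(\<Sum>j. ennreal (8 * w (j + k0) + 16 * w (Suc j + k0))) = (\<Sum>j. ennreal (v (j + k0)))"
      by (simp add: v_def)
    also have "\<dots> = ennreal (\<Sum>j. v (j + k0))"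
      using sv v0 by (intro suminf_ennreal2) (auto simp: summable_iff_shift)
    also have "\<dots> \<le> ennreal r" using N1[of k0] by (intro ennreal_leI) (simp add: k0_def)
    finally have "(\<Sum>j. ennreal (8 * w (j + k0) + 16 * w (Suc j + k0))) \<le> ennreal r" .
    moreover have "ennreal (8 * w k0) \<le> ennreal r" using N2[of k0] by (intro ennreal_leI) (simp add: k0_def)
    ultimately have "ennreal (8 * w k0) + (\<Sum>j. ennreal (8 * w (j + k0) + 16 * w (Suc j + k0))) \<le> ennreal r + ennreal r"
      by (intro add_mono)
    then show ?thesis using r by (simp add: ennreal_plus[symmetric] del: ennreal_plus)
  qed
  have "\<exists>Y\<in>borel_measurable gauss_seq. (\<integral>\<^sup>+z. Y z \<partial>gauss_seq) \<le> ennreal (2 * r) \<and>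
    (\<forall>z. \<forall>h\<in>T. ennreal \<bar>\<Sum>k<N. z k * (h \<bullet> e k)\<bar> \<le> Y z)" for N
  proof -
    have "T \<subseteq> (\<Union>c\<in>C k. ball c ((1/2)^k))" for k using C(4)[of k] by (auto simp: T_def)
    moreover have "norm h \<le> (1/2)^k0" if "h \<in> T" for h using that by (simp add: T_def)
    ultimately have "\<exists>Y\<in>borel_measurable gauss_seq. (\<integral>\<^sup>+z. Y z \<partial>gauss_seq)
        \<le> ennreal (8 * w k0) + (\<Sum>j. ennreal (8 * w (j + k0) + 16 * w (Suc j + k0))) \<and>
      (\<forall>z. \<forall>h\<in>T. ennreal \<bar>\<Sum>k<N. z k * (h \<bullet> e k)\<bar> \<le> Y z)"
      by (intro chaining_partial_sums[OF w_def C(1-3)])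
    then obtain Y where Y: "Y \<in> borel_measurable gauss_seq"
      and Y_int: "(\<integral>\<^sup>+z. Y z \<partial>gauss_seq)
        \<le> ennreal (8 * w k0) + (\<Sum>j. ennreal (8 * w (j + k0) + 16 * w (Suc j + k0)))"
      and Y_le: "\<forall>z. \<forall>h\<in>T. ennreal \<bar>\<Sum>k<N. z k * (h \<bullet> e k)\<bar> \<le> Y z"
      by (elim bexE conjE)
    from Y_int bound have "(\<integral>\<^sup>+z. Y z \<partial>gauss_seq) \<le> ennreal (2 * r)" by (rule order_trans)
    with Y Y_le show ?thesis by blast
  qed
  then obtain Y where Y [measurable]: "\<And>N. Y N \<in> borel_measurable gauss_seq"
    and Y_int: "\<And>N. (\<integral>\<^sup>+z. Y N z \<partial>gauss_seq) \<le> ennreal (2 * r)"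
    and Y_le: "\<And>N z h. h \<in> T \<Longrightarrow> ennreal \<bar>\<Sum>k<N. z k * (h \<bullet> e k)\<bar> \<le> Y N z"
    by metis
  define M where "M z = liminf (\<lambda>N. Y N z)" for z
  have [measurable]: "M \<in> borel_measurable gauss_seq" unfolding M_def by measurable
  have "(\<integral>\<^sup>+z. M z \<partial>gauss_seq) \<le> liminf (\<lambda>N. \<integral>\<^sup>+z. Y N z \<partial>gauss_seq)"
    unfolding M_def by (rule nn_integral_liminf) measurable
  also have "\<dots> \<le> ennreal (2 * r)"
    using Y_int by (intro Liminf_le) auto
  finally have M_int: "(\<integral>\<^sup>+z. M z \<partial>gauss_seq) \<le> ennreal (2 * r)" .
  define E where "E = {z. ennreal b \<le> M z}"
  have E [measurable]: "E \<in> sets gauss_seq"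
  proof -
    have "{z \<in> space gauss_seq. ennreal b \<le> M z} \<in> sets gauss_seq" by measurable
    then show ?thesis by (simp add: E_def)
  qed
  have "ennreal b * emeasure gauss_seq E = (\<integral>\<^sup>+z. ennreal b * indicator E z \<partial>gauss_seq)"
    by (simp add: nn_integral_cmult)
  also have "\<dots> \<le> (\<integral>\<^sup>+z. M z \<partial>gauss_seq)"
    by (intro nn_integral_mono) (auto simp: E_def indicator_def)
  also have "\<dots> \<le> ennreal (b * \<tau>)" 
  proof -
    have "ennreal (2 * r) \<le> ennreal (b * \<tau>)" using b \<tau> by (intro ennreal_leI) (simp add: r_def)
    with M_int show ?thesis by (rule order_trans)
  qed
  finally have "ennreal b * emeasure gauss_seq E \<le> ennreal b * ennreal \<tau>"
    using b \<tau> by (simp add: ennreal_mult)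
  then have "emeasure gauss_seq E \<le> ennreal \<tau>"
    using b by (simp add: ennreal_mult_le_mult_iff)
  moreover have "\<bar>obs_inner e z h\<bar> \<le> b" if "z \<notin> E" "h \<in> B" "norm h \<le> (1/2)^k0" "h \<in> conv_set e z" for z h
  proof -
    have "(\<lambda>N. \<Sum>k<N. z k * (h \<bullet> e k)) \<longlonglongrightarrow> obs_inner e z h"
      using that(4) by (auto simp: conv_set_def obs_inner_def intro: summable_LIMSEQ)
    then have "(\<lambda>N. ennreal \<bar>\<Sum>k<N. z k * (h \<bullet> e k)\<bar>) \<longlonglongrightarrow> ennreal \<bar>obs_inner e z h\<bar>"
      by (intro tendsto_ennrealI tendsto_rabs)
    then have "ennreal \<bar>obs_inner e z h\<bar> = liminf (\<lambda>N. ennreal \<bar>\<Sum>k<N. z k * (h \<bullet> e k)\<bar>)"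
      by (intro lim_imp_Liminf[symmetric]) auto
    also have "\<dots> \<le> M z" unfolding M_def
      using Y_le that(2,3) by (intro Liminf_mono always_eventually) (auto simp: T_def)
    also have "\<dots> \<le> ennreal b" using that(1) by (simp add: E_def not_le less_imp_le)
    finally show ?thesis using b by simp
  qed
  ultimately show ?thesis by (intro exI[of _ "(1/2)^k0"] conjI bexI[OF _ E]) auto
qed

end

section \<open>Likelihood ratios\<close>

text \<open>For a = f - f0 and \<open>b = K \<theta> f - K \<theta>0 f0\<close> this is the
  logarithm of the likelihood ratio of (\<theta>, f) to the truth, written in terms of the noise.
  Its exponential has mean at most one.\<close>

definition log_ratio :: "(nat \<Rightarrow> 'h::real_inner) \<Rightarrow> nat \<Rightarrow> obs \<Rightarrow> 'h \<Rightarrow> 'h \<Rightarrow> real" where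
  "log_ratio e n z a b = sqrt (real n) * (obs_inner e (fst z) a + obs_inner e (snd z) b)
     - real n / 2 * ((norm a)\<^sup>2 + (norm b)\<^sup>2)"

lemma measurable_log_ratio [measurable]:
  fixes e :: "nat \<Rightarrow> 'h::{real_inner, second_countable_topology}"
  assumes [measurable]: "z \<in> M \<rightarrow>\<^sub>M white_noise" "a \<in> borel_measurable M" "b \<in> borel_measurable M"
  shows "(\<lambda>x. log_ratio e n (z x) (a x) (b x)) \<in> borel_measurable M"
proof -
  have [measurable]: "(\<lambda>x. fst (z x)) \<in> M \<rightarrow>\<^sub>M (\<Pi>\<^sub>M k\<in>UNIV. borel)" "(\<lambda>x. snd (z x)) \<in> M \<rightarrow>\<^sub>M (\<Pi>\<^sub>M k\<in>UNIV. borel)"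
    using assms(1) by (simp_all cong: measurable_cong_sets add: sets_white_noise measurable_fst'' measurable_snd'')
  show ?thesis unfolding log_ratio_def by measurable
qed

lemma markov_bound:
  fixes c p :: real
  assumes [measurable]: "u \<in> borel_measurable M" and "(\<integral>\<^sup>+x. u x \<partial>M) \<le> ennreal (c * p)" and c: "0 < c" and p: "0 \<le> p"
  shows "emeasure M {x \<in> space M. ennreal c \<le> u x} \<le> ennreal p"
proof -
  let ?E = "{x \<in> space M. ennreal c \<le> u x}"
  have "ennreal c * emeasure M ?E = (\<integral>\<^sup>+x. ennreal c * indicator ?E x \<partial>M)"
    by (simp add: nn_integral_cmult)
  also have "\<dots> \<le> (\<integral>\<^sup>+x. u x \<partial>M)"
    by (intro nn_integral_mono) (auto simp: indicator_def)
  also have "\<dots> \<le> ennreal c * ennreal p" using assms by (simp add: ennreal_mult)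
  finally show ?thesis using c by (simp add: ennreal_mult_le_mult_iff)
qed

lemma (in hilbert_basis) mgf_white_noise_affine:
  "(\<integral>\<^sup>+z. ennreal (exp (c * (obs_inner e (fst z) a + obs_inner e (snd z) b) - d)) \<partial>white_noise)
    \<le> ennreal (exp (c\<^sup>2 * ((norm a)\<^sup>2 + (norm b)\<^sup>2) / 2 - d))"
proof -
  have "(\<integral>\<^sup>+z. ennreal (exp (c * (obs_inner e (fst z) a + obs_inner e (snd z) b) - d)) \<partial>white_noise)
      = (\<integral>\<^sup>+z. ennreal (exp (- d)) * ennreal (exp (obs_inner e (fst z) (c *\<^sub>R a) + obs_inner e (snd z) (c *\<^sub>R b))) \<partial>white_noise)"
  proof (rule nn_integral_cong_AE)
    show "AE z in white_noise. ennreal (exp (c * (obs_inner e (fst z) a + obs_inner e (snd z) b) - d))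
      = ennreal (exp (- d)) * ennreal (exp (obs_inner e (fst z) (c *\<^sub>R a) + obs_inner e (snd z) (c *\<^sub>R b)))"
      using AE_white_noise_conv_set[of a b]
      by eventually_elim
         (simp add: obs_inner_scaleR ennreal_mult[symmetric] exp_add[symmetric] algebra_simps)
  qed
  also have "\<dots> = ennreal (exp (- d)) * (\<integral>\<^sup>+z. ennreal (exp (obs_inner e (fst z) (c *\<^sub>R a) + obs_inner e (snd z) (c *\<^sub>R b))) \<partial>white_noise)"
    by (rule nn_integral_cmult) (simp add: white_noise_eq)
  also have "\<dots> \<le> ennreal (exp (- d)) * ennreal (exp (((norm (c *\<^sub>R a))\<^sup>2 + (norm (c *\<^sub>R b))\<^sup>2) / 2))"
    by (intro mult_left_mono mgf_white_noise) auto
  also have "\<dots> = ennreal (exp (c\<^sup>2 * ((norm a)\<^sup>2 + (norm b)\<^sup>2) / 2 - d))"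
    by (simp add: ennreal_mult[symmetric] exp_add[symmetric] power_mult_distrib algebra_simps)
  finally show ?thesis .
qed

text \<open>The denominator is bounded from below through the expectation of the reciprocal likelihood
  ratio, using \<open>2 \<le> s y + 1 / (s y)\<close>.\<close>

lemma (in hilbert_basis) ratio_mass_negligible:
  fixes M :: "'w measure" and a b :: "'w \<Rightarrow> 'h" and \<kappa> \<delta> t q :: real
  assumes M: "finite_measure M" and [measurable]: "a \<in> borel_measurable M" "b \<in> borel_measurable M"
    and A [measurable]: "A \<in> sets M" and B [measurable]: "B \<in> sets M"
    and q: "\<And>w. w \<in> B \<Longrightarrow> (norm (a w))\<^sup>2 + (norm (b w))\<^sup>2 \<le> q"
    and AB: "measure M A \<le> \<kappa> * measure M B" and Bpos: "0 < measure M B"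
    and \<kappa>: "0 \<le> \<kappa>" and \<delta>: "0 < \<delta>" and t: "0 < t"
  shows "\<exists>E\<in>sets white_noise. emeasure white_noise E \<le> ennreal (\<kappa> / t + t * exp (real n * q) / \<delta>) \<and>
    (\<forall>z. z \<notin> E \<longrightarrow> (\<integral>\<^sup>+w. ennreal (exp (log_ratio e n z (a w) (b w))) * indicator A w \<partial>M)
        \<le> ennreal \<delta> * (\<integral>\<^sup>+w. ennreal (exp (log_ratio e n z (a w) (b w))) \<partial>M))"
proof -
  interpret M: finite_measure M by fact
  interpret N: prob_space white_noise by (rule prob_space_white_noise)
  interpret pair_sigma_finite white_noise M ..
  define l where "l z w = log_ratio e n z (a w) (b w)" for z w
  have [measurable]: "(\<lambda>(z, w). l z w) \<in> borel_measurable (white_noise \<Otimes>\<^sub>M M)"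
    unfolding l_def by measurable
  define mB where "mB = measure M B"
  have eB: "emeasure M B = ennreal mB" by (simp add: mB_def M.emeasure_eq_measure)
  have mB: "0 < mB" using Bpos by (simp add: mB_def)
  define NA where "NA z = (\<integral>\<^sup>+w. ennreal (exp (l z w)) * indicator A w \<partial>M)" for z
  define NI where "NI z = (\<integral>\<^sup>+w. ennreal (exp (- l z w)) * indicator B w \<partial>M)" for z
  define D where "D z = (\<integral>\<^sup>+w. ennreal (exp (l z w)) * indicator B w \<partial>M)" for z
  have [measurable]: "NA \<in> borel_measurable white_noise" "NI \<in> borel_measurable white_noise"
    unfolding NA_def NI_def by measurable
  have sq: "(sqrt (real n))\<^sup>2 = real n" by simp
  have el: "(\<integral>\<^sup>+z. ennreal (exp (l z w)) \<partial>white_noise) \<le> 1" for w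
  proof -
    have "(\<integral>\<^sup>+z. ennreal (exp (l z w)) \<partial>white_noise)
        \<le> ennreal (exp ((sqrt (real n))\<^sup>2 * ((norm (a w))\<^sup>2 + (norm (b w))\<^sup>2) / 2
            - real n / 2 * ((norm (a w))\<^sup>2 + (norm (b w))\<^sup>2)))"
      unfolding l_def log_ratio_def by (rule mgf_white_noise_affine)
    then show ?thesis by (simp add: sq)
  qed
  have ei: "(\<integral>\<^sup>+z. ennreal (exp (- l z w)) \<partial>white_noise) \<le> ennreal (exp (real n * q))" if "w \<in> B" for w
  proof -
    have "(\<integral>\<^sup>+z. ennreal (exp (- l z w)) \<partial>white_noise)
      = (\<integral>\<^sup>+z. ennreal (exp ((- sqrt (real n)) * (obs_inner e (fst z) (a w) + obs_inner e (snd z) (b w))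
          - (- (real n / 2 * ((norm (a w))\<^sup>2 + (norm (b w))\<^sup>2))))) \<partial>white_noise)"
      unfolding l_def log_ratio_def by (simp add: algebra_simps)
    also have "\<dots> \<le> ennreal (exp ((- sqrt (real n))\<^sup>2 * ((norm (a w))\<^sup>2 + (norm (b w))\<^sup>2) / 2
            - (- (real n / 2 * ((norm (a w))\<^sup>2 + (norm (b w))\<^sup>2)))))"
      by (rule mgf_white_noise_affine)
    also have "\<dots> = ennreal (exp (real n * ((norm (a w))\<^sup>2 + (norm (b w))\<^sup>2)))"
      by (simp add: sq field_simps)
    also have "\<dots> \<le> ennreal (exp (real n * q))"
      using q[OF that] by (intro ennreal_leI) (simp add: mult_left_mono)
    finally show ?thesis .
  qed
  have "(\<integral>\<^sup>+z. NA z \<partial>white_noise) = (\<integral>\<^sup>+w. (\<integral>\<^sup>+z. ennreal (exp (l z w)) * indicator A w \<partial>white_noise) \<partial>M)"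
    unfolding NA_def by (rule Fubini'[symmetric]) measurable
  also have "\<dots> = (\<integral>\<^sup>+w. (\<integral>\<^sup>+z. ennreal (exp (l z w)) \<partial>white_noise) * indicator A w \<partial>M)"
    by (intro nn_integral_cong nn_integral_multc) measurable
  also have "\<dots> \<le> (\<integral>\<^sup>+w. 1 * indicator A w \<partial>M)"
    by (intro nn_integral_mono mult_right_mono el) auto
  also have "\<dots> \<le> ennreal (t * mB * (\<kappa> / t))"
    using AB t by (simp add: M.emeasure_eq_measure mB_def ennreal_leI mult.commute)
  finally have E1: "emeasure white_noise {z \<in> space white_noise. ennreal (t * mB) \<le> NA z} \<le> ennreal (\<kappa> / t)"
    using t mB \<kappa> by (intro markov_bound) auto
  have "(\<integral>\<^sup>+z. NI z \<partial>white_noise) = (\<integral>\<^sup>+w. (\<integral>\<^sup>+z. ennreal (exp (- l z w)) * indicator B w \<partial>white_noise) \<partial>M)"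
    unfolding NI_def by (rule Fubini'[symmetric]) measurable
  also have "\<dots> = (\<integral>\<^sup>+w. (\<integral>\<^sup>+z. ennreal (exp (- l z w)) \<partial>white_noise) * indicator B w \<partial>M)"
    by (intro nn_integral_cong nn_integral_multc) measurable
  also have "\<dots> \<le> (\<integral>\<^sup>+w. ennreal (exp (real n * q)) * indicator B w \<partial>M)"
    using ei by (intro nn_integral_mono) (auto simp: indicator_def)
  also have "\<dots> = ennreal ((mB * \<delta> / t) * (t * exp (real n * q) / \<delta>))"
    using t \<delta> mB by (simp add: nn_integral_cmult eB ennreal_mult[symmetric])
  finally have E2: "emeasure white_noise {z \<in> space white_noise. ennreal (mB * \<delta> / t) \<le> NI z}
      \<le> ennreal (t * exp (real n * q) / \<delta>)"
    using t mB \<delta> by (intro markov_bound) auto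
  \<comment> \<open>Markov's inequality for both integrals: off E the numerator is below
    \<open>t * mB\<close> and the integral of the reciprocal ratio below
    \<open>mB * \<delta> / t\<close>. The free parameter t trades one probability against the
    other.\<close>
  define E where "E = {z \<in> space white_noise. ennreal (t * mB) \<le> NA z} \<union> {z \<in> space white_noise. ennreal (mB * \<delta> / t) \<le> NI z}"
  have "E \<in> sets white_noise" unfolding E_def by measurable
  moreover have "emeasure white_noise E \<le> ennreal (\<kappa> / t + t * exp (real n * q) / \<delta>)"
  proof -
    have "emeasure white_noise E \<le> ennreal (\<kappa> / t) + ennreal (t * exp (real n * q) / \<delta>)"
      unfolding E_def by (rule order_trans[OF emeasure_subadditive add_mono[OF E1 E2]]) measurable
    then show ?thesis using \<kappa> t \<delta> by simp
  qed
  moreover have "NA z \<le> ennreal \<delta> * (\<integral>\<^sup>+w. ennreal (exp (l z w)) \<partial>M)" if z: "z \<notin> E" for z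
  proof -
    have zs: "z \<in> space white_noise" by simp
    have NA: "NA z < ennreal (t * mB)" and NI: "NI z < ennreal (mB * \<delta> / t)"
      using z zs by (auto simp: E_def not_le)
    have [measurable]: "l z \<in> borel_measurable M" unfolding l_def by measurable
    \<comment> \<open>At this scale the reciprocal term integrates to at most mB, half of the
      left-hand side 2 mB, which leaves \<open>mB \<le> s * D z\<close>.\<close>
    define s where "s = \<delta> / t"
    have s: "0 < s" using \<delta> t by (simp add: s_def)
    have "2 \<le> s * y + 1 / s * (1 / y)" if y: "0 < y" for y :: real
    proof -
      have "0 \<le> (s * y - 1)\<^sup>2 / (s * y)" using s y by simp
      also have "\<dots> = s * y - 2 + 1 / s * (1 / y)" using s y by (simp add: power2_eq_square field_simps)
      finally show ?thesis by simp
    qed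
    then have pw: "ennreal 2 \<le> ennreal s * ennreal (exp (l z w)) + ennreal (1 / s) * ennreal (exp (- l z w))" for w
      using s by (simp add: ennreal_mult[symmetric] ennreal_plus[symmetric] exp_minus inverse_eq_divide ennreal_leI
          del: ennreal_plus ennreal_numeral)
    have "ennreal (2 * mB) = (\<integral>\<^sup>+w. ennreal 2 * indicator B w \<partial>M)"
      using mB by (simp add: nn_integral_cmult eB ennreal_mult)
    also have "\<dots> \<le> (\<integral>\<^sup>+w. ennreal s * (ennreal (exp (l z w)) * indicator B w)
        + ennreal (1 / s) * (ennreal (exp (- l z w)) * indicator B w) \<partial>M)"
      using pw by (intro nn_integral_mono) (auto simp: indicator_def)
    also have "\<dots> = ennreal s * D z + ennreal (1 / s) * NI z"
      unfolding D_def NI_def by (simp add: nn_integral_add nn_integral_cmult)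
    also have "\<dots> \<le> ennreal s * D z + ennreal (1 / s) * ennreal (mB * \<delta> / t)"
      using NI by (intro add_left_mono mult_left_mono) auto
    also have "ennreal (1 / s) * ennreal (mB * \<delta> / t) = ennreal mB"
      using s mB \<delta> t by (simp add: ennreal_mult[symmetric] s_def)
    finally have "ennreal (2 * mB) \<le> ennreal s * D z + ennreal mB" .
    moreover have "ennreal (2 * mB) = ennreal mB + ennreal mB" using mB by (simp add: ennreal_plus[symmetric] del: ennreal_plus)
    ultimately have "ennreal mB \<le> ennreal s * D z"
      by (simp add: add.commute[of "ennreal s * D z"] ennreal_add_left_cancel_le)
    then have "ennreal t * ennreal mB \<le> ennreal t * (ennreal s * D z)" by (intro mult_left_mono) auto
    also have "\<dots> = ennreal \<delta> * D z"
      using t \<delta> by (simp add: mult.assoc[symmetric] ennreal_mult[symmetric] s_def)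
    finally have "NA z \<le> ennreal \<delta> * D z" using NA t mB by (simp add: ennreal_mult order.trans[OF less_imp_le])
    also have "\<dots> \<le> ennreal \<delta> * (\<integral>\<^sup>+w. ennreal (exp (l z w)) \<partial>M)"
      unfolding D_def by (intro mult_left_mono nn_integral_mono) (auto simp: indicator_def)
    finally show ?thesis .
  qed
  ultimately show ?thesis unfolding NA_def l_def by (intro bexI[of _ E]) auto
qed

section \<open>Expansion of the log-likelihood ratio\<close>

text \<open>The normal equation is used twice. At v = d it cancels the term linear in both u and d,
  up to the error \<gamma> - \<gamma>0. At v = \<gamma>0 it turns |k|^2 - |\<gamma>0|^2 - |A
  \<gamma>0|^2 into the efficient information |\<gamma>0|^2 + |k - A \<gamma>0|^2.\<close>

lemma quadratic_expansion:
  fixes d \<gamma> \<gamma>0 k R :: "'h::real_inner" and A A' :: "'h \<Rightarrow>\<^sub>L 'h" and u n :: real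
  assumes foc: "\<And>v. \<gamma>0 \<bullet> v + A \<gamma>0 \<bullet> A v = k \<bullet> A v"
  defines "b \<equiv> A d + u *\<^sub>R k + u *\<^sub>R A' d + R" and "g \<equiv> d + u *\<^sub>R \<gamma>" and "y \<equiv> A' d"
  shows "(- n / 2 * ((norm d)\<^sup>2 + (norm b)\<^sup>2)) - (- n / 2 * ((norm g)\<^sup>2 + (norm (A g))\<^sup>2))
    = - (n * u\<^sup>2 / 2) * ((norm \<gamma>0)\<^sup>2 + (norm (k - A \<gamma>0))\<^sup>2)
      + n * u * (d \<bullet> (\<gamma> - \<gamma>0) + A d \<bullet> A (\<gamma> - \<gamma>0)) - n * u * (A d \<bullet> A' d) - n * (A d \<bullet> R)
      + n * u\<^sup>2 / 2 * ((norm \<gamma>)\<^sup>2 - (norm \<gamma>0)\<^sup>2 + ((norm (A \<gamma>))\<^sup>2 - (norm (A \<gamma>0))\<^sup>2))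
      - n / 2 * ((norm (u *\<^sub>R k + u *\<^sub>R A' d + R))\<^sup>2 - u\<^sup>2 * (norm k)\<^sup>2)"
proof -
  define x where "x = A d"
  define w where "w = A \<gamma>"
  define w0 where "w0 = A \<gamma>0"
  have Ag: "A g = x + u *\<^sub>R w" by (simp add: g_def x_def w_def blinfun.add_right blinfun.scaleR_right)
  have Ad: "A (\<gamma> - \<gamma>0) = w - w0" by (simp add: w_def w0_def blinfun.diff_right)
  have foc1: "\<gamma>0 \<bullet> d = k \<bullet> x - w0 \<bullet> x" using foc[of d] by (simp add: x_def w0_def)
  have foc2: "\<gamma>0 \<bullet> \<gamma>0 = k \<bullet> w0 - w0 \<bullet> w0" using foc[of \<gamma>0] by (simp add: w0_def)
  define c where "c = u *\<^sub>R k + u *\<^sub>R y + R"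
  have bc: "b = x + c" by (simp add: b_def c_def x_def y_def add.assoc)
  have xc: "x \<bullet> c = u * (x \<bullet> k) + u * (x \<bullet> y) + x \<bullet> R" by (simp add: c_def inner_add_right)
  have 1: "(norm b)\<^sup>2 = x \<bullet> x + 2 * (x \<bullet> c) + c \<bullet> c"
    unfolding bc power2_norm_eq_inner by (simp add: inner_add_left inner_add_right inner_commute)
  have 2: "(norm g)\<^sup>2 = d \<bullet> d + 2 * u * (d \<bullet> \<gamma>) + u\<^sup>2 * (\<gamma> \<bullet> \<gamma>)"
    unfolding g_def power2_norm_eq_inner by (simp add: inner_add_left inner_add_right inner_commute power2_eq_square algebra_simps)
  have 3: "(norm (A g))\<^sup>2 = x \<bullet> x + 2 * u * (x \<bullet> w) + u\<^sup>2 * (w \<bullet> w)"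
    unfolding Ag power2_norm_eq_inner by (simp add: inner_add_left inner_add_right inner_commute power2_eq_square algebra_simps)
  have 4: "(norm (k - w0))\<^sup>2 = k \<bullet> k - 2 * (k \<bullet> w0) + w0 \<bullet> w0"
    unfolding power2_norm_eq_inner by (simp add: inner_diff_left inner_diff_right inner_commute algebra_simps)
  have 5: "d \<bullet> (\<gamma> - \<gamma>0) = d \<bullet> \<gamma> - (k \<bullet> x - w0 \<bullet> x)" using foc1 by (simp add: inner_diff_right inner_commute)
  have 6: "x \<bullet> (w - w0) = x \<bullet> w - w0 \<bullet> x" by (simp add: inner_diff_right inner_commute)
  show ?thesis
    unfolding Ad x_def[symmetric] w_def[symmetric] w0_def[symmetric] y_def[symmetric] c_def[symmetric] 1 2 3 4 5 6
    unfolding power2_norm_eq_inner foc2 xc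
    by (simp add: inner_commute[of x k] field_simps)
qed

lemma norm_sq_diff_bound:
  fixes a b :: "'h::real_inner"
  assumes "norm (a - b) \<le> r"
  shows "\<bar>(norm a)\<^sup>2 - (norm b)\<^sup>2\<bar> \<le> r * (2 * norm b + r)"
proof -
  have "(norm a)\<^sup>2 - (norm b)\<^sup>2 = (norm a - norm b) * (norm a + norm b)"
    by (simp add: power2_eq_square algebra_simps)
  then have "\<bar>(norm a)\<^sup>2 - (norm b)\<^sup>2\<bar> = \<bar>norm a - norm b\<bar> * (norm a + norm b)"
    by (simp add: abs_mult)
  also have "\<dots> \<le> r * (2 * norm b + r)"
    using norm_triangle_ineq3[of a b] assms norm_ge_zero[of "a - b"] norm_triangle_sub[of a b]
    by (intro mult_mono) (auto intro: add_nonneg_nonneg)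
  finally show ?thesis .
qed

text \<open>The five errors are sorted by their power of u: linear ones carry the weight sqrt n |u|,
  quadratic ones n u^2. Both weights are at most 1 + n u^2, and the coefficients vanish
  asymptotically in the application.\<close>

lemma quadratic_expansion_bound:
  fixes d \<gamma> \<gamma>0 k R :: "'h::real_inner" and A A' :: "'h \<Rightarrow>\<^sub>L 'h" and u :: real and n :: nat and D r s \<epsilon> c \<kappa> :: real
  assumes foc: "\<And>v. \<gamma>0 \<bullet> v + A \<gamma>0 \<bullet> A v = k \<bullet> A v"
  defines "b \<equiv> A d + u *\<^sub>R k + u *\<^sub>R A' d + R" and "g \<equiv> d + u *\<^sub>R \<gamma>"
  assumes A: "norm A \<le> D" and A': "norm A' \<le> D"
    and d: "norm d \<le> 2 * \<epsilon>" and u: "\<bar>u\<bar> \<le> \<epsilon>" and \<gamma>: "norm (\<gamma> - \<gamma>0) \<le> r"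
    and R: "norm R \<le> c * u\<^sup>2" and c: "0 \<le> c" and \<kappa>: "sqrt (real n) * \<bar>A d \<bullet> A' d\<bar> \<le> \<kappa>"
  shows "\<bar>(- real n / 2 * ((norm d)\<^sup>2 + (norm b)\<^sup>2)) - (- real n / 2 * ((norm g)\<^sup>2 + (norm (A g))\<^sup>2))
      + (real n * u\<^sup>2 / 2) * ((norm \<gamma>0)\<^sup>2 + (norm (k - A \<gamma>0))\<^sup>2)\<bar>
    \<le> sqrt (real n) * \<bar>u\<bar> * (\<kappa> + sqrt (real n) * \<epsilon> * r * (2 + 2 * D\<^sup>2))
      + real n * u\<^sup>2 * (2 * D * \<epsilon> * c + (r * (2 * norm \<gamma>0 + r) + (D * r) * (2 * norm (A \<gamma>0) + D * r))
          + ((2 * D + c) * \<epsilon>) * (2 * norm k + (2 * D + c) * \<epsilon>))"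
proof -
  have D: "0 \<le> D" using A norm_ge_zero order_trans by blast
  have \<epsilon>: "0 \<le> \<epsilon>" using u by linarith
  have r: "0 \<le> r" using \<gamma> norm_ge_zero order_trans by blast
  have nA: "norm (A v) \<le> D * norm v" for v
    using norm_blinfun[of A v] A by (meson mult_right_mono norm_ge_zero order_trans)
  have nA': "norm (A' v) \<le> D * norm v" for v
    using norm_blinfun[of A' v] A' by (meson mult_right_mono norm_ge_zero order_trans)
  have nAd: "norm (A d) \<le> 2 * D * \<epsilon>" using nA[of d] mult_left_mono[OF d D] by linarith
  have nA'd: "norm (A' d) \<le> 2 * D * \<epsilon>" using nA'[of d] mult_left_mono[OF d D] by linarith
  have nAg: "norm (A (\<gamma> - \<gamma>0)) \<le> D * r" using nA[of "\<gamma> - \<gamma>0"] mult_left_mono[OF \<gamma> D] by linarith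
  define n' where "n' = real n"
  define s where "s = sqrt n'"
  have n': "0 \<le> n'" "s * s = n'" "0 \<le> s" by (auto simp: n'_def s_def)
  define T1 where "T1 = d \<bullet> (\<gamma> - \<gamma>0) + A d \<bullet> A (\<gamma> - \<gamma>0)"
  define T2 where "T2 = A d \<bullet> A' d"
  define T3 where "T3 = A d \<bullet> R"
  define T4 where "T4 = (norm \<gamma>)\<^sup>2 - (norm \<gamma>0)\<^sup>2 + ((norm (A \<gamma>))\<^sup>2 - (norm (A \<gamma>0))\<^sup>2)"
  define T5 where "T5 = (norm (u *\<^sub>R k + u *\<^sub>R A' d + R))\<^sup>2 - u\<^sup>2 * (norm k)\<^sup>2"
  have "\<bar>T1\<bar> \<le> norm d * norm (\<gamma> - \<gamma>0) + norm (A d) * norm (A (\<gamma> - \<gamma>0))"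
    unfolding T1_def using Cauchy_Schwarz_ineq2[of d "\<gamma> - \<gamma>0"] Cauchy_Schwarz_ineq2[of "A d" "A (\<gamma> - \<gamma>0)"] by linarith
  also have "\<dots> \<le> 2 * \<epsilon> * r + (2 * D * \<epsilon>) * (D * r)"
    using d \<gamma> nAd nAg \<epsilon> D r by (intro add_mono mult_mono) auto
  finally have T1: "\<bar>T1\<bar> \<le> \<epsilon> * r * (2 + 2 * D\<^sup>2)" by (simp add: power2_eq_square algebra_simps)
  \<comment> \<open>One factor sqrt n stays with u, the other multiplies \<epsilon> r. That product
    is what the rate n \<epsilon>^2 \<rho>^2 \<rightarrow> 0 makes small.\<close>
  have "\<bar>n' * u * T1\<bar> = s * \<bar>u\<bar> * (s * \<bar>T1\<bar>)" using n' by (simp add: abs_mult mult_ac)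
  also have "\<dots> \<le> s * \<bar>u\<bar> * (s * (\<epsilon> * r * (2 + 2 * D\<^sup>2)))"
    using T1 n' by (intro mult_left_mono) auto
  finally have B1: "\<bar>n' * u * T1\<bar> \<le> s * \<bar>u\<bar> * (s * \<epsilon> * r * (2 + 2 * D\<^sup>2))" by (simp add: mult_ac)
  have "\<bar>n' * u * T2\<bar> = s * \<bar>u\<bar> * (s * \<bar>T2\<bar>)" using n' by (simp add: abs_mult mult_ac)
  also have "\<dots> \<le> s * \<bar>u\<bar> * \<kappa>"
    using \<kappa> n' unfolding T2_def s_def n'_def by (intro mult_left_mono) auto
  finally have B2: "\<bar>n' * u * T2\<bar> \<le> s * \<bar>u\<bar> * \<kappa>" .
  have "\<bar>T3\<bar> \<le> norm (A d) * norm R" unfolding T3_def by (rule Cauchy_Schwarz_ineq2)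
  also have "\<dots> \<le> (2 * D * \<epsilon>) * (c * u\<^sup>2)" using nAd R D \<epsilon> by (intro mult_mono) auto
  finally have B3: "\<bar>n' * T3\<bar> \<le> n' * u\<^sup>2 * (2 * D * \<epsilon> * c)"
    using n' mult_left_mono[of "\<bar>T3\<bar>" "(2 * D * \<epsilon>) * (c * u\<^sup>2)" n'] by (simp add: abs_mult mult_ac)
  have "\<bar>T4\<bar> \<le> r * (2 * norm \<gamma>0 + r) + (D * r) * (2 * norm (A \<gamma>0) + D * r)"
    unfolding T4_def using norm_sq_diff_bound[OF \<gamma>] norm_sq_diff_bound[of "A \<gamma>" "A \<gamma>0" "D * r"] nAg
    by (simp add: blinfun.diff_right)
  then have "\<bar>T4\<bar> / 2 \<le> r * (2 * norm \<gamma>0 + r) + (D * r) * (2 * norm (A \<gamma>0) + D * r)" by linarith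
  then have "n' * u\<^sup>2 * (\<bar>T4\<bar> / 2) \<le> n' * u\<^sup>2 * (r * (2 * norm \<gamma>0 + r) + (D * r) * (2 * norm (A \<gamma>0) + D * r))"
    using n' by (intro mult_left_mono) auto
  then have B4: "\<bar>n' * u\<^sup>2 / 2 * T4\<bar> \<le> n' * u\<^sup>2 * (r * (2 * norm \<gamma>0 + r) + (D * r) * (2 * norm (A \<gamma>0) + D * r))"
    using n' by (simp add: abs_mult)
  have "norm ((u *\<^sub>R k + u *\<^sub>R A' d + R) - u *\<^sub>R k) \<le> \<bar>u\<bar> * ((2 * D + c) * \<epsilon>)"
  proof -
    have "norm ((u *\<^sub>R k + u *\<^sub>R A' d + R) - u *\<^sub>R k) \<le> norm (u *\<^sub>R A' d) + norm R"
      by (metis add_diff_cancel_left' add.assoc norm_triangle_ineq)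
    also have "\<dots> \<le> \<bar>u\<bar> * (2 * D * \<epsilon>) + \<bar>u\<bar> * (c * \<epsilon>)"
    proof (rule add_mono)
      show "norm (u *\<^sub>R A' d) \<le> \<bar>u\<bar> * (2 * D * \<epsilon>)" using nA'd by (simp add: mult_left_mono)
      \<comment> \<open>One factor |u| is traded for its bound \<epsilon>, so that R can be treated
        like the term u A' d.\<close>
      have "c * u\<^sup>2 = \<bar>u\<bar> * (c * \<bar>u\<bar>)" by (simp add: power2_eq_square)
      also have "\<dots> \<le> \<bar>u\<bar> * (c * \<epsilon>)" using u c by (intro mult_left_mono) auto
      finally show "norm R \<le> \<bar>u\<bar> * (c * \<epsilon>)" using R by linarith
    qed
    finally show ?thesis by (simp add: algebra_simps)
  qed
  from norm_sq_diff_bound[OF this]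
  have "\<bar>T5\<bar> \<le> \<bar>u\<bar> * ((2 * D + c) * \<epsilon>) * (2 * (\<bar>u\<bar> * norm k) + \<bar>u\<bar> * ((2 * D + c) * \<epsilon>))"
    by (simp add: T5_def power_mult_distrib)
  also have "\<dots> = \<bar>u\<bar> * \<bar>u\<bar> * (((2 * D + c) * \<epsilon>) * (2 * norm k + (2 * D + c) * \<epsilon>))" by (simp only: algebra_simps)
  also have "\<bar>u\<bar> * \<bar>u\<bar> = u\<^sup>2" by (simp add: power2_eq_square)
  finally have T5: "\<bar>T5\<bar> \<le> u\<^sup>2 * (((2 * D + c) * \<epsilon>) * (2 * norm k + (2 * D + c) * \<epsilon>))" .
  have "\<bar>n' / 2 * T5\<bar> = n' / 2 * \<bar>T5\<bar>" using n' by (simp add: abs_mult)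
  also have "\<dots> \<le> n' * \<bar>T5\<bar>" using n' by (intro mult_right_mono) auto
  also have "\<dots> \<le> n' * (u\<^sup>2 * (((2 * D + c) * \<epsilon>) * (2 * norm k + (2 * D + c) * \<epsilon>)))"
    using T5 n' by (intro mult_left_mono)
  finally have B5: "\<bar>n' / 2 * T5\<bar> \<le> n' * u\<^sup>2 * (((2 * D + c) * \<epsilon>) * (2 * norm k + (2 * D + c) * \<epsilon>))"
    by (simp add: mult.assoc)
  have eq: "(- n' / 2 * ((norm d)\<^sup>2 + (norm b)\<^sup>2)) - (- n' / 2 * ((norm g)\<^sup>2 + (norm (A g))\<^sup>2))
      + (n' * u\<^sup>2 / 2) * ((norm \<gamma>0)\<^sup>2 + (norm (k - A \<gamma>0))\<^sup>2)
    = n' * u * T1 - n' * u * T2 - n' * T3 + n' * u\<^sup>2 / 2 * T4 - n' / 2 * T5"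
    unfolding b_def g_def T1_def T2_def T3_def T4_def T5_def
    using quadratic_expansion[OF foc, of n' d u A' R \<gamma>] by simp
  show ?thesis
    unfolding n'_def[symmetric] s_def[symmetric] eq
    using B1 B2 B3 B4 B5 by (simp only: distrib_left) linarith
qed

section \<open>Bayes' formula and change of variables\<close>

text \<open>Allows the likelihood to be replaced by its ratio to the likelihood at the truth: the
  factor depends on the data alone and cancels in Bayes' formula.\<close>

lemma bayes_cong_scale:
  assumes [measurable]: "l \<in> borel_measurable M" "R \<in> borel_measurable M"
    and eq: "AE w in M. l w = c * R w" and c: "0 < c" and R: "\<And>w. 0 \<le> R w"
  shows "bayes M l = bayes M R"
proof -
  have int: "(\<integral>\<^sup>+v. ennreal (l v) \<partial>M) = ennreal c * (\<integral>\<^sup>+v. ennreal (R v) \<partial>M)"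
  proof -
    have "(\<integral>\<^sup>+v. ennreal (l v) \<partial>M) = (\<integral>\<^sup>+v. ennreal c * ennreal (R v) \<partial>M)"
      using eq c R by (intro nn_integral_cong_AE) (auto simp: ennreal_mult)
    then show ?thesis by (simp add: nn_integral_cmult)
  qed
  have cancel: "ennreal c * a / (ennreal c * b) = a / b" for a b :: ennreal
  proof -
    have "ennreal c * a / (ennreal c * b) = (a * ennreal c) / (b * ennreal c)" by (simp add: mult.commute)
    also have "\<dots> = a / b" using c by (intro divide_mult_eq) auto
    finally show ?thesis .
  qed
  show ?thesis
    unfolding bayes_def
  proof (rule density_cong)
    show "AE w in M. ennreal (l w) / (\<integral>\<^sup>+v. ennreal (l v) \<partial>M) = ennreal (R w) / (\<integral>\<^sup>+v. ennreal (R v) \<partial>M)"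
      using eq
    proof eventually_elim
      case (elim w)
      then have "ennreal (l w) = ennreal c * ennreal (R w)" using c R by (simp add: ennreal_mult)
      then show ?case unfolding int by (simp add: cancel)
    qed
  qed measurable
qed

lemma emeasure_bayes:
  assumes [measurable]: "R \<in> borel_measurable M" "A \<in> sets M"
  shows "emeasure (bayes M R) A
    = (\<integral>\<^sup>+w. ennreal (R w) * indicator A w \<partial>M) / (\<integral>\<^sup>+v. ennreal (R v) \<partial>M)"
proof -
  have "emeasure (bayes M R) A
      = (\<integral>\<^sup>+w. (ennreal (R w) * indicator A w) / (\<integral>\<^sup>+v. ennreal (R v) \<partial>M) \<partial>M)"
    unfolding bayes_def by (simp add: emeasure_density ennreal_times_divide divide_ennreal_def mult_ac)
  then show ?thesis by (simp add: nn_integral_divide)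
qed

text \<open>In \<open>ennreal\<close>, division by infinity gives 0, and a vanishing normaliser
  forces a vanishing numerator. Positive posterior mass of a single set therefore certifies a proper
  normalising constant.\<close>

lemma bayes_mass_finite:
  assumes [measurable]: "R \<in> borel_measurable M" "A \<in> sets M" and R: "\<And>w. 0 < R w"
    and pos: "0 < measure (bayes M R) A"
  shows "0 < (\<integral>\<^sup>+v. ennreal (R v) \<partial>M)" "(\<integral>\<^sup>+v. ennreal (R v) \<partial>M) < \<infinity>"
proof -
  let ?I = "\<integral>\<^sup>+v. ennreal (R v) \<partial>M"
  have "emeasure (bayes M R) A \<noteq> 0" using pos by (auto simp: measure_def)
  then have ne: "(\<integral>\<^sup>+w. ennreal (R w) * indicator A w \<partial>M) / ?I \<noteq> 0"
    by (simp add: emeasure_bayes)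
  then show "?I < \<infinity>" by (auto simp: less_top[symmetric])
  have "(\<integral>\<^sup>+w. ennreal (R w) * indicator A w \<partial>M) \<noteq> 0" using ne by auto
  moreover have "(\<integral>\<^sup>+w. ennreal (R w) * indicator A w \<partial>M) \<le> ?I"
    by (intro nn_integral_mono) (auto simp: indicator_def)
  ultimately show "0 < ?I" by (auto simp: zero_less_iff_neq_zero)
qed

lemma bayes_mass_ge:
  assumes [measurable]: "R \<in> borel_measurable M" "A \<in> sets M" and R: "\<And>w. 0 < R w"
    and c: "0 < c" and ge: "c \<le> measure (bayes M R) A"
  shows "ennreal c * (\<integral>\<^sup>+v. ennreal (R v) \<partial>M) \<le> (\<integral>\<^sup>+w. ennreal (R w) * indicator A w \<partial>M)"
proof -
  let ?I = "\<integral>\<^sup>+v. ennreal (R v) \<partial>M" and ?A = "\<integral>\<^sup>+w. ennreal (R w) * indicator A w \<partial>M"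
  have I: "0 < ?I" "?I < \<infinity>"
    using bayes_mass_finite[of R M A] assms by auto
  have "ennreal c \<le> ennreal (measure (bayes M R) A)" using ge by (rule ennreal_leI)
  also have "\<dots> \<le> emeasure (bayes M R) A"
    by (cases "emeasure (bayes M R) A") (auto simp: measure_def)
  also have "\<dots> = ?A / ?I" by (simp add: emeasure_bayes)
  finally have "ennreal c * ?I \<le> ?A / ?I * ?I" by (intro mult_right_mono) auto
  also have "?A / ?I * ?I = ?A"
    using I by (simp add: ennreal_divide_times less_top[symmetric] zero_less_iff_neq_zero)
  finally show ?thesis .
qed

lemma prob_space_bayes:
  assumes [measurable]: "R \<in> borel_measurable M"
    and "0 < (\<integral>\<^sup>+v. ennreal (R v) \<partial>M)" "(\<integral>\<^sup>+v. ennreal (R v) \<partial>M) < \<infinity>"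
  shows "prob_space (bayes M R)"
proof
  have "emeasure (bayes M R) (space M) = 1"
    using assms by (simp add: emeasure_bayes ennreal_divide_self less_top[symmetric] zero_less_iff_neq_zero
        cong: nn_integral_cong_simp)
  then show "emeasure (bayes M R) (space (bayes M R)) = 1" by (simp add: bayes_def)
qed

lemma nn_integral_shifted_law:
  fixes \<pi>f :: "'h::{real_normed_vector, second_countable_topology} measure"
  assumes [measurable_cong]: "sets \<pi>f = sets borel" and [measurable]: "h \<in> borel_measurable borel"
  shows "(\<integral>\<^sup>+x. h x \<partial>shifted_law \<pi>f a) = (\<integral>\<^sup>+x. h (x + a) \<partial>\<pi>f)"
  unfolding shifted_law_def by (rule nn_integral_distr) measurable

lemma shifted_law_0:
  fixes \<pi>f :: "'h::real_normed_vector measure"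
  assumes "sets \<pi>f = sets borel"
  shows "shifted_law \<pi>f 0 = \<pi>f"
  unfolding shifted_law_def using distr_id2[OF assms[symmetric]] by simp

text \<open>The exceptional set of the prior densities is controlled under \<open>\<pi>f\<close> but not under its shifts.
  Hence the density is evaluated before the shift in the upper bound and after it in the lower bound.\<close>

lemma shift_upper_bound:
  fixes \<pi>f :: "'h::{real_normed_vector, second_countable_topology} measure" and c \<eta> :: real
  assumes s [measurable_cong]: "sets \<pi>f = sets borel" and G [measurable]: "G \<in> sets borel"
    and [measurable]: "l \<in> borel_measurable borel" "l0 \<in> borel_measurable borel"
    and L: "log_density_version (shifted_law \<pi>f 0) (shifted_law \<pi>f (- a)) L"
    and L_le: "\<And>f. f \<in> G \<Longrightarrow> L f \<le> \<eta>"
    and le: "AE f in \<pi>f. f \<in> G \<longrightarrow> l f \<le> ennreal (exp c) * l0 (f + a)"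
  shows "(\<integral>\<^sup>+f. l f * indicator G f \<partial>\<pi>f) \<le> ennreal (exp (c + \<eta>)) * (\<integral>\<^sup>+f. l0 f \<partial>\<pi>f)"
proof -
  have ssl: "sets (shifted_law \<pi>f h) = sets borel" for h by (simp add: shifted_law_def)
  have [measurable]: "L \<in> borel_measurable borel"
    using L by (simp add: log_density_version_def ssl cong: measurable_cong_sets)
  have dens: "\<pi>f = density (shifted_law \<pi>f (- a)) (\<lambda>x. ennreal (exp (L x)))"
    using L by (simp add: log_density_version_def shifted_law_0[OF s])
  have "(\<integral>\<^sup>+f. l f * indicator G f \<partial>\<pi>f) \<le> (\<integral>\<^sup>+f. ennreal (exp c) * (l0 (f + a) * indicator G f) \<partial>\<pi>f)"
    using le by (intro nn_integral_mono_AE) (auto simp: indicator_def)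
  also have "\<dots> = ennreal (exp c) * (\<integral>\<^sup>+f. l0 (f + a) * indicator G f \<partial>\<pi>f)"
    by (rule nn_integral_cmult) measurable
  also have "(\<integral>\<^sup>+f. l0 (f + a) * indicator G f \<partial>\<pi>f)
      = (\<integral>\<^sup>+f. l0 (f + a) * indicator G f \<partial>density (shifted_law \<pi>f (- a)) (\<lambda>x. ennreal (exp (L x))))"
    using dens by simp
  also have "\<dots> = (\<integral>\<^sup>+f. ennreal (exp (L f)) * (l0 (f + a) * indicator G f) \<partial>shifted_law \<pi>f (- a))"
    by (rule nn_integral_density) (simp_all cong: measurable_cong_sets add: ssl)
  also have "\<dots> \<le> (\<integral>\<^sup>+f. ennreal (exp \<eta>) * l0 (f + a) \<partial>shifted_law \<pi>f (- a))"
    using L_le by (intro nn_integral_mono) (auto simp: indicator_def intro!: mult_right_mono ennreal_leI)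
  \<comment> \<open>The shift of the measure by -a and the shift of the argument by a
    cancel.\<close>
  also have "\<dots> = (\<integral>\<^sup>+f. ennreal (exp \<eta>) * l0 f \<partial>\<pi>f)"
    by (subst nn_integral_shifted_law[OF s]) auto
  also have "\<dots> = ennreal (exp \<eta>) * (\<integral>\<^sup>+f. l0 f \<partial>\<pi>f)"
    by (rule nn_integral_cmult) measurable
  finally have "(\<integral>\<^sup>+f. l f * indicator G f \<partial>\<pi>f)
      \<le> ennreal (exp c) * (ennreal (exp \<eta>) * (\<integral>\<^sup>+f. l0 f \<partial>\<pi>f))"
    by (simp add: mult_left_mono)
  then show ?thesis by (simp add: mult.assoc[symmetric] ennreal_mult[symmetric] exp_add)
qed

lemma shift_lower_bound:
  fixes \<pi>f :: "'h::{real_normed_vector, second_countable_topology} measure" and c \<eta> :: real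
  assumes s [measurable_cong]: "sets \<pi>f = sets borel" and G [measurable]: "G \<in> sets borel"
    and B [measurable]: "B \<in> sets borel"
    and [measurable]: "l \<in> borel_measurable borel" "l0 \<in> borel_measurable borel"
    and L: "log_density_version (shifted_law \<pi>f a) (shifted_law \<pi>f 0) L"
    and L_ge: "\<And>f. f \<notin> B \<Longrightarrow> - \<eta> \<le> L f"
    and le: "AE f in \<pi>f. f \<in> G \<longrightarrow> ennreal (exp (- c)) * l0 (f + a) \<le> l f"
  shows "ennreal (exp (- c - \<eta>)) * (\<integral>\<^sup>+f. l0 f * indicator ({f. f - a \<in> G} - B) f \<partial>\<pi>f)
    \<le> (\<integral>\<^sup>+f. l f * indicator G f \<partial>\<pi>f)"
proof -
  have ssl: "sets (shifted_law \<pi>f h) = sets borel" for h by (simp add: shifted_law_def)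
  have [measurable]: "L \<in> borel_measurable borel"
    using L by (simp add: log_density_version_def ssl cong: measurable_cong_sets)
  have dens: "shifted_law \<pi>f a = density \<pi>f (\<lambda>x. ennreal (exp (L x)))"
    using L by (simp add: log_density_version_def shifted_law_0[OF s])
  have [measurable]: "{f. f - a \<in> G} \<in> sets borel"
  proof -
    have "(\<lambda>f. f - a) -` G \<inter> space borel \<in> sets borel" by measurable
    then show ?thesis by (simp add: vimage_def)
  qed
  have "ennreal (exp (- c - \<eta>)) * (\<integral>\<^sup>+f. l0 f * indicator ({f. f - a \<in> G} - B) f \<partial>\<pi>f)
      = ennreal (exp (- c)) * (\<integral>\<^sup>+f. ennreal (exp (- \<eta>)) * (l0 f * indicator ({f. f - a \<in> G} - B) f) \<partial>\<pi>f)"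
    by (subst nn_integral_cmult) (auto simp: mult.assoc[symmetric] ennreal_mult[symmetric] exp_add[symmetric])
  also have "\<dots> \<le> ennreal (exp (- c)) * (\<integral>\<^sup>+f. ennreal (exp (L f)) * (l0 f * indicator {f. f - a \<in> G} f) \<partial>\<pi>f)"
    using L_ge by (intro mult_left_mono nn_integral_mono)
      (auto simp: indicator_def intro!: mult_right_mono ennreal_leI)
  also have "(\<integral>\<^sup>+f. ennreal (exp (L f)) * (l0 f * indicator {f. f - a \<in> G} f) \<partial>\<pi>f)
      = (\<integral>\<^sup>+f. l0 f * indicator {f. f - a \<in> G} f \<partial>shifted_law \<pi>f a)"
    unfolding dens by (rule nn_integral_density[symmetric]) measurable
  also have "\<dots> = (\<integral>\<^sup>+f. l0 (f + a) * indicator G f \<partial>\<pi>f)"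
    by (subst nn_integral_shifted_law[OF s]) (auto simp: indicator_def)
  also have "ennreal (exp (- c)) * (\<integral>\<^sup>+f. l0 (f + a) * indicator G f \<partial>\<pi>f)
      = (\<integral>\<^sup>+f. ennreal (exp (- c)) * (l0 (f + a) * indicator G f) \<partial>\<pi>f)"
    by (rule nn_integral_cmult[symmetric]) measurable
  also have "\<dots> \<le> (\<integral>\<^sup>+f. l f * indicator G f \<partial>\<pi>f)"
    using le by (intro nn_integral_mono_AE) (auto simp: indicator_def)
  finally show ?thesis .
qed

section \<open>Comparison with the normal law\<close>

text \<open>A lower bound valid for all events applies to complements, and since both measures have
  mass one it is then also an upper bound. Cutting down to A and the factor 1 - \<delta> cost
  \<delta> each; the factor 2 in \<open>tv_dist\<close> doubles the result.\<close>

lemma tv_dist_le_one_sided: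
  fixes Q N :: "'a measure"
  assumes "prob_space Q" "prob_space N" and sets: "sets Q = sets N" and A: "A \<in> sets N" and \<delta>: "0 \<le> \<delta>"
    and NA: "1 - \<delta> \<le> measure N A"
    and ge: "\<And>F. F \<in> sets N \<Longrightarrow> (1 - \<delta>) * measure N (F \<inter> A) \<le> measure Q F"
  shows "tv_dist Q N \<le> 4 * \<delta>" "0 \<le> tv_dist Q N"
proof -
  interpret Q: prob_space Q by fact
  interpret N: prob_space N by fact
  have sp: "space Q = space N" using sets by (rule sets_eq_imp_space_eq)
  have one: "measure N F - 2 * \<delta> \<le> measure Q F" if F: "F \<in> sets N" for F
  proof -
    have "measure N F \<le> measure N (F \<inter> A) + measure N (space N - A)"
    proof -
      have "measure N F \<le> measure N ((F \<inter> A) \<union> (space N - A))"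
        using F A sets.sets_into_space[OF F] by (intro N.finite_measure_mono) auto
      also have "\<dots> \<le> measure N (F \<inter> A) + measure N (space N - A)"
        using F A by (intro measure_Un_le) auto
      finally show ?thesis .
    qed
    also have "measure N (space N - A) \<le> \<delta>" using NA N.prob_compl[OF A] by simp
    finally have "measure N F - \<delta> \<le> measure N (F \<inter> A)" by simp
    moreover have "measure N (F \<inter> A) - \<delta> \<le> (1 - \<delta>) * measure N (F \<inter> A)"
      using mult_left_mono[OF N.prob_le_1[of "F \<inter> A"] \<delta>] by (simp add: algebra_simps)
    ultimately show ?thesis using ge[OF F] by linarith
  qed
  have two: "\<bar>measure Q F - measure N F\<bar> \<le> 2 * \<delta>" if F: "F \<in> sets Q" for F
  proof -
    have FN: "F \<in> sets N" using F sets by simp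
    have "measure Q (space Q - F) = 1 - measure Q F" using F by (rule Q.prob_compl)
    moreover have "measure N (space N - F) = 1 - measure N F" using FN by (rule N.prob_compl)
    ultimately show ?thesis using one[OF FN] one[of "space N - F"] FN sp by (auto simp: abs_le_iff)
  qed
  show "tv_dist Q N \<le> 4 * \<delta>"
    unfolding tv_dist_def using two cSUP_least[of "sets Q" "\<lambda>F. \<bar>measure Q F - measure N F\<bar>" "2 * \<delta>"] by force
  have "\<bar>measure Q {} - measure N {}\<bar> \<le> (SUP F\<in>sets Q. \<bar>measure Q F - measure N F\<bar>)"
    using two by (intro cSUP_upper bdd_aboveI2[of _ _ "2 * \<delta>"]) auto
  then show "0 \<le> tv_dist Q N" by (simp add: tv_dist_def)
qed

text \<open>The integral over \<theta> of exp (sqrt n u V - n u^2 I / 2) with u = \<theta> -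
  \<theta>0, read off after completing the square.\<close>

definition gauss_const :: "nat \<Rightarrow> real \<Rightarrow> real \<Rightarrow> real" where
  "gauss_const n V I = sqrt (2 * pi / (real n * I)) * exp (V\<^sup>2 / (2 * I))"

lemma gauss_const_pos: "0 < n \<Longrightarrow> 0 < I \<Longrightarrow> 0 < gauss_const n V I"
  by (simp add: gauss_const_def)

lemma exp_quadratic_eq_normal_density:
  fixes V I \<theta>0 \<theta> :: real
  assumes n: "0 < n" and I: "0 < I"
  shows "exp (sqrt (real n) * (\<theta> - \<theta>0) * V - real n * (\<theta> - \<theta>0)\<^sup>2 * I / 2)
    = gauss_const n V I * normal_density (\<theta>0 + V / I / sqrt (real n)) (sqrt (inverse I / real n)) \<theta>"
proof -
  define s where "s = sqrt (real n)"
  define x where "x = \<theta> - \<theta>0"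
  have s: "0 < s" "s\<^sup>2 = real n" using n by (auto simp: s_def)
  have sd: "(sqrt (inverse I / real n))\<^sup>2 = 1 / (s\<^sup>2 * I)" using I n by (simp add: s field_simps)
  have "s * x * V - s\<^sup>2 * x\<^sup>2 * I / 2 = V\<^sup>2 / (2 * I) + - ((x - V / I / s)\<^sup>2 / (2 * (1 / (s\<^sup>2 * I))))"
    using s(1) I by (simp add: power2_eq_square field_simps)
  then have "exp (s * x * V - s\<^sup>2 * x\<^sup>2 * I / 2) = exp (V\<^sup>2 / (2 * I)) * exp (- ((x - V / I / s)\<^sup>2 / (2 * (1 / (s\<^sup>2 * I)))))"
    by (simp flip: exp_add)
  also have "\<dots> = (sqrt (2 * pi / (s\<^sup>2 * I)) * (1 / sqrt (2 * pi * (1 / (s\<^sup>2 * I)))))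
      * (exp (V\<^sup>2 / (2 * I)) * exp (- ((x - V / I / s)\<^sup>2 / (2 * (1 / (s\<^sup>2 * I))))))"
    using s I n by (simp add: real_sqrt_mult real_sqrt_divide)
  also have "\<dots> = gauss_const n V I * normal_density (\<theta>0 + V / I / s) (sqrt (inverse I / real n)) \<theta>"
    unfolding normal_density_def gauss_const_def sd unfolding s(2)[symmetric]
    by (simp add: x_def diff_diff_eq mult_ac)
  finally show ?thesis unfolding s(2) unfolding x_def s_def .
qed

lemma nn_integral_exp_quadratic:
  fixes V I \<theta>0 :: real
  assumes n: "0 < n" and I: "0 < I" and [measurable]: "F \<in> sets borel"
  shows "(\<integral>\<^sup>+\<theta>. ennreal (exp (sqrt (real n) * (\<theta> - \<theta>0) * V - real n * (\<theta> - \<theta>0)\<^sup>2 * I / 2)) * indicator F \<theta> \<partial>lborel)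
    = ennreal (gauss_const n V I) * emeasure (normal_law (\<theta>0 + V / I / sqrt (real n)) (inverse I / real n)) F"
proof -
  have "(\<integral>\<^sup>+\<theta>. ennreal (exp (sqrt (real n) * (\<theta> - \<theta>0) * V - real n * (\<theta> - \<theta>0)\<^sup>2 * I / 2)) * indicator F \<theta> \<partial>lborel)
    = (\<integral>\<^sup>+\<theta>. ennreal (gauss_const n V I) * (ennreal (normal_density (\<theta>0 + V / I / sqrt (real n)) (sqrt (inverse I / real n)) \<theta>) * indicator F \<theta>) \<partial>lborel)"
    unfolding exp_quadratic_eq_normal_density[OF n I]
    using gauss_const_pos[OF n I, of V] by (simp add: ennreal_mult mult.assoc)
  also have "\<dots> = ennreal (gauss_const n V I) * emeasure (normal_law (\<theta>0 + V / I / sqrt (real n)) (inverse I / real n)) F"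
    unfolding normal_law_def by (subst nn_integral_cmult) (auto simp: emeasure_density)
  finally show ?thesis .
qed

lemma nn_integral_exp_quadratic_UNIV:
  fixes V I \<theta>0 :: real
  assumes n: "0 < n" and I: "0 < I"
  shows "(\<integral>\<^sup>+\<theta>. ennreal (exp (sqrt (real n) * (\<theta> - \<theta>0) * V - real n * (\<theta> - \<theta>0)\<^sup>2 * I / 2)) \<partial>lborel)
    = ennreal (gauss_const n V I)"
proof -
  interpret prob_space "normal_law (\<theta>0 + V / I / sqrt (real n)) (inverse I / real n)"
    using n I by (intro prob_space_normal_law) simp
  show ?thesis
    using nn_integral_exp_quadratic[OF n I, of UNIV \<theta>0 V] emeasure_space_1 by simp
qed

text \<open>Bounds the growth of \<open>gauss_const\<close> when I is lowered to I - 2 r, uniformly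
  over |V| \<le> v. It tends to one with r, so absorbing an error r n u^2 into the information is
  asymptotically free.\<close>

definition gauss_ratio :: "real \<Rightarrow> real \<Rightarrow> real \<Rightarrow> real" where
  "gauss_ratio I v r = sqrt (I / (I - 2 * r)) * exp (v\<^sup>2 * (1 / (2 * (I - 2 * r)) - 1 / (2 * I)))"

lemma gauss_const_le_ratio:
  assumes n: "0 < n" and r: "0 \<le> r" "2 * r < I" and V: "\<bar>V\<bar> \<le> v"
  shows "gauss_const n V (I - 2 * r) \<le> gauss_ratio I v r * gauss_const n V I"
proof -
  have I: "0 < I" "0 < I - 2 * r" using r by auto
  have d: "0 \<le> 1 / (2 * (I - 2 * r)) - 1 / (2 * I)" using I r by (simp add: frac_le)
  have "V\<^sup>2 / (2 * (I - 2 * r)) = V\<^sup>2 * (1 / (2 * (I - 2 * r)) - 1 / (2 * I)) + V\<^sup>2 / (2 * I)"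
    by (simp add: right_diff_distrib)
  also have "\<dots> \<le> v\<^sup>2 * (1 / (2 * (I - 2 * r)) - 1 / (2 * I)) + V\<^sup>2 / (2 * I)"
    using power_mono[OF V, of 2] d by (intro add_right_mono mult_right_mono) auto
  finally have "exp (V\<^sup>2 / (2 * (I - 2 * r))) \<le> exp (v\<^sup>2 * (1 / (2 * (I - 2 * r)) - 1 / (2 * I))) * exp (V\<^sup>2 / (2 * I))"
    by (simp flip: exp_add)
  moreover have "sqrt (2 * pi / (real n * (I - 2 * r))) = sqrt (I / (I - 2 * r)) * sqrt (2 * pi / (real n * I))"
    using I n by (simp add: real_sqrt_mult[symmetric] field_simps)
  ultimately show ?thesis
    unfolding gauss_const_def gauss_ratio_def using I n
    by (simp add: mult.assoc mult_left_mono mult.left_commute[of "exp _"])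
qed

lemma gauss_ratio_tendsto:
  assumes "0 < I"
  shows "((\<lambda>r. exp r * gauss_ratio I v r) \<longlongrightarrow> 1) (at_right 0)"
proof -
  have "((\<lambda>r. exp r * gauss_ratio I v r) \<longlongrightarrow> exp 0 * (sqrt (I / (I - 2 * 0)) * exp (v\<^sup>2 * (1 / (2 * (I - 2 * 0)) - 1 / (2 * I))))) (at_right 0)"
    unfolding gauss_ratio_def using assms by (intro tendsto_intros) auto
  then show ?thesis using assms by simp
qed

text \<open>Chernoff's method with a quadratic exponent: on the tail exp (r n u^2 - r M^2) is at
  least one, and inserting it lowers I to I - 2 r in the Gaussian integral.\<close>

lemma normal_tail_bound:
  assumes n: "0 < n" and r: "0 \<le> r" "2 * r < I" and V: "\<bar>V\<bar> \<le> v" and M: "0 \<le> M"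
  shows "measure (normal_law (\<theta>0 + V / I / sqrt (real n)) (inverse I / real n)) {\<theta>. M < sqrt (real n) * \<bar>\<theta> - \<theta>0\<bar>}
    \<le> exp (- (r * M\<^sup>2)) * gauss_ratio I v r"
proof -
  have I: "0 < I" "0 < I - 2 * r" using r by auto
  let ?N = "normal_law (\<theta>0 + V / I / sqrt (real n)) (inverse I / real n)"
  let ?F = "{\<theta>. M < sqrt (real n) * \<bar>\<theta> - \<theta>0\<bar>}"
  interpret N: prob_space ?N using n I by (intro prob_space_normal_law) simp
  have F [measurable]: "?F \<in> sets borel" by measurable
  have "ennreal (gauss_const n V I) * emeasure ?N ?F
    = (\<integral>\<^sup>+\<theta>. ennreal (exp (sqrt (real n) * (\<theta> - \<theta>0) * V - real n * (\<theta> - \<theta>0)\<^sup>2 * I / 2)) * indicator ?F \<theta> \<partial>lborel)"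
    using nn_integral_exp_quadratic[OF n I(1) F] by simp
  also have "\<dots> \<le> (\<integral>\<^sup>+\<theta>. ennreal (exp (- (r * M\<^sup>2))) * ennreal (exp (sqrt (real n) * (\<theta> - \<theta>0) * V - real n * (\<theta> - \<theta>0)\<^sup>2 * (I - 2 * r) / 2)) \<partial>lborel)"
  proof (intro nn_integral_mono)
    fix \<theta>
    show "ennreal (exp (sqrt (real n) * (\<theta> - \<theta>0) * V - real n * (\<theta> - \<theta>0)\<^sup>2 * I / 2)) * indicator ?F \<theta>
      \<le> ennreal (exp (- (r * M\<^sup>2))) * ennreal (exp (sqrt (real n) * (\<theta> - \<theta>0) * V - real n * (\<theta> - \<theta>0)\<^sup>2 * (I - 2 * r) / 2))"
    proof (cases "\<theta> \<in> ?F")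
      case True
      then have "M\<^sup>2 \<le> (sqrt (real n) * \<bar>\<theta> - \<theta>0\<bar>)\<^sup>2" using M by (intro power_mono) auto
      then have "r * M\<^sup>2 \<le> r * (real n * (\<theta> - \<theta>0)\<^sup>2)" using r by (intro mult_left_mono) (auto simp: power_mult_distrib)
      then have "sqrt (real n) * (\<theta> - \<theta>0) * V - real n * (\<theta> - \<theta>0)\<^sup>2 * I / 2
        \<le> - (r * M\<^sup>2) + (sqrt (real n) * (\<theta> - \<theta>0) * V - real n * (\<theta> - \<theta>0)\<^sup>2 * (I - 2 * r) / 2)"
        by (simp add: field_simps)
      then show ?thesis using True by (simp add: ennreal_mult[symmetric] exp_add[symmetric])
    qed simp
  qed
  also have "\<dots> = ennreal (exp (- (r * M\<^sup>2))) * ennreal (gauss_const n V (I - 2 * r))"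
    by (subst nn_integral_cmult) (auto simp: nn_integral_exp_quadratic_UNIV[OF n I(2)])
  also have "\<dots> = ennreal (exp (- (r * M\<^sup>2)) * gauss_const n V (I - 2 * r))"
    using gauss_const_pos[OF n I(2), of V] by (simp add: ennreal_mult)
  finally have "gauss_const n V I * measure ?N ?F \<le> exp (- (r * M\<^sup>2)) * gauss_const n V (I - 2 * r)"
    unfolding N.emeasure_eq_measure
    using gauss_const_pos[OF n I(1), of V] gauss_const_pos[OF n I(2), of V]
    by (simp add: ennreal_mult[symmetric])
  also have "\<dots> \<le> exp (- (r * M\<^sup>2)) * (gauss_ratio I v r * gauss_const n V I)"
    by (intro mult_left_mono gauss_const_le_ratio n r V) auto
  finally show ?thesis using gauss_const_pos[OF n I(1), of V] by (simp add: mult.assoc[symmetric] mult.commute[of "gauss_const n V I"])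
qed

text \<open>The normal density never exceeds \<open>sqrt (real n * I)\<close>. This disposes of the
  part of the window missed by the localising sets, whose Lebesgue measure is of smaller order than
  1 / sqrt n.\<close>

lemma normal_law_measure_le:
  assumes n: "0 < n" and I: "0 < I" and F [measurable]: "F \<in> sets borel" and c: "0 \<le> c"
    and F_le: "emeasure lborel F \<le> ennreal (c / sqrt (real n))"
  shows "measure (normal_law \<mu> (inverse I / real n)) F \<le> sqrt I * c"
proof -
  let ?N = "normal_law \<mu> (inverse I / real n)"
  interpret N: prob_space ?N using n I by (intro prob_space_normal_law) simp
  have dens: "normal_density \<mu> (sqrt (inverse I / real n)) x \<le> sqrt (real n * I)" for x
  proof -
    have "normal_density \<mu> (sqrt (inverse I / real n)) x \<le> 1 / sqrt (2 * pi * (inverse I / real n)) * 1"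
      unfolding normal_density_def using n I by (intro mult_mono) auto
    also have "\<dots> \<le> 1 / sqrt (inverse I / real n)"
    proof -
      have "1 \<le> 2 * pi" using pi_gt3 by linarith
      then have "inverse I / real n \<le> 2 * pi * (inverse I / real n)"
        using mult_right_mono[of 1 "2 * pi" "inverse I / real n"] n I by simp
      then show ?thesis using n I by (simp add: frac_le)
    qed
    also have "\<dots> = sqrt (real n * I)" using n I by (simp add: real_sqrt_divide real_sqrt_inverse real_sqrt_mult field_simps)
    finally show ?thesis .
  qed
  have "emeasure ?N F = (\<integral>\<^sup>+x. ennreal (normal_density \<mu> (sqrt (inverse I / real n)) x) * indicator F x \<partial>lborel)"
    unfolding normal_law_def by (rule emeasure_density) auto
  also have "\<dots> \<le> (\<integral>\<^sup>+x. ennreal (sqrt (real n * I)) * indicator F x \<partial>lborel)"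
    using dens by (intro nn_integral_mono mult_right_mono ennreal_leI) auto
  also have "\<dots> = ennreal (sqrt (real n * I)) * emeasure lborel F" by (simp add: nn_integral_cmult)
  also have "\<dots> \<le> ennreal (sqrt (real n * I)) * ennreal (c / sqrt (real n))" by (intro mult_left_mono F_le) auto
  also have "\<dots> = ennreal (sqrt I * c)" using n I c by (simp add: ennreal_mult[symmetric] real_sqrt_mult)
  finally show ?thesis using I c by (simp add: N.emeasure_eq_measure)
qed

text \<open>The lower bound for the unnormalised posterior density on \<open>A\<close> and the upper bound for the
  normalising constant \<open>Z\<close> together give a one-sided comparison with the normal law, which
  suffices for total variation.\<close>

lemma normal_comparison:
  fixes Q :: "real measure" and Z Z0 p0 \<delta> r M I V v \<theta>0 :: real
  assumes n: "0 < n" and pos: "0 < Z" "0 < Z0" "0 < p0" and \<delta>: "0 < \<delta>" "\<delta> \<le> 1 / 10"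
    and r: "0 \<le> r" "2 * r < I" and V: "\<bar>V\<bar> \<le> v"
    and rM: "r * (1 + M\<^sup>2) \<le> \<delta>" and ratio: "exp r * gauss_ratio I v r \<le> 1 + \<delta>"
    and Q: "prob_space Q" and F [measurable]: "F \<in> sets borel" and A [measurable]: "A \<in> sets borel"
    and upper: "ennreal ((1 - 3 * \<delta>) * Z) \<le> (\<integral>\<^sup>+\<theta>. ennreal (p0 * (1 + \<delta>) * Z0
        * exp (sqrt (real n) * (\<theta> - \<theta>0) * V - real n * (\<theta> - \<theta>0)\<^sup>2 * I / 2 + r * (1 + real n * (\<theta> - \<theta>0)\<^sup>2))) \<partial>lborel)"
    and lower: "(\<integral>\<^sup>+\<theta>. ennreal ((1 - 3 * \<delta>) * Z0 * (p0 * (1 - \<delta>))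
        * exp (sqrt (real n) * (\<theta> - \<theta>0) * V - real n * (\<theta> - \<theta>0)\<^sup>2 * I / 2 - r * (1 + M\<^sup>2))) * indicator (F \<inter> A) \<theta> \<partial>lborel)
      \<le> ennreal (Z * measure Q F)"
  shows "(1 - 10 * \<delta>) * measure (normal_law (\<theta>0 + V / I / sqrt (real n)) (inverse I / real n)) (F \<inter> A) \<le> measure Q F"
proof -
  have I: "0 < I" "0 < I - 2 * r" using r by auto
  let ?N = "normal_law (\<theta>0 + V / I / sqrt (real n)) (inverse I / real n)"
  interpret N: prob_space ?N using n I by (intro prob_space_normal_law) simp
  let ?c = "gauss_const n V I"
  let ?q = "\<lambda>\<theta>. sqrt (real n) * (\<theta> - \<theta>0) * V - real n * (\<theta> - \<theta>0)\<^sup>2 * I / 2"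
  have c: "0 < ?c" by (rule gauss_const_pos[OF n I(1)])
  have c': "0 < gauss_const n V (I - 2 * r)" by (rule gauss_const_pos[OF n I(2)])
  have "(\<integral>\<^sup>+\<theta>. ennreal (p0 * (1 + \<delta>) * Z0 * exp (?q \<theta> + r * (1 + real n * (\<theta> - \<theta>0)\<^sup>2))) \<partial>lborel)
    = (\<integral>\<^sup>+\<theta>. ennreal (p0 * (1 + \<delta>) * Z0 * exp r)
        * ennreal (exp (sqrt (real n) * (\<theta> - \<theta>0) * V - real n * (\<theta> - \<theta>0)\<^sup>2 * (I - 2 * r) / 2)) \<partial>lborel)"
  proof (intro nn_integral_cong)
    fix \<theta>
    \<comment> \<open>The error r n u^2 joins the quadratic term and turns I into I - 2 r; its
      constant part leaves the factor exp r.\<close>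
    have eq: "?q \<theta> + r * (1 + real n * (\<theta> - \<theta>0)\<^sup>2)
      = r + (sqrt (real n) * (\<theta> - \<theta>0) * V - real n * (\<theta> - \<theta>0)\<^sup>2 * (I - 2 * r) / 2)"
      by (simp add: field_simps)
    show "ennreal (p0 * (1 + \<delta>) * Z0 * exp (?q \<theta> + r * (1 + real n * (\<theta> - \<theta>0)\<^sup>2)))
      = ennreal (p0 * (1 + \<delta>) * Z0 * exp r)
        * ennreal (exp (sqrt (real n) * (\<theta> - \<theta>0) * V - real n * (\<theta> - \<theta>0)\<^sup>2 * (I - 2 * r) / 2))"
      unfolding eq exp_add using pos \<delta> by (simp add: ennreal_mult[symmetric] mult.assoc)
  qed
  also have "\<dots> = ennreal (p0 * (1 + \<delta>) * Z0 * exp r) * ennreal (gauss_const n V (I - 2 * r))"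
    by (subst nn_integral_cmult) (auto simp: nn_integral_exp_quadratic_UNIV[OF n I(2)])
  also have "\<dots> = ennreal (p0 * (1 + \<delta>) * Z0 * exp r * gauss_const n V (I - 2 * r))"
    using pos \<delta> c' by (simp add: ennreal_mult)
  finally have "ennreal ((1 - 3 * \<delta>) * Z) \<le> ennreal (p0 * (1 + \<delta>) * Z0 * exp r * gauss_const n V (I - 2 * r))"
    using upper by simp
  then have "(1 - 3 * \<delta>) * Z \<le> p0 * (1 + \<delta>) * Z0 * exp r * gauss_const n V (I - 2 * r)"
    using pos \<delta> c' by (subst (asm) ennreal_le_iff) auto
  also have "\<dots> \<le> p0 * (1 + \<delta>) * Z0 * exp r * (gauss_ratio I v r * ?c)"
    using pos \<delta> by (intro mult_left_mono gauss_const_le_ratio n r V) auto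
  also have "\<dots> = p0 * (1 + \<delta>) * Z0 * ?c * (exp r * gauss_ratio I v r)" by simp
  also have "\<dots> \<le> p0 * (1 + \<delta>) * Z0 * ?c * (1 + \<delta>)"
    using pos \<delta> c by (intro mult_left_mono ratio) auto
  finally have up: "(1 - 3 * \<delta>) * Z \<le> (1 + \<delta>)\<^sup>2 * (p0 * Z0 * ?c)"
    by (simp add: power2_eq_square mult_ac)
  let ?k = "(1 - 3 * \<delta>) * Z0 * (p0 * (1 - \<delta>)) * exp (- (r * (1 + M\<^sup>2)))"
  have k0: "0 \<le> ?k" using pos \<delta> by simp
  have "(\<integral>\<^sup>+\<theta>. ennreal ((1 - 3 * \<delta>) * Z0 * (p0 * (1 - \<delta>)) * exp (?q \<theta> - r * (1 + M\<^sup>2))) * indicator (F \<inter> A) \<theta> \<partial>lborel)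
    = (\<integral>\<^sup>+\<theta>. ennreal ?k * (ennreal (exp (?q \<theta>)) * indicator (F \<inter> A) \<theta>) \<partial>lborel)"
  proof (intro nn_integral_cong)
    fix \<theta>
    have eq: "(1 - 3 * \<delta>) * Z0 * (p0 * (1 - \<delta>)) * exp (?q \<theta> - r * (1 + M\<^sup>2)) = ?k * exp (?q \<theta>)"
      by (simp add: mult.assoc exp_add[symmetric])
    show "ennreal ((1 - 3 * \<delta>) * Z0 * (p0 * (1 - \<delta>)) * exp (?q \<theta> - r * (1 + M\<^sup>2))) * indicator (F \<inter> A) \<theta>
      = ennreal ?k * (ennreal (exp (?q \<theta>)) * indicator (F \<inter> A) \<theta>)"
      unfolding eq by (subst ennreal_mult[OF k0]) (simp_all only: mult.assoc exp_ge_zero)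
  qed
  also have "\<dots> = ennreal ?k * (ennreal ?c * emeasure ?N (F \<inter> A))"
    by (subst nn_integral_cmult) (auto simp: nn_integral_exp_quadratic[OF n I(1)])
  also have "\<dots> = ennreal (?k * (?c * measure ?N (F \<inter> A)))"
    unfolding N.emeasure_eq_measure using k0 c by (simp add: ennreal_mult)
  finally have "ennreal (?k * (?c * measure ?N (F \<inter> A))) \<le> ennreal (Z * measure Q F)"
    using lower by simp
  then have low1: "?k * (?c * measure ?N (F \<inter> A)) \<le> Z * measure Q F"
    using pos by (subst (asm) ennreal_le_iff) auto
  let ?m = "measure ?N (F \<inter> A)"
  have "1 - \<delta> \<le> exp (- (r * (1 + M\<^sup>2)))"
    using exp_ge_add_one_self[of "- (r * (1 + M\<^sup>2))"] rM by linarith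
  then have "(1 - 3 * \<delta>) * Z0 * (p0 * (1 - \<delta>)) * (1 - \<delta>) \<le> ?k"
    using pos \<delta> by (intro mult_left_mono) auto
  then have "((1 - 3 * \<delta>) * Z0 * (p0 * (1 - \<delta>)) * (1 - \<delta>)) * (?c * ?m) \<le> ?k * (?c * ?m)"
    using c by (intro mult_right_mono) auto
  with low1 have low: "((1 - 3 * \<delta>) * (1 - \<delta>)\<^sup>2 * ?m) * (p0 * Z0 * ?c) \<le> Z * measure Q F"
    by (simp add: power2_eq_square mult_ac)
  have "((1 - 3 * \<delta>) * (1 - \<delta>)\<^sup>2 * ?m) * ((1 - 3 * \<delta>) * Z)
      \<le> ((1 - 3 * \<delta>) * (1 - \<delta>)\<^sup>2 * ?m) * ((1 + \<delta>)\<^sup>2 * (p0 * Z0 * ?c))"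
    using \<delta> by (intro mult_left_mono up) auto
  also have "\<dots> = (1 + \<delta>)\<^sup>2 * (((1 - 3 * \<delta>) * (1 - \<delta>)\<^sup>2 * ?m) * (p0 * Z0 * ?c))" by simp
  also have "\<dots> \<le> (1 + \<delta>)\<^sup>2 * (Z * measure Q F)" by (intro mult_left_mono low) auto
  finally have "Z * (((1 - 3 * \<delta>)\<^sup>2 * (1 - \<delta>)\<^sup>2) * ?m) \<le> Z * ((1 + \<delta>)\<^sup>2 * measure Q F)"
    by (simp add: power2_eq_square mult_ac)
  then have main: "((1 - 3 * \<delta>)\<^sup>2 * (1 - \<delta>)\<^sup>2) * ?m \<le> (1 + \<delta>)\<^sup>2 * measure Q F"
    using pos by simp
  \<comment> \<open>The first-order losses add up to 10: twice 3 from the two mass bounds, twice 1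
    from the lower density bound and exp (-x) \<ge> 1 - x, twice 1 from the upper density bound and
    \<open>ratio\<close>.\<close>
  have "(1 - 10 * \<delta>) * (1 + \<delta>)\<^sup>2 \<le> (1 - 3 * \<delta>)\<^sup>2 * (1 - \<delta>)\<^sup>2"
  proof -
    have "(1 - 3 * \<delta>)\<^sup>2 * (1 - \<delta>)\<^sup>2 = (1 - 4 * \<delta> + 3 * \<delta>\<^sup>2)\<^sup>2" by (simp add: power2_eq_square algebra_simps)
    moreover have "(1 - 4 * \<delta>)\<^sup>2 \<le> (1 - 4 * \<delta> + 3 * \<delta>\<^sup>2)\<^sup>2" using \<delta> by (intro power_mono) auto
    moreover have "(1 - 10 * \<delta>) * (1 + \<delta>)\<^sup>2 \<le> (1 - 4 * \<delta>)\<^sup>2"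
    proof -
      have "(1 - 10 * \<delta>) * (1 + \<delta>)\<^sup>2 = 1 - 8 * \<delta> - 19 * \<delta>\<^sup>2 - 10 * (\<delta> * \<delta>\<^sup>2)" by (simp add: power2_eq_square algebra_simps)
      also have "\<dots> \<le> 1 - 8 * \<delta> + 16 * \<delta>\<^sup>2" using \<delta> zero_le_power2[of \<delta>] mult_nonneg_nonneg[of \<delta> "\<delta>\<^sup>2"] by linarith
      finally show ?thesis by (simp add: power2_eq_square algebra_simps)
    qed
    ultimately show ?thesis by linarith
  qed
  then have "((1 - 10 * \<delta>) * (1 + \<delta>)\<^sup>2) * ?m \<le> ((1 - 3 * \<delta>)\<^sup>2 * (1 - \<delta>)\<^sup>2) * ?m"
    by (intro mult_right_mono) auto
  with main have "(1 + \<delta>)\<^sup>2 * ((1 - 10 * \<delta>) * ?m) \<le> (1 + \<delta>)\<^sup>2 * measure Q F"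
    by (simp add: mult_ac)
  then show ?thesis using \<delta> by (simp add: mult_le_cancel_left)
qed

section \<open>Events of probability tending to one\<close>

text \<open>Formulated with the outer measure and a non-strict bound, so that finite conjunctions
  and eventual implications hold for arbitrary, possibly non-measurable events.\<close>

definition whp :: "(nat \<Rightarrow> 'x measure) \<Rightarrow> (nat \<Rightarrow> 'x \<Rightarrow> bool) \<Rightarrow> bool" where
  "whp P A \<longleftrightarrow> (\<forall>\<tau>>0. \<forall>\<^sub>F n in sequentially.
     outer_measure_of (P n) {x \<in> space (P n). \<not> A n x} \<le> ennreal \<tau>)"

lemma outer_measure_of_Un:
  assumes A: "A \<subseteq> space M" and B: "B \<subseteq> space M"
  shows "outer_measure_of M (A \<union> B) \<le> outer_measure_of M A + outer_measure_of M B"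
proof -
  obtain E F where E: "E \<in> sets M" "A \<subseteq> E" "outer_measure_of M A = emeasure M E"
    and F: "F \<in> sets M" "B \<subseteq> F" "outer_measure_of M B = emeasure M F"
    using outer_measure_of_attain[OF A] outer_measure_of_attain[OF B] by blast
  have "outer_measure_of M (A \<union> B) \<le> outer_measure_of M (E \<union> F)"
    using E F by (intro outer_measure_of_mono) auto
  also have "\<dots> = emeasure M (E \<union> F)" using E F by simp
  also have "\<dots> \<le> emeasure M E + emeasure M F" using E F by (intro emeasure_subadditive)
  finally show ?thesis using E F by simp
qed

lemma whp_conj:
  assumes "whp P A" "whp P B"
  shows "whp P (\<lambda>n x. A n x \<and> B n x)"
  unfolding whp_def
proof (intro allI impI)
  fix \<tau> :: real assume \<tau>: "0 < \<tau>"
  have "\<forall>\<^sub>F n in sequentially. outer_measure_of (P n) {x \<in> space (P n). \<not> A n x} \<le> ennreal (\<tau> / 2)"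
    "\<forall>\<^sub>F n in sequentially. outer_measure_of (P n) {x \<in> space (P n). \<not> B n x} \<le> ennreal (\<tau> / 2)"
    using assms(1)[unfolded whp_def, rule_format, of "\<tau> / 2"] assms(2)[unfolded whp_def, rule_format, of "\<tau> / 2"] \<tau>
    by simp_all
  then show "\<forall>\<^sub>F n in sequentially. outer_measure_of (P n) {x \<in> space (P n). \<not> (A n x \<and> B n x)} \<le> ennreal \<tau>"
  proof eventually_elim
    case (elim n)
    have "{x \<in> space (P n). \<not> (A n x \<and> B n x)} = {x \<in> space (P n). \<not> A n x} \<union> {x \<in> space (P n). \<not> B n x}" by auto
    then have "outer_measure_of (P n) {x \<in> space (P n). \<not> (A n x \<and> B n x)}
      \<le> outer_measure_of (P n) {x \<in> space (P n). \<not> A n x} + outer_measure_of (P n) {x \<in> space (P n). \<not> B n x}"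
      using outer_measure_of_Un[of "{x \<in> space (P n). \<not> A n x}" "P n" "{x \<in> space (P n). \<not> B n x}"] by auto
    also have "\<dots> \<le> ennreal (\<tau> / 2) + ennreal (\<tau> / 2)" by (intro add_mono elim)
    also have "\<dots> = ennreal \<tau>" using \<tau> by (simp add: ennreal_plus[symmetric] del: ennreal_plus)
    finally show ?case .
  qed
qed

lemma whp_mono:
  assumes "whp P A" and "\<forall>\<^sub>F n in sequentially. \<forall>x\<in>space (P n). A n x \<longrightarrow> B n x"
  shows "whp P B"
  unfolding whp_def
proof (intro allI impI)
  fix \<tau> :: real assume \<tau>: "0 < \<tau>"
  have "\<forall>\<^sub>F n in sequentially. outer_measure_of (P n) {x \<in> space (P n). \<not> A n x} \<le> ennreal \<tau>"
    using assms \<tau> unfolding whp_def by blast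
  with assms(2) show "\<forall>\<^sub>F n in sequentially. outer_measure_of (P n) {x \<in> space (P n). \<not> B n x} \<le> ennreal \<tau>"
  proof eventually_elim
    case (elim n)
    have "outer_measure_of (P n) {x \<in> space (P n). \<not> B n x} \<le> outer_measure_of (P n) {x \<in> space (P n). \<not> A n x}"
      using elim(1) by (intro outer_measure_of_mono) auto
    then show ?case using elim(2) by (rule order_trans)
  qed
qed

lemma conv_in_prob_iff_whp:
  "conv_in_prob P Y c \<longleftrightarrow> (\<forall>\<delta>>0. whp P (\<lambda>n x. \<bar>Y n x - c\<bar> \<le> \<delta>))"
proof -
  have "(f \<longlonglongrightarrow> 0) \<longleftrightarrow> (\<forall>\<tau>>0. \<forall>\<^sub>F n in sequentially. f n \<le> ennreal \<tau>)" for f :: "nat \<Rightarrow> ennreal"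
  proof
    assume lim: "f \<longlonglongrightarrow> 0"
    show "\<forall>\<tau>>0. \<forall>\<^sub>F n in sequentially. f n \<le> ennreal \<tau>"
    proof (intro allI impI)
      fix \<tau> :: real assume "0 < \<tau>"
      then have "\<forall>\<^sub>F n in sequentially. f n < ennreal \<tau>" by (intro order_tendstoD(2)[OF lim]) simp
      then show "\<forall>\<^sub>F n in sequentially. f n \<le> ennreal \<tau>" by eventually_elim simp
    qed
  next
    assume *: "\<forall>\<tau>>0. \<forall>\<^sub>F n in sequentially. f n \<le> ennreal \<tau>"
    show "f \<longlonglongrightarrow> 0"
    proof (rule order_tendstoI)
      fix a :: ennreal assume "0 < a"
      then obtain y where y: "0 < y" "y < a" using dense by blast
      then obtain t where t: "y = ennreal t" by (cases y) auto
      with y * have "\<forall>\<^sub>F n in sequentially. f n \<le> y" by simp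
      then show "\<forall>\<^sub>F n in sequentially. f n < a" by eventually_elim (use y in auto)
    qed simp
  qed
  then show ?thesis unfolding conv_in_prob_def whp_def by (simp add: not_le)
qed

section \<open>The linear model\<close>

text \<open>Collects what the two alternatives of (e) share. Differentiability in \<theta>,
  posterior contraction and (e) itself appear as explicit premises of the later results.\<close>

locale linear_model = hilbert_basis e
  for e :: "nat \<Rightarrow> 'h::{real_inner, complete_space, second_countable_topology}" +
  fixes \<Theta> :: "real set" and \<theta>0 :: real and K K' :: "real \<Rightarrow> 'h \<Rightarrow>\<^sub>L 'h" and f0 :: 'h
    and p :: "real \<Rightarrow> real" and \<pi>f :: "'h measure" and S :: "'h set" and nS :: "'h \<Rightarrow> real"
    and D0 D1 D2 D3 :: real and \<epsilon> \<eta> \<rho> :: "nat \<Rightarrow> real" and \<gamma> :: "nat \<Rightarrow> 'h"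
  assumes compact: "compact \<Theta>"
    and prior_prob: "prob_space (param_prior \<Theta> p)" and p_cont: "continuous_on \<Theta> p"
    and p_bounds: "\<exists>c C. 0 < c \<and> (\<forall>\<theta>\<in>\<Theta>. c \<le> p \<theta> \<and> p \<theta> \<le> C)"
    and \<pi>f_prob: "prob_space \<pi>f" and sets_\<pi>f: "sets \<pi>f = sets borel"
    and interior: "\<theta>0 \<in> interior \<Theta>" and nonzero: "K' \<theta>0 f0 \<noteq> 0"
    and S_norm: "normed_subspace S nS" and S_stronger: "\<exists>C. \<forall>h\<in>S. norm h \<le> C * nS h"
    and entropy: "entropy_integral {h \<in> S. nS h \<le> 1} < \<infinity>"
    and K_bound: "\<forall>\<theta>\<in>\<Theta>. norm (K \<theta>) \<le> D0 \<and> norm (K' \<theta>) \<le> D0"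
    and K_diff: "\<forall>\<theta>\<in>\<Theta>. onorm_into S nS (K \<theta> - K \<theta>0) \<le> ereal (D1 * \<bar>\<theta> - \<theta>0\<bar>)"
    and K_diff2: "\<forall>\<theta>\<in>\<Theta>. onorm_into S nS (K \<theta> - K \<theta>0 - (\<theta> - \<theta>0) *\<^sub>R K' \<theta>0) \<le> ereal (D2 * (\<theta> - \<theta>0)\<^sup>2)"
    and K_lip: "\<forall>\<theta>1\<in>\<Theta>. \<forall>\<theta>2\<in>\<Theta>. \<forall>f1 f2. norm (K \<theta>1 f1 - K \<theta>2 f2)
             \<le> D3 * \<bar>\<theta>1 - \<theta>2\<bar> * min (norm f1) (norm f2) + D3 * norm (f1 - f2)"
    and \<epsilon>_pos: "\<forall>n\<ge>1. 0 < \<epsilon> n" and \<epsilon>_lim: "\<epsilon> \<longlonglongrightarrow> 0"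
    and \<epsilon>_rate: "(\<lambda>n. (1 / sqrt (real n)) / \<epsilon> n) \<longlonglongrightarrow> 0"
    and \<eta>_lim: "\<eta> \<longlonglongrightarrow> 0"
    and \<gamma>_approx: "\<exists>C. \<forall>n\<ge>1. norm (\<gamma> n - least_favorable K K' \<theta>0 f0) \<le> C * \<bar>\<rho> n\<bar>"
    and \<rho>_rate: "(\<lambda>n. real n * (\<epsilon> n)\<^sup>2 * (\<rho> n)\<^sup>2) \<longlonglongrightarrow> 0"
    and prior_mass: "\<forall>n\<ge>1. measure \<pi>f {f. norm (f - f0) \<le> \<epsilon> n / (2 * D3 + 2)} \<ge> exp (- (real n * (\<epsilon> n)\<^sup>2 / 65))"
    and prior_shift: "\<forall>n\<ge>1. \<exists>L :: real \<Rightarrow> real \<Rightarrow> 'h \<Rightarrow> real.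
           (\<forall>s\<in>{- \<epsilon> n<..<\<epsilon> n}. \<forall>t\<in>{- \<epsilon> n<..<\<epsilon> n}.
              log_density_version (shifted_law \<pi>f ((s + t) *\<^sub>R \<gamma> n)) (shifted_law \<pi>f (s *\<^sub>R \<gamma> n)) (L s t)) \<and>
           outer_measure_of \<pi>f {f. \<exists>s\<in>{- \<epsilon> n<..<\<epsilon> n}. \<exists>t\<in>{- \<epsilon> n<..<\<epsilon> n}.
              \<bar>L s t f\<bar> > \<eta> n * (1 + real n * t\<^sup>2)} \<le> ennreal (exp (- (3 * real n * (\<epsilon> n)\<^sup>2)))"
begin

abbreviation "P \<equiv> obs_law e K \<theta>0 f0"
abbreviation "\<pi>\<theta> \<equiv> param_prior \<Theta> p"
abbreviation "K0 \<equiv> K \<theta>0"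
abbreviation "K0' \<equiv> K' \<theta>0"
abbreviation "k0 \<equiv> K' \<theta>0 f0"
abbreviation "\<gamma>0 \<equiv> least_favorable K K' \<theta>0 f0"
abbreviation "I0 \<equiv> efficient_info K K' \<theta>0 f0"

definition lr :: "nat \<Rightarrow> obs \<Rightarrow> real \<Rightarrow> 'h \<Rightarrow> real" where
  "lr n z \<theta> f = exp (log_ratio e n z (f - f0) (K \<theta> f - K0 f0))"

text \<open>Inverts the map from noise to data inside \<open>obs_law\<close>; under the true law
  with n \<ge> 1 the result is distributed as \<open>white_noise\<close>.\<close>

definition noise :: "nat \<Rightarrow> obs \<Rightarrow> obs" where
  "noise n x = (\<lambda>k. sqrt (real n) * (fst x k - f0 \<bullet> e k), \<lambda>k. sqrt (real n) * (snd x k - K0 f0 \<bullet> e k))"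

text \<open>For g = \<gamma>0 and regular noise this is the efficient score, \<open>I0\<close> times
  \<open>efficient_influence\<close>. The direction is left free because the expansion produces it
  at \<open>\<gamma> n\<close>.\<close>

definition score :: "obs \<Rightarrow> 'h \<Rightarrow> real" where
  "score z g = obs_inner e (snd z) k0 - obs_inner e (fst z) g - obs_inner e (snd z) (K0 g)"

text \<open>Collects the exceptional null sets of the noise. For the parameters the
  almost-everywhere quantifier stays inside, relative to the prior, since the exceptional null set
  of the noise varies with f.\<close>

definition regular :: "obs \<Rightarrow> bool" where
  "regular z \<longleftrightarrow> f0 \<in> conv_set e (fst z) \<and> K0 f0 \<in> conv_set e (snd z) \<and> k0 \<in> conv_set e (snd z) \<and>
     \<gamma>0 \<in> conv_set e (fst z) \<and> K0 \<gamma>0 \<in> conv_set e (snd z) \<and>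
     (\<forall>n. \<gamma> n \<in> conv_set e (fst z) \<and> K0 (\<gamma> n) \<in> conv_set e (snd z)) \<and>
     (AE w in \<pi>\<theta> \<Otimes>\<^sub>M \<pi>f. snd w \<in> conv_set e (fst z) \<and> K (fst w) (snd w) \<in> conv_set e (snd z)) \<and>
     (AE f in \<pi>f. f \<in> conv_set e (fst z) \<and> K0 f \<in> conv_set e (snd z)) \<and>
     (AE f in \<pi>f. f \<in> conv_set e (fst z) \<and> K0' f \<in> conv_set e (snd z))"

definition remainder :: "nat \<Rightarrow> obs \<Rightarrow> real \<Rightarrow> 'h \<Rightarrow> real" where
  "remainder n z \<theta> f = log_ratio e n z (f - f0) (K \<theta> f - K0 f0)
     - log_ratio e n z (f + (\<theta> - \<theta>0) *\<^sub>R \<gamma> n - f0) (K0 (f + (\<theta> - \<theta>0) *\<^sub>R \<gamma> n) - K0 f0)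
     - (sqrt (real n) * (\<theta> - \<theta>0) * score z \<gamma>0 - real n * (\<theta> - \<theta>0)\<^sup>2 * I0 / 2)"

text \<open>The convergences under which the noise integral of \<open>K \<theta> f\<close> splits
  linearly into those of \<open>K0 f\<close>, \<open>K0' f\<close> and the second-order
  remainder.\<close>

definition param_conv :: "obs \<Rightarrow> real \<Rightarrow> 'h \<Rightarrow> bool" where
  "param_conv z \<theta> f \<longleftrightarrow> f \<in> conv_set e (fst z) \<and> K \<theta> f \<in> conv_set e (snd z) \<and>
     K0 f \<in> conv_set e (snd z) \<and> K0' f \<in> conv_set e (snd z)"

text \<open>The radius is twice \<epsilon> because the lower bound moves points of the
  \<epsilon>-ball by a multiple of \<open>\<gamma> n\<close> of norm at most \<epsilon>.\<close>

definition small_remainder :: "nat \<Rightarrow> obs \<Rightarrow> 'h set \<Rightarrow> real \<Rightarrow> bool" where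
  "small_remainder n z A t \<longleftrightarrow> (\<forall>\<theta>\<in>\<Theta>. \<bar>\<theta> - \<theta>0\<bar> \<le> \<epsilon> n \<longrightarrow> (\<forall>f\<in>A. norm (f - f0) \<le> 2 * \<epsilon> n \<longrightarrow>
     param_conv z \<theta> f \<longrightarrow> \<bar>remainder n z \<theta> f\<bar> \<le> t * (1 + real n * (\<theta> - \<theta>0)\<^sup>2)))"

abbreviation "post n x \<equiv> posterior e K \<pi>\<theta> \<pi>f n x"
abbreviation "post_known n x \<equiv> posterior_known e K \<theta>0 \<pi>f n x"
abbreviation "contraction_set n \<equiv> {(\<theta>, f). \<theta> \<in> \<Theta> \<and> \<bar>\<theta> - \<theta>0\<bar> < \<epsilon> n \<and> norm (f - f0) < \<epsilon> n}"
abbreviation "tv_error n x \<equiv> tv_dist (distr (post n x) borel fst)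
  (normal_law (\<theta>0 + efficient_influence e K K' \<theta>0 f0 n x / sqrt (real n)) (inverse I0 / real n))"

lemma \<theta>0_in: "\<theta>0 \<in> \<Theta>"
  using interior interior_subset by blast

lemma sets_\<pi>\<theta> [measurable_cong, simp]: "sets \<pi>\<theta> = sets (restrict_space borel \<Theta>)"
  by (simp add: param_prior_def sets_restrict_space)

lemma sets_\<pi>f' [measurable_cong, simp]: "sets \<pi>f = sets borel"
  by (rule sets_\<pi>f)

lemma space_\<pi>f [simp]: "space \<pi>f = UNIV"
  using sets_eq_imp_space_eq[OF sets_\<pi>f] by simp

lemma space_\<pi>\<theta> [simp]: "space \<pi>\<theta> = \<Theta>"
  by (simp add: param_prior_def space_restrict_space)

lemma \<Theta>_borel [measurable]: "\<Theta> \<in> sets borel"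
  using compact by (simp add: borel_closed compact_imp_closed)

text \<open>At \<open>f0\<close> and 0, with equal \<theta>, the Lipschitz bound reduces to
  \<open>D3 * norm f0\<close>, and \<open>f0\<close> is non-zero because its image under
  \<open>K0'\<close> is.\<close>

lemma D3_nonneg: "0 \<le> D3"
proof -
  have "f0 \<noteq> 0" using nonzero by auto
  moreover have "norm (K \<theta>0 f0 - K \<theta>0 0) \<le> D3 * \<bar>\<theta>0 - \<theta>0\<bar> * min (norm f0) (norm (0::'h)) + D3 * norm (f0 - 0)"
    using K_lip \<theta>0_in by blast
  then have "0 \<le> D3 * norm f0" using norm_ge_zero[of "K0 f0"] by (simp del: norm_ge_zero)
  ultimately show ?thesis by (simp add: zero_le_mult_iff)
qed

text \<open>The Lipschitz condition gives joint continuity, and from it the joint measurability of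
  the likelihood that Fubini's theorem requires.\<close>

lemma continuous_on_K: "continuous_on (\<Theta> \<times> UNIV) (\<lambda>(\<theta>, f). K \<theta> f)"
  unfolding continuous_on_def
proof
  fix w :: "real \<times> 'h" assume w: "w \<in> \<Theta> \<times> UNIV"
  obtain \<theta>1 f1 where w1: "w = (\<theta>1, f1)" by (cases w)
  let ?b = "\<lambda>v. D3 * \<bar>fst v - \<theta>1\<bar> * norm f1 + D3 * norm (snd v - f1)"
  have "((\<lambda>v. K (fst v) (snd v)) \<longlongrightarrow> K \<theta>1 f1) (at w within \<Theta> \<times> UNIV)"
  proof (rule metric_tendsto_imp_tendsto)
    have "(?b \<longlongrightarrow> D3 * \<bar>fst w - \<theta>1\<bar> * norm f1 + D3 * norm (snd w - f1)) (at w within \<Theta> \<times> UNIV)"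
      by (intro tendsto_intros)
    then show "(?b \<longlongrightarrow> 0) (at w within \<Theta> \<times> UNIV)" by (simp add: w1)
    show "\<forall>\<^sub>F v in at w within \<Theta> \<times> UNIV. dist (K (fst v) (snd v)) (K \<theta>1 f1) \<le> dist (?b v) 0"
      unfolding eventually_at_filter
    proof (intro always_eventually allI impI)
      fix v :: "real \<times> 'h" assume v: "v \<in> \<Theta> \<times> UNIV"
      have "norm (K (fst v) (snd v) - K \<theta>1 f1) \<le> D3 * \<bar>fst v - \<theta>1\<bar> * min (norm (snd v)) (norm f1) + D3 * norm (snd v - f1)"
        using K_lip v w by (auto simp: w1)
      also have "\<dots> \<le> ?b v" using D3_nonneg by (intro add_mono mult_left_mono) auto
      finally show "dist (K (fst v) (snd v)) (K \<theta>1 f1) \<le> dist (?b v) 0" by (simp add: dist_norm)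
    qed
  qed
  then show "((\<lambda>(\<theta>, f). K \<theta> f) \<longlongrightarrow> (case w of (\<theta>, f) \<Rightarrow> K \<theta> f)) (at w within \<Theta> \<times> UNIV)"
    by (simp add: w1 case_prod_unfold)
qed

lemma measurable_K [measurable]: "(\<lambda>w. K (fst w) (snd w)) \<in> borel_measurable (\<pi>\<theta> \<Otimes>\<^sub>M \<pi>f)"
proof -
  have [measurable]: "fst \<in> borel_measurable (\<pi>\<theta> \<Otimes>\<^sub>M \<pi>f)"
    by (rule measurable_compose[OF measurable_fst]) (simp cong: measurable_cong_sets add: measurable_restrict_space1)
  have [measurable]: "snd \<in> borel_measurable (\<pi>\<theta> \<Otimes>\<^sub>M \<pi>f)" by measurable
  have "(\<lambda>w. (fst w, snd w)) \<in> \<pi>\<theta> \<Otimes>\<^sub>M \<pi>f \<rightarrow>\<^sub>M borel" by (intro borel_measurable_Pair) measurable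
  then have "(\<lambda>w. (fst w, snd w)) \<in> \<pi>\<theta> \<Otimes>\<^sub>M \<pi>f \<rightarrow>\<^sub>M restrict_space borel (\<Theta> \<times> UNIV)"
    by (intro measurable_restrict_space2) (auto simp: space_pair_measure)
  moreover have "(\<lambda>(\<theta>, f). K \<theta> f) \<in> borel_measurable (restrict_space borel (\<Theta> \<times> UNIV))"
    by (rule borel_measurable_continuous_on_restrict[OF continuous_on_K])
  ultimately have "(\<lambda>w. (\<lambda>(\<theta>, f). K \<theta> f) (fst w, snd w)) \<in> borel_measurable (\<pi>\<theta> \<Otimes>\<^sub>M \<pi>f)"
    by (rule measurable_compose)
  then show ?thesis by simp
qed

lemma measurable_blinfun [measurable]: "(\<lambda>x. blinfun_apply (A :: 'h \<Rightarrow>\<^sub>L 'h) x) \<in> borel_measurable borel"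
  by (intro borel_measurable_continuous_onI linear_continuous_on blinfun.bounded_linear_right)

lemma prob_space_P': "prob_space (\<pi>\<theta> \<Otimes>\<^sub>M \<pi>f)"
proof -
  interpret A: prob_space \<pi>\<theta> by (rule prior_prob)
  interpret B: prob_space \<pi>f by (rule \<pi>f_prob)
  interpret pair_prob_space \<pi>\<theta> \<pi>f ..
  show ?thesis by (rule prob_space_axioms)
qed

lemma measurable_lr [measurable]:
  "(\<lambda>w. lr n z (fst w) (snd w)) \<in> borel_measurable (\<pi>\<theta> \<Otimes>\<^sub>M \<pi>f)"
  "(\<lambda>f. lr n z \<theta> f) \<in> borel_measurable borel"
  unfolding lr_def by measurable

text \<open>Fubini's theorem exchanges the quantifiers: each parameter is good for almost every
  noise, hence almost every noise is good for almost every parameter.\<close>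

lemma AE_conv_param:
  fixes M :: "'w measure" and a b :: "'w \<Rightarrow> 'h"
  assumes M: "prob_space M" and [measurable]: "a \<in> borel_measurable M" "b \<in> borel_measurable M"
  shows "AE z in white_noise. AE w in M. a w \<in> conv_set e (fst z) \<and> b w \<in> conv_set e (snd z)"
proof -
  interpret M: prob_space M by fact
  interpret N: prob_space white_noise by (rule prob_space_white_noise)
  interpret pair_sigma_finite white_noise M ..
  have [measurable]: "(\<lambda>y. fst (fst y)) \<in> white_noise \<Otimes>\<^sub>M M \<rightarrow>\<^sub>M (\<Pi>\<^sub>M k\<in>UNIV. borel)"
    "(\<lambda>y. snd (fst y)) \<in> white_noise \<Otimes>\<^sub>M M \<rightarrow>\<^sub>M (\<Pi>\<^sub>M k\<in>UNIV. borel)"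
    unfolding white_noise_eq by (simp_all cong: measurable_cong_sets add: sets_gauss_seq[symmetric] measurable_fst'' measurable_snd'')
  have "AE w in M. AE z in white_noise. a w \<in> conv_set e (fst z) \<and> b w \<in> conv_set e (snd z)"
    by (intro AE_I2 AE_white_noise_conv_set)
  then show ?thesis by (subst AE_commute) measurable
qed

lemma AE_regular: "AE z in white_noise. regular z"
proof -
  have "AE z in white_noise. \<forall>n. \<gamma> n \<in> conv_set e (fst z) \<and> K0 (\<gamma> n) \<in> conv_set e (snd z)"
    by (subst AE_all_countable) (intro allI AE_white_noise_conv_set)
  moreover have "AE z in white_noise. f0 \<in> conv_set e (fst z) \<and> K0 f0 \<in> conv_set e (snd z)"
    "AE z in white_noise. \<gamma>0 \<in> conv_set e (fst z) \<and> K0 \<gamma>0 \<in> conv_set e (snd z)"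
    "AE z in white_noise. f0 \<in> conv_set e (fst z) \<and> k0 \<in> conv_set e (snd z)"
    by (intro AE_white_noise_conv_set)+
  moreover have "AE z in white_noise. AE w in \<pi>\<theta> \<Otimes>\<^sub>M \<pi>f. snd w \<in> conv_set e (fst z) \<and> K (fst w) (snd w) \<in> conv_set e (snd z)"
    by (intro AE_conv_param prob_space_P') measurable
  moreover have "AE z in white_noise. AE f in \<pi>f. f \<in> conv_set e (fst z) \<and> K0 f \<in> conv_set e (snd z)"
    by (intro AE_conv_param \<pi>f_prob) measurable
  moreover have "AE z in white_noise. AE f in \<pi>f. f \<in> conv_set e (fst z) \<and> K0' f \<in> conv_set e (snd z)"
    by (intro AE_conv_param \<pi>f_prob) measurable
  ultimately show ?thesis by eventually_elim (auto simp: regular_def)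
qed

lemma sets_P: "sets (P n) = sets white_noise"
  by (simp add: obs_law_def sets_white_noise)

lemma space_P [simp]: "space (P n) = UNIV"
  using sets_eq_imp_space_eq[OF sets_P] by simp

lemma measurable_noise: "noise n \<in> P n \<rightarrow>\<^sub>M white_noise"
proof -
  have "noise n \<in> (\<Pi>\<^sub>M k\<in>UNIV. borel) \<Otimes>\<^sub>M (\<Pi>\<^sub>M k\<in>UNIV. borel) \<rightarrow>\<^sub>M (\<Pi>\<^sub>M k\<in>UNIV. borel) \<Otimes>\<^sub>M (\<Pi>\<^sub>M k\<in>UNIV. borel)"
    unfolding noise_def by (intro measurable_Pair measurable_PiM_single') (auto simp: space_PiM)
  then show ?thesis by (simp cong: measurable_cong_sets add: sets_P sets_white_noise)
qed

text \<open>\<open>noise n\<close> undoes the affine map that defines the law of the data; the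
  division by sqrt n is why n \<ge> 1 is assumed.\<close>

lemma emeasure_noise:
  assumes n: "1 \<le> n" and E: "E \<in> sets white_noise"
  shows "emeasure (P n) (noise n -` E \<inter> space (P n)) = emeasure white_noise E"
proof -
  let ?T = "\<lambda>(z1, z2). (\<lambda>k. f0 \<bullet> e k + z1 k / sqrt (real n), \<lambda>k. K0 f0 \<bullet> e k + z2 k / sqrt (real n))"
  have T: "?T \<in> white_noise \<rightarrow>\<^sub>M (\<Pi>\<^sub>M k\<in>UNIV. borel) \<Otimes>\<^sub>M (\<Pi>\<^sub>M k\<in>UNIV. borel)"
  proof -
    have "?T \<in> (\<Pi>\<^sub>M k\<in>UNIV. borel) \<Otimes>\<^sub>M (\<Pi>\<^sub>M k\<in>UNIV. borel) \<rightarrow>\<^sub>M (\<Pi>\<^sub>M k\<in>UNIV. borel) \<Otimes>\<^sub>M (\<Pi>\<^sub>M k\<in>UNIV. borel)"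
      unfolding case_prod_unfold by (intro measurable_Pair measurable_PiM_single') (auto simp: space_PiM)
    then show ?thesis by (simp cong: measurable_cong_sets add: sets_white_noise)
  qed
  have N: "noise n -` E \<inter> space (P n) \<in> sets ((\<Pi>\<^sub>M k\<in>UNIV. borel) \<Otimes>\<^sub>M (\<Pi>\<^sub>M k\<in>UNIV. borel))"
    using measurable_sets[OF measurable_noise E] by (simp add: obs_law_def)
  have inv: "noise n (?T z) = z" for z
    using n by (auto simp: noise_def case_prod_unfold)
  have "emeasure (P n) (noise n -` E \<inter> space (P n)) = emeasure white_noise (?T -` (noise n -` E \<inter> space (P n)) \<inter> space white_noise)"
    unfolding obs_law_def by (rule emeasure_distr[OF T]) (use N in \<open>simp add: obs_law_def\<close>)
  also have "?T -` (noise n -` E \<inter> space (P n)) \<inter> space white_noise = E"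
    using inv by auto
  finally show ?thesis .
qed

lemma outer_measure_noise:
  assumes n: "1 \<le> n" and E: "E \<in> sets white_noise" and le: "emeasure white_noise E \<le> \<tau>"
    and sub: "\<And>x. noise n x \<notin> E \<Longrightarrow> A x"
  shows "outer_measure_of (P n) {x \<in> space (P n). \<not> A x} \<le> \<tau>"
proof -
  have "outer_measure_of (P n) {x \<in> space (P n). \<not> A x} \<le> outer_measure_of (P n) (noise n -` E \<inter> space (P n))"
    using sub by (intro outer_measure_of_mono) auto
  also have "\<dots> = emeasure white_noise E"
    using measurable_sets[OF measurable_noise E] emeasure_noise[OF n E] by simp
  finally show ?thesis using le by (rule order_trans)
qed

text \<open>Moves probability bounds from the n-dependent laws of the data to measurable exceptional
  sets under the single law \<open>white_noise\<close>.\<close>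

lemma whp_noiseI:
  assumes "\<And>\<tau>. 0 < \<tau> \<Longrightarrow> \<forall>\<^sub>F n in sequentially. \<exists>E\<in>sets white_noise.
      emeasure white_noise E \<le> ennreal \<tau> \<and> (\<forall>z. z \<notin> E \<longrightarrow> A n z)"
  shows "whp P (\<lambda>n x. A n (noise n x))"
  unfolding whp_def
proof (intro allI impI)
  fix \<tau> :: real assume "0 < \<tau>"
  from assms[OF this] eventually_ge_at_top[of 1]
  show "\<forall>\<^sub>F n in sequentially. outer_measure_of (P n) {x \<in> space (P n). \<not> A n (noise n x)} \<le> ennreal \<tau>"
  proof eventually_elim
    case (elim n)
    then show ?case using outer_measure_noise[of n _ "ennreal \<tau>" "\<lambda>x. A n (noise n x)"] by blast
  qed
qed

lemma whp_regular: "whp P (\<lambda>n x. regular (noise n x))"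
proof (rule whp_noiseI)
  obtain E where "E \<in> sets white_noise" "emeasure white_noise E = 0" "{z \<in> space white_noise. \<not> regular z} \<subseteq> E"
    using AE_regular by (auto elim!: AE_E)
  then show "\<forall>\<^sub>F n in sequentially. \<exists>E\<in>sets white_noise. emeasure white_noise E \<le> ennreal \<tau> \<and> (\<forall>z. z \<notin> E \<longrightarrow> regular z)" for \<tau>
    by (intro always_eventually allI bexI[of _ E]) auto
qed

text \<open>Chernoff's bound for both signs. The parameter c stays free: tightness of the score uses
  c = 1 and a high level, smallness of a noise term uses a large c and a small variance.\<close>

lemma noise_tail:
  fixes r c \<sigma> :: real
  assumes \<sigma>: "(norm a)\<^sup>2 + (norm b)\<^sup>2 \<le> \<sigma>\<^sup>2" and c: "0 < c"
  shows "\<exists>E\<in>sets white_noise. emeasure white_noise E \<le> ennreal (2 * exp (c\<^sup>2 * \<sigma>\<^sup>2 / 2 - c * r)) \<and>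
    (\<forall>z. z \<notin> E \<longrightarrow> \<bar>obs_inner e (fst z) a + obs_inner e (snd z) b\<bar> \<le> r)"
proof -
  define X where "X z = obs_inner e (fst z) a + obs_inner e (snd z) b" for z
  have [measurable]: "X \<in> borel_measurable white_noise" unfolding X_def white_noise_eq by measurable
  have bound: "emeasure white_noise {z \<in> space white_noise. ennreal 1 \<le> ennreal (exp (s * X z - c * r))}
      \<le> ennreal (exp (c\<^sup>2 * \<sigma>\<^sup>2 / 2 - c * r))" if "s\<^sup>2 = c\<^sup>2" for s
  proof (rule markov_bound)
    have "(\<integral>\<^sup>+z. ennreal (exp (s * X z - c * r)) \<partial>white_noise)
        \<le> ennreal (exp (s\<^sup>2 * ((norm a)\<^sup>2 + (norm b)\<^sup>2) / 2 - c * r))"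
      unfolding X_def by (rule mgf_white_noise_affine)
    also have "\<dots> \<le> ennreal (1 * exp (c\<^sup>2 * \<sigma>\<^sup>2 / 2 - c * r))"
      using \<sigma> that by (intro ennreal_leI) (simp add: mult_left_mono)
    finally show "(\<integral>\<^sup>+z. ennreal (exp (s * X z - c * r)) \<partial>white_noise) \<le> ennreal (1 * exp (c\<^sup>2 * \<sigma>\<^sup>2 / 2 - c * r))" .
  qed auto
  define E where "E = {z \<in> space white_noise. ennreal 1 \<le> ennreal (exp (c * X z - c * r))}
    \<union> {z \<in> space white_noise. ennreal 1 \<le> ennreal (exp ((- c) * X z - c * r))}"
  have "E \<in> sets white_noise" unfolding E_def by measurable
  moreover have "emeasure white_noise E \<le> ennreal (exp (c\<^sup>2 * \<sigma>\<^sup>2 / 2 - c * r)) + ennreal (exp (c\<^sup>2 * \<sigma>\<^sup>2 / 2 - c * r))"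
  proof -
    have "emeasure white_noise E \<le> emeasure white_noise {z \<in> space white_noise. ennreal 1 \<le> ennreal (exp (c * X z - c * r))}
      + emeasure white_noise {z \<in> space white_noise. ennreal 1 \<le> ennreal (exp ((- c) * X z - c * r))}"
      unfolding E_def by (rule emeasure_subadditive) measurable
    also have "\<dots> \<le> ennreal (exp (c\<^sup>2 * \<sigma>\<^sup>2 / 2 - c * r)) + ennreal (exp (c\<^sup>2 * \<sigma>\<^sup>2 / 2 - c * r))"
      using bound[of c] bound[of "- c"] by (intro add_mono) auto
    finally show ?thesis .
  qed
  then have "emeasure white_noise E \<le> ennreal (2 * exp (c\<^sup>2 * \<sigma>\<^sup>2 / 2 - c * r))"
    by (simp add: ennreal_plus[symmetric] del: ennreal_plus)
  moreover have "\<bar>X z\<bar> \<le> r" if "z \<notin> E" for z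
  proof -
    have "exp (c * X z - c * r) < 1" "exp ((- c) * X z - c * r) < 1"
      using that by (auto simp: E_def not_le ennreal_less_iff simp flip: ennreal_1)
    then have "c * X z < c * r" "c * (- X z) < c * r" by simp_all
    then have "X z < r" "- X z < r" using c by (simp_all only: mult_less_cancel_left_pos)
    then show ?thesis by (simp add: abs_le_iff)
  qed
  ultimately show ?thesis unfolding X_def by blast
qed

lemma score_tight:
  assumes \<tau>: "0 < \<tau>"
  shows "\<exists>v>0. \<exists>E\<in>sets white_noise. emeasure white_noise E \<le> ennreal \<tau> \<and>
    (\<forall>z. z \<notin> E \<longrightarrow> regular z \<longrightarrow> \<bar>score z \<gamma>0\<bar> \<le> v)"
proof -
  define \<sigma> where "\<sigma> = sqrt ((norm (- \<gamma>0))\<^sup>2 + (norm (k0 - K0 \<gamma>0))\<^sup>2)"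
  have \<sigma>: "(norm (- \<gamma>0))\<^sup>2 + (norm (k0 - K0 \<gamma>0))\<^sup>2 \<le> \<sigma>\<^sup>2" by (simp add: \<sigma>_def)
  \<comment> \<open>The level is solved from 2 exp (\<sigma>^2 / 2 - v) \<le> \<tau>.\<close>
  define v where "v = max 1 (\<sigma>\<^sup>2 / 2 - ln (\<tau> / 2))"
  obtain E where E: "E \<in> sets white_noise" "emeasure white_noise E \<le> ennreal (2 * exp (1\<^sup>2 * \<sigma>\<^sup>2 / 2 - 1 * v))"
    "\<And>z. z \<notin> E \<Longrightarrow> \<bar>obs_inner e (fst z) (- \<gamma>0) + obs_inner e (snd z) (k0 - K0 \<gamma>0)\<bar> \<le> v"
    using noise_tail[OF \<sigma> zero_less_one, of v] by blast
  have "\<sigma>\<^sup>2 / 2 - v \<le> ln (\<tau> / 2)" by (simp add: v_def)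
  then have "exp (\<sigma>\<^sup>2 / 2 - v) \<le> \<tau> / 2" using \<tau> by (metis exp_le_cancel_iff exp_ln half_gt_zero)
  then have "ennreal (2 * exp (1\<^sup>2 * \<sigma>\<^sup>2 / 2 - 1 * v)) \<le> ennreal \<tau>" by (intro ennreal_leI) simp
  moreover have "\<bar>score z \<gamma>0\<bar> \<le> v" if "z \<notin> E" "regular z" for z
  proof -
    have "obs_inner e (fst z) (- \<gamma>0) = - obs_inner e (fst z) \<gamma>0"
      using obs_inner_scaleR[of \<gamma>0 e "fst z" "-1"] that(2) by (simp add: regular_def)
    moreover have "obs_inner e (snd z) (k0 - K0 \<gamma>0) = obs_inner e (snd z) k0 - obs_inner e (snd z) (K0 \<gamma>0)"
      using that(2) by (intro obs_inner_diff) (auto simp: regular_def)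
    ultimately show ?thesis using E(3)[OF that(1)] by (simp add: score_def algebra_simps)
  qed
  moreover have "0 < v" by (simp add: v_def)
  ultimately show ?thesis using E(1,2) by (meson order_trans)
qed

lemma n\<epsilon>_at_top: "filterlim (\<lambda>n. real n * (\<epsilon> n)\<^sup>2) at_top sequentially"
proof -
  have "(\<lambda>n. ((1 / sqrt (real n)) / \<epsilon> n)\<^sup>2) \<longlonglongrightarrow> 0\<^sup>2" by (intro tendsto_power \<epsilon>_rate)
  then have "(\<lambda>n. ((1 / sqrt (real n)) / \<epsilon> n)\<^sup>2) \<longlonglongrightarrow> 0" by simp
  moreover have "\<forall>\<^sub>F n in sequentially. 0 < ((1 / sqrt (real n)) / \<epsilon> n)\<^sup>2"
    using eventually_ge_at_top[of 1] by eventually_elim (use \<epsilon>_pos in auto)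
  ultimately have "filterlim (\<lambda>n. inverse (((1 / sqrt (real n)) / \<epsilon> n)\<^sup>2)) at_top sequentially"
    by (rule filterlim_inverse_at_top)
  moreover have "inverse (((1 / sqrt (real n)) / \<epsilon> n)\<^sup>2) = real n * (\<epsilon> n)\<^sup>2" for n
    by (simp add: power_divide power_mult_distrib)
  ultimately show ?thesis by simp
qed

text \<open>Since n \<epsilon>^2 tends to infinity, the rate n \<epsilon>^2 \<rho>^2 \<rightarrow> 0
  forces \<rho> to vanish.\<close>

lemma \<rho>_lim: "\<rho> \<longlonglongrightarrow> 0"
proof -
  have "(\<lambda>n. (real n * (\<epsilon> n)\<^sup>2 * (\<rho> n)\<^sup>2) * inverse (real n * (\<epsilon> n)\<^sup>2)) \<longlonglongrightarrow> 0 * 0"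
    by (intro tendsto_mult \<rho>_rate tendsto_inverse_0_at_top n\<epsilon>_at_top)
  moreover have "\<forall>\<^sub>F n in sequentially. (real n * (\<epsilon> n)\<^sup>2 * (\<rho> n)\<^sup>2) * inverse (real n * (\<epsilon> n)\<^sup>2) = (\<rho> n)\<^sup>2"
    using eventually_ge_at_top[of 1]
  proof eventually_elim
    case (elim n)
    then have "\<epsilon> n \<noteq> 0" "real n \<noteq> 0" using \<epsilon>_pos by force+
    then show ?case by (simp add: field_simps)
  qed
  ultimately have "(\<lambda>n. (\<rho> n)\<^sup>2) \<longlonglongrightarrow> 0" by (simp add: Lim_transform_eventually)
  then have "(\<lambda>n. sqrt ((\<rho> n)\<^sup>2)) \<longlonglongrightarrow> sqrt 0" by (intro tendsto_real_sqrt)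
  then show ?thesis by (simp add: tendsto_rabs_zero_iff)
qed

lemma \<gamma>_lim: "\<gamma> \<longlonglongrightarrow> \<gamma>0"
proof -
  obtain C where C: "\<And>n. n \<ge> 1 \<Longrightarrow> norm (\<gamma> n - \<gamma>0) \<le> C * \<bar>\<rho> n\<bar>" using \<gamma>_approx by blast
  have "(\<lambda>n. C * \<bar>\<rho> n\<bar>) \<longlonglongrightarrow> C * \<bar>0\<bar>" by (intro tendsto_intros \<rho>_lim)
  then have "(\<lambda>n. C * \<bar>\<rho> n\<bar>) \<longlonglongrightarrow> 0" by simp
  then have "(\<lambda>n. \<gamma> n - \<gamma>0) \<longlonglongrightarrow> 0"
    by (rule Lim_null_comparison[rotated]) (use C in \<open>auto simp: eventually_sequentially\<close>)
  then show ?thesis by (simp add: LIM_zero_iff)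
qed

lemma whp_score_diff:
  assumes r: "0 < r"
  shows "whp P (\<lambda>n x. regular (noise n x) \<longrightarrow> \<bar>score (noise n x) (\<gamma> n) - score (noise n x) \<gamma>0\<bar> \<le> r)"
proof (rule whp_noiseI)
  fix \<tau> :: real assume \<tau>: "0 < \<tau>"
  \<comment> \<open>Once the variance is below 1 / c^2 the tail bound is 2 exp (1/2 - c r), and this
    c makes it at most \<tau>.\<close>
  define c where "c = max 1 ((1/2 - ln (\<tau> / 2)) / r)"
  have c: "0 < c" "1/2 - c * r \<le> ln (\<tau> / 2)"
  proof -
    have "(1/2 - ln (\<tau> / 2)) / r \<le> c" by (simp add: c_def)
    then show "1/2 - c * r \<le> ln (\<tau> / 2)" using r by (simp add: field_simps)
  qed (simp add: c_def)
  have "(\<lambda>n. (norm (\<gamma>0 - \<gamma> n))\<^sup>2 + (norm (K0 (\<gamma>0 - \<gamma> n)))\<^sup>2) \<longlonglongrightarrow> (norm (\<gamma>0 - \<gamma>0))\<^sup>2 + (norm (K0 (\<gamma>0 - \<gamma>0)))\<^sup>2"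
    by (intro tendsto_intros \<gamma>_lim blinfun.tendsto)
  then have "\<forall>\<^sub>F n in sequentially. (norm (\<gamma>0 - \<gamma> n))\<^sup>2 + (norm (K0 (\<gamma>0 - \<gamma> n)))\<^sup>2 < (1 / c)\<^sup>2"
    by (rule order_tendstoD(2)) (use c in auto)
  then show "\<forall>\<^sub>F n in sequentially. \<exists>E\<in>sets white_noise. emeasure white_noise E \<le> ennreal \<tau> \<and>
      (\<forall>z. z \<notin> E \<longrightarrow> regular z \<longrightarrow> \<bar>score z (\<gamma> n) - score z \<gamma>0\<bar> \<le> r)"
  proof eventually_elim
    case (elim n)
    obtain E where E: "E \<in> sets white_noise" "emeasure white_noise E \<le> ennreal (2 * exp (c\<^sup>2 * (1 / c)\<^sup>2 / 2 - c * r))"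
      "\<And>z. z \<notin> E \<Longrightarrow> \<bar>obs_inner e (fst z) (\<gamma>0 - \<gamma> n) + obs_inner e (snd z) (K0 (\<gamma>0 - \<gamma> n))\<bar> \<le> r"
      using noise_tail[OF less_imp_le[OF elim] c(1), of r] by blast
    have "exp (1/2 - c * r) \<le> \<tau> / 2" using c(2) \<tau> by (metis exp_le_cancel_iff exp_ln half_gt_zero)
    moreover have "c\<^sup>2 * (1 / c)\<^sup>2 = 1" using c(1) by (simp add: power_divide)
    ultimately have "ennreal (2 * exp (c\<^sup>2 * (1 / c)\<^sup>2 / 2 - c * r)) \<le> ennreal \<tau>" by (intro ennreal_leI) simp
    moreover have "\<bar>score z (\<gamma> n) - score z \<gamma>0\<bar> \<le> r" if "z \<notin> E" "regular z" for z
    proof -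
      have "obs_inner e (fst z) (\<gamma>0 - \<gamma> n) = obs_inner e (fst z) \<gamma>0 - obs_inner e (fst z) (\<gamma> n)"
        "obs_inner e (snd z) (K0 (\<gamma>0 - \<gamma> n)) = obs_inner e (snd z) (K0 \<gamma>0) - obs_inner e (snd z) (K0 (\<gamma> n))"
        using that(2) by (auto simp: regular_def obs_inner_diff blinfun.diff_right)
      then show ?thesis using E(3)[OF that(1)] by (simp add: score_def algebra_simps)
    qed
    ultimately show ?case using E(1,2) by (intro bexI[of _ E]) (auto intro: order_trans)
  qed
qed

text \<open>Only the second noise component is involved, so the exceptional set is a cylinder. Radii
  tending to zero eventually fall below the fixed radius obtained by chaining.\<close>

lemma whp_small_ball:
  assumes b: "0 < b" and \<delta>: "\<delta> \<longlonglongrightarrow> 0"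
  shows "whp P (\<lambda>n x. \<forall>h\<in>S. nS h \<le> 1 \<longrightarrow> norm h \<le> \<delta> n \<longrightarrow> h \<in> conv_set e (snd (noise n x))
    \<longrightarrow> \<bar>obs_inner e (snd (noise n x)) h\<bar> \<le> b)"
proof (rule whp_noiseI)
  fix \<tau> :: real assume \<tau>: "0 < \<tau>"
  interpret G: prob_space gauss_seq by (rule prob_space_gauss_seq)
  obtain d E where d: "0 < d" and E: "E \<in> sets gauss_seq" "emeasure gauss_seq E \<le> ennreal \<tau>"
    and EE: "\<And>z h. z \<notin> E \<Longrightarrow> h \<in> S \<Longrightarrow> nS h \<le> 1 \<Longrightarrow> norm h \<le> d \<Longrightarrow> h \<in> conv_set e z \<Longrightarrow> \<bar>obs_inner e z h\<bar> \<le> b"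
    using small_ball_sup[OF entropy b \<tau>] by blast
  have "emeasure white_noise (UNIV \<times> E) \<le> ennreal \<tau>"
    unfolding white_noise_eq using E G.emeasure_space_1 sets.top[of gauss_seq]
    by (subst G.emeasure_pair_measure_Times) auto
  moreover have "UNIV \<times> E \<in> sets white_noise"
    unfolding white_noise_eq using E sets.top[of gauss_seq] by auto
  moreover have "\<forall>\<^sub>F n in sequentially. \<delta> n < d" by (rule order_tendstoD(2)[OF \<delta> d])
  ultimately show "\<forall>\<^sub>F n in sequentially. \<exists>E\<in>sets white_noise. emeasure white_noise E \<le> ennreal \<tau> \<and>
      (\<forall>z. z \<notin> E \<longrightarrow> (\<forall>h\<in>S. nS h \<le> 1 \<longrightarrow> norm h \<le> \<delta> n \<longrightarrow> h \<in> conv_set e (snd z) \<longrightarrow> \<bar>obs_inner e (snd z) h\<bar> \<le> b))"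
  proof (rule_tac eventually_mono)
    fix n assume n: "\<delta> n < d"
    show "\<exists>E\<in>sets white_noise. emeasure white_noise E \<le> ennreal \<tau> \<and>
      (\<forall>z. z \<notin> E \<longrightarrow> (\<forall>h\<in>S. nS h \<le> 1 \<longrightarrow> norm h \<le> \<delta> n \<longrightarrow> h \<in> conv_set e (snd z) \<longrightarrow> \<bar>obs_inner e (snd z) h\<bar> \<le> b))"
    proof (intro bexI[of _ "UNIV \<times> E"] conjI allI impI ballI)
      fix z :: obs and h assume "z \<notin> UNIV \<times> E" "h \<in> S" "nS h \<le> 1" "norm h \<le> \<delta> n" "h \<in> conv_set e (snd z)"
      then show "\<bar>obs_inner e (snd z) h\<bar> \<le> b" using n by (intro EE) (auto simp: mem_Times_iff)
    qed fact+
  qed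
qed


lemma obs_inner_eq_noise:
  assumes n: "1 \<le> n"
  shows "f \<in> conv_set e (fst (noise n x)) \<Longrightarrow>
      obs_inner e (fst x) f = f0 \<bullet> f + obs_inner e (fst (noise n x)) f / sqrt (real n)"
    and "f \<in> conv_set e (snd (noise n x)) \<Longrightarrow>
      obs_inner e (snd x) f = K0 f0 \<bullet> f + obs_inner e (snd (noise n x)) f / sqrt (real n)"
proof -
  have gen: "obs_inner e y f = g \<bullet> f + obs_inner e z f / sqrt (real n)"
    if z: "z = (\<lambda>k. sqrt (real n) * (y k - g \<bullet> e k))" and f: "f \<in> conv_set e z" for y z g
  proof -
    have "(\<lambda>k. z k * (f \<bullet> e k)) sums obs_inner e z f"
      using f by (simp add: conv_set_def obs_inner_def summable_sums)
    then have "(\<lambda>k. (g \<bullet> e k) * (f \<bullet> e k) + z k * (f \<bullet> e k) / sqrt (real n)) sums (g \<bullet> f + obs_inner e z f / sqrt (real n))"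
      by (intro sums_add parseval sums_divide)
    moreover have "(g \<bullet> e k) * (f \<bullet> e k) + z k * (f \<bullet> e k) / sqrt (real n) = y k * (f \<bullet> e k)" for k
    proof -
      have "z k * (f \<bullet> e k) / sqrt (real n) = (y k - g \<bullet> e k) * (f \<bullet> e k)" using n by (simp add: z)
      then show ?thesis by (simp add: left_diff_distrib)
    qed
    ultimately show ?thesis by (simp add: obs_inner_def sums_unique[symmetric])
  qed
  show "f \<in> conv_set e (fst (noise n x)) \<Longrightarrow>
      obs_inner e (fst x) f = f0 \<bullet> f + obs_inner e (fst (noise n x)) f / sqrt (real n)"
    and "f \<in> conv_set e (snd (noise n x)) \<Longrightarrow>
      obs_inner e (snd x) f = K0 f0 \<bullet> f + obs_inner e (snd (noise n x)) f / sqrt (real n)"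
    by (rule gen; simp add: noise_def)+
qed

text \<open>The exponential in front is the likelihood at the truth, constant in the
  parameter.\<close>

lemma likelihood_eq_lr:
  assumes n: "1 \<le> n" and reg: "regular (noise n x)"
    and f: "f \<in> conv_set e (fst (noise n x))" "K \<theta> f \<in> conv_set e (snd (noise n x))"
  shows "likelihood e K n x \<theta> f = exp (sqrt (real n) * (obs_inner e (fst (noise n x)) f0 + obs_inner e (snd (noise n x)) (K0 f0))
      + real n / 2 * ((norm f0)\<^sup>2 + (norm (K0 f0))\<^sup>2)) * lr n (noise n x) \<theta> f"
proof -
  define z where "z = noise n x"
  define w1 where "w1 = obs_inner e (fst z) f"
  define w2 where "w2 = obs_inner e (snd z) (K \<theta> f)"
  define v1 where "v1 = obs_inner e (fst z) f0"
  define v2 where "v2 = obs_inner e (snd z) (K0 f0)"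
  have 1: "obs_inner e (fst x) f = f0 \<bullet> f + w1 / sqrt (real n)"
    and 2: "obs_inner e (snd x) (K \<theta> f) = K0 f0 \<bullet> K \<theta> f + w2 / sqrt (real n)"
    using obs_inner_eq_noise[OF n] f unfolding w1_def w2_def z_def by blast+
  have 3: "obs_inner e (fst z) (f - f0) = w1 - v1" "obs_inner e (snd z) (K \<theta> f - K0 f0) = w2 - v2"
    using f reg by (auto simp: w1_def w2_def v1_def v2_def z_def regular_def obs_inner_diff)
  have sq: "real n * (y / sqrt (real n)) = sqrt (real n) * y" for y
  proof -
    have "real n * (y / sqrt (real n)) = (real n / sqrt (real n)) * y" by simp
    also have "real n / sqrt (real n) = sqrt (real n)" by (rule real_div_sqrt) simp
    finally show ?thesis .
  qed
  have e1: "real n * (y + w / sqrt (real n)) = real n * y + sqrt (real n) * w" for y w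
    by (simp only: distrib_left sq)
  have nd: "(norm (a - b))\<^sup>2 = (norm a)\<^sup>2 - 2 * (b \<bullet> a) + (norm b)\<^sup>2" for a b :: 'h
    unfolding power2_norm_eq_inner by (simp add: inner_diff_left inner_diff_right inner_commute)
  show ?thesis
    unfolding likelihood_def lr_def log_ratio_def exp_add[symmetric] z_def[symmetric] 3 1 2 nd e1 v1_def[symmetric] v2_def[symmetric]
    by (simp add: field_simps)
qed

lemma measurable_likelihood [measurable]:
  "(\<lambda>w. likelihood e K n x (fst w) (snd w)) \<in> borel_measurable (\<pi>\<theta> \<Otimes>\<^sub>M \<pi>f)"
  "(\<lambda>f. likelihood e K n x \<theta> f) \<in> borel_measurable borel"
proof -
  have [measurable]: "(\<lambda>_. fst x) \<in> M \<rightarrow>\<^sub>M (\<Pi>\<^sub>M k\<in>UNIV. borel)" "(\<lambda>_. snd x) \<in> M \<rightarrow>\<^sub>M (\<Pi>\<^sub>M k\<in>UNIV. borel)" for M :: "'w measure"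
    by (auto simp: space_PiM)
  show "(\<lambda>w. likelihood e K n x (fst w) (snd w)) \<in> borel_measurable (\<pi>\<theta> \<Otimes>\<^sub>M \<pi>f)"
    "(\<lambda>f. likelihood e K n x \<theta> f) \<in> borel_measurable borel"
    unfolding likelihood_def by (measurable; auto simp: space_PiM)+
qed

lemma posterior_eq:
  assumes n: "1 \<le> n" and reg: "regular (noise n x)"
  shows "posterior e K \<pi>\<theta> \<pi>f n x = bayes (\<pi>\<theta> \<Otimes>\<^sub>M \<pi>f) (\<lambda>w. lr n (noise n x) (fst w) (snd w))"
  unfolding posterior_def case_prod_unfold
proof (rule bayes_cong_scale)
  have "AE w in \<pi>\<theta> \<Otimes>\<^sub>M \<pi>f. snd w \<in> conv_set e (fst (noise n x)) \<and> K (fst w) (snd w) \<in> conv_set e (snd (noise n x))"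
    using reg by (simp add: regular_def)
  then show "AE w in \<pi>\<theta> \<Otimes>\<^sub>M \<pi>f. likelihood e K n x (fst w) (snd w) =
    exp (sqrt (real n) * (obs_inner e (fst (noise n x)) f0 + obs_inner e (snd (noise n x)) (K0 f0))
      + real n / 2 * ((norm f0)\<^sup>2 + (norm (K0 f0))\<^sup>2)) * lr n (noise n x) (fst w) (snd w)"
    by eventually_elim (rule likelihood_eq_lr[OF n reg]; simp)
qed (auto simp: lr_def intro: measurable_lr[unfolded lr_def])

lemma posterior_known_eq:
  assumes n: "1 \<le> n" and reg: "regular (noise n x)"
  shows "posterior_known e K \<theta>0 \<pi>f n x = bayes \<pi>f (lr n (noise n x) \<theta>0)"
  unfolding posterior_known_def
proof (rule bayes_cong_scale)
  have "AE f in \<pi>f. f \<in> conv_set e (fst (noise n x)) \<and> K0 f \<in> conv_set e (snd (noise n x))"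
    using reg by (simp add: regular_def)
  then show "AE f in \<pi>f. likelihood e K n x \<theta>0 f =
    exp (sqrt (real n) * (obs_inner e (fst (noise n x)) f0 + obs_inner e (snd (noise n x)) (K0 f0))
      + real n / 2 * ((norm f0)\<^sup>2 + (norm (K0 f0))\<^sup>2)) * lr n (noise n x) \<theta>0 f"
    by eventually_elim (rule likelihood_eq_lr[OF n reg]; simp)
qed (auto simp: lr_def)

lemma nn_integral_prior:
  assumes [measurable]: "F \<in> borel_measurable \<pi>\<theta>"
  shows "(\<integral>\<^sup>+\<theta>. F \<theta> \<partial>\<pi>\<theta>) = (\<integral>\<^sup>+\<theta>. ennreal (p \<theta>) * F \<theta> * indicator \<Theta> \<theta> \<partial>lborel)"
proof -
  have [measurable]: "p \<in> borel_measurable (restrict_space lborel \<Theta>)"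
    using borel_measurable_continuous_on_restrict[OF p_cont] by (simp cong: measurable_cong_sets add: sets_restrict_space)
  have [measurable]: "F \<in> borel_measurable (restrict_space lborel \<Theta>)"
    using assms by (simp cong: measurable_cong_sets add: sets_restrict_space)
  have "(\<integral>\<^sup>+\<theta>. F \<theta> \<partial>\<pi>\<theta>) = (\<integral>\<^sup>+\<theta>. ennreal (p \<theta>) * F \<theta> \<partial>restrict_space lborel \<Theta>)"
    unfolding param_prior_def by (rule nn_integral_density) measurable
  also have "\<dots> = (\<integral>\<^sup>+\<theta>. ennreal (p \<theta>) * F \<theta> * indicator \<Theta> \<theta> \<partial>lborel)"
    by (rule nn_integral_restrict_space) simp
  finally show ?thesis .
qed

lemma sets_prior_iff: "E \<in> sets \<pi>\<theta> \<longleftrightarrow> E \<in> sets borel \<and> E \<subseteq> \<Theta>"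
  by (auto simp: sets_restrict_space_iff)

lemma emeasure_prior:
  assumes E: "E \<in> sets borel" "E \<subseteq> \<Theta>"
  shows "emeasure \<pi>\<theta> E = (\<integral>\<^sup>+\<theta>. ennreal (p \<theta>) * indicator E \<theta> \<partial>lborel)"
proof -
  have Em [measurable]: "E \<in> sets \<pi>\<theta>" using E sets_prior_iff by blast
  have "emeasure \<pi>\<theta> E = (\<integral>\<^sup>+\<theta>. indicator E \<theta> \<partial>\<pi>\<theta>)"
    by (rule nn_integral_indicator[OF Em, symmetric])
  also have "\<dots> = (\<integral>\<^sup>+\<theta>. ennreal (p \<theta>) * indicator E \<theta> * indicator \<Theta> \<theta> \<partial>lborel)"
    by (rule nn_integral_prior) measurable
  also have "\<dots> = (\<integral>\<^sup>+\<theta>. ennreal (p \<theta>) * indicator E \<theta> \<partial>lborel)"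
    using E by (intro nn_integral_cong) (auto simp: indicator_def)
  finally show ?thesis .
qed

text \<open>For a shift by \<open>u *\<^sub>R \<gamma> n\<close> the proof uses the pairs (s, t) =
  (-u, u) and (0, u): the prior against its shift by -u, and the shift by u against the prior. B is
  a measurable hull of the exceptional set, common to all u.\<close>

lemma shift_densities:
  "\<exists>L B. \<forall>n\<ge>1. B n \<in> sets borel \<and> measure \<pi>f (B n) \<le> exp (- (3 * (real n * (\<epsilon> n)\<^sup>2))) \<and>
     (\<forall>u. \<bar>u\<bar> < \<epsilon> n \<longrightarrow>
        log_density_version (shifted_law \<pi>f 0) (shifted_law \<pi>f (- (u *\<^sub>R \<gamma> n))) (L n (- u) u) \<and>
        log_density_version (shifted_law \<pi>f (u *\<^sub>R \<gamma> n)) (shifted_law \<pi>f 0) (L n 0 u) \<and>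
        (\<forall>f. f \<notin> B n \<longrightarrow> \<bar>L n (- u) u f\<bar> \<le> \<eta> n * (1 + real n * u\<^sup>2) \<and> \<bar>L n 0 u f\<bar> \<le> \<eta> n * (1 + real n * u\<^sup>2)))"
proof -
  interpret prob_space \<pi>f by (rule \<pi>f_prob)
  have "\<exists>L B. B \<in> sets borel \<and> measure \<pi>f B \<le> exp (- (3 * (real n * (\<epsilon> n)\<^sup>2))) \<and>
     (\<forall>u. \<bar>u\<bar> < \<epsilon> n \<longrightarrow>
        log_density_version (shifted_law \<pi>f 0) (shifted_law \<pi>f (- (u *\<^sub>R \<gamma> n))) (L (- u) u) \<and>
        log_density_version (shifted_law \<pi>f (u *\<^sub>R \<gamma> n)) (shifted_law \<pi>f 0) (L 0 u) \<and>
        (\<forall>f. f \<notin> B \<longrightarrow> \<bar>L (- u) u f\<bar> \<le> \<eta> n * (1 + real n * u\<^sup>2) \<and> \<bar>L 0 u f\<bar> \<le> \<eta> n * (1 + real n * u\<^sup>2)))"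
    if n: "1 \<le> n" for n
  proof -
    let ?J = "{- \<epsilon> n<..<\<epsilon> n}"
    obtain L :: "real \<Rightarrow> real \<Rightarrow> 'h \<Rightarrow> real" where
      L: "\<And>s t. s \<in> ?J \<Longrightarrow> t \<in> ?J \<Longrightarrow> log_density_version (shifted_law \<pi>f ((s + t) *\<^sub>R \<gamma> n)) (shifted_law \<pi>f (s *\<^sub>R \<gamma> n)) (L s t)"
      and out: "outer_measure_of \<pi>f {f. \<exists>s\<in>?J. \<exists>t\<in>?J. \<bar>L s t f\<bar> > \<eta> n * (1 + real n * t\<^sup>2)}
        \<le> ennreal (exp (- (3 * real n * (\<epsilon> n)\<^sup>2)))"
      using prior_shift n by blast
    obtain B where B: "B \<in> sets \<pi>f" "{f. \<exists>s\<in>?J. \<exists>t\<in>?J. \<bar>L s t f\<bar> > \<eta> n * (1 + real n * t\<^sup>2)} \<subseteq> B"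
      "outer_measure_of \<pi>f {f. \<exists>s\<in>?J. \<exists>t\<in>?J. \<bar>L s t f\<bar> > \<eta> n * (1 + real n * t\<^sup>2)} = emeasure \<pi>f B"
      using outer_measure_of_attain[of "{f. \<exists>s\<in>?J. \<exists>t\<in>?J. \<bar>L s t f\<bar> > \<eta> n * (1 + real n * t\<^sup>2)}" \<pi>f] by auto
    have \<epsilon>: "0 < \<epsilon> n" using \<epsilon>_pos n by blast
    show ?thesis
    proof (intro exI[of _ L] exI[of _ B] conjI allI impI)
      show "B \<in> sets borel" using B(1) by simp
      show "measure \<pi>f B \<le> exp (- (3 * (real n * (\<epsilon> n)\<^sup>2)))"
        using out unfolding B(3) by (simp add: emeasure_eq_measure mult.assoc)
    next
      fix u :: real assume "\<bar>u\<bar> < \<epsilon> n"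
      then have u: "u \<in> ?J" "- u \<in> ?J" "0 \<in> ?J" using \<epsilon> by auto
      show "log_density_version (shifted_law \<pi>f 0) (shifted_law \<pi>f (- (u *\<^sub>R \<gamma> n))) (L (- u) u)"
        using L[OF u(2) u(1)] by simp
      show "log_density_version (shifted_law \<pi>f (u *\<^sub>R \<gamma> n)) (shifted_law \<pi>f 0) (L 0 u)"
        using L[OF u(3) u(1)] by simp
      fix f assume f: "f \<notin> B"
      have le: "\<bar>L s t f\<bar> \<le> \<eta> n * (1 + real n * t\<^sup>2)" if "s \<in> ?J" "t \<in> ?J" for s t
      proof (rule ccontr)
        assume "\<not> \<bar>L s t f\<bar> \<le> \<eta> n * (1 + real n * t\<^sup>2)"
        then have "\<exists>s\<in>?J. \<exists>t\<in>?J. \<bar>L s t f\<bar> > \<eta> n * (1 + real n * t\<^sup>2)"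
          using that by (intro bexI[of _ s] bexI[of _ t]) (auto simp: not_le)
        then show False using B(2) f by blast
      qed
      show "\<bar>L (- u) u f\<bar> \<le> \<eta> n * (1 + real n * u\<^sup>2)" by (rule le[OF u(2) u(1)])
      show "\<bar>L 0 u f\<bar> \<le> \<eta> n * (1 + real n * u\<^sup>2)" by (rule le[OF u(3) u(1)])
    qed
  qed
  then show ?thesis by metis
qed

lemma exp_n\<epsilon>_tendsto: "0 < c \<Longrightarrow> (\<lambda>n. exp (- (c * (real n * (\<epsilon> n)\<^sup>2)))) \<longlonglongrightarrow> 0"
proof -
  assume "0 < c"
  then have "filterlim (\<lambda>n. c * (real n * (\<epsilon> n)\<^sup>2)) at_top sequentially"
    by (rule filterlim_tendsto_pos_mult_at_top[OF tendsto_const _ n\<epsilon>_at_top])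
  then have "filterlim (\<lambda>n. - (c * (real n * (\<epsilon> n)\<^sup>2))) at_bot sequentially"
    by (simp add: filterlim_uminus_at_bot)
  then show ?thesis by (rule filterlim_compose[OF exp_at_bot])
qed

text \<open>The exponent 194/65 is 3 - 1/65: prior mass of the exceptional set relative to that of
  the small ball. The factor 5/4 bounds the squared distances on the ball in units of
  \<epsilon>^2.\<close>

lemma whp_negligible:
  fixes M :: "'w measure" and a b :: "'w \<Rightarrow> 'h" and A B :: "nat \<Rightarrow> 'w set" and C \<delta> :: real
  assumes M: "finite_measure M" and meas: "a \<in> borel_measurable M" "b \<in> borel_measurable M"
    and A: "\<And>n. 1 \<le> n \<Longrightarrow> A n \<in> sets M"
    and ev: "\<forall>\<^sub>F n in sequentially. B n \<in> sets M \<and> 0 < measure M (B n)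
      \<and> (\<forall>w\<in>B n. (norm (a w))\<^sup>2 + (norm (b w))\<^sup>2 \<le> 5 / 4 * (\<epsilon> n)\<^sup>2)
      \<and> measure M (A n) \<le> C * exp (- (194 / 65 * (real n * (\<epsilon> n)\<^sup>2))) * measure M (B n)"
    and C: "0 \<le> C" and \<delta>: "0 < \<delta>"
  shows "whp P (\<lambda>n x. (\<integral>\<^sup>+w. ennreal (exp (log_ratio e n (noise n x) (a w) (b w))) * indicator (A n) w \<partial>M)
        \<le> ennreal \<delta> * (\<integral>\<^sup>+w. ennreal (exp (log_ratio e n (noise n x) (a w) (b w))) \<partial>M))"
proof (rule whp_noiseI)
  fix \<tau> :: real assume \<tau>: "0 < \<tau>"
  let ?X = "\<lambda>n. real n * (\<epsilon> n)\<^sup>2"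
  have "(\<lambda>n. C * exp (- (64 / 65 * ?X n)) + exp (- (3 / 4 * ?X n)) / \<delta>) \<longlonglongrightarrow> C * 0 + 0 / \<delta>"
    using \<delta> by (intro tendsto_intros exp_n\<epsilon>_tendsto) auto
  then have "\<forall>\<^sub>F n in sequentially. C * exp (- (64 / 65 * ?X n)) + exp (- (3 / 4 * ?X n)) / \<delta> < \<tau>"
    by (rule order_tendstoD(2)) (use \<tau> in simp)
  with ev eventually_ge_at_top[of 1]
  show "\<forall>\<^sub>F n in sequentially. \<exists>E\<in>sets white_noise. emeasure white_noise E \<le> ennreal \<tau> \<and>
      (\<forall>z. z \<notin> E \<longrightarrow> (\<integral>\<^sup>+w. ennreal (exp (log_ratio e n z (a w) (b w))) * indicator (A n) w \<partial>M)
        \<le> ennreal \<delta> * (\<integral>\<^sup>+w. ennreal (exp (log_ratio e n z (a w) (b w))) \<partial>M))"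
  proof eventually_elim
    case (elim n)
    \<comment> \<open>Any exponent strictly between 5/4 and 194/65 makes both probabilities vanish;
      the choice 2 leaves 64/65 and 3/4.\<close>
    define t where "t = exp (- (2 * ?X n))"
    define k where "k = C * exp (- (194 / 65 * ?X n))"
    have "\<exists>E\<in>sets white_noise. emeasure white_noise E \<le> ennreal (k / t + t * exp (real n * (5 / 4 * (\<epsilon> n)\<^sup>2)) / \<delta>) \<and>
      (\<forall>z. z \<notin> E \<longrightarrow> (\<integral>\<^sup>+w. ennreal (exp (log_ratio e n z (a w) (b w))) * indicator (A n) w \<partial>M)
        \<le> ennreal \<delta> * (\<integral>\<^sup>+w. ennreal (exp (log_ratio e n z (a w) (b w))) \<partial>M))"
      using elim A[of n] C \<delta> by (intro ratio_mass_negligible[where B = "B n"] M meas) (auto simp: t_def k_def)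
    then obtain E where E: "E \<in> sets white_noise" "emeasure white_noise E \<le> ennreal (k / t + t * exp (real n * (5 / 4 * (\<epsilon> n)\<^sup>2)) / \<delta>)"
      "\<forall>z. z \<notin> E \<longrightarrow> (\<integral>\<^sup>+w. ennreal (exp (log_ratio e n z (a w) (b w))) * indicator (A n) w \<partial>M)
        \<le> ennreal \<delta> * (\<integral>\<^sup>+w. ennreal (exp (log_ratio e n z (a w) (b w))) \<partial>M)"
      by blast
    have "k / t = C * exp (- (64 / 65 * ?X n))"
      unfolding k_def t_def times_divide_eq_right[symmetric] exp_diff[symmetric] by simp
    moreover have "t * exp (real n * (5 / 4 * (\<epsilon> n)\<^sup>2)) = exp (- (3 / 4 * ?X n))"
      unfolding t_def exp_add[symmetric] by (simp add: algebra_simps)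
    ultimately have "ennreal (k / t + t * exp (real n * (5 / 4 * (\<epsilon> n)\<^sup>2)) / \<delta>) \<le> ennreal \<tau>"
      using elim(3) by (intro ennreal_leI) simp
    with E show ?case by (intro bexI[of _ E]) (auto intro: order_trans)
  qed
qed

lemma norm_K_diff: "\<theta> \<in> \<Theta> \<Longrightarrow> norm (K \<theta> f - K0 f0) \<le> D3 * \<bar>\<theta> - \<theta>0\<bar> * norm f0 + D3 * norm (f - f0)"
proof -
  assume "\<theta> \<in> \<Theta>"
  then have "norm (K \<theta> f - K0 f0) \<le> D3 * \<bar>\<theta> - \<theta>0\<bar> * min (norm f) (norm f0) + D3 * norm (f - f0)"
    using K_lip \<theta>0_in by blast
  also have "\<dots> \<le> D3 * \<bar>\<theta> - \<theta>0\<bar> * norm f0 + D3 * norm (f - f0)"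
    using D3_nonneg by (intro add_right_mono mult_left_mono) auto
  finally show ?thesis .
qed

text \<open>The denominator 2 D3 + 2 is chosen so that both f - f0 and its Lipschitz image stay
  within \<epsilon> / 2.\<close>

lemma prior_ball_radius:
  assumes "1 \<le> n" and f: "norm (f - f0) \<le> \<epsilon> n / (2 * D3 + 2)"
  shows "norm (f - f0) \<le> \<epsilon> n / 2" "D3 * norm (f - f0) \<le> \<epsilon> n / 2"
proof -
  have \<epsilon>: "0 < \<epsilon> n" using \<epsilon>_pos assms(1) by blast
  have "(2 * D3 + 2) * norm (f - f0) \<le> \<epsilon> n"
    using f D3_nonneg by (simp add: field_simps pos_le_divide_eq)
  then have *: "2 * (D3 * norm (f - f0)) + 2 * norm (f - f0) \<le> \<epsilon> n" by (simp add: algebra_simps)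
  moreover have "0 \<le> D3 * norm (f - f0)" using D3_nonneg by simp
  ultimately show "norm (f - f0) \<le> \<epsilon> n / 2" "D3 * norm (f - f0) \<le> \<epsilon> n / 2"
    using norm_ge_zero[of "f - f0"] by linarith+
qed

lemma whp_negligible_known:
  assumes B: "\<And>n. 1 \<le> n \<Longrightarrow> B n \<in> sets borel" "\<And>n. 1 \<le> n \<Longrightarrow> measure \<pi>f (B n) \<le> exp (- (3 * (real n * (\<epsilon> n)\<^sup>2)))"
    and \<delta>: "0 < \<delta>"
  shows "whp P (\<lambda>n x. (\<integral>\<^sup>+f. ennreal (lr n (noise n x) \<theta>0 f) * indicator (B n) f \<partial>\<pi>f)
        \<le> ennreal \<delta> * (\<integral>\<^sup>+f. ennreal (lr n (noise n x) \<theta>0 f) \<partial>\<pi>f))"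
  unfolding lr_def
proof (rule whp_negligible[where C = 1 and B = "\<lambda>n. {f. norm (f - f0) \<le> \<epsilon> n / (2 * D3 + 2)}"])
  interpret prob_space \<pi>f by (rule \<pi>f_prob)
  show "finite_measure \<pi>f" by unfold_locales
  show "\<forall>\<^sub>F n in sequentially. {f. norm (f - f0) \<le> \<epsilon> n / (2 * D3 + 2)} \<in> sets \<pi>f
      \<and> 0 < measure \<pi>f {f. norm (f - f0) \<le> \<epsilon> n / (2 * D3 + 2)}
      \<and> (\<forall>w\<in>{f. norm (f - f0) \<le> \<epsilon> n / (2 * D3 + 2)}. (norm (w - f0))\<^sup>2 + (norm (K0 w - K0 f0))\<^sup>2 \<le> 5 / 4 * (\<epsilon> n)\<^sup>2)
      \<and> measure \<pi>f (B n) \<le> 1 * exp (- (194 / 65 * (real n * (\<epsilon> n)\<^sup>2))) * measure \<pi>f {f. norm (f - f0) \<le> \<epsilon> n / (2 * D3 + 2)}"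
    using eventually_ge_at_top[of 1]
  proof eventually_elim
    case (elim n)
    let ?m = "measure \<pi>f {f. norm (f - f0) \<le> \<epsilon> n / (2 * D3 + 2)}"
    have m: "exp (- (real n * (\<epsilon> n)\<^sup>2 / 65)) \<le> ?m" using prior_mass elim by blast
    have "measure \<pi>f (B n) \<le> exp (- (3 * (real n * (\<epsilon> n)\<^sup>2)))" using B elim by blast
    also have "\<dots> = exp (- (194 / 65 * (real n * (\<epsilon> n)\<^sup>2))) * exp (- (real n * (\<epsilon> n)\<^sup>2 / 65))"
      by (simp add: exp_add[symmetric])
    also have "\<dots> \<le> exp (- (194 / 65 * (real n * (\<epsilon> n)\<^sup>2))) * ?m" using m by simp
    finally have 1: "measure \<pi>f (B n) \<le> 1 * exp (- (194 / 65 * (real n * (\<epsilon> n)\<^sup>2))) * ?m" by simp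
    have 2: "0 < ?m" using m by (rule less_le_trans[rotated]) simp
    have 3: "(norm (w - f0))\<^sup>2 + (norm (K0 w - K0 f0))\<^sup>2 \<le> 5 / 4 * (\<epsilon> n)\<^sup>2"
      if "norm (w - f0) \<le> \<epsilon> n / (2 * D3 + 2)" for w
    proof -
      have "norm (w - f0) \<le> \<epsilon> n / 2" "norm (K0 w - K0 f0) \<le> \<epsilon> n / 2"
        using prior_ball_radius[OF elim that] norm_K_diff[OF \<theta>0_in, of w] by auto
      then have "(norm (w - f0))\<^sup>2 \<le> (\<epsilon> n / 2)\<^sup>2" "(norm (K0 w - K0 f0))\<^sup>2 \<le> (\<epsilon> n / 2)\<^sup>2"
        by (auto intro!: power_mono)
      moreover have "(\<epsilon> n / 2)\<^sup>2 = (\<epsilon> n)\<^sup>2 / 4" by (simp add: power_divide)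
      ultimately show ?thesis using zero_le_power2[of "\<epsilon> n"] by linarith
    qed
    have 4: "{f. norm (f - f0) \<le> \<epsilon> n / (2 * D3 + 2)} \<in> sets \<pi>f" by measurable
    show ?case using 1 2 3 4 by blast
  qed
qed (use B \<delta> in auto)

text \<open>Both the exceptional set and the neighbourhood in the denominator carry a factor of order
  \<open>\<epsilon>\<^sub>n\<close> from the prior of \<open>\<theta>\<close>. These cancel, which matters since \<open>\<epsilon>\<^sub>n\<close> need not exceed
  \<open>exp (- c n \<epsilon>\<^sub>n\<^sup>2)\<close>.\<close>

lemma whp_negligible_full:
  assumes B: "\<And>n. 1 \<le> n \<Longrightarrow> B n \<in> sets borel" "\<And>n. 1 \<le> n \<Longrightarrow> measure \<pi>f (B n) \<le> exp (- (3 * (real n * (\<epsilon> n)\<^sup>2)))"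
    and \<delta>: "0 < \<delta>"
  shows "whp P (\<lambda>n x. (\<integral>\<^sup>+w. ennreal (lr n (noise n x) (fst w) (snd w)) * indicator ({\<theta>\<in>\<Theta>. \<bar>\<theta> - \<theta>0\<bar> < \<epsilon> n} \<times> B n) w \<partial>(\<pi>\<theta> \<Otimes>\<^sub>M \<pi>f))
        \<le> ennreal \<delta> * (\<integral>\<^sup>+w. ennreal (lr n (noise n x) (fst w) (snd w)) \<partial>(\<pi>\<theta> \<Otimes>\<^sub>M \<pi>f)))"
proof -
  interpret T: prob_space \<pi>\<theta> by (rule prior_prob)
  interpret F: prob_space \<pi>f by (rule \<pi>f_prob)
  interpret TF: prob_space "\<pi>\<theta> \<Otimes>\<^sub>M \<pi>f" by (rule prob_space_P')
  obtain c0 C0 where p: "0 < c0" "\<And>\<theta>. \<theta> \<in> \<Theta> \<Longrightarrow> c0 \<le> p \<theta>" "\<And>\<theta>. \<theta> \<in> \<Theta> \<Longrightarrow> p \<theta> \<le> C0"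
    using p_bounds by blast
  have C0: "0 < C0" using p(2,3)[OF \<theta>0_in] p(1) by linarith
  obtain r where r: "0 < r" "ball \<theta>0 r \<subseteq> \<Theta>" using interior by (meson mem_interior)
  \<comment> \<open>Shrinking the \<theta>-interval by c keeps the contribution of \<theta> to the
    distance in the second component at most \<epsilon> / 2; together with that of f it is at most
    \<epsilon>.\<close>
  define c where "c = 1 / (2 * D3 * norm f0 + 1)"
  have den: "0 < 2 * D3 * norm f0 + 1" using D3_nonneg by (simp add: add_nonneg_pos)
  have c: "0 < c" "c \<le> 1" "D3 * c * norm f0 \<le> 1 / 2"
    using den D3_nonneg by (auto simp: c_def field_simps)
  let ?A = "\<lambda>n. {\<theta>\<in>\<Theta>. \<bar>\<theta> - \<theta>0\<bar> < \<epsilon> n}"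
  let ?T = "\<lambda>n. {\<theta>0 - c * \<epsilon> n..\<theta>0 + c * \<epsilon> n}"
  let ?F = "\<lambda>n. {f. norm (f - f0) \<le> \<epsilon> n / (2 * D3 + 2)}"
  have A_meas: "?A n \<in> sets \<pi>\<theta>" for n
  proof -
    have "{\<theta>\<in>\<Theta>. \<bar>\<theta> - \<theta>0\<bar> < \<epsilon> n} = \<Theta> \<inter> {\<theta>. \<bar>\<theta> - \<theta>0\<bar> < \<epsilon> n}" by auto
    also have "\<dots> \<in> sets borel" by measurable
    finally show ?thesis unfolding sets_prior_iff by auto
  qed
  show ?thesis
    unfolding lr_def
  proof (rule whp_negligible[where C = "C0 / (c0 * c)" and B = "\<lambda>n. ?T n \<times> ?F n"])
    show "finite_measure (\<pi>\<theta> \<Otimes>\<^sub>M \<pi>f)" by unfold_locales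
    show "?A n \<times> B n \<in> sets (\<pi>\<theta> \<Otimes>\<^sub>M \<pi>f)" if "1 \<le> n" for n using A_meas B(1)[OF that] by auto
    show "0 \<le> C0 / (c0 * c)" using C0 p(1) c by simp
    show "0 < \<delta>" by fact
    have "\<forall>\<^sub>F n in sequentially. \<epsilon> n < r" by (rule order_tendstoD(2)[OF \<epsilon>_lim r(1)])
    then show "\<forall>\<^sub>F n in sequentially. ?T n \<times> ?F n \<in> sets (\<pi>\<theta> \<Otimes>\<^sub>M \<pi>f)
      \<and> 0 < measure (\<pi>\<theta> \<Otimes>\<^sub>M \<pi>f) (?T n \<times> ?F n)
      \<and> (\<forall>w\<in>?T n \<times> ?F n. (norm (snd w - f0))\<^sup>2 + (norm (K (fst w) (snd w) - K0 f0))\<^sup>2 \<le> 5 / 4 * (\<epsilon> n)\<^sup>2)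
      \<and> measure (\<pi>\<theta> \<Otimes>\<^sub>M \<pi>f) (?A n \<times> B n)
        \<le> C0 / (c0 * c) * exp (- (194 / 65 * (real n * (\<epsilon> n)\<^sup>2))) * measure (\<pi>\<theta> \<Otimes>\<^sub>M \<pi>f) (?T n \<times> ?F n)"
      using eventually_ge_at_top[of 1]
    proof eventually_elim
      case (elim n)
      have \<epsilon>: "0 < \<epsilon> n" using \<epsilon>_pos elim by blast
      have c\<epsilon>: "c * \<epsilon> n \<le> \<epsilon> n" "0 < c * \<epsilon> n" using c \<epsilon> by (auto simp: mult_le_cancel_right1)
      have T_sub: "?T n \<subseteq> \<Theta>" using r(2) c\<epsilon> elim by (force simp: dist_real_def)
      have T_meas: "?T n \<in> sets \<pi>\<theta>" unfolding sets_prior_iff using T_sub by auto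
      have F_meas: "?F n \<in> sets \<pi>f" by measurable
      have B_meas: "B n \<in> sets \<pi>f" using B(1) elim by simp
      have mT: "c0 * (2 * (c * \<epsilon> n)) \<le> measure \<pi>\<theta> (?T n)"
      proof -
        have "ennreal (c0 * (2 * (c * \<epsilon> n))) = (\<integral>\<^sup>+\<theta>. ennreal c0 * indicator (?T n) \<theta> \<partial>lborel)"
          using p(1) c\<epsilon> by (simp add: nn_integral_cmult ennreal_mult)
        also have "\<dots> \<le> (\<integral>\<^sup>+\<theta>. ennreal (p \<theta>) * indicator (?T n) \<theta> \<partial>lborel)"
          using T_sub p(2) by (intro nn_integral_mono) (auto simp: indicator_def intro!: ennreal_leI)
        also have "\<dots> = ennreal (measure \<pi>\<theta> (?T n))" using emeasure_prior[of "?T n"] T_sub by (simp add: T.emeasure_eq_measure)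
        finally show ?thesis by simp
      qed
      have mA: "measure \<pi>\<theta> (?A n) \<le> C0 * (2 * \<epsilon> n)"
      proof -
        have Ab: "?A n \<in> sets borel" "?A n \<subseteq> \<Theta>" using A_meas unfolding sets_prior_iff by auto
        have "ennreal (measure \<pi>\<theta> (?A n)) = (\<integral>\<^sup>+\<theta>. ennreal (p \<theta>) * indicator (?A n) \<theta> \<partial>lborel)"
          using emeasure_prior[OF Ab] by (simp add: T.emeasure_eq_measure)
        also have "\<dots> \<le> (\<integral>\<^sup>+\<theta>. ennreal C0 * indicator {\<theta>0 - \<epsilon> n..\<theta>0 + \<epsilon> n} \<theta> \<partial>lborel)"
          using p(3) by (intro nn_integral_mono) (auto simp: indicator_def intro!: ennreal_leI)
        also have "\<dots> = ennreal (C0 * (2 * \<epsilon> n))" using C0 \<epsilon> by (simp add: nn_integral_cmult ennreal_mult)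
        finally show ?thesis using C0 \<epsilon> by simp
      qed
      have mF: "exp (- (real n * (\<epsilon> n)\<^sup>2 / 65)) \<le> measure \<pi>f (?F n)" using prior_mass elim by blast
      have TF: "measure (\<pi>\<theta> \<Otimes>\<^sub>M \<pi>f) (X \<times> Y) = measure \<pi>\<theta> X * measure \<pi>f Y" if "X \<in> sets \<pi>\<theta>" "Y \<in> sets \<pi>f" for X Y
        using F.emeasure_pair_measure_Times[OF that] by (simp add: measure_def enn2real_mult)
      have pos: "0 < c0 * (2 * (c * \<epsilon> n)) * exp (- (real n * (\<epsilon> n)\<^sup>2 / 65))" using p(1) c\<epsilon> by simp
      have BB: "c0 * (2 * (c * \<epsilon> n)) * exp (- (real n * (\<epsilon> n)\<^sup>2 / 65)) \<le> measure (\<pi>\<theta> \<Otimes>\<^sub>M \<pi>f) (?T n \<times> ?F n)"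
        unfolding TF[OF T_meas F_meas] using p(1) c\<epsilon> by (intro mult_mono mT mF) auto
      have "measure (\<pi>\<theta> \<Otimes>\<^sub>M \<pi>f) (?A n \<times> B n) \<le> (C0 * (2 * \<epsilon> n)) * exp (- (3 * (real n * (\<epsilon> n)\<^sup>2)))"
        unfolding TF[OF A_meas B_meas] using C0 \<epsilon> B(2) elim by (intro mult_mono mA) auto
      also have "exp (- (3 * (real n * (\<epsilon> n)\<^sup>2))) = exp (- (194 / 65 * (real n * (\<epsilon> n)\<^sup>2))) * exp (- (real n * (\<epsilon> n)\<^sup>2 / 65))"
        by (simp add: exp_add[symmetric])
      also have "(C0 * (2 * \<epsilon> n)) * (exp (- (194 / 65 * (real n * (\<epsilon> n)\<^sup>2))) * exp (- (real n * (\<epsilon> n)\<^sup>2 / 65)))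
        = C0 / (c0 * c) * exp (- (194 / 65 * (real n * (\<epsilon> n)\<^sup>2))) * (c0 * (2 * (c * \<epsilon> n)) * exp (- (real n * (\<epsilon> n)\<^sup>2 / 65)))"
        using p(1) c by (simp add: field_simps)
      also have "\<dots> \<le> C0 / (c0 * c) * exp (- (194 / 65 * (real n * (\<epsilon> n)\<^sup>2))) * measure (\<pi>\<theta> \<Otimes>\<^sub>M \<pi>f) (?T n \<times> ?F n)"
        using BB C0 p(1) c by (intro mult_left_mono) auto
      finally have 1: "measure (\<pi>\<theta> \<Otimes>\<^sub>M \<pi>f) (?A n \<times> B n)
        \<le> C0 / (c0 * c) * exp (- (194 / 65 * (real n * (\<epsilon> n)\<^sup>2))) * measure (\<pi>\<theta> \<Otimes>\<^sub>M \<pi>f) (?T n \<times> ?F n)" .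
      have 2: "0 < measure (\<pi>\<theta> \<Otimes>\<^sub>M \<pi>f) (?T n \<times> ?F n)" using pos BB by (rule less_le_trans)
      have 3: "(norm (snd w - f0))\<^sup>2 + (norm (K (fst w) (snd w) - K0 f0))\<^sup>2 \<le> 5 / 4 * (\<epsilon> n)\<^sup>2" if w: "w \<in> ?T n \<times> ?F n" for w
      proof -
        have f: "norm (snd w - f0) \<le> \<epsilon> n / (2 * D3 + 2)" and t: "\<bar>fst w - \<theta>0\<bar> \<le> c * \<epsilon> n" "fst w \<in> \<Theta>"
          using w T_sub by auto
        have "D3 * \<bar>fst w - \<theta>0\<bar> * norm f0 \<le> D3 * (c * \<epsilon> n) * norm f0"
          using t D3_nonneg by (intro mult_right_mono mult_left_mono) auto
        also have "\<dots> = (D3 * c * norm f0) * \<epsilon> n" by simp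
        also have "\<dots> \<le> 1 / 2 * \<epsilon> n" using c(3) \<epsilon> by (intro mult_right_mono) auto
        finally have "norm (K (fst w) (snd w) - K0 f0) \<le> \<epsilon> n"
          using norm_K_diff[OF t(2), of "snd w"] prior_ball_radius(2)[OF elim(2) f] by linarith
        then have "(norm (K (fst w) (snd w) - K0 f0))\<^sup>2 \<le> (\<epsilon> n)\<^sup>2" "(norm (snd w - f0))\<^sup>2 \<le> (\<epsilon> n / 2)\<^sup>2"
          using prior_ball_radius(1)[OF elim(2) f] by (auto intro!: power_mono)
        then show ?thesis by (simp add: power_divide)
      qed
      have 4: "?T n \<times> ?F n \<in> sets (\<pi>\<theta> \<Otimes>\<^sub>M \<pi>f)" using T_meas F_meas by auto
      show ?case using 1 2 3 4 by blast
    qed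
  qed measurable
qed

end

section \<open>Uniform control of the remainder\<close>

text \<open>A finite bound excludes the value infinity of \<open>onorm_into\<close>, which yields
  membership in S; homogeneity extends the estimate beyond the unit ball.\<close>

lemma onorm_into_bound:
  fixes A :: "'h::real_normed_vector \<Rightarrow>\<^sub>L 'h"
  assumes S: "normed_subspace S nS" and le: "onorm_into S nS (blinfun_apply A) \<le> ereal d"
  shows "A v \<in> S" "nS (A v) \<le> d * norm v"
proof -
  have sub: "subspace S" and hom: "\<And>x c. x \<in> S \<Longrightarrow> nS (c *\<^sub>R x) = \<bar>c\<bar> * nS x" and zero: "\<And>x. x \<in> S \<Longrightarrow> nS x = 0 \<longleftrightarrow> x = 0"
    using S by (auto simp: normed_subspace_def)
  have "A v \<in> S \<and> nS (A v) \<le> d * norm v"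
  proof (cases "v = 0")
    case True
    moreover have "nS 0 = 0" using zero[of 0] sub by (simp add: subspace_0)
    ultimately show ?thesis using sub by (simp add: blinfun.zero_right subspace_0)
  next
    case False
    define w where "w = v /\<^sub>R norm v"
    have "norm w \<le> 1" using False by (simp add: w_def)
    then have "(if A w \<in> S then ereal (nS (A w)) else \<infinity>) \<le> onorm_into S nS (blinfun_apply A)"
      unfolding onorm_into_def by (intro SUP_upper) simp
    also note le
    finally have w: "A w \<in> S" "nS (A w) \<le> d" by (auto split: if_splits)
    have v: "A v = norm v *\<^sub>R A w" using False by (simp add: w_def blinfun.scaleR_right)
    show ?thesis unfolding v
      using w sub hom[OF w(1), of "norm v"] mult_left_mono[OF w(2) norm_ge_zero[of v]]
      by (auto simp: subspace_scale mult.commute)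
  qed
  then show "A v \<in> S" "nS (A v) \<le> d * norm v" by auto
qed

context linear_model
begin

text \<open>At one fixed parameter \<theta>0 + u near \<theta>0 the derivative is 1 / u times the
  difference of two operators that map boundedly into S: the increment of K and its second-order
  remainder.\<close>

lemma K0'_into_S: "\<exists>c\<ge>0. \<forall>v. K0' v \<in> S \<and> nS (K0' v) \<le> c * norm v"
proof -
  have sub: "subspace S" and hom: "\<And>x c. x \<in> S \<Longrightarrow> nS (c *\<^sub>R x) = \<bar>c\<bar> * nS x"
    and tri: "\<And>x y. x \<in> S \<Longrightarrow> y \<in> S \<Longrightarrow> nS (x + y) \<le> nS x + nS y"
    using S_norm by (auto simp: normed_subspace_def)
  obtain r where r: "0 < r" "ball \<theta>0 r \<subseteq> \<Theta>" using interior by (meson mem_interior)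
  define u where "u = r / 2"
  have u: "0 < u" "\<theta>0 + u \<in> \<Theta>" using r by (auto simp: u_def dist_real_def intro!: subsetD[OF r(2)])
  define A where "A = K (\<theta>0 + u) - K0"
  define B where "B = K (\<theta>0 + u) - K0 - u *\<^sub>R K0'"
  have A: "A v \<in> S" "nS (A v) \<le> (D1 * u) * norm v" for v
  proof -
    have "onorm_into S nS (blinfun_apply A) \<le> ereal (D1 * u)"
      unfolding A_def using K_diff[rule_format, OF u(2)] u(1) by simp
    then show "A v \<in> S" "nS (A v) \<le> (D1 * u) * norm v" using onorm_into_bound[OF S_norm] by blast+
  qed
  have B: "B v \<in> S" "nS (B v) \<le> (D2 * u\<^sup>2) * norm v" for v
  proof -
    have "onorm_into S nS (blinfun_apply B) \<le> ereal (D2 * u\<^sup>2)"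
      unfolding B_def using K_diff2[rule_format, OF u(2)] u(1) by simp
    then show "B v \<in> S" "nS (B v) \<le> (D2 * u\<^sup>2) * norm v" using onorm_into_bound[OF S_norm] by blast+
  qed
  have eq: "K0' v = (1 / u) *\<^sub>R (A v + (-1) *\<^sub>R B v)" for v
    using u(1) by (simp add: A_def B_def blinfun.diff_left blinfun.scaleR_left)
  define c where "c = \<bar>D1\<bar> + \<bar>D2\<bar> * u"
  have "K0' v \<in> S \<and> nS (K0' v) \<le> c * norm v" for v
  proof
    have mem: "(-1) *\<^sub>R B v \<in> S" using sub B by (intro subspace_scale)
    then have mem2: "A v + (-1) *\<^sub>R B v \<in> S" using sub A by (intro subspace_add)
    then show "K0' v \<in> S" unfolding eq using sub by (intro subspace_scale)
    have "nS (A v + (-1) *\<^sub>R B v) \<le> nS (A v) + nS ((-1) *\<^sub>R B v)" by (rule tri[OF A(1) mem])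
    also have "nS ((-1) *\<^sub>R B v) = nS (B v)" using hom[OF B(1), of "-1"] by simp
    also have "nS (A v) + nS (B v) \<le> (D1 * u) * norm v + (D2 * u\<^sup>2) * norm v" by (intro add_mono A B)
    also have "\<dots> \<le> u * (c * norm v)"
    proof -
      have "D1 * (u * norm v) \<le> \<bar>D1\<bar> * (u * norm v)" "D2 * (u\<^sup>2 * norm v) \<le> \<bar>D2\<bar> * (u\<^sup>2 * norm v)"
        using u(1) by (auto intro!: mult_right_mono)
      then show ?thesis by (simp add: c_def algebra_simps power2_eq_square)
    qed
    finally have "nS (A v + (-1) *\<^sub>R B v) / u \<le> c * norm v" using u(1) by (simp add: field_simps)
    then show "nS (K0' v) \<le> c * norm v" unfolding eq using hom[OF mem2, of "1 / u"] u(1) by simp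
  qed
  moreover have "0 \<le> c" using u(1) by (simp add: c_def)
  ultimately show ?thesis by blast
qed

text \<open>Chaining controls the noise on small vectors of the unit ball of S. The noise integrals
  at \<open>K0' d\<close> and at R are brought there by rescaling, and undoing it returns the
  weights sqrt n |u| and n u^2. The rest is the score difference and the deterministic quadratic
  bound.\<close>

lemma remainder_bound:
  fixes a b \<kappa> r c1 cR cS :: real and z :: obs and \<theta> :: real and f :: 'h
  defines "u \<equiv> \<theta> - \<theta>0" and "c \<equiv> cS * cR"
  assumes n: "1 \<le> n" and reg: "regular z" and \<theta>: "\<theta> \<in> \<Theta>" and u: "\<bar>u\<bar> \<le> \<epsilon> n" and \<epsilon>1: "\<epsilon> n \<le> 1"
    and f: "norm (f - f0) \<le> 2 * \<epsilon> n"
    and pc: "param_conv z \<theta> f"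
    and cS: "0 \<le> cS" "\<And>h. h \<in> S \<Longrightarrow> norm h \<le> cS * nS h"
    and c1: "0 \<le> c1" "\<And>v. K0' v \<in> S \<and> nS (K0' v) \<le> c1 * norm v"
    and cR: "cR = \<bar>D2\<bar> * (norm f0 + 2) + 1"
    and a: "\<bar>score z (\<gamma> n) - score z \<gamma>0\<bar> \<le> a" and b0: "0 \<le> b"
    and b: "\<And>h. h \<in> S \<Longrightarrow> nS h \<le> 1 \<Longrightarrow> norm h \<le> cS * (\<epsilon> n + 1 / sqrt (real n)) \<Longrightarrow> h \<in> conv_set e (snd z)
      \<Longrightarrow> \<bar>obs_inner e (snd z) h\<bar> \<le> b"
    and \<kappa>: "sqrt (real n) * \<bar>K0 (f - f0) \<bullet> K0' (f - f0)\<bar> \<le> \<kappa>"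
    and r: "norm (\<gamma> n - \<gamma>0) \<le> r"
  shows "\<bar>remainder n z \<theta> f\<bar>
    \<le> (1 + real n * u\<^sup>2) * (a + (2 * c1 + 1) * b + cR * b + (\<kappa> + sqrt (real n) * \<epsilon> n * r * (2 + 2 * D0\<^sup>2))
      + (2 * D0 * \<epsilon> n * c + (r * (2 * norm \<gamma>0 + r) + (D0 * r) * (2 * norm (K0 \<gamma>0) + D0 * r))
          + ((2 * D0 + c) * \<epsilon> n) * (2 * norm k0 + (2 * D0 + c) * \<epsilon> n)))"
proof -
  have hom: "\<And>x t. x \<in> S \<Longrightarrow> nS (t *\<^sub>R x) = \<bar>t\<bar> * nS x" and sub: "subspace S"
    and zero: "\<And>x. x \<in> S \<Longrightarrow> nS x = 0 \<longleftrightarrow> x = 0" and nonneg: "\<And>x. x \<in> S \<Longrightarrow> 0 \<le> nS x"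
    using S_norm by (auto simp: normed_subspace_def)
  have conv: "f \<in> conv_set e (fst z)" "K \<theta> f \<in> conv_set e (snd z)" "K0 f \<in> conv_set e (snd z)" "K0' f \<in> conv_set e (snd z)"
    using pc by (auto simp: param_conv_def)
  define d where "d = f - f0"
  define R where "R = (K \<theta> - K0 - u *\<^sub>R K0') f"
  define s where "s = sqrt (real n)"
  have s: "0 < s" "s\<^sup>2 = real n" "1 \<le> s" using n by (auto simp: s_def)
  have \<epsilon>: "0 < \<epsilon> n" using \<epsilon>_pos n by blast
  have cRpos: "1 \<le> cR" by (simp add: cR)
  let ?o1 = "obs_inner e (fst z)" and ?o2 = "obs_inner e (snd z)"
  have R_eq: "R = K \<theta> f - K0 f - u *\<^sub>R K0' f" by (simp add: R_def blinfun.diff_left blinfun.scaleR_left)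
  have R_S: "R \<in> S" "nS R \<le> cR * u\<^sup>2"
  proof -
    have "onorm_into S nS (blinfun_apply (K \<theta> - K0 - u *\<^sub>R K0')) \<le> ereal (D2 * u\<^sup>2)"
      unfolding u_def using K_diff2 \<theta> by blast
    then have "R \<in> S" "nS R \<le> (D2 * u\<^sup>2) * norm f" unfolding R_def using onorm_into_bound[OF S_norm] by blast+
    moreover have "(D2 * u\<^sup>2) * norm f \<le> cR * u\<^sup>2"
    proof -
      have "norm f \<le> norm f0 + 2" using f \<epsilon>1 norm_triangle_sub[of f f0] by linarith
      then have "D2 * norm f \<le> \<bar>D2\<bar> * (norm f0 + 2)" by (intro mult_mono) auto
      then have "D2 * norm f \<le> cR" by (simp add: cR)
      then have "(D2 * norm f) * u\<^sup>2 \<le> cR * u\<^sup>2" by (intro mult_right_mono) auto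
      then show ?thesis by (simp add: mult_ac)
    qed
    ultimately show "R \<in> S" "nS R \<le> cR * u\<^sup>2" by auto
  qed
  have R_norm: "norm R \<le> c * u\<^sup>2"
    using cS(2)[OF R_S(1)] mult_left_mono[OF R_S(2) cS(1)] by (simp add: c_def mult.assoc)
  have conv': "f0 \<in> conv_set e (fst z)" "K0 f0 \<in> conv_set e (snd z)" "k0 \<in> conv_set e (snd z)"
    "\<gamma> n \<in> conv_set e (fst z)" "K0 (\<gamma> n) \<in> conv_set e (snd z)"
    using reg by (auto simp: regular_def)
  have R_conv: "R \<in> conv_set e (snd z)"
    unfolding R_eq by (intro conv_set_diff conv_set_scaleR conv)
  have d_conv: "K0' d \<in> conv_set e (snd z)"
    unfolding d_def blinfun.diff_right by (intro conv_set_diff conv conv')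
  have o_R: "?o2 (K \<theta> f) = ?o2 (K0 f) + u * ?o2 (K0' f) + ?o2 R"
    unfolding R_eq using conv by (simp add: obs_inner_diff obs_inner_scaleR conv_set_diff conv_set_scaleR)
  have o_d: "?o2 (K0' d) = ?o2 (K0' f) - ?o2 k0"
    unfolding d_def blinfun.diff_right using conv conv' by (simp add: obs_inner_diff)
  have o1: "?o1 (f - f0) = ?o1 f - ?o1 f0" "?o1 (f + u *\<^sub>R \<gamma> n - f0) = ?o1 f + u * ?o1 (\<gamma> n) - ?o1 f0"
    using conv conv' by (simp_all add: obs_inner_diff obs_inner_add obs_inner_scaleR conv_set_add conv_set_scaleR)
  have o2: "?o2 (K \<theta> f - K0 f0) = ?o2 (K \<theta> f) - ?o2 (K0 f0)"
    "?o2 (K0 (f + u *\<^sub>R \<gamma> n) - K0 f0) = ?o2 (K0 f) + u * ?o2 (K0 (\<gamma> n)) - ?o2 (K0 f0)"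
    using conv conv' unfolding blinfun.add_right blinfun.scaleR_right
    by (simp_all add: obs_inner_diff obs_inner_add obs_inner_scaleR conv_set_add conv_set_scaleR)
  define Q where "Q = (- real n / 2 * ((norm d)\<^sup>2 + (norm (K0 d + u *\<^sub>R k0 + u *\<^sub>R K0' d + R))\<^sup>2))
      - (- real n / 2 * ((norm (d + u *\<^sub>R \<gamma> n))\<^sup>2 + (norm (K0 (d + u *\<^sub>R \<gamma> n)))\<^sup>2))"
  have I0: "I0 = (norm \<gamma>0)\<^sup>2 + (norm (k0 - K0 \<gamma>0))\<^sup>2" by (simp add: efficient_info_def Let_def)
  have v1: "K \<theta> f - K0 f0 = K0 d + u *\<^sub>R k0 + u *\<^sub>R K0' d + R"
    by (simp add: R_eq d_def blinfun.diff_right scaleR_diff_right)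
  have v2: "f + u *\<^sub>R \<gamma> n - f0 = d + u *\<^sub>R \<gamma> n" by (simp add: d_def)
  have v3: "K0 (f + u *\<^sub>R \<gamma> n) - K0 f0 = K0 (d + u *\<^sub>R \<gamma> n)"
    by (simp add: d_def blinfun.diff_right blinfun.add_right)
  \<comment> \<open>Writing \<open>K0' f\<close> as \<open>k0 + K0' d\<close> separates the score
    from a small noise term; Q collects the deterministic part.\<close>
  have split: "log_ratio e n z (f - f0) (K \<theta> f - K0 f0) - log_ratio e n z (f + u *\<^sub>R \<gamma> n - f0) (K0 (f + u *\<^sub>R \<gamma> n) - K0 f0)
      = s * u * score z (\<gamma> n) + s * u * ?o2 (K0' d) + s * ?o2 R + Q"
  proof -
    have "s * (?o1 (f - f0) + ?o2 (K \<theta> f - K0 f0)) - s * (?o1 (f + u *\<^sub>R \<gamma> n - f0) + ?o2 (K0 (f + u *\<^sub>R \<gamma> n) - K0 f0))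
      = s * u * score z (\<gamma> n) + s * u * ?o2 (K0' d) + s * ?o2 R"
      unfolding o1 o2 o_R o_d score_def by (simp add: algebra_simps)
    then show ?thesis
      unfolding log_ratio_def s_def[symmetric] Q_def v1 v2 v3 d_def[symmetric] by (simp add: algebra_simps)
  qed
  have foc: "\<gamma>0 \<bullet> v + K0 \<gamma>0 \<bullet> K0 v = k0 \<bullet> K0 v" for v by (rule least_favorable_normal_equation)
  have D0: "norm K0 \<le> D0" "norm K0' \<le> D0" using K_bound \<theta>0_in by auto
  have c0: "0 \<le> c" using cS(1) cRpos by (simp add: c_def)
  let ?q1 = "\<kappa> + s * \<epsilon> n * r * (2 + 2 * D0\<^sup>2)"
  let ?q2 = "2 * D0 * \<epsilon> n * c + (r * (2 * norm \<gamma>0 + r) + (D0 * r) * (2 * norm (K0 \<gamma>0) + D0 * r))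
          + ((2 * D0 + c) * \<epsilon> n) * (2 * norm k0 + (2 * D0 + c) * \<epsilon> n)"
  have Q: "\<bar>Q + real n * u\<^sup>2 * I0 / 2\<bar> \<le> s * \<bar>u\<bar> * ?q1 + real n * u\<^sup>2 * ?q2"
    using quadratic_expansion_bound[OF foc D0 f[folded d_def] u r R_norm c0 \<kappa>[folded d_def]]
    unfolding Q_def I0 s_def by simp
  have B1: "\<bar>s * u * score z (\<gamma> n) - s * u * score z \<gamma>0\<bar> \<le> s * \<bar>u\<bar> * a"
  proof -
    have "s * u * score z (\<gamma> n) - s * u * score z \<gamma>0 = s * u * (score z (\<gamma> n) - score z \<gamma>0)" by (simp add: algebra_simps)
    then show ?thesis using a s(1) by (simp add: abs_mult mult_left_mono)
  qed
  have B2: "\<bar>s * u * ?o2 (K0' d)\<bar> \<le> s * \<bar>u\<bar> * ((2 * c1 + 1) * b)"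
  proof -
    \<comment> \<open>The 2 matches |d| \<le> 2 \<epsilon>, and the added one keeps the divisor
      positive; the rescaled vector has S-norm at most \<epsilon>.\<close>
    define C where "C = 2 * c1 + 1"
    have C: "0 < C" "1 \<le> C" using c1 by (auto simp: C_def)
    define h where "h = (1 / C) *\<^sub>R K0' d"
    have h_S: "h \<in> S" unfolding h_def using c1 sub by (intro subspace_scale) auto
    have "nS h = nS (K0' d) / C" unfolding h_def using hom c1 C by simp
    also have "\<dots> \<le> (c1 * (2 * \<epsilon> n)) / C"
      using c1(2)[of d] mult_left_mono[OF f[folded d_def] c1(1)] C by (intro divide_right_mono) auto
    also have "\<dots> \<le> \<epsilon> n" using C c1 \<epsilon> by (simp add: C_def field_simps)
    finally have h_n: "nS h \<le> \<epsilon> n" .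
    have "norm h \<le> cS * \<epsilon> n" using cS(2)[OF h_S] mult_left_mono[OF h_n cS(1)] by linarith
    also have "\<dots> \<le> cS * (\<epsilon> n + 1 / sqrt (real n))" using cS(1) by (intro mult_left_mono) auto
    finally have "\<bar>?o2 h\<bar> \<le> b" using h_S h_n \<epsilon>1 d_conv unfolding h_def by (intro b conv_set_scaleR) auto
    moreover have "?o2 h = ?o2 (K0' d) / C" unfolding h_def using d_conv by (simp add: obs_inner_scaleR)
    ultimately have "\<bar>?o2 (K0' d)\<bar> \<le> C * b" using C by (simp add: field_simps)
    then show ?thesis using s(1) unfolding C_def[symmetric] by (simp add: abs_mult mult_left_mono)
  qed
  have B3: "\<bar>s * ?o2 R\<bar> \<le> real n * u\<^sup>2 * (cR * b)"
  proof (cases "u = 0")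
    case True
    \<comment> \<open>For u = 0 the rescaling below would divide by zero, but then R itself
      vanishes.\<close>
    then have "nS R = 0" using R_S nonneg[OF R_S(1)] by simp
    then have "R = 0" using zero R_S by blast
    then show ?thesis using True by (simp add: obs_inner_def)
  next
    case False
    \<comment> \<open>This scale brings the S-norm down to 1 / sqrt n; multiplying back, together
      with the outer factor s, produces exactly n u^2.\<close>
    define C where "C = cR * u\<^sup>2 * s"
    have C: "0 < C" using False s cRpos by (simp add: C_def)
    define h where "h = (1 / C) *\<^sub>R R"
    have h_S: "h \<in> S" unfolding h_def using R_S sub by (intro subspace_scale)
    have "nS h = nS R / C" unfolding h_def using hom[OF R_S(1)] C by simp
    also have "\<dots> \<le> (cR * u\<^sup>2) / C" using R_S C by (intro divide_right_mono) auto
    also have "\<dots> = 1 / s" using False cRpos s by (simp add: C_def)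
    finally have h_n: "nS h \<le> 1 / s" .
    have "norm h \<le> cS * (1 / s)" using cS(2)[OF h_S] mult_left_mono[OF h_n cS(1)] by linarith
    also have "\<dots> \<le> cS * (\<epsilon> n + 1 / sqrt (real n))" using cS(1) \<epsilon> unfolding s_def by (intro mult_left_mono) auto
    finally have h_norm: "norm h \<le> cS * (\<epsilon> n + 1 / sqrt (real n))" .
    have "1 / s \<le> 1" using s by simp
    then have "nS h \<le> 1" using h_n by linarith
    then have "\<bar>?o2 h\<bar> \<le> b" using h_S h_norm R_conv unfolding h_def by (intro b conv_set_scaleR) auto
    moreover have "?o2 h = ?o2 R / C" unfolding h_def using R_conv by (simp add: obs_inner_scaleR)
    ultimately have "\<bar>?o2 R\<bar> \<le> C * b" using C by (simp add: field_simps)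
    then have "s * \<bar>?o2 R\<bar> \<le> s * (C * b)" using s by (intro mult_left_mono) auto
    also have "\<dots> = s\<^sup>2 * u\<^sup>2 * (cR * b)" by (simp add: C_def power2_eq_square)
    finally show ?thesis using s by (simp add: abs_mult)
  qed
  define w where "w = 1 + real n * u\<^sup>2"
  have w1: "s * \<bar>u\<bar> \<le> w"
  proof -
    have "0 \<le> (s * \<bar>u\<bar> - 1)\<^sup>2" by simp
    then have "2 * (s * \<bar>u\<bar>) \<le> 1 + real n * u\<^sup>2" using s(2) by (simp add: power2_diff power_mult_distrib)
    moreover have "0 \<le> s * \<bar>u\<bar>" using s by simp
    ultimately show ?thesis unfolding w_def by linarith
  qed
  have w2: "real n * u\<^sup>2 \<le> w" by (simp add: w_def)
  have r0: "0 \<le> r" using r norm_ge_zero order_trans by blast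
  have a0: "0 \<le> a" using a abs_ge_zero order_trans by blast
  have "0 \<le> sqrt (real n) * \<bar>K0 (f - f0) \<bullet> K0' (f - f0)\<bar>" by simp
  then have \<kappa>0: "0 \<le> \<kappa>" using \<kappa> by (rule order_trans)
  have D00: "0 \<le> D0" using D0(1) norm_ge_zero order_trans by blast
  have q0: "0 \<le> ?q1" "0 \<le> ?q2" "0 \<le> (2 * c1 + 1) * b" "0 \<le> cR * b"
    using r0 \<kappa>0 D00 c0 \<epsilon> s c1(1) b0 cRpos by (auto intro!: add_nonneg_nonneg mult_nonneg_nonneg)
  have "\<bar>(s * u * score z (\<gamma> n) + s * u * ?o2 (K0' d) + s * ?o2 R + Q) - (s * u * score z \<gamma>0 - real n * u\<^sup>2 * I0 / 2)\<bar>
    \<le> s * \<bar>u\<bar> * a + s * \<bar>u\<bar> * ((2 * c1 + 1) * b) + real n * u\<^sup>2 * (cR * b) + (s * \<bar>u\<bar> * ?q1 + real n * u\<^sup>2 * ?q2)"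
    using B1 B2 B3 Q by linarith
  also have "\<dots> \<le> w * a + w * ((2 * c1 + 1) * b) + w * (cR * b) + (w * ?q1 + w * ?q2)"
    using w1 w2 a0 q0 by (intro add_mono mult_right_mono)
  also have "\<dots> = w * (a + (2 * c1 + 1) * b + cR * b + ?q1 + ?q2)" by (simp only: distrib_left add.assoc)
  finally show ?thesis unfolding remainder_def u_def[symmetric] split w_def s_def .
qed

lemma whp_remainder:
  fixes H :: "nat \<Rightarrow> 'h set" and \<kappa> :: "nat \<Rightarrow> real" and t :: real
  assumes t: "0 < t" and \<kappa>: "\<kappa> \<longlonglongrightarrow> 0"
    and H: "\<forall>\<^sub>F n in sequentially. \<forall>f\<in>H n. sqrt (real n) * \<bar>K0 (f - f0) \<bullet> K0' (f - f0)\<bar> \<le> \<kappa> n"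
  shows "whp P (\<lambda>n x. regular (noise n x) \<and> small_remainder n (noise n x) (H n) t)"
proof -
  obtain c1 where c1: "0 \<le> c1" "\<And>v. K0' v \<in> S \<and> nS (K0' v) \<le> c1 * norm v" using K0'_into_S by blast
  obtain cS' where cS': "\<And>h. h \<in> S \<Longrightarrow> norm h \<le> cS' * nS h" using S_stronger by blast
  define cS where "cS = \<bar>cS'\<bar>"
  have cS: "0 \<le> cS" "\<And>h. h \<in> S \<Longrightarrow> norm h \<le> cS * nS h"
  proof -
    fix h assume h: "h \<in> S"
    then have "0 \<le> nS h" using S_norm by (auto simp: normed_subspace_def)
    then show "norm h \<le> cS * nS h" unfolding cS_def
      by (intro order_trans[OF cS'[OF h]] mult_right_mono) auto
  qed (simp add: cS_def)
  define cR where "cR = \<bar>D2\<bar> * (norm f0 + 2) + 1"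
  have cR: "1 \<le> cR" by (simp add: cR_def)
  obtain C where C: "\<And>n. n \<ge> 1 \<Longrightarrow> norm (\<gamma> n - \<gamma>0) \<le> C * \<bar>\<rho> n\<bar>" using \<gamma>_approx by blast
  \<comment> \<open>The score difference, the two noise integrals together and the deterministic
    part T are each allotted t / 4.\<close>
  define b where "b = t / (4 * (2 * c1 + 1 + cR))"
  have b: "0 < b" "(2 * c1 + 1) * b + cR * b = t / 4"
  proof -
    have pos: "0 < 2 * c1 + 1 + cR" using c1 cR by linarith
    then show "0 < b" using t by (simp add: b_def)
    have "X * (t / (4 * X)) = t / 4" if "0 < X" for X :: real using that by simp
    from this[OF pos] have "(2 * c1 + 1 + cR) * b = t / 4" by (simp only: b_def)
    then show "(2 * c1 + 1) * b + cR * b = t / 4" by (simp only: distrib_right)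
  qed
  define c where "c = cS * cR"
  define T where "T n = (\<kappa> n + sqrt (real n) * \<epsilon> n * (C * \<bar>\<rho> n\<bar>) * (2 + 2 * D0\<^sup>2))
      + (2 * D0 * \<epsilon> n * c + ((C * \<bar>\<rho> n\<bar>) * (2 * norm \<gamma>0 + (C * \<bar>\<rho> n\<bar>)) + (D0 * (C * \<bar>\<rho> n\<bar>)) * (2 * norm (K0 \<gamma>0) + D0 * (C * \<bar>\<rho> n\<bar>)))
          + ((2 * D0 + c) * \<epsilon> n) * (2 * norm k0 + (2 * D0 + c) * \<epsilon> n))" for n
  have n\<epsilon>\<rho>: "(\<lambda>n. sqrt (real n) * \<epsilon> n * \<bar>\<rho> n\<bar>) \<longlonglongrightarrow> 0"
  proof -
    have "(\<lambda>n. sqrt (real n * (\<epsilon> n)\<^sup>2 * (\<rho> n)\<^sup>2)) \<longlonglongrightarrow> sqrt 0" by (intro tendsto_real_sqrt \<rho>_rate)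
    moreover have "\<forall>\<^sub>F n in sequentially. sqrt (real n * (\<epsilon> n)\<^sup>2 * (\<rho> n)\<^sup>2) = sqrt (real n) * \<epsilon> n * \<bar>\<rho> n\<bar>"
      using eventually_ge_at_top[of 1]
      by eventually_elim (use \<epsilon>_pos in \<open>auto simp: real_sqrt_mult less_imp_le\<close>)
    ultimately show ?thesis by (simp add: Lim_transform_eventually)
  qed
  have "T \<longlonglongrightarrow> (0 + (C * 0) * (2 + 2 * D0\<^sup>2)) + (2 * D0 * 0 * c + ((C * \<bar>0\<bar>) * (2 * norm \<gamma>0 + (C * \<bar>0\<bar>)) + (D0 * (C * \<bar>0\<bar>)) * (2 * norm (K0 \<gamma>0) + D0 * (C * \<bar>0\<bar>)))
          + ((2 * D0 + c) * 0) * (2 * norm k0 + (2 * D0 + c) * 0))"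
  proof -
    have "T = (\<lambda>n. (\<kappa> n + (C * (sqrt (real n) * \<epsilon> n * \<bar>\<rho> n\<bar>)) * (2 + 2 * D0\<^sup>2))
      + (2 * D0 * \<epsilon> n * c + ((C * \<bar>\<rho> n\<bar>) * (2 * norm \<gamma>0 + (C * \<bar>\<rho> n\<bar>)) + (D0 * (C * \<bar>\<rho> n\<bar>)) * (2 * norm (K0 \<gamma>0) + D0 * (C * \<bar>\<rho> n\<bar>)))
          + ((2 * D0 + c) * \<epsilon> n) * (2 * norm k0 + (2 * D0 + c) * \<epsilon> n)))"
      by (simp add: T_def[abs_def] mult_ac)
    then show ?thesis by (simp only:) (intro tendsto_add tendsto_mult tendsto_const tendsto_rabs \<kappa> n\<epsilon>\<rho> \<rho>_lim \<epsilon>_lim)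
  qed
  then have "T \<longlonglongrightarrow> 0" by simp
  then have T: "\<forall>\<^sub>F n in sequentially. T n < t / 4" by (rule order_tendstoD(2)) (use t in simp)
  have \<epsilon>1: "\<forall>\<^sub>F n in sequentially. \<epsilon> n < 1" by (rule order_tendstoD(2)[OF \<epsilon>_lim]) simp
  have small: "(\<lambda>n. cS * (\<epsilon> n + 1 / sqrt (real n))) \<longlonglongrightarrow> 0"
  proof -
    have "(\<lambda>n. inverse (sqrt (real n))) \<longlonglongrightarrow> 0"
      by (intro tendsto_inverse_0_at_top filterlim_compose[OF sqrt_at_top] filterlim_real_sequentially)
    then have "(\<lambda>n. cS * (\<epsilon> n + inverse (sqrt (real n)))) \<longlonglongrightarrow> cS * (0 + 0)"
      by (intro tendsto_intros \<epsilon>_lim)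
    then show ?thesis by (simp add: inverse_eq_divide)
  qed
  have t4: "0 < t / 4" using t by simp
  show ?thesis
  proof (rule whp_mono[OF whp_conj[OF whp_regular whp_conj[OF whp_score_diff[OF t4] whp_small_ball[OF b(1) small]]]])
    show "\<forall>\<^sub>F n in sequentially. \<forall>x\<in>space (P n).
      regular (noise n x) \<and> (regular (noise n x) \<longrightarrow> \<bar>score (noise n x) (\<gamma> n) - score (noise n x) \<gamma>0\<bar> \<le> t / 4) \<and>
        (\<forall>h\<in>S. nS h \<le> 1 \<longrightarrow> norm h \<le> cS * (\<epsilon> n + 1 / sqrt (real n)) \<longrightarrow> h \<in> conv_set e (snd (noise n x))
          \<longrightarrow> \<bar>obs_inner e (snd (noise n x)) h\<bar> \<le> b) \<longrightarrow>
      regular (noise n x) \<and> small_remainder n (noise n x) (H n) t"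
      using T \<epsilon>1 H eventually_ge_at_top[of 1]
    proof eventually_elim
      case (elim n)
      show ?case
        unfolding small_remainder_def
      proof (intro ballI impI conjI)
        fix x \<theta> f
        let ?z = "noise n x"
        assume A: "regular ?z \<and> (regular ?z \<longrightarrow> \<bar>score ?z (\<gamma> n) - score ?z \<gamma>0\<bar> \<le> t / 4) \<and>
          (\<forall>h\<in>S. nS h \<le> 1 \<longrightarrow> norm h \<le> cS * (\<epsilon> n + 1 / sqrt (real n)) \<longrightarrow> h \<in> conv_set e (snd ?z)
          \<longrightarrow> \<bar>obs_inner e (snd ?z) h\<bar> \<le> b)"
        assume \<theta>: "\<theta> \<in> \<Theta>" "\<bar>\<theta> - \<theta>0\<bar> \<le> \<epsilon> n" and f: "f \<in> H n" "norm (f - f0) \<le> 2 * \<epsilon> n"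
          and conv: "param_conv ?z \<theta> f"
        have reg: "regular ?z" and a: "\<bar>score ?z (\<gamma> n) - score ?z \<gamma>0\<bar> \<le> t / 4" using A by auto
        have bb: "\<bar>obs_inner e (snd ?z) h\<bar> \<le> b"
          if "h \<in> S" "nS h \<le> 1" "norm h \<le> cS * (\<epsilon> n + 1 / sqrt (real n))" "h \<in> conv_set e (snd ?z)" for h
          using A that by blast
        have "\<bar>remainder n ?z \<theta> f\<bar>
          \<le> (1 + real n * (\<theta> - \<theta>0)\<^sup>2) * (t / 4 + (2 * c1 + 1) * b + cR * b + (\<kappa> n + sqrt (real n) * \<epsilon> n * (C * \<bar>\<rho> n\<bar>) * (2 + 2 * D0\<^sup>2))
            + (2 * D0 * \<epsilon> n * (cS * cR) + ((C * \<bar>\<rho> n\<bar>) * (2 * norm \<gamma>0 + (C * \<bar>\<rho> n\<bar>)) + (D0 * (C * \<bar>\<rho> n\<bar>)) * (2 * norm (K0 \<gamma>0) + D0 * (C * \<bar>\<rho> n\<bar>)))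
            + ((2 * D0 + (cS * cR)) * \<epsilon> n) * (2 * norm k0 + (2 * D0 + (cS * cR)) * \<epsilon> n)))"
          by (rule remainder_bound[OF elim(4) reg \<theta> less_imp_le[OF elim(2)] f(2) conv cS c1 cR_def a less_imp_le[OF b(1)] bb
                elim(3)[rule_format, OF f(1)] C[OF elim(4)]])
        also have "\<dots> = (1 + real n * (\<theta> - \<theta>0)\<^sup>2) * (t / 4 + t / 4 + T n)"
          unfolding T_def c_def b(2)[symmetric] by (simp only: add.assoc)
        also have "\<dots> \<le> (1 + real n * (\<theta> - \<theta>0)\<^sup>2) * t"
          using elim(1) t by (intro mult_left_mono) auto
        finally show "\<bar>remainder n ?z \<theta> f\<bar>
          \<le> t * (1 + real n * (\<theta> - \<theta>0)\<^sup>2)" by (simp only: mult.commute)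
      qed auto
    qed
  qed
qed

end

section \<open>The Bernstein-von Mises theorem\<close>

lemma bayes_mass_le:
  assumes [measurable]: "R \<in> borel_measurable M" "A \<in> sets M"
    and I: "0 < (\<integral>\<^sup>+v. ennreal (R v) \<partial>M)" "(\<integral>\<^sup>+v. ennreal (R v) \<partial>M) < \<infinity>" and \<delta>: "0 \<le> \<delta>"
    and le: "(\<integral>\<^sup>+w. ennreal (R w) * indicator A w \<partial>M) \<le> ennreal \<delta> * (\<integral>\<^sup>+v. ennreal (R v) \<partial>M)"
  shows "measure (bayes M R) A \<le> \<delta>"
proof -
  let ?I = "\<integral>\<^sup>+v. ennreal (R v) \<partial>M"
  have "emeasure (bayes M R) A \<le> ennreal \<delta> * ?I / ?I"
    unfolding emeasure_bayes[OF assms(1,2)] by (intro divide_right_mono_ennreal le)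
  also have "\<dots> = ennreal \<delta>" using I by (simp add: mult_divide_eq_ennreal less_top[symmetric] zero_less_iff_neq_zero)
  finally show ?thesis using \<delta> by (simp add: measure_def enn2real_leI)
qed

lemma (in prob_space) prob_Int_Diff_ge:
  assumes A: "A \<in> events" and B: "B \<in> events" and C: "C \<in> events"
    and "1 - a \<le> prob A" "1 - b \<le> prob B" "prob C \<le> c"
  shows "1 - (a + b + c) \<le> prob (A \<inter> B - C)"
proof -
  have "prob (space M - (A \<inter> B - C)) \<le> prob ((space M - A) \<union> (space M - B) \<union> C)"
    using A B C by (intro finite_measure_mono) auto
  also have "\<dots> \<le> prob (space M - A) + prob (space M - B) + prob C"
    using measure_Un_le[of "(space M - A) \<union> (space M - B)" M C] measure_Un_le[of "space M - A" M "space M - B"] A B C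
    by auto
  also have "\<dots> \<le> a + b + c" using assms prob_compl[OF A] prob_compl[OF B] by linarith
  finally show ?thesis using prob_compl[of "A \<inter> B - C"] A B C by auto
qed

context linear_model
begin

lemma I0_pos: "0 < I0"
proof -
  have I0: "I0 = (norm \<gamma>0)\<^sup>2 + (norm (k0 - K0 \<gamma>0))\<^sup>2" by (simp add: efficient_info_def Let_def)
  show ?thesis
  proof (cases "\<gamma>0 = 0")
    case True
    then show ?thesis using nonzero unfolding I0 by (simp add: blinfun.zero_right)
  next
    case False
    then show ?thesis unfolding I0 by (simp add: add_pos_nonneg)
  qed
qed

lemma efficient_influence_eq:
  assumes n: "1 \<le> n" and reg: "regular (noise n x)"
  shows "efficient_influence e K K' \<theta>0 f0 n x = score (noise n x) \<gamma>0 / I0"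
proof -
  have s: "0 < sqrt (real n)" using n by simp
  have c: "\<gamma>0 \<in> conv_set e (fst (noise n x))" "k0 \<in> conv_set e (snd (noise n x))" "K0 \<gamma>0 \<in> conv_set e (snd (noise n x))"
    using reg by (auto simp: regular_def)
  have "noise1 e f0 n x \<gamma>0 = obs_inner e (fst (noise n x)) \<gamma>0"
    "noise2 e K \<theta>0 f0 n x k0 = obs_inner e (snd (noise n x)) k0"
    "noise2 e K \<theta>0 f0 n x (K0 \<gamma>0) = obs_inner e (snd (noise n x)) (K0 \<gamma>0)"
    unfolding noise1_def noise2_def
    using obs_inner_eq_noise(1)[OF n c(1)] obs_inner_eq_noise(2)[OF n c(2)] obs_inner_eq_noise(2)[OF n c(3)] s
    by simp_all
  then show ?thesis by (simp add: efficient_influence_def Let_def score_def)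
qed

text \<open>A deterministic statement about a single data point; probability enters only when its
  hypotheses are verified. r covers the errors of the likelihood and of the prior densities
  together, M is the half-width of the window in units of 1 / sqrt n, and c / sqrt n bounds the
  Lebesgue measure of the part of the window that T misses.\<close>

lemma tv_bound:
  fixes n :: nat and x :: obs and \<delta> r M v p0 c :: real and H B :: "'h set" and T :: "real set" and L :: "real \<Rightarrow> real \<Rightarrow> 'h \<Rightarrow> real"
  defines "z \<equiv> noise n x" and "V \<equiv> score (noise n x) \<gamma>0"
  assumes n: "1 \<le> n" and reg: "regular z" and \<delta>: "0 < \<delta>" "\<delta> \<le> 1 / 10"
    and r: "0 \<le> r" "2 * r < I0" and V: "\<bar>V\<bar> \<le> v" and rM: "r * (1 + M\<^sup>2) \<le> \<delta>"
    and ratio: "exp r * gauss_ratio I0 v r \<le> 1 + \<delta>"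
    and M: "0 \<le> M" "M < sqrt (real n) * \<epsilon> n" "M * norm (\<gamma> n) \<le> sqrt (real n) * \<epsilon> n"
    and H [measurable]: "H \<in> sets borel" and T [measurable]: "T \<in> sets borel" and T_sub: "T \<subseteq> \<Theta>"
    and B [measurable]: "B \<in> sets borel"
    and L1: "\<And>u. \<bar>u\<bar> < \<epsilon> n \<Longrightarrow> log_density_version (shifted_law \<pi>f 0) (shifted_law \<pi>f (- (u *\<^sub>R \<gamma> n))) (L (- u) u)"
    and L2: "\<And>u. \<bar>u\<bar> < \<epsilon> n \<Longrightarrow> log_density_version (shifted_law \<pi>f (u *\<^sub>R \<gamma> n)) (shifted_law \<pi>f 0) (L 0 u)"
    and L_le: "\<And>u f. \<bar>u\<bar> < \<epsilon> n \<Longrightarrow> f \<notin> B \<Longrightarrow> \<bar>L (- u) u f\<bar> \<le> r / 2 * (1 + real n * u\<^sup>2) \<and> \<bar>L 0 u f\<bar> \<le> r / 2 * (1 + real n * u\<^sup>2)"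
    and rem: "small_remainder n z H (r / 2)"
    and post_ball: "1 - \<delta> \<le> measure (post n x) (contraction_set n)"
    and known_ball: "1 - \<delta> \<le> measure (post_known n x) {f. norm (f - f0) < \<epsilon> n}"
    and post_H: "1 - \<delta> \<le> measure (post n x) (T \<times> H)"
    and known_H: "\<And>\<theta>. \<theta> \<in> T \<Longrightarrow> 1 - \<delta> \<le> measure (post_known n x) ((\<lambda>f. f + (\<theta> - \<theta>0) *\<^sub>R \<gamma> n) ` H)"
    and bad_known: "(\<integral>\<^sup>+f. ennreal (lr n z \<theta>0 f) * indicator B f \<partial>\<pi>f) \<le> ennreal \<delta> * (\<integral>\<^sup>+f. ennreal (lr n z \<theta>0 f) \<partial>\<pi>f)"
    and bad_full: "(\<integral>\<^sup>+w. ennreal (lr n z (fst w) (snd w)) * indicator ({\<theta>\<in>\<Theta>. \<bar>\<theta> - \<theta>0\<bar> < \<epsilon> n} \<times> B) w \<partial>(\<pi>\<theta> \<Otimes>\<^sub>M \<pi>f))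
        \<le> ennreal \<delta> * (\<integral>\<^sup>+w. ennreal (lr n z (fst w) (snd w)) \<partial>(\<pi>\<theta> \<Otimes>\<^sub>M \<pi>f))"
    and p: "0 < p0" "\<And>\<theta>. \<theta> \<in> \<Theta> \<Longrightarrow> \<bar>\<theta> - \<theta>0\<bar> < \<epsilon> n \<Longrightarrow> p0 * (1 - \<delta>) \<le> p \<theta> \<and> p \<theta> \<le> p0 * (1 + \<delta>)"
    and tail: "measure (normal_law (\<theta>0 + V / I0 / sqrt (real n)) (inverse I0 / real n)) {\<theta>. M < sqrt (real n) * \<bar>\<theta> - \<theta>0\<bar>} \<le> \<delta>"
    and missing: "emeasure lborel ({\<theta>. sqrt (real n) * \<bar>\<theta> - \<theta>0\<bar> \<le> M} - T) \<le> ennreal (c / sqrt (real n))" "0 \<le> c" "sqrt I0 * c \<le> \<delta>"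
  shows "\<bar>tv_error n x\<bar> \<le> 40 * \<delta>"
proof -
  interpret PT: prob_space \<pi>\<theta> by (rule prior_prob)
  interpret PF: prob_space \<pi>f by (rule \<pi>f_prob)
  interpret TF: pair_sigma_finite \<pi>\<theta> \<pi>f ..
  have \<epsilon>: "0 < \<epsilon> n" using \<epsilon>_pos n by blast
  have s: "0 < sqrt (real n)" using n by simp
  have I0: "0 < I0" by (rule I0_pos)
  define R where "R w = lr n z (fst w) (snd w)" for w
  define R0 where "R0 f = lr n z \<theta>0 f" for f
  have [measurable]: "R \<in> borel_measurable (\<pi>\<theta> \<Otimes>\<^sub>M \<pi>f)" "R0 \<in> borel_measurable borel"
    unfolding R_def R0_def by measurable
  have R0_m: "R0 \<in> borel_measurable \<pi>f" by measurable
  have R_pos: "0 < R w" "0 < R0 f" for w f by (auto simp: R_def R0_def lr_def)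
  have post_eq: "post n x = bayes (\<pi>\<theta> \<Otimes>\<^sub>M \<pi>f) R"
    using posterior_eq[OF n, of x] reg by (simp add: z_def R_def[abs_def])
  have known_eq: "post_known n x = bayes \<pi>f R0"
    using posterior_known_eq[OF n, of x] reg by (simp add: z_def R0_def[abs_def])
  define q where "q \<theta> = sqrt (real n) * (\<theta> - \<theta>0) * V - real n * (\<theta> - \<theta>0)\<^sup>2 * I0 / 2" for \<theta>
  have [measurable]: "q \<in> borel_measurable borel" unfolding q_def by measurable
  define TE where "TE = {\<theta>\<in>T. \<bar>\<theta> - \<theta>0\<bar> < \<epsilon> n}"
  have TE_eq: "TE = T \<inter> {\<theta>. \<bar>\<theta> - \<theta>0\<bar> < \<epsilon> n}" by (auto simp: TE_def)
  have TE [measurable]: "TE \<in> sets borel" unfolding TE_eq by measurable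
  have TE_prior: "TE \<in> sets \<pi>\<theta>" unfolding sets_prior_iff using T_sub by (auto simp: TE_def)
  have T_prior: "T \<in> sets \<pi>\<theta>" unfolding sets_prior_iff using T_sub by auto
  have E_prior: "{\<theta>\<in>\<Theta>. \<bar>\<theta> - \<theta>0\<bar> < \<epsilon> n} \<in> sets \<pi>\<theta>"
  proof -
    have "{\<theta>\<in>\<Theta>. \<bar>\<theta> - \<theta>0\<bar> < \<epsilon> n} = \<Theta> \<inter> {\<theta>. \<bar>\<theta> - \<theta>0\<bar> < \<epsilon> n}" by auto
    also have "\<dots> \<in> sets borel" by measurable
    finally show ?thesis unfolding sets_prior_iff by auto
  qed
  have ball_m [measurable]: "{f. norm (f - f0) < \<epsilon> n} \<in> sets borel" by measurable
  have ball_prior: "contraction_set n = {\<theta>\<in>\<Theta>. \<bar>\<theta> - \<theta>0\<bar> < \<epsilon> n} \<times> {f. norm (f - f0) < \<epsilon> n}"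
    by auto
  have m1: "{\<theta>\<in>\<Theta>. \<bar>\<theta> - \<theta>0\<bar> < \<epsilon> n} \<times> {f. norm (f - f0) < \<epsilon> n} \<in> sets (\<pi>\<theta> \<Otimes>\<^sub>M \<pi>f)"
    using E_prior by (intro pair_measureI) auto
  have m2: "T \<times> H \<in> sets (\<pi>\<theta> \<Otimes>\<^sub>M \<pi>f)" using T_prior by (intro pair_measureI) auto
  have m3: "{\<theta>\<in>\<Theta>. \<bar>\<theta> - \<theta>0\<bar> < \<epsilon> n} \<times> B \<in> sets (\<pi>\<theta> \<Otimes>\<^sub>M \<pi>f)" using E_prior by (intro pair_measureI) auto

  \<comment> \<open>Normalising constants of the two posteriors\<close>
  have Z: "0 < (\<integral>\<^sup>+w. ennreal (R w) \<partial>(\<pi>\<theta> \<Otimes>\<^sub>M \<pi>f))" "(\<integral>\<^sup>+w. ennreal (R w) \<partial>(\<pi>\<theta> \<Otimes>\<^sub>M \<pi>f)) < \<infinity>"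
    using bayes_mass_finite[of R "\<pi>\<theta> \<Otimes>\<^sub>M \<pi>f" "T \<times> H"] m2 R_pos post_H \<delta> unfolding post_eq by auto
  have Z0: "0 < (\<integral>\<^sup>+f. ennreal (R0 f) \<partial>\<pi>f)" "(\<integral>\<^sup>+f. ennreal (R0 f) \<partial>\<pi>f) < \<infinity>"
    using bayes_mass_finite[of R0 \<pi>f "{f. norm (f - f0) < \<epsilon> n}"] R_pos known_ball \<delta> unfolding known_eq by auto
  define ZZ where "ZZ = enn2real (\<integral>\<^sup>+w. ennreal (R w) \<partial>(\<pi>\<theta> \<Otimes>\<^sub>M \<pi>f))"
  define Z1 where "Z1 = enn2real (\<integral>\<^sup>+f. ennreal (R0 f) \<partial>\<pi>f)"
  have ZZ: "(\<integral>\<^sup>+w. ennreal (R w) \<partial>(\<pi>\<theta> \<Otimes>\<^sub>M \<pi>f)) = ennreal ZZ" "0 < ZZ"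
    using Z by (auto simp: ZZ_def enn2real_positive_iff)
  have Z1: "(\<integral>\<^sup>+f. ennreal (R0 f) \<partial>\<pi>f) = ennreal Z1" "0 < Z1"
    using Z0 by (auto simp: Z1_def enn2real_positive_iff)
  interpret Po: prob_space "bayes (\<pi>\<theta> \<Otimes>\<^sub>M \<pi>f) R" using Z by (intro prob_space_bayes) auto
  interpret Kn: prob_space "bayes \<pi>f R0" using Z0 by (intro prob_space_bayes R0_m) auto
  have sets_Po: "sets (bayes (\<pi>\<theta> \<Otimes>\<^sub>M \<pi>f) R) = sets (\<pi>\<theta> \<Otimes>\<^sub>M \<pi>f)" and sets_Kn: "sets (bayes \<pi>f R0) = sets borel"
    by (simp_all add: bayes_def)

  \<comment> \<open>Comparison of the likelihood with the shifted likelihood for known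
    \<theta>0\<close>
  have "AE w in \<pi>\<theta> \<Otimes>\<^sub>M \<pi>f. snd w \<in> conv_set e (fst z) \<and> K (fst w) (snd w) \<in> conv_set e (snd z)"
    using reg by (simp add: regular_def)
  then have AE1: "AE \<theta> in \<pi>\<theta>. AE f in \<pi>f. f \<in> conv_set e (fst z) \<and> K \<theta> f \<in> conv_set e (snd z)"
    using TF.AE_pair[of "\<lambda>w. snd w \<in> conv_set e (fst z) \<and> K (fst w) (snd w) \<in> conv_set e (snd z)"] by simp
  have AE2: "AE f in \<pi>f. K0 f \<in> conv_set e (snd z)" and AE3: "AE f in \<pi>f. K0' f \<in> conv_set e (snd z)"
    using reg by (auto simp: regular_def elim: eventually_mono)
  have AE_rem: "AE \<theta> in \<pi>\<theta>. \<bar>\<theta> - \<theta>0\<bar> < \<epsilon> n \<longrightarrow> (AE f in \<pi>f. f \<in> H \<longrightarrow> norm (f - f0) < 2 * \<epsilon> n \<longrightarrow>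
      ennreal (exp (q \<theta> - r / 2 * (1 + real n * (\<theta> - \<theta>0)\<^sup>2))) * ennreal (R0 (f + (\<theta> - \<theta>0) *\<^sub>R \<gamma> n)) \<le> ennreal (lr n z \<theta> f) \<and>
      ennreal (lr n z \<theta> f) \<le> ennreal (exp (q \<theta> + r / 2 * (1 + real n * (\<theta> - \<theta>0)\<^sup>2))) * ennreal (R0 (f + (\<theta> - \<theta>0) *\<^sub>R \<gamma> n)))"
    using AE1 AE_space
  proof eventually_elim
    case (elim \<theta>)
    show ?case
    proof
      assume u: "\<bar>\<theta> - \<theta>0\<bar> < \<epsilon> n"
      show "AE f in \<pi>f. f \<in> H \<longrightarrow> norm (f - f0) < 2 * \<epsilon> n \<longrightarrow>
        ennreal (exp (q \<theta> - r / 2 * (1 + real n * (\<theta> - \<theta>0)\<^sup>2))) * ennreal (R0 (f + (\<theta> - \<theta>0) *\<^sub>R \<gamma> n)) \<le> ennreal (lr n z \<theta> f) \<and>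
        ennreal (lr n z \<theta> f) \<le> ennreal (exp (q \<theta> + r / 2 * (1 + real n * (\<theta> - \<theta>0)\<^sup>2))) * ennreal (R0 (f + (\<theta> - \<theta>0) *\<^sub>R \<gamma> n))"
        using elim(1) AE2 AE3
      proof eventually_elim
        case (elim f)
        show ?case
        proof (intro impI)
          assume f: "f \<in> H" "norm (f - f0) < 2 * \<epsilon> n"
          have "\<theta> \<in> \<Theta>" using \<open>\<theta> \<in> space \<pi>\<theta>\<close> by simp
          then have "\<bar>remainder n z \<theta> f\<bar> \<le> r / 2 * (1 + real n * (\<theta> - \<theta>0)\<^sup>2)"
            using rem u f elim by (auto simp: small_remainder_def param_conv_def)
          then have a: "\<bar>log_ratio e n z (f - f0) (K \<theta> f - K0 f0)
            - log_ratio e n z (f + (\<theta> - \<theta>0) *\<^sub>R \<gamma> n - f0) (K0 (f + (\<theta> - \<theta>0) *\<^sub>R \<gamma> n) - K0 f0) - q \<theta>\<bar> \<le> r / 2 * (1 + real n * (\<theta> - \<theta>0)\<^sup>2)"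
            unfolding q_def remainder_def V_def z_def .
          show "ennreal (exp (q \<theta> - r / 2 * (1 + real n * (\<theta> - \<theta>0)\<^sup>2))) * ennreal (R0 (f + (\<theta> - \<theta>0) *\<^sub>R \<gamma> n)) \<le> ennreal (lr n z \<theta> f) \<and>
            ennreal (lr n z \<theta> f) \<le> ennreal (exp (q \<theta> + r / 2 * (1 + real n * (\<theta> - \<theta>0)\<^sup>2))) * ennreal (R0 (f + (\<theta> - \<theta>0) *\<^sub>R \<gamma> n))"
            using a unfolding R0_def lr_def ennreal_mult[symmetric, OF exp_ge_zero exp_ge_zero] exp_add[symmetric]
            by (intro conjI ennreal_leI) (simp_all only: exp_le_cancel_iff abs_le_iff, linarith+)
        qed
      qed
    qed
  qed

  \<comment> \<open>Upper bound for the normalising constant of the joint posterior\<close>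
  define GU where "GU = H \<inter> {f. norm (f - f0) < \<epsilon> n} - B"
  have GU [measurable]: "GU \<in> sets borel" unfolding GU_def by measurable
  have AE_upper: "AE \<theta> in \<pi>\<theta>. \<theta> \<in> TE \<longrightarrow> (\<integral>\<^sup>+f. ennreal (lr n z \<theta> f) * indicator GU f \<partial>\<pi>f)
      \<le> ennreal (Z1 * exp (q \<theta> + r * (1 + real n * (\<theta> - \<theta>0)\<^sup>2)))"
    using AE_rem
  proof eventually_elim
    case (elim \<theta>)
    show ?case
    proof
      assume \<theta>: "\<theta> \<in> TE"
      then have u: "\<bar>\<theta> - \<theta>0\<bar> < \<epsilon> n" by (simp add: TE_def)
      \<comment> \<open>Half of r pays for the expansion of the likelihood and half for the change
        of the prior under the shift.\<close>
      let ?h = "r / 2 * (1 + real n * (\<theta> - \<theta>0)\<^sup>2)"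
      have "(\<integral>\<^sup>+f. ennreal (lr n z \<theta> f) * indicator GU f \<partial>\<pi>f) \<le> ennreal (exp ((q \<theta> + ?h) + ?h)) * (\<integral>\<^sup>+f. ennreal (R0 f) \<partial>\<pi>f)"
      proof (rule shift_upper_bound[OF sets_\<pi>f GU _ _ L1[OF u]])
        show "L (- (\<theta> - \<theta>0)) (\<theta> - \<theta>0) f \<le> ?h" if "f \<in> GU" for f
          using L_le[OF u, of f] that abs_ge_self order_trans unfolding GU_def by blast
        show "AE f in \<pi>f. f \<in> GU \<longrightarrow> ennreal (lr n z \<theta> f) \<le> ennreal (exp (q \<theta> + ?h)) * ennreal (R0 (f + (\<theta> - \<theta>0) *\<^sub>R \<gamma> n))"
          using elim[rule_format, OF u] by eventually_elim (use \<epsilon> in \<open>auto simp: GU_def\<close>)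
      qed measurable
      also have "\<dots> = ennreal (Z1 * exp (q \<theta> + r * (1 + real n * (\<theta> - \<theta>0)\<^sup>2)))"
      proof -
        have "(q \<theta> + ?h) + ?h = q \<theta> + r * (1 + real n * (\<theta> - \<theta>0)\<^sup>2)" by (simp add: field_simps)
        then show ?thesis unfolding Z1(1) using Z1(2) by (simp add: ennreal_mult[symmetric] mult.commute)
      qed
      finally show "(\<integral>\<^sup>+f. ennreal (lr n z \<theta> f) * indicator GU f \<partial>\<pi>f)
        \<le> ennreal (Z1 * exp (q \<theta> + r * (1 + real n * (\<theta> - \<theta>0)\<^sup>2)))" .
    qed
  qed
  \<comment> \<open>Three losses of \<delta>: contraction, localisation, and the exceptional set of
    the prior densities.\<close>
  define W where "W = {\<theta>\<in>\<Theta>. \<bar>\<theta> - \<theta>0\<bar> < \<epsilon> n} \<times> {f. norm (f - f0) < \<epsilon> n} \<inter> (T \<times> H) - {\<theta>\<in>\<Theta>. \<bar>\<theta> - \<theta>0\<bar> < \<epsilon> n} \<times> B"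
  have W [measurable]: "W \<in> sets (\<pi>\<theta> \<Otimes>\<^sub>M \<pi>f)" unfolding W_def using m1 m2 m3 by auto
  have "1 - (\<delta> + \<delta> + \<delta>) \<le> measure (bayes (\<pi>\<theta> \<Otimes>\<^sub>M \<pi>f) R) W"
    unfolding W_def
  proof (rule Po.prob_Int_Diff_ge)
    show "measure (bayes (\<pi>\<theta> \<Otimes>\<^sub>M \<pi>f) R) ({\<theta>\<in>\<Theta>. \<bar>\<theta> - \<theta>0\<bar> < \<epsilon> n} \<times> B) \<le> \<delta>"
      using bad_full Z \<delta> m3 unfolding R_def[symmetric] by (intro bayes_mass_le) auto
    show "1 - \<delta> \<le> measure (bayes (\<pi>\<theta> \<Otimes>\<^sub>M \<pi>f) R) ({\<theta>\<in>\<Theta>. \<bar>\<theta> - \<theta>0\<bar> < \<epsilon> n} \<times> {f. norm (f - f0) < \<epsilon> n})"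
      using post_ball unfolding post_eq ball_prior .
    show "1 - \<delta> \<le> measure (bayes (\<pi>\<theta> \<Otimes>\<^sub>M \<pi>f) R) (T \<times> H)" using post_H unfolding post_eq .
  qed (use m1 m2 m3 sets_Po in auto)
  then have W_mass: "ennreal (1 - 3 * \<delta>) * ennreal ZZ \<le> (\<integral>\<^sup>+w. ennreal (R w) * indicator W w \<partial>(\<pi>\<theta> \<Otimes>\<^sub>M \<pi>f))"
    unfolding ZZ(1)[symmetric] using \<delta> R_pos by (intro bayes_mass_ge W) auto
  have "(\<integral>\<^sup>+w. ennreal (R w) * indicator W w \<partial>(\<pi>\<theta> \<Otimes>\<^sub>M \<pi>f))
      = (\<integral>\<^sup>+\<theta>. (\<integral>\<^sup>+f. ennreal (R (\<theta>, f)) * indicator W (\<theta>, f) \<partial>\<pi>f) \<partial>\<pi>\<theta>)"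
    by (rule PF.nn_integral_fst[symmetric]) measurable
  also have "\<dots> \<le> (\<integral>\<^sup>+\<theta>. ennreal (Z1 * exp (q \<theta> + r * (1 + real n * (\<theta> - \<theta>0)\<^sup>2))) * indicator TE \<theta> \<partial>\<pi>\<theta>)"
  proof (rule nn_integral_mono_AE)
    show "AE \<theta> in \<pi>\<theta>. (\<integral>\<^sup>+f. ennreal (R (\<theta>, f)) * indicator W (\<theta>, f) \<partial>\<pi>f)
      \<le> ennreal (Z1 * exp (q \<theta> + r * (1 + real n * (\<theta> - \<theta>0)\<^sup>2))) * indicator TE \<theta>"
      using AE_upper
    proof eventually_elim
      case (elim \<theta>)
      have "(\<integral>\<^sup>+f. ennreal (R (\<theta>, f)) * indicator W (\<theta>, f) \<partial>\<pi>f)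
        \<le> (\<integral>\<^sup>+f. (ennreal (lr n z \<theta> f) * indicator GU f) * indicator TE \<theta> \<partial>\<pi>f)"
        by (intro nn_integral_mono) (auto simp: R_def W_def GU_def TE_def indicator_def)
      also have "\<dots> \<le> ennreal (Z1 * exp (q \<theta> + r * (1 + real n * (\<theta> - \<theta>0)\<^sup>2))) * indicator TE \<theta>"
        using elim by (auto simp: indicator_def)
      finally show ?case .
    qed
  qed
  also have "\<dots> = (\<integral>\<^sup>+\<theta>. ennreal (p \<theta>) * (ennreal (Z1 * exp (q \<theta> + r * (1 + real n * (\<theta> - \<theta>0)\<^sup>2))) * indicator TE \<theta>) * indicator \<Theta> \<theta> \<partial>lborel)"
  proof (rule nn_integral_prior)
    have "(\<lambda>\<theta>. ennreal (Z1 * exp (q \<theta> + r * (1 + real n * (\<theta> - \<theta>0)\<^sup>2))) * indicator TE \<theta>) \<in> borel_measurable borel" by measurable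
    then show "(\<lambda>\<theta>. ennreal (Z1 * exp (q \<theta> + r * (1 + real n * (\<theta> - \<theta>0)\<^sup>2))) * indicator TE \<theta>) \<in> borel_measurable \<pi>\<theta>"
      by (simp cong: measurable_cong_sets add: measurable_restrict_space1)
  qed
  also have "\<dots> \<le> (\<integral>\<^sup>+\<theta>. ennreal (p0 * (1 + \<delta>) * Z1 * exp (q \<theta> + r * (1 + real n * (\<theta> - \<theta>0)\<^sup>2))) \<partial>lborel)"
  proof (intro nn_integral_mono)
    fix \<theta>
    show "ennreal (p \<theta>) * (ennreal (Z1 * exp (q \<theta> + r * (1 + real n * (\<theta> - \<theta>0)\<^sup>2))) * indicator TE \<theta>) * indicator \<Theta> \<theta>
      \<le> ennreal (p0 * (1 + \<delta>) * Z1 * exp (q \<theta> + r * (1 + real n * (\<theta> - \<theta>0)\<^sup>2)))"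
    proof (cases "\<theta> \<in> TE")
      case True
      then have "\<theta> \<in> \<Theta>" "\<bar>\<theta> - \<theta>0\<bar> < \<epsilon> n" using T_sub by (auto simp: TE_def)
      then have "ennreal (p \<theta>) * ennreal (Z1 * exp (q \<theta> + r * (1 + real n * (\<theta> - \<theta>0)\<^sup>2)))
        \<le> ennreal (p0 * (1 + \<delta>)) * ennreal (Z1 * exp (q \<theta> + r * (1 + real n * (\<theta> - \<theta>0)\<^sup>2)))"
        using p(2) by (intro mult_right_mono ennreal_leI) auto
      also have "\<dots> = ennreal (p0 * (1 + \<delta>) * Z1 * exp (q \<theta> + r * (1 + real n * (\<theta> - \<theta>0)\<^sup>2)))"
        using p(1) \<delta> Z1(2) by (simp add: ennreal_mult[symmetric] mult.assoc)
      finally show ?thesis using True \<open>\<theta> \<in> \<Theta>\<close> by simp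
    qed simp
  qed
  finally have W_upper: "(\<integral>\<^sup>+w. ennreal (R w) * indicator W w \<partial>(\<pi>\<theta> \<Otimes>\<^sub>M \<pi>f))
    \<le> (\<integral>\<^sup>+\<theta>. ennreal (p0 * (1 + \<delta>) * Z1 * exp (q \<theta> + r * (1 + real n * (\<theta> - \<theta>0)\<^sup>2))) \<partial>lborel)" .
  have upper: "ennreal ((1 - 3 * \<delta>) * ZZ) \<le> (\<integral>\<^sup>+\<theta>. ennreal (p0 * (1 + \<delta>) * Z1
        * exp (sqrt (real n) * (\<theta> - \<theta>0) * V - real n * (\<theta> - \<theta>0)\<^sup>2 * I0 / 2 + r * (1 + real n * (\<theta> - \<theta>0)\<^sup>2))) \<partial>lborel)"
    using order_trans[OF W_mass W_upper] \<delta> ZZ(2) unfolding q_def by (simp add: ennreal_mult)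

  \<comment> \<open>Lower bound for the unnormalised marginal density on the window\<close>
  define GL where "GL = H \<inter> {f. norm (f - f0) < 2 * \<epsilon> n}"
  have GL [measurable]: "GL \<in> sets borel" unfolding GL_def by measurable
  \<comment> \<open>In the window the errors stay small, and for \<theta> in T the shifted set H
    carries most of the posterior mass given \<theta>0.\<close>
  define A where "A = {\<theta>. sqrt (real n) * \<bar>\<theta> - \<theta>0\<bar> \<le> M} \<inter> T"
  have A [measurable]: "A \<in> sets borel" unfolding A_def by measurable
  have A_prop: "\<theta> \<in> T" "\<theta> \<in> \<Theta>" "\<bar>\<theta> - \<theta>0\<bar> < \<epsilon> n" "real n * (\<theta> - \<theta>0)\<^sup>2 \<le> M\<^sup>2" "\<bar>\<theta> - \<theta>0\<bar> * norm (\<gamma> n) \<le> \<epsilon> n" if "\<theta> \<in> A" for \<theta>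
  proof -
    have le: "sqrt (real n) * \<bar>\<theta> - \<theta>0\<bar> \<le> M" and "\<theta> \<in> T" using that by (auto simp: A_def)
    then show "\<theta> \<in> T" "\<theta> \<in> \<Theta>" using T_sub by auto
    have "sqrt (real n) * \<bar>\<theta> - \<theta>0\<bar> < sqrt (real n) * \<epsilon> n" using le M(2) by linarith
    then show "\<bar>\<theta> - \<theta>0\<bar> < \<epsilon> n" using s by (simp add: mult_less_cancel_left_pos)
    have "(sqrt (real n) * \<bar>\<theta> - \<theta>0\<bar>)\<^sup>2 \<le> M\<^sup>2" using le s by (intro power_mono) auto
    then show "real n * (\<theta> - \<theta>0)\<^sup>2 \<le> M\<^sup>2" by (simp add: power_mult_distrib)
    have "sqrt (real n) * (\<bar>\<theta> - \<theta>0\<bar> * norm (\<gamma> n)) \<le> M * norm (\<gamma> n)"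
      using mult_right_mono[OF le, of "norm (\<gamma> n)"] by (simp add: mult.assoc)
    also note M(3)
    finally show "\<bar>\<theta> - \<theta>0\<bar> * norm (\<gamma> n) \<le> \<epsilon> n" using s by (simp add: mult_le_cancel_left_pos)
  qed
  have AE_lower: "AE \<theta> in \<pi>\<theta>. \<theta> \<in> A \<longrightarrow> ennreal ((1 - 3 * \<delta>) * Z1 * exp (q \<theta> - r * (1 + M\<^sup>2)))
      \<le> (\<integral>\<^sup>+f. ennreal (lr n z \<theta> f) * indicator GL f \<partial>\<pi>f)"
    using AE_rem
  proof eventually_elim
    case (elim \<theta>)
    show ?case
    proof
      assume \<theta>: "\<theta> \<in> A"
      note u = A_prop(3)[OF \<theta>]
      let ?a = "(\<theta> - \<theta>0) *\<^sub>R \<gamma> n"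
      let ?h = "r / 2 * (1 + real n * (\<theta> - \<theta>0)\<^sup>2)"
      let ?I = "(\<lambda>f. f + ?a) ` H"
      have I_eq: "?I = {f. f - ?a \<in> H}"
      proof (intro set_eqI iffI)
        fix f assume "f \<in> {f. f - ?a \<in> H}"
        then show "f \<in> ?I" by (intro image_eqI[of _ _ "f - ?a"]) auto
      qed auto
      have I_m: "?I \<in> sets borel"
      proof -
        have "(\<lambda>f. f - ?a) -` H \<inter> space borel \<in> sets borel" by measurable
        then show ?thesis unfolding I_eq by (simp add: vimage_def)
      qed
      have GL_m: "{f. f - ?a \<in> GL} \<in> sets borel"
      proof -
        have "(\<lambda>f. f - ?a) -` GL \<inter> space borel \<in> sets borel" by measurable
        then show ?thesis by (simp add: vimage_def)
      qed
      \<comment> \<open>Again three losses of \<delta>, now for the posterior given \<theta>0.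
        Pulling back by ?a takes the shifted H to H and the \<epsilon>-ball into the ball of radius
        2 \<epsilon>.\<close>
      have "1 - (\<delta> + \<delta> + \<delta>) \<le> measure (bayes \<pi>f R0) ({f. norm (f - f0) < \<epsilon> n} \<inter> ?I - B)"
      proof (rule Kn.prob_Int_Diff_ge)
        show "measure (bayes \<pi>f R0) B \<le> \<delta>"
          using bad_known Z0 \<delta> unfolding R0_def[symmetric] by (intro bayes_mass_le) auto
        show "1 - \<delta> \<le> measure (bayes \<pi>f R0) {f. norm (f - f0) < \<epsilon> n}" using known_ball unfolding known_eq .
        show "1 - \<delta> \<le> measure (bayes \<pi>f R0) ?I" using known_H[OF A_prop(1)[OF \<theta>]] unfolding known_eq .
      qed (use I_m sets_Kn in auto)
      also have "\<dots> \<le> measure (bayes \<pi>f R0) ({f. f - ?a \<in> GL} - B)"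
      proof (rule Kn.finite_measure_mono)
        have "norm (f - ?a - f0) < 2 * \<epsilon> n" if "norm (f - f0) < \<epsilon> n" for f
        proof -
          have "norm (f - ?a - f0) = norm ((f - f0) - ?a)" by (simp add: algebra_simps)
          also have "\<dots> \<le> norm (f - f0) + norm ?a" by (rule norm_triangle_ineq4)
          also have "\<dots> < 2 * \<epsilon> n" using that A_prop(5)[OF \<theta>] by simp
          finally show ?thesis .
        qed
        then show "{f. norm (f - f0) < \<epsilon> n} \<inter> ?I - B \<subseteq> {f. f - ?a \<in> GL} - B"
          unfolding I_eq GL_def by auto
        show "{f. f - ?a \<in> GL} - B \<in> sets (bayes \<pi>f R0)" using GL_m sets_Kn by auto
      qed
      finally have "ennreal (1 - 3 * \<delta>) * (\<integral>\<^sup>+f. ennreal (R0 f) \<partial>\<pi>f) \<le> (\<integral>\<^sup>+f. ennreal (R0 f) * indicator ({f. f - ?a \<in> GL} - B) f \<partial>\<pi>f)"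
        using \<delta> R_pos GL_m by (intro bayes_mass_ge R0_m) auto
      then have known_mass: "ennreal ((1 - 3 * \<delta>) * Z1) \<le> (\<integral>\<^sup>+f. ennreal (R0 f) * indicator ({f. f - ?a \<in> GL} - B) f \<partial>\<pi>f)"
        unfolding Z1(1) using \<delta> Z1(2) by (simp add: ennreal_mult)
      have "ennreal ((1 - 3 * \<delta>) * Z1 * exp (q \<theta> - r * (1 + M\<^sup>2))) = ennreal (exp (q \<theta> - r * (1 + M\<^sup>2))) * ennreal ((1 - 3 * \<delta>) * Z1)"
        using \<delta> Z1(2) by (simp add: ennreal_mult[symmetric] mult.commute)
      also have "\<dots> \<le> ennreal (exp (- (?h - q \<theta>) - ?h)) * (\<integral>\<^sup>+f. ennreal (R0 f) * indicator ({f. f - ?a \<in> GL} - B) f \<partial>\<pi>f)"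
      proof (intro mult_mono known_mass ennreal_leI)
        \<comment> \<open>Inside the window the error growing in u is replaced by its value at the
          edge, so the remaining factor is constant in \<theta>.\<close>
        have "r * (1 + real n * (\<theta> - \<theta>0)\<^sup>2) \<le> r * (1 + M\<^sup>2)" using A_prop(4)[OF \<theta>] r by (intro mult_left_mono) auto
        then have "q \<theta> - r * (1 + M\<^sup>2) \<le> - (?h - q \<theta>) - ?h" by (simp add: field_simps)
        then show "exp (q \<theta> - r * (1 + M\<^sup>2)) \<le> exp (- (?h - q \<theta>) - ?h)" by simp
      qed auto
      also have "\<dots> \<le> (\<integral>\<^sup>+f. ennreal (lr n z \<theta> f) * indicator GL f \<partial>\<pi>f)"
      proof (rule shift_lower_bound[OF sets_\<pi>f GL B _ _ L2[OF u]])
        show "- ?h \<le> L 0 (\<theta> - \<theta>0) f" if "f \<notin> B" for f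
          using L_le[OF u that] abs_le_D2[of "L 0 (\<theta> - \<theta>0) f" ?h] by linarith
        show "AE f in \<pi>f. f \<in> GL \<longrightarrow> ennreal (exp (- (?h - q \<theta>))) * ennreal (R0 (f + ?a)) \<le> ennreal (lr n z \<theta> f)"
          using elim[rule_format, OF u] by eventually_elim (auto simp: GL_def)
      qed measurable
      finally show "ennreal ((1 - 3 * \<delta>) * Z1 * exp (q \<theta> - r * (1 + M\<^sup>2)))
        \<le> (\<integral>\<^sup>+f. ennreal (lr n z \<theta> f) * indicator GL f \<partial>\<pi>f)" .
    qed
  qed

  \<comment> \<open>The marginal posterior of \<theta> bounded from below\<close>
  define Q where "Q = distr (bayes (\<pi>\<theta> \<Otimes>\<^sub>M \<pi>f) R) borel fst"
  have fst_m: "fst \<in> \<pi>\<theta> \<Otimes>\<^sub>M \<pi>f \<rightarrow>\<^sub>M borel"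
    by (rule measurable_compose[OF measurable_fst]) (simp cong: measurable_cong_sets add: measurable_restrict_space1)
  have fst_m': "fst \<in> bayes (\<pi>\<theta> \<Otimes>\<^sub>M \<pi>f) R \<rightarrow>\<^sub>M borel" using fst_m by (simp add: bayes_def)
  have Q_prob: "prob_space Q" unfolding Q_def by (rule Po.prob_space_distr[OF fst_m'])
  have lower: "(\<integral>\<^sup>+\<theta>. ennreal ((1 - 3 * \<delta>) * Z1 * (p0 * (1 - \<delta>))
        * exp (sqrt (real n) * (\<theta> - \<theta>0) * V - real n * (\<theta> - \<theta>0)\<^sup>2 * I0 / 2 - r * (1 + M\<^sup>2))) * indicator (F \<inter> A) \<theta> \<partial>lborel)
      \<le> ennreal (ZZ * measure Q F)" if F [measurable]: "F \<in> sets borel" for F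
  proof -
    let ?g = "\<lambda>\<theta>. ennreal ((1 - 3 * \<delta>) * Z1 * exp (q \<theta> - r * (1 + M\<^sup>2))) * indicator (F \<inter> A) \<theta>"
    define F' where "F' = fst -` F \<inter> space (\<pi>\<theta> \<Otimes>\<^sub>M \<pi>f)"
    have F' [measurable]: "F' \<in> sets (\<pi>\<theta> \<Otimes>\<^sub>M \<pi>f)" unfolding F'_def by (rule measurable_sets[OF fst_m F])
    have "(\<integral>\<^sup>+\<theta>. ennreal ((1 - 3 * \<delta>) * Z1 * (p0 * (1 - \<delta>)) * exp (q \<theta> - r * (1 + M\<^sup>2))) * indicator (F \<inter> A) \<theta> \<partial>lborel)
      \<le> (\<integral>\<^sup>+\<theta>. ennreal (p \<theta>) * ?g \<theta> * indicator \<Theta> \<theta> \<partial>lborel)"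
    proof (intro nn_integral_mono)
      fix \<theta>
      show "ennreal ((1 - 3 * \<delta>) * Z1 * (p0 * (1 - \<delta>)) * exp (q \<theta> - r * (1 + M\<^sup>2))) * indicator (F \<inter> A) \<theta>
        \<le> ennreal (p \<theta>) * ?g \<theta> * indicator \<Theta> \<theta>"
      proof (cases "\<theta> \<in> F \<inter> A")
        case True
        then have \<theta>: "\<theta> \<in> A" by simp
        have "(1 - 3 * \<delta>) * Z1 * (p0 * (1 - \<delta>)) * exp (q \<theta> - r * (1 + M\<^sup>2))
          = (p0 * (1 - \<delta>)) * ((1 - 3 * \<delta>) * Z1 * exp (q \<theta> - r * (1 + M\<^sup>2)))" by simp
        then have "ennreal ((1 - 3 * \<delta>) * Z1 * (p0 * (1 - \<delta>)) * exp (q \<theta> - r * (1 + M\<^sup>2)))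
          = ennreal (p0 * (1 - \<delta>)) * ennreal ((1 - 3 * \<delta>) * Z1 * exp (q \<theta> - r * (1 + M\<^sup>2)))"
          using \<delta> p(1) Z1(2) by (simp only:) (intro ennreal_mult, auto)
        also have "\<dots> \<le> ennreal (p \<theta>) * ennreal ((1 - 3 * \<delta>) * Z1 * exp (q \<theta> - r * (1 + M\<^sup>2)))"
          using p(2) A_prop[OF \<theta>] by (intro mult_right_mono ennreal_leI) auto
        finally show ?thesis using True A_prop(2)[OF \<theta>] by simp
      qed simp
    qed
    also have "\<dots> = (\<integral>\<^sup>+\<theta>. ?g \<theta> \<partial>\<pi>\<theta>)"
    proof (rule nn_integral_prior[symmetric])
      have "?g \<in> borel_measurable borel" by measurable
      then show "?g \<in> borel_measurable \<pi>\<theta>" by (simp cong: measurable_cong_sets add: measurable_restrict_space1)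
    qed
    also have "\<dots> \<le> (\<integral>\<^sup>+\<theta>. (\<integral>\<^sup>+f. ennreal (R (\<theta>, f)) * indicator F' (\<theta>, f) \<partial>\<pi>f) \<partial>\<pi>\<theta>)"
    proof (rule nn_integral_mono_AE)
      show "AE \<theta> in \<pi>\<theta>. ?g \<theta> \<le> (\<integral>\<^sup>+f. ennreal (R (\<theta>, f)) * indicator F' (\<theta>, f) \<partial>\<pi>f)"
        using AE_lower
      proof eventually_elim
        case (elim \<theta>)
        show ?case
        proof (cases "\<theta> \<in> F \<inter> A")
          case True
          then have \<theta>: "\<theta> \<in> A" "\<theta> \<in> F" by auto
          have "?g \<theta> \<le> (\<integral>\<^sup>+f. ennreal (lr n z \<theta> f) * indicator GL f \<partial>\<pi>f)" using elim True by simp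
          also have "\<dots> \<le> (\<integral>\<^sup>+f. ennreal (R (\<theta>, f)) * indicator F' (\<theta>, f) \<partial>\<pi>f)"
            using A_prop(2)[OF \<theta>(1)] \<theta>(2)
            by (intro nn_integral_mono) (auto simp: R_def F'_def indicator_def space_pair_measure)
          finally show ?thesis .
        qed simp
      qed
    qed
    also have "\<dots> = (\<integral>\<^sup>+w. ennreal (R w) * indicator F' w \<partial>(\<pi>\<theta> \<Otimes>\<^sub>M \<pi>f))"
      by (rule PF.nn_integral_fst) measurable
    also have "\<dots> = ennreal ZZ * emeasure (bayes (\<pi>\<theta> \<Otimes>\<^sub>M \<pi>f) R) F'"
      unfolding emeasure_bayes[OF \<open>R \<in> borel_measurable (\<pi>\<theta> \<Otimes>\<^sub>M \<pi>f)\<close> F'] ZZ(1)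
      using ZZ(2) by (simp add: ennreal_times_divide mult.commute[of "ennreal ZZ"] mult_divide_eq_ennreal)
    also have "emeasure (bayes (\<pi>\<theta> \<Otimes>\<^sub>M \<pi>f) R) F' = ennreal (measure Q F)"
    proof -
      have "space (bayes (\<pi>\<theta> \<Otimes>\<^sub>M \<pi>f) R) = space (\<pi>\<theta> \<Otimes>\<^sub>M \<pi>f)" by (simp add: bayes_def)
      then have "measure Q F = measure (bayes (\<pi>\<theta> \<Otimes>\<^sub>M \<pi>f) R) F'"
        unfolding Q_def F'_def by (simp add: measure_distr[OF fst_m'])
      then show ?thesis by (simp add: Po.emeasure_eq_measure)
    qed
    also have "ennreal ZZ * ennreal (measure Q F) = ennreal (ZZ * measure Q F)" using ZZ(2) by (simp add: ennreal_mult)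
    finally show ?thesis unfolding q_def .
  qed

  \<comment> \<open>Comparison with the limiting normal law\<close>
  let ?N = "normal_law (\<theta>0 + V / I0 / sqrt (real n)) (inverse I0 / real n)"
  interpret N: prob_space ?N using n I0 by (intro prob_space_normal_law) simp
  \<comment> \<open>The normal law misses A either in its tail beyond the window or on the part of
    the window not covered by T; each has mass at most \<delta>.\<close>
  have NA: "1 - 10 * \<delta> \<le> measure ?N A"
  proof -
    let ?C = "{\<theta>. sqrt (real n) * \<bar>\<theta> - \<theta>0\<bar> \<le> M} - T"
    have "measure ?N (space ?N - A) \<le> measure ?N ({\<theta>. M < sqrt (real n) * \<bar>\<theta> - \<theta>0\<bar>} \<union> ?C)"
      by (rule N.finite_measure_mono) (auto simp: A_def not_le)
    also have "\<dots> \<le> measure ?N {\<theta>. M < sqrt (real n) * \<bar>\<theta> - \<theta>0\<bar>} + measure ?N ?C"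
      by (intro measure_Un_le) auto
    also have "measure ?N ?C \<le> \<delta>"
      using normal_law_measure_le[of n I0 ?C c "\<theta>0 + V / I0 / sqrt (real n)"] n I0 missing by auto
    finally have "measure ?N (space ?N - A) \<le> 2 * \<delta>" using tail by simp
    moreover have "measure ?N (space ?N - A) = 1 - measure ?N A" by (rule N.prob_compl) simp
    ultimately show ?thesis using \<delta> by linarith
  qed
  have "(1 - 10 * \<delta>) * measure ?N (F \<inter> A) \<le> measure Q F" if F: "F \<in> sets ?N" for F
    using F n by (intro normal_comparison[OF _ ZZ(2) Z1(2) p(1) \<delta> r V rM ratio Q_prob _ A upper lower]) auto
  then have "tv_dist Q ?N \<le> 4 * (10 * \<delta>)" "0 \<le> tv_dist Q ?N"
    using NA \<delta> by (intro tv_dist_le_one_sided[where A = A] Q_prob N.prob_space_axioms; simp add: Q_def)+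
  moreover have "efficient_influence e K K' \<theta>0 f0 n x = V / I0"
    using efficient_influence_eq[OF n] reg by (simp add: V_def z_def)
  ultimately show ?thesis unfolding post_eq Q_def by simp
qed


lemma sqrt_n\<epsilon>_at_top: "filterlim (\<lambda>n. sqrt (real n) * \<epsilon> n) at_top sequentially"
proof -
  have "filterlim (\<lambda>n. sqrt (real n * (\<epsilon> n)\<^sup>2)) at_top sequentially"
    by (rule filterlim_compose[OF sqrt_at_top n\<epsilon>_at_top])
  moreover have "\<forall>\<^sub>F n in sequentially. sqrt (real n * (\<epsilon> n)\<^sup>2) = sqrt (real n) * \<epsilon> n"
    using eventually_ge_at_top[of 1]
    by eventually_elim (use \<epsilon>_pos in \<open>auto simp: real_sqrt_mult less_imp_le\<close>)
  ultimately show ?thesis by (simp add: filterlim_cong[OF refl refl])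
qed

text \<open>The tail estimate asks for r1 M^2 \<ge> ln (2 / \<delta>), the expansion for r (1 + M^2)
  \<le> \<delta>, which for small \<delta> excludes a common exponent. Hence r1 is fixed first, it
  determines M, and r is chosen afterwards.\<close>

lemma comparison_constants:
  assumes \<delta>: "0 < \<delta>"
  shows "\<exists>r>0. \<exists>M>0. 2 * r < I0 \<and> r * (1 + M\<^sup>2) \<le> \<delta> \<and> exp r * gauss_ratio I0 v r \<le> 1 + \<delta> \<and>
    (\<forall>n V. 0 < n \<longrightarrow> \<bar>V\<bar> \<le> v \<longrightarrow>
      measure (normal_law (\<theta>0 + V / I0 / sqrt (real n)) (inverse I0 / real n)) {\<theta>. M < sqrt (real n) * \<bar>\<theta> - \<theta>0\<bar>} \<le> \<delta>)"
proof -
  have pos: "\<forall>\<^sub>F r in at_right (0::real). 0 < r" by (simp add: eventually_at_right_less)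
  have lt: "\<forall>\<^sub>F r in at_right (0::real). r < x" if "0 < x" for x
    using that by (auto simp: eventually_at_right_field)
  have gr: "\<forall>\<^sub>F r in at_right (0::real). exp r * gauss_ratio I0 v r < 1 + x" if "0 < x" for x
    by (rule order_tendstoD(2)[OF gauss_ratio_tendsto[OF I0_pos]]) (use that in simp)
  have "\<forall>\<^sub>F r in at_right (0::real). 0 < r \<and> r < I0 / 2 \<and> exp r * gauss_ratio I0 v r < 1 + 1"
    using pos lt[of "I0 / 2"] gr[of 1] I0_pos by (simp add: eventually_conj_iff)
  from eventually_happens'[OF trivial_limit_at_right_real this]
  obtain r1 where r1: "0 < r1" "r1 < I0 / 2" "exp r1 * gauss_ratio I0 v r1 < 2" by auto
  \<comment> \<open>The maximum with 1 ensures M \<le> M^2, so r1 M^2 \<ge> ln (2 / \<delta>); the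
    tail is then at most \<delta> / 2 times a Gaussian ratio that r1 keeps below 2.\<close>
  define M where "M = max 1 (ln (2 / \<delta>) / r1)"
  have M: "1 \<le> M" "ln (2 / \<delta>) / r1 \<le> M" by (auto simp: M_def)
  have "\<forall>\<^sub>F r in at_right (0::real). 0 < r \<and> r < I0 / 2 \<and> r < \<delta> / (1 + M\<^sup>2) \<and> exp r * gauss_ratio I0 v r < 1 + \<delta>"
    using pos lt[of "I0 / 2"] lt[of "\<delta> / (1 + M\<^sup>2)"] gr[of \<delta>] I0_pos \<delta> by (simp add: eventually_conj_iff add_pos_nonneg)
  from eventually_happens'[OF trivial_limit_at_right_real this]
  obtain r where r: "0 < r" "r < I0 / 2" "r < \<delta> / (1 + M\<^sup>2)" "exp r * gauss_ratio I0 v r < 1 + \<delta>" by auto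
  have "r * (1 + M\<^sup>2) \<le> \<delta>" using r(3) by (simp add: pos_less_divide_eq add_pos_nonneg less_imp_le)
  moreover have "measure (normal_law (\<theta>0 + V / I0 / sqrt (real n)) (inverse I0 / real n)) {\<theta>. M < sqrt (real n) * \<bar>\<theta> - \<theta>0\<bar>} \<le> \<delta>"
    if n: "0 < n" and V: "\<bar>V\<bar> \<le> v" for n V
  proof -
    have g0: "0 \<le> gauss_ratio I0 v r1" using r1 by (simp add: gauss_ratio_def)
    have "gauss_ratio I0 v r1 \<le> exp r1 * gauss_ratio I0 v r1"
      using mult_right_mono[OF _ g0, of 1 "exp r1"] r1 by simp
    then have g2: "gauss_ratio I0 v r1 \<le> 2" using r1 by linarith
    have "M \<le> M\<^sup>2" using self_le_power[OF M(1), of 2] by simp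
    then have "ln (2 / \<delta>) / r1 \<le> M\<^sup>2" using M(2) by linarith
    then have "ln (2 / \<delta>) \<le> r1 * M\<^sup>2" using r1 by (simp add: field_simps)
    then have "exp (- (r1 * M\<^sup>2)) \<le> exp (- ln (2 / \<delta>))" by simp
    also have "\<dots> = \<delta> / 2" using \<delta> by (simp add: exp_minus)
    finally have "exp (- (r1 * M\<^sup>2)) * gauss_ratio I0 v r1 \<le> \<delta> / 2 * 2"
      using g0 g2 \<delta> by (intro mult_mono) auto
    then show ?thesis
      using normal_tail_bound[OF n less_imp_le[OF r1(1)] _ V, of I0 M \<theta>0] r1 M by simp
  qed
  ultimately show ?thesis using r M by (intro exI[of _ r] exI[of _ M] conjI) auto
qed

text \<open>Common form of the two alternatives of (e): \<kappa> bounds the cross term on H, and T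
  needs to exhaust the window only up to small Lebesgue measure.\<close>

lemma bernstein_von_mises:
  fixes H :: "nat \<Rightarrow> 'h set" and T :: "nat \<Rightarrow> real set" and \<kappa> :: "nat \<Rightarrow> real"
  assumes HT: "\<And>n. 1 \<le> n \<Longrightarrow> H n \<in> sets borel \<and> T n \<in> sets borel \<and> T n \<subseteq> \<Theta>"
    and \<kappa>: "\<kappa> \<longlonglongrightarrow> 0"
    and H\<kappa>: "\<forall>\<^sub>F n in sequentially. \<forall>f\<in>H n. sqrt (real n) * \<bar>K0 (f - f0) \<bullet> K0' (f - f0)\<bar> \<le> \<kappa> n"
    and grow: "\<And>M c. 0 < M \<Longrightarrow> 0 < c \<Longrightarrow>
      \<forall>\<^sub>F n in sequentially. emeasure lborel ({\<theta>. sqrt (real n) * \<bar>\<theta> - \<theta>0\<bar> \<le> M} - T n) \<le> ennreal (c / sqrt (real n))"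
    and contr: "\<And>\<delta>. 0 < \<delta> \<Longrightarrow> whp P (\<lambda>n x. 1 - \<delta> \<le> measure (post n x)
           (contraction_set n))"
    and contr_known: "\<And>\<delta>. 0 < \<delta> \<Longrightarrow> whp P (\<lambda>n x. 1 - \<delta> \<le> measure (post_known n x) {f. norm (f - f0) < \<epsilon> n})"
    and loc: "\<And>\<delta>. 0 < \<delta> \<Longrightarrow> whp P (\<lambda>n x. 1 - \<delta> \<le> measure (post n x) (T n \<times> H n))"
    and loc_known: "\<And>\<delta>. 0 < \<delta> \<Longrightarrow> whp P (\<lambda>n x. \<forall>\<theta>\<in>T n. 1 - \<delta> \<le>
      measure (post_known n x) ((\<lambda>f. f + (\<theta> - \<theta>0) *\<^sub>R \<gamma> n) ` H n))"
  shows "conv_in_prob P tv_error 0"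
  unfolding conv_in_prob_iff_whp
proof (intro allI impI)
  fix \<delta>' :: real assume \<delta>': "0 < \<delta>'"
  \<comment> \<open>The comparison with the normal law works for \<delta> \<le> 1/10, and the
    resulting distance is at most 40 \<delta>.\<close>
  define \<delta> where "\<delta> = min (1 / 10) (\<delta>' / 40)"
  have \<delta>: "0 < \<delta>" "\<delta> \<le> 1 / 10" "40 * \<delta> \<le> \<delta>'" using \<delta>' by (auto simp: \<delta>_def)
  show "whp P (\<lambda>n x. \<bar>tv_error n x - 0\<bar> \<le> \<delta>')"
    unfolding whp_def
  proof (intro allI impI)
    fix \<tau> :: real assume \<tau>: "0 < \<tau>"
    \<comment> \<open>Order of the choices: \<tau> fixes the bound v on the score, then v and
      \<delta> fix r and M, all before n.\<close>
    obtain v E where v: "0 < v" and E: "E \<in> sets white_noise" "emeasure white_noise E \<le> ennreal (\<tau> / 2)"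
      and score_le: "\<And>z. z \<notin> E \<Longrightarrow> regular z \<Longrightarrow> \<bar>score z \<gamma>0\<bar> \<le> v"
      using score_tight[of "\<tau> / 2"] \<tau> by auto
    obtain r M where r: "0 < r" "2 * r < I0" and M: "0 < M" and rM: "r * (1 + M\<^sup>2) \<le> \<delta>"
      and ratio: "exp r * gauss_ratio I0 v r \<le> 1 + \<delta>"
      and tail: "\<And>n V. 0 < n \<Longrightarrow> \<bar>V\<bar> \<le> v \<Longrightarrow>
        measure (normal_law (\<theta>0 + V / I0 / sqrt (real n)) (inverse I0 / real n)) {\<theta>. M < sqrt (real n) * \<bar>\<theta> - \<theta>0\<bar>} \<le> \<delta>"
      using comparison_constants[OF \<delta>(1), of v] by blast
    \<comment> \<open>The normal density is at most \<open>sqrt (real n * I0)\<close>, so a missing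
      set of Lebesgue measure c / sqrt n has normal mass at most \<delta>.\<close>
    define c where "c = \<delta> / sqrt I0"
    have c: "0 < c" "sqrt I0 * c \<le> \<delta>" using \<delta> I0_pos by (auto simp: c_def)
    obtain L B where LB0: "\<forall>n\<ge>1. B n \<in> sets borel \<and> measure \<pi>f (B n) \<le> exp (- (3 * (real n * (\<epsilon> n)\<^sup>2))) \<and>
     (\<forall>u. \<bar>u\<bar> < \<epsilon> n \<longrightarrow>
        log_density_version (shifted_law \<pi>f 0) (shifted_law \<pi>f (- (u *\<^sub>R \<gamma> n))) (L n (- u) u) \<and>
        log_density_version (shifted_law \<pi>f (u *\<^sub>R \<gamma> n)) (shifted_law \<pi>f 0) (L n 0 u) \<and>
        (\<forall>f. f \<notin> B n \<longrightarrow> \<bar>L n (- u) u f\<bar> \<le> \<eta> n * (1 + real n * u\<^sup>2) \<and> \<bar>L n 0 u f\<bar> \<le> \<eta> n * (1 + real n * u\<^sup>2)))"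
      using shift_densities by (elim exE)
    have LB: "B n \<in> sets borel" "measure \<pi>f (B n) \<le> exp (- (3 * (real n * (\<epsilon> n)\<^sup>2)))" if "1 \<le> n" for n
      using LB0[rule_format, OF that] by blast+
    have L1: "log_density_version (shifted_law \<pi>f 0) (shifted_law \<pi>f (- (u *\<^sub>R \<gamma> n))) (L n (- u) u)"
      and L2: "log_density_version (shifted_law \<pi>f (u *\<^sub>R \<gamma> n)) (shifted_law \<pi>f 0) (L n 0 u)"
      and L_le: "f \<notin> B n \<Longrightarrow> \<bar>L n (- u) u f\<bar> \<le> \<eta> n * (1 + real n * u\<^sup>2) \<and> \<bar>L n 0 u f\<bar> \<le> \<eta> n * (1 + real n * u\<^sup>2)"
      if "1 \<le> n" "\<bar>u\<bar> < \<epsilon> n" for n u f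
      using LB0[rule_format, OF that(1)] that(2) by blast+
    have r2: "0 < r / 2" using r by simp
    define G where "G n x \<longleftrightarrow>
      (regular (noise n x) \<and> small_remainder n (noise n x) (H n) (r / 2)) \<and>
      1 - \<delta> \<le> measure (post n x) (contraction_set n) \<and>
      1 - \<delta> \<le> measure (post_known n x) {f. norm (f - f0) < \<epsilon> n} \<and>
      1 - \<delta> \<le> measure (post n x) (T n \<times> H n) \<and>
      (\<forall>\<theta>\<in>T n. 1 - \<delta> \<le> measure (post_known n x) ((\<lambda>f. f + (\<theta> - \<theta>0) *\<^sub>R \<gamma> n) ` H n)) \<and>
      (\<integral>\<^sup>+f. ennreal (lr n (noise n x) \<theta>0 f) * indicator (B n) f \<partial>\<pi>f)
        \<le> ennreal \<delta> * (\<integral>\<^sup>+f. ennreal (lr n (noise n x) \<theta>0 f) \<partial>\<pi>f) \<and>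
      (\<integral>\<^sup>+w. ennreal (lr n (noise n x) (fst w) (snd w)) * indicator ({\<theta>\<in>\<Theta>. \<bar>\<theta> - \<theta>0\<bar> < \<epsilon> n} \<times> B n) w \<partial>(\<pi>\<theta> \<Otimes>\<^sub>M \<pi>f))
        \<le> ennreal \<delta> * (\<integral>\<^sup>+w. ennreal (lr n (noise n x) (fst w) (snd w)) \<partial>(\<pi>\<theta> \<Otimes>\<^sub>M \<pi>f))" for n x
    have "whp P G"
      unfolding G_def[abs_def]
      by (intro whp_conj[OF whp_remainder[OF r2 \<kappa> H\<kappa>]] whp_conj[OF contr] whp_conj[OF contr_known] whp_conj[OF loc]
          whp_conj[OF loc_known] whp_conj[OF whp_negligible_known[OF LB]] whp_negligible_full[OF LB] \<delta>(1))
    then have evG: "\<forall>\<^sub>F n in sequentially. outer_measure_of (P n) {x \<in> space (P n). \<not> G n x} \<le> ennreal (\<tau> / 2)"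
      using \<tau> unfolding whp_def by simp
    have p0: "0 < p \<theta>0" using p_bounds \<theta>0_in by force
    obtain d where d: "0 < d" "\<And>\<theta>. \<theta> \<in> \<Theta> \<Longrightarrow> \<bar>\<theta> - \<theta>0\<bar> < d \<Longrightarrow> \<bar>p \<theta> - p \<theta>0\<bar> < p \<theta>0 * \<delta>"
    proof -
      have "0 < p \<theta>0 * \<delta>" using p0 \<delta> by simp
      then show ?thesis using p_cont \<theta>0_in that unfolding continuous_on_iff dist_real_def by blast
    qed
    have ev\<epsilon>: "\<forall>\<^sub>F n in sequentially. \<epsilon> n < d" by (rule order_tendstoD(2)[OF \<epsilon>_lim d(1)])
    have ev\<eta>: "\<forall>\<^sub>F n in sequentially. \<eta> n < r / 2" by (rule order_tendstoD(2)[OF \<eta>_lim r2])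
    have ev1: "\<forall>\<^sub>F n in sequentially. max (M + 1) (M * (norm \<gamma>0 + 1)) \<le> sqrt (real n) * \<epsilon> n"
      using sqrt_n\<epsilon>_at_top by (simp only: filterlim_at_top)
    have ev\<gamma>: "\<forall>\<^sub>F n in sequentially. norm (\<gamma> n) < norm \<gamma>0 + 1"
      by (rule order_tendstoD(2)[OF tendsto_norm[OF \<gamma>_lim]]) simp
    show "\<forall>\<^sub>F n in sequentially. outer_measure_of (P n) {x \<in> space (P n). \<not> \<bar>tv_error n x - 0\<bar> \<le> \<delta>'} \<le> ennreal \<tau>"
      using evG ev\<epsilon> ev\<eta> ev1 ev\<gamma> grow[OF M c(1)] eventually_ge_at_top[of 1]
    proof eventually_elim
      case (elim n)
      have \<epsilon>: "0 < \<epsilon> n" using \<epsilon>_pos elim by blast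
      have tv: "\<bar>tv_error n x\<bar> \<le> \<delta>'" if Gx: "G n x" and Ex: "noise n x \<notin> E" for x
      proof -
        have M2: "M < sqrt (real n) * \<epsilon> n" using elim(4) by linarith
        have "M * norm (\<gamma> n) \<le> M * (norm \<gamma>0 + 1)" using M elim(5) by (intro mult_left_mono) auto
        then have M3: "M * norm (\<gamma> n) \<le> sqrt (real n) * \<epsilon> n" using elim(4) by linarith
        have reg: "regular (noise n x)" using Gx by (simp add: G_def)
        have V: "\<bar>score (noise n x) \<gamma>0\<bar> \<le> v" by (rule score_le[OF Ex reg])
        have L_le': "\<bar>L n (- u) u f\<bar> \<le> r / 2 * (1 + real n * u\<^sup>2) \<and> \<bar>L n 0 u f\<bar> \<le> r / 2 * (1 + real n * u\<^sup>2)"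
          if "\<bar>u\<bar> < \<epsilon> n" "f \<notin> B n" for u f
        proof -
          have "\<eta> n * (1 + real n * u\<^sup>2) \<le> r / 2 * (1 + real n * u\<^sup>2)" using elim(3) by (intro mult_right_mono) auto
          then show ?thesis using L_le[OF elim(7) that] by linarith
        qed
        have pb: "p \<theta>0 * (1 - \<delta>) \<le> p \<theta> \<and> p \<theta> \<le> p \<theta>0 * (1 + \<delta>)" if "\<theta> \<in> \<Theta>" "\<bar>\<theta> - \<theta>0\<bar> < \<epsilon> n" for \<theta>
        proof -
          have "\<bar>p \<theta> - p \<theta>0\<bar> < p \<theta>0 * \<delta>" using d(2)[OF that(1)] that(2) elim(2) by linarith
          then show ?thesis by (auto simp: abs_less_iff algebra_simps)
        qed
        have "\<bar>tv_error n x\<bar> \<le> 40 * \<delta>"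
        proof (rule tv_bound[where r = r and M = M and v = v and c = c and H = "H n" and T = "T n" and B = "B n" and L = "L n" and ?p0.0 = "p \<theta>0"])
          show "1 \<le> n" "regular (noise n x)" "0 < \<delta>" "\<delta> \<le> 1 / 10" "2 * r < I0" "r * (1 + M\<^sup>2) \<le> \<delta>"
            "exp r * gauss_ratio I0 v r \<le> 1 + \<delta>" "\<bar>score (noise n x) \<gamma>0\<bar> \<le> v" "sqrt I0 * c \<le> \<delta>"
            "M < sqrt (real n) * \<epsilon> n" "M * norm (\<gamma> n) \<le> sqrt (real n) * \<epsilon> n" "0 < p \<theta>0"
            "emeasure lborel ({\<theta>. sqrt (real n) * \<bar>\<theta> - \<theta>0\<bar> \<le> M} - T n) \<le> ennreal (c / sqrt (real n))"
            by fact+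
          show "0 \<le> r" "0 \<le> M" "0 \<le> c" using r M c by auto
          show "H n \<in> sets borel" "T n \<in> sets borel" "T n \<subseteq> \<Theta>" "B n \<in> sets borel"
            using HT[OF elim(7)] LB(1)[OF elim(7)] by auto
          show "measure (normal_law (\<theta>0 + score (noise n x) \<gamma>0 / I0 / sqrt (real n)) (inverse I0 / real n)) {\<theta>. M < sqrt (real n) * \<bar>\<theta> - \<theta>0\<bar>} \<le> \<delta>"
            using elim(7) V by (intro tail) auto
        qed (use Gx L1[OF elim(7)] L2[OF elim(7)] L_le' pb in \<open>(simp add: G_def; fail)+\<close>)
        then show ?thesis using \<delta>(3) by linarith
      qed
      have "outer_measure_of (P n) {x \<in> space (P n). \<not> \<bar>tv_error n x - 0\<bar> \<le> \<delta>'}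
        \<le> outer_measure_of (P n) ({x \<in> space (P n). \<not> G n x} \<union> {x \<in> space (P n). \<not> noise n x \<notin> E})"
        using tv by (intro outer_measure_of_mono) auto
      also have "\<dots> \<le> outer_measure_of (P n) {x \<in> space (P n). \<not> G n x} + outer_measure_of (P n) {x \<in> space (P n). \<not> noise n x \<notin> E}"
        by (rule outer_measure_of_Un) auto
      also have "\<dots> \<le> ennreal (\<tau> / 2) + ennreal (\<tau> / 2)"
        by (intro add_mono elim(1) outer_measure_noise[OF elim(7) E]) auto
      also have "\<dots> = ennreal \<tau>" using \<tau> by (simp add: ennreal_plus[symmetric] del: ennreal_plus)
      finally show ?case .
    qed
  qed
qed

lemma conv_in_prob_1_whp:
  assumes "conv_in_prob P Y 1" and "0 < \<delta>"
  shows "whp P (\<lambda>n x. 1 - \<delta> \<le> Y n x)"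
proof (rule whp_mono)
  show "whp P (\<lambda>n x. \<bar>Y n x - 1\<bar> \<le> \<delta>)" using assms unfolding conv_in_prob_iff_whp by blast
qed (auto simp: abs_le_iff)

text \<open>With H the whole space, every shifted localising set is \<open>UNIV\<close>. When 1 -
  \<delta> > 0 the mass of A forces a proper normaliser, so the posterior is a probability
  measure.\<close>

lemma posterior_known_UNIV:
  assumes n: "1 \<le> n" and reg: "regular (noise n x)"
    and ge: "1 - \<delta> \<le> measure (post_known n x) A" and A: "A \<in> sets borel"
  shows "1 - \<delta> \<le> measure (post_known n x) UNIV"
proof (cases "1 - \<delta> \<le> 0")
  case False
  have R: "lr n (noise n x) \<theta>0 \<in> borel_measurable \<pi>f" by measurable
  have "0 < measure (bayes \<pi>f (lr n (noise n x) \<theta>0)) A" using False ge posterior_known_eq[OF n reg] by simp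
  then interpret prob_space "bayes \<pi>f (lr n (noise n x) \<theta>0)"
    using bayes_mass_finite[OF R] A by (intro prob_space_bayes R) (auto simp: lr_def)
  have "prob UNIV = 1" using prob_space by (simp add: bayes_def)
  moreover have "1 - \<delta> \<le> prob A" using ge posterior_known_eq[OF n reg] by simp
  then have "1 - \<delta> \<le> 1" using prob_le_1 by (rule order_trans)
  ultimately show ?thesis using posterior_known_eq[OF n reg] by simp
qed (simp add: order_trans[OF _ measure_nonneg])

lemma posterior_mono:
  assumes n: "1 \<le> n" and reg: "regular (noise n x)" and AB: "A \<subseteq> B"
    and ge: "1 - \<delta> \<le> measure (post n x) A"
    and A: "A \<in> sets (\<pi>\<theta> \<Otimes>\<^sub>M \<pi>f)" and B: "B \<in> sets (\<pi>\<theta> \<Otimes>\<^sub>M \<pi>f)"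
  shows "1 - \<delta> \<le> measure (post n x) B"
proof (cases "1 - \<delta> \<le> 0")
  case False
  let ?R = "\<lambda>w. lr n (noise n x) (fst w) (snd w)"
  have R: "?R \<in> borel_measurable (\<pi>\<theta> \<Otimes>\<^sub>M \<pi>f)" by measurable
  have "0 < measure (bayes (\<pi>\<theta> \<Otimes>\<^sub>M \<pi>f) ?R) A" using False ge posterior_eq[OF n reg] by simp
  then interpret prob_space "bayes (\<pi>\<theta> \<Otimes>\<^sub>M \<pi>f) ?R"
    using bayes_mass_finite[OF R A] by (intro prob_space_bayes R) (auto simp: lr_def)
  have "prob A \<le> prob B" using AB B by (intro finite_measure_mono) (auto simp: bayes_def)
  then show ?thesis using ge posterior_eq[OF n reg] by simp
qed (simp add: order_trans[OF _ measure_nonneg])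

text \<open>The inner product is half the derivative at \<theta>0 of the constant squared norm of
  \<open>K \<theta> v\<close>. This makes the cross term in the expansion vanish
  identically.\<close>

lemma isometry_orthogonal:
  assumes deriv: "((\<lambda>s. (K (\<theta>0 + s) v - K0 v) /\<^sub>R s) \<longlongrightarrow> K0' v) (at 0 within {s. \<theta>0 + s \<in> \<Theta>})"
    and iso: "\<And>\<theta>. \<theta> \<in> \<Theta> \<Longrightarrow> norm (K \<theta> v) = norm (K0 v)"
  shows "K0 v \<bullet> K0' v = 0"
proof -
  let ?S = "{s. \<theta>0 + s \<in> \<Theta>}"
  obtain r where r: "0 < r" "ball \<theta>0 r \<subseteq> \<Theta>" using interior by (meson mem_interior)
  \<comment> \<open>The derivative is a limit within \<Theta>; interiority of \<theta>0 makes that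
    filter non-trivial and the limit unique.\<close>
  have "0 islimpt ?S"
    unfolding islimpt_approachable
  proof (intro allI impI)
    fix d :: real assume d: "0 < d"
    show "\<exists>s\<in>?S. s \<noteq> 0 \<and> dist s 0 < d"
      using r d by (intro bexI[of _ "min (r / 2) (d / 2)"]) (auto simp: dist_real_def intro!: subsetD[OF r(2)])
  qed
  then have nt: "at 0 within ?S \<noteq> bot" by (simp add: trivial_limit_within)
  define D where "D s = (K (\<theta>0 + s) v - K0 v) /\<^sub>R s" for s
  have "((\<lambda>s. 2 * (K0 v \<bullet> D s) + s * (D s \<bullet> D s)) \<longlongrightarrow> 2 * (K0 v \<bullet> K0' v) + 0 * (K0' v \<bullet> K0' v)) (at 0 within ?S)"
    unfolding D_def by (intro tendsto_intros deriv)
  moreover have "\<forall>\<^sub>F s in at 0 within ?S. 2 * (K0 v \<bullet> D s) + s * (D s \<bullet> D s) = 0"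
    unfolding eventually_at_filter
  proof (intro always_eventually allI impI)
    fix s :: real assume s: "s \<noteq> 0" "s \<in> ?S"
    have K: "K (\<theta>0 + s) v = K0 v + s *\<^sub>R D s" using s by (simp add: D_def)
    have "K (\<theta>0 + s) v \<bullet> K (\<theta>0 + s) v = K0 v \<bullet> K0 v"
      using iso[of "\<theta>0 + s"] s by (simp flip: power2_norm_eq_inner)
    then have "s * (2 * (K0 v \<bullet> D s) + s * (D s \<bullet> D s)) = 0"
      unfolding K by (simp add: inner_add_left inner_add_right inner_commute algebra_simps)
    then show "2 * (K0 v \<bullet> D s) + s * (D s \<bullet> D s) = 0" using s by simp
  qed
  ultimately have "((\<lambda>s. 0) \<longlongrightarrow> 2 * (K0 v \<bullet> K0' v)) (at 0 within ?S)"
    by (simp add: Lim_transform_eventually)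
  then have "2 * (K0 v \<bullet> K0' v) = 0" using tendsto_unique[OF nt _ tendsto_const] by blast
  then show ?thesis by simp
qed

text \<open>Increasing sets that exhaust the line need not contain a whole window at any finite
  stage, but continuity from above makes the measure of the missing part vanish. Rescaling back
  contributes the factor 1 / sqrt n.\<close>

lemma rescaled_cover_grows:
  assumes T: "\<And>n. 1 \<le> n \<Longrightarrow> T n \<in> sets borel"
    and mono: "\<And>m n. 1 \<le> m \<Longrightarrow> m \<le> n \<Longrightarrow>
      (\<lambda>\<theta>. sqrt (real m) * (\<theta> - \<theta>0)) ` T m \<subseteq> (\<lambda>\<theta>. sqrt (real n) * (\<theta> - \<theta>0)) ` T n"
    and cover: "(\<Union>n\<in>{1..}. (\<lambda>\<theta>. sqrt (real n) * (\<theta> - \<theta>0)) ` T n) = UNIV"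
    and c: "0 < c"
  shows "\<forall>\<^sub>F n in sequentially. emeasure lborel ({\<theta>. sqrt (real n) * \<bar>\<theta> - \<theta>0\<bar> \<le> M} - T n) \<le> ennreal (c / sqrt (real n))"
proof -
  define U where "U n = (\<lambda>\<theta>. sqrt (real n) * (\<theta> - \<theta>0)) ` T n" for n
  have U_iff: "h \<in> U n \<longleftrightarrow> \<theta>0 + h / sqrt (real n) \<in> T n" if "1 \<le> n" for n h
  proof
    assume "h \<in> U n"
    then show "\<theta>0 + h / sqrt (real n) \<in> T n" using that by (auto simp: U_def)
  next
    assume "\<theta>0 + h / sqrt (real n) \<in> T n"
    then show "h \<in> U n" unfolding U_def using that by (intro image_eqI[of _ _ "\<theta>0 + h / sqrt (real n)"]) auto
  qed
  \<comment> \<open>The index starts at \<open>Suc n\<close> because the sets are assumed increasing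
    from 1 on; it is shifted back below through n - 1.\<close>
  define C where "C n = {h. \<bar>h\<bar> \<le> M} - U (Suc n)" for n
  have C_m: "C n \<in> sets borel" for n
  proof -
    have "(\<lambda>h. \<theta>0 + h / sqrt (real (Suc n))) -` T (Suc n) \<inter> space borel \<in> sets borel"
      using T[of "Suc n"] by (intro measurable_sets[of _ borel borel]) auto
    moreover have "U (Suc n) = (\<lambda>h. \<theta>0 + h / sqrt (real (Suc n))) -` T (Suc n) \<inter> space borel" using U_iff[of "Suc n"] by auto
    ultimately have [measurable]: "U (Suc n) \<in> sets borel" by simp
    show ?thesis unfolding C_def by measurable
  qed
  have "(\<lambda>n. emeasure lborel (C n)) \<longlonglongrightarrow> emeasure lborel (\<Inter>n. C n)"
  proof (rule Lim_emeasure_decseq)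
    have "U (Suc m) \<subseteq> U (Suc n)" if "m \<le> n" for m n unfolding U_def by (rule mono) (use that in auto)
    then show "decseq C" unfolding decseq_def C_def by blast
    show "emeasure lborel (C n) \<noteq> \<infinity>" for n
    proof -
      have "emeasure lborel (C n) \<le> emeasure lborel {- M..M}" by (intro emeasure_mono) (auto simp: C_def)
      also have "\<dots> < \<infinity>" by (simp add: emeasure_lborel_Icc_eq)
      finally show ?thesis by simp
    qed
  qed (use C_m in auto)
  also have "(\<Inter>n. C n) = {}"
  proof -
    have "\<exists>n. h \<in> U (Suc n)" for h
    proof -
      have "h \<in> (\<Union>n\<in>{1..}. U n)" using cover unfolding U_def by simp
      then obtain n where "1 \<le> n" "h \<in> U n" by auto
      then show ?thesis by (intro exI[of _ "n - 1"]) simp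
    qed
    then show ?thesis by (auto simp: C_def)
  qed
  finally have "\<forall>\<^sub>F n in sequentially. emeasure lborel (C n) < ennreal c"
    by (intro order_tendstoD(2)[of _ 0]) (use c in auto)
  then have "\<forall>\<^sub>F n in sequentially. emeasure lborel (C (n - 1)) < ennreal c"
    by (subst eventually_sequentially_Suc[symmetric]) simp
  then show ?thesis using eventually_ge_at_top[of 1]
  proof eventually_elim
    case (elim n)
    have s: "0 < sqrt (real n)" using elim by simp
    let ?D = "{\<theta>. sqrt (real n) * \<bar>\<theta> - \<theta>0\<bar> \<le> M} - T n"
    have [measurable]: "?D \<in> sets borel" using T[OF elim(2)] by measurable
    have "emeasure lborel ?D = (\<integral>\<^sup>+\<theta>. indicator ?D \<theta> \<partial>lborel)" by simp
    also have "\<dots> = ennreal \<bar>1 / sqrt (real n)\<bar> * (\<integral>\<^sup>+h. indicator ?D (\<theta>0 + 1 / sqrt (real n) * h) \<partial>lborel)"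
      using s by (intro nn_integral_real_affine) auto
    also have "(\<integral>\<^sup>+h. indicator ?D (\<theta>0 + 1 / sqrt (real n) * h) \<partial>lborel) = (\<integral>\<^sup>+h. indicator (C (n - 1)) h \<partial>lborel)"
    proof (intro nn_integral_cong)
      fix h
      have "\<theta>0 + 1 / sqrt (real n) * h \<in> ?D \<longleftrightarrow> h \<in> C (n - 1)"
        using U_iff[OF elim(2), of h] elim(2) s by (simp add: C_def abs_mult)
      then show "indicator ?D (\<theta>0 + 1 / sqrt (real n) * h) = (indicator (C (n - 1)) h :: ennreal)" by (simp add: indicator_def)
    qed
    also have "\<dots> = emeasure lborel (C (n - 1))" using C_m by simp
    also have "ennreal \<bar>1 / sqrt (real n)\<bar> * emeasure lborel (C (n - 1)) \<le> ennreal \<bar>1 / sqrt (real n)\<bar> * ennreal c"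
      using elim(1) by (intro mult_left_mono) auto
    also have "\<dots> = ennreal (c / sqrt (real n))" using s c by (simp add: ennreal_mult[symmetric])
    finally show ?case .
  qed
qed

text \<open>Orthogonality gives \<kappa> = 0 with H the whole space. T is a fixed interval around
  \<theta>0: it eventually contains every window of order 1 / sqrt n as well as the \<theta>-range
  of the contraction sets.\<close>

theorem bernstein_von_mises_constant_norm:
  assumes const: "\<forall>f. \<forall>\<theta>1\<in>\<Theta>. \<forall>\<theta>2\<in>\<Theta>. norm (K \<theta>1 f) = norm (K \<theta>2 f)"
    and deriv: "\<And>f. ((\<lambda>s. (K (\<theta>0 + s) f - K0 f) /\<^sub>R s) \<longlongrightarrow> K0' f) (at 0 within {s. \<theta>0 + s \<in> \<Theta>})"
    and ball: "conv_in_prob P (\<lambda>n x. measure (post n x) (contraction_set n)) 1"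
    and known: "conv_in_prob P (\<lambda>n x. measure (post_known n x) {f. norm (f - f0) < \<epsilon> n}) 1"
  shows "conv_in_prob P tv_error 0"
proof -
  obtain r where r: "0 < r" "ball \<theta>0 r \<subseteq> \<Theta>" using interior by (meson mem_interior)
  define T where "T = {\<theta>0 - r / 2..\<theta>0 + r / 2}"
  have T_sub: "T \<subseteq> \<Theta>" using r by (force simp: T_def dist_real_def)
  have T_prior: "T \<in> sets \<pi>\<theta>" unfolding sets_prior_iff using T_sub by (simp add: T_def)
  have orth: "K0 v \<bullet> K0' v = 0" for v
    using deriv const \<theta>0_in by (intro isometry_orthogonal) blast+
  have ev_r: "\<forall>\<^sub>F n in sequentially. \<epsilon> n < r / 2" by (rule order_tendstoD(2)[OF \<epsilon>_lim]) (use r in simp)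
  show ?thesis
  proof (rule bernstein_von_mises[where H = "\<lambda>_. UNIV" and T = "\<lambda>_. T" and \<kappa> = "\<lambda>_. 0"])
    show "\<forall>\<^sub>F n in sequentially. emeasure lborel ({\<theta>. sqrt (real n) * \<bar>\<theta> - \<theta>0\<bar> \<le> M} - T) \<le> ennreal (c / sqrt (real n))"
      if "0 < M" for M c
    proof -
      have "filterlim (\<lambda>n. sqrt (real n)) at_top sequentially"
        by (intro filterlim_compose[OF sqrt_at_top] filterlim_real_sequentially)
      then have "\<forall>\<^sub>F n in sequentially. 2 * M / r \<le> sqrt (real n)" by (simp only: filterlim_at_top)
      then show ?thesis using eventually_ge_at_top[of 1]
      proof eventually_elim
        case (elim n)
        have s: "0 < sqrt (real n)" using elim by simp
        have "M \<le> sqrt (real n) * (r / 2)" using elim(1) r by (simp add: field_simps)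
        have "\<theta> \<in> T" if "sqrt (real n) * \<bar>\<theta> - \<theta>0\<bar> \<le> M" for \<theta>
        proof -
          have "sqrt (real n) * \<bar>\<theta> - \<theta>0\<bar> \<le> sqrt (real n) * (r / 2)"
            using that \<open>M \<le> sqrt (real n) * (r / 2)\<close> by linarith
          then have "\<bar>\<theta> - \<theta>0\<bar> \<le> r / 2" using s by (simp only: mult_le_cancel_left_pos)
          then show ?thesis unfolding T_def atLeastAtMost_iff by linarith
        qed
        then have empty: "{\<theta>. sqrt (real n) * \<bar>\<theta> - \<theta>0\<bar> \<le> M} - T = {}" by auto
        show ?case unfolding empty by simp
      qed
    qed
    show "whp P (\<lambda>n x. 1 - \<delta> \<le> measure (post n x) (T \<times> UNIV))" if "0 < \<delta>" for \<delta>
    proof (rule whp_mono[OF whp_conj[OF whp_regular conv_in_prob_1_whp[OF ball that]]])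
      show "\<forall>\<^sub>F n in sequentially. \<forall>x\<in>space (P n). regular (noise n x) \<and>
          1 - \<delta> \<le> measure (post n x) (contraction_set n)
        \<longrightarrow> 1 - \<delta> \<le> measure (post n x) (T \<times> UNIV)"
        using ev_r eventually_ge_at_top[of 1]
      proof eventually_elim
        case (elim n)
        let ?A = "contraction_set n"
        have "{\<theta>\<in>\<Theta>. \<bar>\<theta> - \<theta>0\<bar> < \<epsilon> n} = \<Theta> \<inter> {\<theta>. \<bar>\<theta> - \<theta>0\<bar> < \<epsilon> n}" by auto
        also have "\<dots> \<in> sets borel" by measurable
        finally have "{\<theta>\<in>\<Theta>. \<bar>\<theta> - \<theta>0\<bar> < \<epsilon> n} \<in> sets \<pi>\<theta>" unfolding sets_prior_iff by auto
        moreover have "{f. norm (f - f0) < \<epsilon> n} \<in> sets \<pi>f" by measurable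
        moreover have "?A = {\<theta>\<in>\<Theta>. \<bar>\<theta> - \<theta>0\<bar> < \<epsilon> n} \<times> {f. norm (f - f0) < \<epsilon> n}" by auto
        ultimately have A: "?A \<in> sets (\<pi>\<theta> \<Otimes>\<^sub>M \<pi>f)" by simp
        have B: "T \<times> UNIV \<in> sets (\<pi>\<theta> \<Otimes>\<^sub>M \<pi>f)" using T_prior by (intro pair_measureI) auto
        have sub: "?A \<subseteq> T \<times> UNIV" using elim(1) by (auto simp: T_def)
        show ?case using posterior_mono[OF elim(2) _ sub _ A B] by blast
      qed
    qed
    show "whp P (\<lambda>n x. \<forall>\<theta>\<in>T. 1 - \<delta> \<le> measure (post_known n x) ((\<lambda>f. f + (\<theta> - \<theta>0) *\<^sub>R \<gamma> n) ` UNIV))"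
      if "0 < \<delta>" for \<delta>
    proof (rule whp_mono[OF whp_conj[OF whp_regular conv_in_prob_1_whp[OF known that]]])
      have ball_m: "{f. norm (f - f0) < \<epsilon> n} \<in> sets borel" for n by measurable
      show "\<forall>\<^sub>F n in sequentially. \<forall>x\<in>space (P n). regular (noise n x) \<and>
          1 - \<delta> \<le> measure (post_known n x) {f. norm (f - f0) < \<epsilon> n}
        \<longrightarrow> (\<forall>\<theta>\<in>T. 1 - \<delta> \<le> measure (post_known n x) ((\<lambda>f. f + (\<theta> - \<theta>0) *\<^sub>R \<gamma> n) ` UNIV))"
        using eventually_ge_at_top[of 1]
      proof eventually_elim
        case (elim n)
        have img: "range (\<lambda>f. f + a) = UNIV" for a :: 'h by (rule surjI[of _ "\<lambda>f. f - a"]) simp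
        show ?case unfolding img using posterior_known_UNIV[OF elim _ _ ball_m] by blast
      qed
    qed
  qed (use orth T_sub conv_in_prob_1_whp[OF ball] conv_in_prob_1_whp[OF known] in \<open>auto simp: T_def\<close>)
qed

theorem bernstein_von_mises_localized:
  fixes H :: "nat \<Rightarrow> 'h set" and T :: "nat \<Rightarrow> real set"
  assumes sets: "\<forall>n\<ge>1. H n \<in> sets borel \<and> T n \<in> sets borel \<and> T n \<subseteq> \<Theta>"
      "(\<lambda>n. ennreal (sqrt (real n)) * (SUP f\<in>H n. ennreal \<bar>K0 (f - f0) \<bullet> K0' (f - f0)\<bar>)) \<longlonglongrightarrow> 0"
      "\<forall>m n. 1 \<le> m \<and> m \<le> n \<longrightarrow> (\<lambda>\<theta>. sqrt (real m) * (\<theta> - \<theta>0)) ` T m \<subseteq> (\<lambda>\<theta>. sqrt (real n) * (\<theta> - \<theta>0)) ` T n"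
      "(\<Union>n\<in>{1..}. (\<lambda>\<theta>. sqrt (real n) * (\<theta> - \<theta>0)) ` T n) = UNIV"
      "conv_in_prob P (\<lambda>n x. measure (post n x) (T n \<times> H n)) 1"
      "conv_in_prob P (\<lambda>n x. INF \<theta>\<in>T n. measure (post_known n x) ((\<lambda>f. f + (\<theta> - \<theta>0) *\<^sub>R \<gamma> n) ` H n)) 1"
    and ball: "conv_in_prob P (\<lambda>n x. measure (post n x) (contraction_set n)) 1"
    and known: "conv_in_prob P (\<lambda>n x. measure (post_known n x) {f. norm (f - f0) < \<epsilon> n}) 1"
  shows "conv_in_prob P tv_error 0"
proof -
  \<comment> \<open>The supremum lives in \<open>ennreal\<close> and may be infinite for small n;
    \<open>enn2real\<close> yields a genuine bound only once it is finite, which holds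
    eventually.\<close>
  define \<kappa> where "\<kappa> n = enn2real (ennreal (sqrt (real n)) * (SUP f\<in>H n. ennreal \<bar>K0 (f - f0) \<bullet> K0' (f - f0)\<bar>))" for n
  show ?thesis
  proof (rule bernstein_von_mises[where H = H and T = T and \<kappa> = \<kappa>])
    have lim: "(\<lambda>n. ennreal (sqrt (real n)) * (SUP f\<in>H n. ennreal \<bar>K0 (f - f0) \<bullet> K0' (f - f0)\<bar>)) \<longlonglongrightarrow> ennreal 0"
      using sets(2) by simp
    show "\<kappa> \<longlonglongrightarrow> 0" unfolding \<kappa>_def by (rule tendsto_enn2real[OF lim]) simp
    have "\<forall>\<^sub>F n in sequentially. ennreal (sqrt (real n)) * (SUP f\<in>H n. ennreal \<bar>K0 (f - f0) \<bullet> K0' (f - f0)\<bar>) < \<infinity>"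
      by (rule order_tendstoD(2)[OF lim]) simp
    then show "\<forall>\<^sub>F n in sequentially. \<forall>f\<in>H n. sqrt (real n) * \<bar>K0 (f - f0) \<bullet> K0' (f - f0)\<bar> \<le> \<kappa> n"
    proof eventually_elim
      case (elim n)
      show ?case
      proof
        fix f assume f: "f \<in> H n"
        have "ennreal (sqrt (real n) * \<bar>K0 (f - f0) \<bullet> K0' (f - f0)\<bar>) = ennreal (sqrt (real n)) * ennreal \<bar>K0 (f - f0) \<bullet> K0' (f - f0)\<bar>"
          by (rule ennreal_mult) auto
        also have "\<dots> \<le> ennreal (sqrt (real n)) * (SUP f\<in>H n. ennreal \<bar>K0 (f - f0) \<bullet> K0' (f - f0)\<bar>)"
          by (intro mult_left_mono SUP_upper f) auto
        also have "\<dots> = ennreal (\<kappa> n)" unfolding \<kappa>_def using elim by simp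
        finally show "sqrt (real n) * \<bar>K0 (f - f0) \<bullet> K0' (f - f0)\<bar> \<le> \<kappa> n"
          by (subst (asm) ennreal_le_iff) (auto simp: \<kappa>_def)
      qed
    qed
    show "\<forall>\<^sub>F n in sequentially. emeasure lborel ({\<theta>. sqrt (real n) * \<bar>\<theta> - \<theta>0\<bar> \<le> M} - T n) \<le> ennreal (c / sqrt (real n))"
      if "0 < c" for M c
      using sets(1,3,4) that by (intro rescaled_cover_grows) auto
    show "whp P (\<lambda>n x. \<forall>\<theta>\<in>T n. 1 - \<delta> \<le> measure (post_known n x) ((\<lambda>f. f + (\<theta> - \<theta>0) *\<^sub>R \<gamma> n) ` H n))"
      if "0 < \<delta>" for \<delta>
    proof (rule whp_mono[OF conv_in_prob_1_whp[OF sets(6) that]], intro always_eventually allI ballI impI)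
      fix n x \<theta>
      assume ge: "1 - \<delta> \<le> (INF \<theta>\<in>T n. measure (post_known n x) ((\<lambda>f. f + (\<theta> - \<theta>0) *\<^sub>R \<gamma> n) ` H n))" and \<theta>: "\<theta> \<in> T n"
      have "(INF \<theta>\<in>T n. measure (post_known n x) ((\<lambda>f. f + (\<theta> - \<theta>0) *\<^sub>R \<gamma> n) ` H n))
        \<le> measure (post_known n x) ((\<lambda>f. f + (\<theta> - \<theta>0) *\<^sub>R \<gamma> n) ` H n)"
        by (intro cINF_lower \<theta> bdd_belowI2[where m = 0]) simp
      with ge show "1 - \<delta> \<le> measure (post_known n x) ((\<lambda>f. f + (\<theta> - \<theta>0) *\<^sub>R \<gamma> n) ` H n)" by simp
    qed
  qed (use sets(1) conv_in_prob_1_whp[OF ball] conv_in_prob_1_whp[OF known] conv_in_prob_1_whp[OF sets(5)] in auto)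
qed

end

theorem corollary2p5:
  fixes \<Theta> :: "real set" and \<theta>0 :: real
    and e :: "nat \<Rightarrow> 'h::{real_inner, complete_space, second_countable_topology}"
    and K K' :: "real \<Rightarrow> 'h \<Rightarrow>\<^sub>L 'h"
    and f0 :: 'h
    and p :: "real \<Rightarrow> real" and \<pi>f :: "'h measure"
    and S :: "'h set" and nS :: "'h \<Rightarrow> real"
    and D0 D1 D2 D3 :: real
    and \<epsilon> \<eta> \<rho> :: "nat \<Rightarrow> real" and \<gamma> :: "nat \<Rightarrow> 'h"
  defines "P \<equiv> obs_law e K \<theta>0 f0"
    and "\<pi>\<theta> \<equiv> param_prior \<Theta> p"
  assumes "compact \<Theta>"
    and "orthonormal_basis e"
    and "prob_space \<pi>\<theta>" and "continuous_on \<Theta> p"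
    and "\<exists>c C. 0 < c \<and> (\<forall>\<theta>\<in>\<Theta>. c \<le> p \<theta> \<and> p \<theta> \<le> C)"
    and "prob_space \<pi>f" and "sets \<pi>f = sets borel"
    and "\<theta>0 \<in> interior \<Theta>"
    and "K' \<theta>0 f0 \<noteq> 0"
    \<comment> \<open>(a)\<close>
    and "normed_subspace S nS"
    and "\<exists>C. \<forall>h\<in>S. norm h \<le> C * nS h"
    and "\<forall>\<theta>\<in>\<Theta>. range (K \<theta>) \<subseteq> S"
    and "entropy_integral {h \<in> S. nS h \<le> 1} < \<infinity>"
    \<comment> \<open>(b)\<close>
    and "\<forall>\<theta>\<in>\<Theta>. \<forall>f. ((\<lambda>s. (K (\<theta> + s) f - K \<theta> f) /\<^sub>R s) \<longlongrightarrow> K' \<theta> f) (at 0 within {s. \<theta> + s \<in> \<Theta>})"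
    and "\<forall>\<theta>\<in>\<Theta>. norm (K \<theta>) \<le> D0 \<and> norm (K' \<theta>) \<le> D0"
    and "\<forall>\<theta>\<in>\<Theta>. onorm_into S nS (K \<theta> - K \<theta>0) \<le> ereal (D1 * \<bar>\<theta> - \<theta>0\<bar>)"
    and "\<forall>\<theta>\<in>\<Theta>. onorm_into S nS (K \<theta> - K \<theta>0 - (\<theta> - \<theta>0) *\<^sub>R K' \<theta>0) \<le> ereal (D2 * (\<theta> - \<theta>0)\<^sup>2)"
    and "\<forall>\<theta>1\<in>\<Theta>. \<forall>\<theta>2\<in>\<Theta>. \<forall>f1 f2.
           norm (K \<theta>1 f1 - K \<theta>2 f2)
             \<le> D3 * \<bar>\<theta>1 - \<theta>2\<bar> * min (norm f1) (norm f2) + D3 * norm (f1 - f2)"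
    \<comment> \<open>(c)\<close>
    and "\<forall>n\<ge>1. 0 < \<epsilon> n" and "\<epsilon> \<longlonglongrightarrow> 0"
    and "(\<lambda>n. (1 / sqrt (real n)) / \<epsilon> n) \<longlonglongrightarrow> 0"
    and "conv_in_prob P (\<lambda>n x. measure (posterior e K \<pi>\<theta> \<pi>f n x)
           {(\<theta>, f). \<theta> \<in> \<Theta> \<and> \<bar>\<theta> - \<theta>0\<bar> < \<epsilon> n \<and> norm (f - f0) < \<epsilon> n}) 1"
    and "conv_in_prob P (\<lambda>n x. measure (posterior_known e K \<theta>0 \<pi>f n x)
           {f. norm (f - f0) < \<epsilon> n}) 1"
    \<comment> \<open>(d)\<close>
    and "\<forall>n\<ge>1. 0 < \<eta> n" and "\<eta> \<longlonglongrightarrow> 0"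
    and "\<exists>C. \<forall>n\<ge>1. norm (\<gamma> n - least_favorable K K' \<theta>0 f0) \<le> C * \<bar>\<rho> n\<bar>"
    and "(\<lambda>n. real n * (\<epsilon> n)\<^sup>2 * (\<rho> n)\<^sup>2) \<longlonglongrightarrow> 0"
    and "\<forall>n\<ge>1. measure \<pi>f {f. norm (f - f0) \<le> \<epsilon> n / (2 * D3 + 2)} \<ge> exp (- (real n * (\<epsilon> n)\<^sup>2 / 65))"
    and "\<forall>n\<ge>1. \<exists>L :: real \<Rightarrow> real \<Rightarrow> 'h \<Rightarrow> real.
           (\<forall>s\<in>{- \<epsilon> n<..<\<epsilon> n}. \<forall>t\<in>{- \<epsilon> n<..<\<epsilon> n}.
              log_density_version (shifted_law \<pi>f ((s + t) *\<^sub>R \<gamma> n)) (shifted_law \<pi>f (s *\<^sub>R \<gamma> n)) (L s t)) \<and>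
           outer_measure_of \<pi>f {f. \<exists>s\<in>{- \<epsilon> n<..<\<epsilon> n}. \<exists>t\<in>{- \<epsilon> n<..<\<epsilon> n}.
              \<bar>L s t f\<bar> > \<eta> n * (1 + real n * t\<^sup>2)} \<le> ennreal (exp (- (3 * real n * (\<epsilon> n)\<^sup>2)))"
    \<comment> \<open>(e)\<close>
    and "(\<forall>f. \<forall>\<theta>1\<in>\<Theta>. \<forall>\<theta>2\<in>\<Theta>. norm (K \<theta>1 f) = norm (K \<theta>2 f)) \<or>
         (\<exists>(Hn :: nat \<Rightarrow> 'h set) (\<Theta>n :: nat \<Rightarrow> real set).
            (\<forall>n\<ge>1. Hn n \<in> sets borel \<and> \<Theta>n n \<in> sets borel \<and> \<Theta>n n \<subseteq> \<Theta>) \<and>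
            (\<lambda>n. ennreal (sqrt (real n)) *
               (SUP f\<in>Hn n. ennreal \<bar>K \<theta>0 (f - f0) \<bullet> K' \<theta>0 (f - f0)\<bar>)) \<longlonglongrightarrow> 0 \<and>
            (\<forall>m n. 1 \<le> m \<and> m \<le> n \<longrightarrow>
               (\<lambda>\<theta>. sqrt (real m) * (\<theta> - \<theta>0)) ` \<Theta>n m \<subseteq> (\<lambda>\<theta>. sqrt (real n) * (\<theta> - \<theta>0)) ` \<Theta>n n) \<and>
            (\<Union>n\<in>{1..}. (\<lambda>\<theta>. sqrt (real n) * (\<theta> - \<theta>0)) ` \<Theta>n n) = UNIV \<and>
            conv_in_prob P (\<lambda>n x. measure (posterior e K \<pi>\<theta> \<pi>f n x) (\<Theta>n n \<times> Hn n)) 1 \<and>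
            conv_in_prob P (\<lambda>n x. INF \<theta>\<in>\<Theta>n n.
               measure (posterior_known e K \<theta>0 \<pi>f n x) ((\<lambda>f. f + (\<theta> - \<theta>0) *\<^sub>R \<gamma> n) ` Hn n)) 1)"
  shows "conv_in_prob P (\<lambda>n x. tv_dist
           (distr (posterior e K \<pi>\<theta> \<pi>f n x) borel fst)
           (normal_law (\<theta>0 + efficient_influence e K K' \<theta>0 f0 n x / sqrt (real n))
                       (inverse (efficient_info K K' \<theta>0 f0) / real n))) 0"
proof -
  interpret linear_model e \<Theta> \<theta>0 K K' f0 p \<pi>f S nS D0 D1 D2 D3 \<epsilon> \<eta> \<rho> \<gamma>
    by (rule linear_model.intro[OF hilbert_basis.intro[OF assms(4)]
        linear_model_axioms.intro[OF assms(3) assms(5)[unfolded \<pi>\<theta>_def] assms(6-13) assms(15) assms(17-23) assms(27-31)]])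
  note ball = assms(24)[unfolded P_def \<pi>\<theta>_def] and known = assms(25)[unfolded P_def]
  from assms(32) show ?thesis
    unfolding P_def \<pi>\<theta>_def
  proof (elim disjE exE conjE)
    assume "\<forall>f. \<forall>\<theta>1\<in>\<Theta>. \<forall>\<theta>2\<in>\<Theta>. norm (K \<theta>1 f) = norm (K \<theta>2 f)"
    then show "conv_in_prob (obs_law e K \<theta>0 f0) tv_error 0"
      using assms(16) \<theta>0_in by (intro bernstein_von_mises_constant_norm ball known) blast+
  qed (rule bernstein_von_mises_localized[OF _ _ _ _ _ _ ball known])
qed

end
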